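(* Let $\gamma>1$. The operator $\hat\chi_\gamma\colon H^2_{\mathsf{dual}}(M_\gamma,\tilde\mu^* )\to\big(H^2(M_\gamma,\tilde\mu)\big)^*$ defined by $$\hat\chi_\gamma(g)\colon f\mapsto\int_{M_\gamma}f\,g\,d\nu\qquad (f\in H^2(M_\gamma,\tilde\mu))$$ is invertible, and the norm of its inverse is $$\big\|\hat\chi_\gamma^{-1}\big\|=\|\mathbf{L}\|_{L^2(M_\gamma,\tilde\mu)},$$ where $\mathbf{L}=\mathbf{L}_\gamma$ is the Leray transform of $M_\gamma$.
   Context: For $\gamma>1$ let $M_\gamma=\{(\zeta_1,\zeta_2)\in\mathbb{C}^2:\operatorname{Im}\zeta_2=|\zeta_1|^\gamma\}$, parametrized up to a null set by $(s,\alpha,\theta)\in\mathbb{R}\times(0,\infty)\times[0,2\pi)$ via $\zeta=(\alpha e^{i\theta},\,s+i\alpha^\gamma)$. For $r\in\mathbb{R}$, $\mu_r=\alpha^{r}\,ds\,d\alpha\,d\theta$. Each $f\in L^2(M_\gamma,\mu_r)$ has a partial Fourier expansion $f=\sum_{k\in\mathbb{Z}}f_k(s,\alpha)e^{ik\theta}$. Leray transform: formally $$\mathbf{L}_\gamma f(z)=\frac{\gamma^2}{8\pi^2 i}\int_{M_\gamma}f(\zeta)\frac{|\zeta_1|^{\gamma-2}\,d\zeta_2\wedge d\bar\zeta_1\wedge d\zeta_1}{[\gamma\bar\zeta_1|\zeta_1|^{\gamma-2}(\zeta_1-z_1)+i(\zeta_2-z_2)]^2};$$ for $z=(\alpha_ze^{i\theta_z},s_z+i\alpha_z^\gamma)\in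 M_\gamma$ it is understood as the sum over $k\ge0$ of the operators $$f\mapsto e^{ik\theta_z}\,\frac{\gamma^2(k+1)}{2\pi}\int_0^\infty\!\int_{-\infty}^\infty\frac{B^k}{A^{k+2}}f_k(s_\zeta,\alpha_\zeta)\,\alpha_\zeta^{\gamma-1}\,ds_\zeta\,d\alpha_\zeta,$$ with $A=(\gamma-1)\alpha_\zeta^\gamma+\alpha_z^\gamma+i(s_\zeta-s_z)$, $B=\gamma\alpha_z\alpha_\zeta^{\gamma-1}$. It is a bounded projection on $L^2(M_\gamma,\mu_r)$ for every $r\in(-1,2\gamma-1)$. Measures on $M_\gamma$: the preferred measure, preferred dual measure and pairing measure are $$\tilde\mu=\tilde\mu_{M_\gamma}=\tfrac{\gamma^2(\gamma-1)^{1/3}}{4\pi^2}\,\mu_{\frac{\gamma+1}{3}},\qquad \tilde\mu^*=\tilde\mu^*_{M_\gamma}=\tfrac{\gamma^2}{4\pi^2(\gamma-1)^{1/3}}\,\mu_{\frac{5\gamma-7}{3}},\qquad \nu=\tfrac{\gamma^2}{4\pi^2}\,\mu_{\gamma-1}.$$ Dual hypersurface: let $\gamma^*=\gamma/(\gamma-1)$. The map $w=(w_1,w_2)$, $w_1(\zeta)=\bar\zeta_1|\zeta_1|^{\gamma-2}$, $w_2(\zeta)=\frac{\zeta_2-i\gamma|\zeta_1|^\gamma}{1-\gamma}$, maps $M_\gamma$ onto $M_{\gamma^*}$ bijectively (it realizes the projective dual of $M_\gamma$ as $M_{\gamma^*}$); $\tilde\mu^*$ is, up to a positive constant, the pullback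 under $w$ of the measure $\mu_{(\gamma^*+1)/3}$ on $M_{\gamma^*}$. Hardy spaces: $H^2(M_\gamma,\tilde\mu):=\mathbf{L}_\gamma\big(L^2(M_\gamma,\tilde\mu)\big)=\ker(\mathbf{L}_\gamma-I)$, a closed subspace of $L^2(M_\gamma,\tilde\mu)$; likewise $H^2(M_{\gamma^*},\tilde\mu_{M_{\gamma^*}})=\mathbf{L}_{\gamma^*}\big(L^2(M_{\gamma^*},\tilde\mu_{M_{\gamma^*}})\big)$, where $\tilde\mu_{M_{\gamma^*}}$ is a positive constant multiple of $\mu_{(\gamma^*+1)/3}$ on $M_{\gamma^*}$. The dual Hardy space is $$H^2_{\mathsf{dual}}(M_\gamma,\tilde\mu^* )=\{G\circ w: G\in H^2(M_{\gamma^*},\tilde\mu_{M_{\gamma^*}})\}\subset L^2(M_\gamma,\tilde\mu^* ),$$ with the norm of $L^2(M_\gamma,\tilde\mu^* )$. $(\cdot)^*$ on a Hilbert space denotes its Banach space dual with the dual norm. *)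

theory Defs
  imports "HOL-Analysis.Analysis"
begin

section \<open>Spaces of functions with a seminorm\<close>

text \<open>
  Elements of an \<open>L\<^sup>2\<close>-space are represented by functions, and elements of a Banach space dual by
  functionals of which only the values on the underlying space matter. Two representatives denote
  the same vector iff the seminorm of their difference is zero; operators are accordingly required
  to be linear, and inverse to each other, up to vectors of seminorm zero.
\<close>

record 'a fspace =
  vecs :: "('a \<Rightarrow> complex) set"
  snorm :: "('a \<Rightarrow> complex) \<Rightarrow> real"

definition op_norm :: "'a fspace \<Rightarrow> 'b fspace \<Rightarrow> (('a \<Rightarrow> complex) \<Rightarrow> ('b \<Rightarrow> complex)) \<Rightarrow> ereal" where
  "op_norm X Y T = (SUP x\<in>{x \<in> vecs X. snorm X x \<le> 1}. ereal (snorm Y (T x)))"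

definition bounded_operator ::
    "'a fspace \<Rightarrow> 'b fspace \<Rightarrow> (('a \<Rightarrow> complex) \<Rightarrow> ('b \<Rightarrow> complex)) \<Rightarrow> bool" where
  "bounded_operator X Y T \<longleftrightarrow>
     (\<forall>x\<in>vecs X. T x \<in> vecs Y) \<and>
     (\<forall>x\<in>vecs X. \<forall>y\<in>vecs X. \<forall>a b.
        snorm Y (\<lambda>t. T (\<lambda>u. a * x u + b * y u) t - (a * T x t + b * T y t)) = 0) \<and>
     (\<exists>C. \<forall>x\<in>vecs X. snorm Y (T x) \<le> C * snorm X x)"

definition inverse_operators ::
    "'a fspace \<Rightarrow> 'b fspace \<Rightarrow> (('a \<Rightarrow> complex) \<Rightarrow> ('b \<Rightarrow> complex))
       \<Rightarrow> (('b \<Rightarrow> complex) \<Rightarrow> ('a \<Rightarrow> complex)) \<Rightarrow> bool" where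
  "inverse_operators X Y T S \<longleftrightarrow>
     bounded_operator X Y T \<and> bounded_operator Y X S \<and>
     (\<forall>x\<in>vecs X. snorm X (\<lambda>u. S (T x) u - x u) = 0) \<and>
     (\<forall>y\<in>vecs Y. snorm Y (\<lambda>t. T (S y) t - y t) = 0)"

definition banach_dual :: "'a fspace \<Rightarrow> ('a \<Rightarrow> complex) fspace" where
  "banach_dual X =
     \<lparr> vecs = {\<phi>. (\<forall>x\<in>vecs X. \<forall>y\<in>vecs X. \<forall>a b. \<phi> (\<lambda>u. a * x u + b * y u) = a * \<phi> x + b * \<phi> y) \<and>
                  (\<exists>C. \<forall>x\<in>vecs X. cmod (\<phi> x) \<le> C * snorm X x)},
       snorm = (\<lambda>\<phi>. SUP x\<in>{x \<in> vecs X. snorm X x \<le> 1}. cmod (\<phi> x)) \<rparr>"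

definition L2 :: "'a measure \<Rightarrow> 'a fspace" where
  "L2 M =
     \<lparr> vecs = {f. f \<in> borel_measurable M \<and> integrable M (\<lambda>x. (cmod (f x))\<^sup>2)},
       snorm = (\<lambda>f. sqrt (LINT x|M. (cmod (f x))\<^sup>2)) \<rparr>"

definition tendsto_L2 :: "'a measure \<Rightarrow> (nat \<Rightarrow> 'a \<Rightarrow> complex) \<Rightarrow> ('a \<Rightarrow> complex) \<Rightarrow> bool" where
  "tendsto_L2 M F g \<longleftrightarrow>
     (\<forall>n. F n \<in> vecs (L2 M)) \<and> g \<in> vecs (L2 M) \<and>
     (\<lambda>n. snorm (L2 M) (\<lambda>x. F n x - g x)) \<longlonglongrightarrow> 0"


section \<open>The hypersurfaces and their measures\<close>

definition hyp :: "real \<Rightarrow> (complex \<times> complex) set" where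
  "hyp \<gamma> = {\<zeta>. Im (snd \<zeta>) = cmod (fst \<zeta>) powr \<gamma>}"

definition param :: "real \<Rightarrow> real \<times> real \<times> real \<Rightarrow> complex \<times> complex" where
  "param \<gamma> = (\<lambda>(s, \<alpha>, \<theta>). (of_real \<alpha> * cis \<theta>, Complex s (\<alpha> powr \<gamma>)))"

definition mu :: "real \<Rightarrow> real \<Rightarrow> (complex \<times> complex) measure" where
  "mu \<gamma> r =
     distr (density (restrict_space lborel (UNIV \<times> {0<..} \<times> {0..<2 * pi}))
                    (\<lambda>(s, \<alpha>, \<theta>). ennreal (\<alpha> powr r)))
           (restrict_space borel (hyp \<gamma>)) (param \<gamma>)"

definition pref_measure :: "real \<Rightarrow> (complex \<times> complex) measure" where
  "pref_measure \<gamma> =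
     scale_measure (ennreal (\<gamma>\<^sup>2 * (\<gamma> - 1) powr (1/3) / (4 * pi\<^sup>2))) (mu \<gamma> ((\<gamma> + 1) / 3))"

definition pref_dual_measure :: "real \<Rightarrow> (complex \<times> complex) measure" where
  "pref_dual_measure \<gamma> =
     scale_measure (ennreal (\<gamma>\<^sup>2 / (4 * pi\<^sup>2 * (\<gamma> - 1) powr (1/3)))) (mu \<gamma> ((5 * \<gamma> - 7) / 3))"

definition pairing_measure :: "real \<Rightarrow> (complex \<times> complex) measure" where
  "pairing_measure \<gamma> = scale_measure (ennreal (\<gamma>\<^sup>2 / (4 * pi\<^sup>2))) (mu \<gamma> (\<gamma> - 1))"


section \<open>The Leray transform\<close>

definition fourier_coeff :: "real \<Rightarrow> (complex \<times> complex \<Rightarrow> complex) \<Rightarrow> int \<Rightarrow> real \<Rightarrow> real \<Rightarrow> complex" where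
  "fourier_coeff \<gamma> f k s \<alpha> =
     (LINT \<theta>:{0..<2 * pi}|lborel. f (param \<gamma> (s, \<alpha>, \<theta>)) * cis (- of_int k * \<theta>)) / (2 * pi)"

text \<open>
  On the hypersurface, \<open>z = (\<alpha>\<^sub>z cis \<theta>\<^sub>z, s\<^sub>z + \<i> \<alpha>\<^sub>z\<^sup>\<gamma>)\<close> has \<open>\<alpha>\<^sub>z = cmod (fst z)\<close>, \<open>s\<^sub>z = Re (snd z)\<close>, and
  \<open>\<theta>\<^sub>z = Arg (fst z)\<close> modulo \<open>2\<pi>\<close>.
\<close>

definition leray_piece :: "real \<Rightarrow> nat \<Rightarrow> (complex \<times> complex \<Rightarrow> complex) \<Rightarrow> complex \<times> complex \<Rightarrow> complex" where
  "leray_piece \<gamma> k f z =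
     (let \<alpha>z = cmod (fst z); \<theta>z = Arg (fst z); sz = Re (snd z);
          A = (\<lambda>s \<alpha>. Complex ((\<gamma> - 1) * \<alpha> powr \<gamma> + \<alpha>z powr \<gamma>) (s - sz));
          B = (\<lambda>\<alpha>. \<gamma> * \<alpha>z * \<alpha> powr (\<gamma> - 1))
      in cis (real k * \<theta>z) * of_real (\<gamma>\<^sup>2 * (real k + 1) / (2 * pi)) *
         (LINT \<alpha>:{0<..}|lborel. (LINT s|lborel.
            of_real (B \<alpha>) ^ k / A s \<alpha> ^ (k + 2) * fourier_coeff \<gamma> f (int k) s \<alpha>
              * of_real (\<alpha> powr (\<gamma> - 1)))))"

text \<open>
  The sum over \<open>k\<close> converges in the sense of \<open>L\<^sup>2(M)\<close>; the chosen limit is unique up to null sets.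
\<close>

definition leray ::
    "real \<Rightarrow> (complex \<times> complex) measure \<Rightarrow> (complex \<times> complex \<Rightarrow> complex) \<Rightarrow> complex \<times> complex \<Rightarrow> complex" where
  "leray \<gamma> M f = (SOME g. tendsto_L2 M (\<lambda>n z. \<Sum>k<n. leray_piece \<gamma> k f z) g)"


section \<open>Hardy spaces and the pairing\<close>

definition hardy :: "real \<Rightarrow> (complex \<times> complex) fspace" where
  "hardy \<gamma> = (L2 (pref_measure \<gamma>))
     \<lparr> vecs := {f \<in> vecs (L2 (pref_measure \<gamma>)).
          \<exists>h\<in>vecs (L2 (pref_measure \<gamma>)). AE z in pref_measure \<gamma>. f z = leray \<gamma> (pref_measure \<gamma>) h z} \<rparr>"

definition dual_exponent :: "real \<Rightarrow> real" where
  "dual_exponent \<gamma> = \<gamma> / (\<gamma> - 1)"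

definition dual_map :: "real \<Rightarrow> complex \<times> complex \<Rightarrow> complex \<times> complex" where
  "dual_map \<gamma> \<zeta> =
     (cnj (fst \<zeta>) * of_real (cmod (fst \<zeta>) powr (\<gamma> - 2)),
      (snd \<zeta> - \<i> * of_real (\<gamma> * cmod (fst \<zeta>) powr \<gamma>)) / of_real (1 - \<gamma>))"

definition hardy_dual :: "real \<Rightarrow> (complex \<times> complex) fspace" where
  "hardy_dual \<gamma> = (L2 (pref_dual_measure \<gamma>))
     \<lparr> vecs := {g \<in> vecs (L2 (pref_dual_measure \<gamma>)).
          \<exists>G\<in>vecs (hardy (dual_exponent \<gamma>)). AE z in pref_dual_measure \<gamma>. g z = G (dual_map \<gamma> z)} \<rparr>"

definition chi ::
    "real \<Rightarrow> (complex \<times> complex \<Rightarrow> complex) \<Rightarrow> (complex \<times> complex \<Rightarrow> complex) \<Rightarrow> complex" where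
  "chi \<gamma> g = (\<lambda>f. LINT z|pairing_measure \<gamma>. f z * g z)"

end

theory Submission
  imports Defs
begin

text \<open>
  Write \<open>\<mu>\<close>, \<open>\<mu>\<^sup>*\<close> and \<open>\<nu>\<close> for the preferred measure, the preferred dual measure and the pairing
  measure. They satisfy \<open>\<nu> = \<rho> \<mu>\<close> and \<open>\<mu>\<^sup>* = \<rho>\<^sup>2 \<mu>\<close> for one positive density \<open>\<rho>\<close>, so the pairing
  \<open>\<integral> f g d\<nu>\<close> makes \<open>L\<^sup>2(\<mu>\<^sup>*)\<close> the isometric dual of \<open>L\<^sup>2(\<mu>)\<close>. The Leray transform \<open>L\<close> is a bounded
  projection of \<open>L\<^sup>2(\<mu>)\<close> onto the Hardy space. The duality map \<open>w\<close> turns the kernel of the Leray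
  transform of the dual hypersurface into the transposed kernel (\<open>leray_kernel_dual\<close>), so the dual
  Hardy space is the range of the transpose of \<open>L\<close> (\<open>hardy_dual_iff\<close>). What remains is a fact
  about a bounded projection \<open>P\<close> on a Hilbert space (\<open>hilbert_pairing_duality\<close>): a functional \<open>\<phi>\<close>
  on the range of \<open>P\<close> is represented by one element of the range of the transpose, the one that
  represents \<open>\<phi> \<circ> P\<close>; and \<open>\<phi> \<mapsto> \<phi> \<circ> P\<close> has the norm of \<open>P\<close>, since every vector in the range is
  normed by a functional on the range.

  That \<open>L\<close> is a bounded projection rests on three properties of its pieces \<open>L\<^sub>k\<close>. Their kernels pass
  Schur's test with a bound independent of \<open>k\<close> (\<open>pref_kernel_schur\<close>): the kernel carries a factor
  \<open>k + 1\<close>, and it concentrates on a set of width \<open>(k + 1)\<^sup>-\<^sup>1\<^sup>/\<^sup>2\<close> both in the height \<open>s\<close> and in the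
  logarithm of the radius. Distinct pieces belong to distinct characters of the rotations of \<open>z\<^sub>1\<close>,
  which makes their ranges, and the ranges of their transposes, mutually orthogonal; therefore the
  series converges and has the same bound (\<open>schur_series\<close>). Each kernel reproduces itself
  (\<open>pref_kernel_reproducing\<close>), by an explicit integration.
\<close>

section \<open>The Hilbert space of square-integrable functions\<close>

abbreviation norm2 :: "'a measure \<Rightarrow> ('a \<Rightarrow> complex) \<Rightarrow> real" where
  "norm2 M \<equiv> snorm (L2 M)"

lemma L2_iff:
  "f \<in> vecs (L2 M) \<longleftrightarrow> f \<in> borel_measurable M \<and> integrable M (\<lambda>x. (cmod (f x))\<^sup>2)"
  by (simp add: L2_def)

lemma norm2_eq: "norm2 M f = sqrt (LINT x|M. (cmod (f x))\<^sup>2)"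
  by (simp add: L2_def)

lemma norm2_nonneg [simp]: "0 \<le> norm2 M f"
  by (simp add: norm2_eq)

lemma norm2_power2: "(norm2 M f)\<^sup>2 = (LINT x|M. (cmod (f x))\<^sup>2)"
  by (simp add: norm2_eq)

lemma L2_measurable [measurable_dest]: "f \<in> vecs (L2 M) \<Longrightarrow> f \<in> borel_measurable M"
  by (simp add: L2_iff)

lemma nn_integral_norm2:
  assumes "f \<in> vecs (L2 M)"
  shows "(\<integral>\<^sup>+x. ennreal ((cmod (f x))\<^sup>2) \<partial>M) = ennreal ((norm2 M f)\<^sup>2)"
  using assms by (simp add: norm2_power2 L2_iff nn_integral_eq_integral)

lemma L2_I_nn_integral:
  assumes "f \<in> borel_measurable M" "0 \<le> c"
    and "(\<integral>\<^sup>+x. ennreal ((cmod (f x))\<^sup>2) \<partial>M) \<le> ennreal (c\<^sup>2)"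
  shows "f \<in> vecs (L2 M)" "norm2 M f \<le> c"
proof -
  have "integrable M (\<lambda>x. (cmod (f x))\<^sup>2)"
    using assms by (intro integrableI_bounded) (auto intro: le_less_trans)
  then show f: "f \<in> vecs (L2 M)"
    using assms by (simp add: L2_iff)
  have "ennreal ((norm2 M f)\<^sup>2) \<le> ennreal (c\<^sup>2)"
    using assms nn_integral_norm2[OF f] by simp
  then show "norm2 M f \<le> c"
    using assms(2) by (auto simp: ennreal_le_iff intro: power2_le_imp_le)
qed

lemma norm2_cong_AE:
  assumes "f \<in> borel_measurable M" "g \<in> borel_measurable M" "AE x in M. f x = g x"
  shows "norm2 M f = norm2 M g"
  unfolding norm2_eq using assms by (intro arg_cong[where f=sqrt] integral_cong_AE) auto

lemma L2_cong_AE: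
  assumes "f \<in> vecs (L2 M)" "g \<in> borel_measurable M" "AE x in M. f x = g x"
  shows "g \<in> vecs (L2 M)"
proof -
  have "integrable M (\<lambda>x. (cmod (g x))\<^sup>2)"
    using assms by (subst integrable_cong_AE[where g="\<lambda>x. (cmod (f x))\<^sup>2"]) (auto simp: L2_iff)
  then show ?thesis using assms by (simp add: L2_iff)
qed

lemma borel_measurable_cnj [measurable]: "cnj \<in> borel_measurable borel"
  by (intro borel_measurable_continuous_onI continuous_intros)

lemma L2_mult_integrable:
  assumes "f \<in> vecs (L2 M)" "g \<in> vecs (L2 M)"
  shows "integrable M (\<lambda>x. f x * g x)"
proof (rule Bochner_Integration.integrable_bound)
  show "integrable M (\<lambda>x. (cmod (f x))\<^sup>2 + (cmod (g x))\<^sup>2)"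
    using assms by (simp add: L2_iff)
  show "(\<lambda>x. f x * g x) \<in> borel_measurable M"
    using assms by (auto simp: L2_iff)
  have "norm (f x * g x) \<le> norm ((cmod (f x))\<^sup>2 + (cmod (g x))\<^sup>2)" for x
  proof -
    have "0 \<le> (cmod (f x) - cmod (g x))\<^sup>2" by simp
    then have "2 * (cmod (f x) * cmod (g x)) \<le> (cmod (f x))\<^sup>2 + (cmod (g x))\<^sup>2"
      unfolding power2_diff by (simp add: mult.assoc)
    moreover have "0 \<le> cmod (f x) * cmod (g x)" by simp
    ultimately have "cmod (f x) * cmod (g x) \<le> (cmod (f x))\<^sup>2 + (cmod (g x))\<^sup>2"
      by linarith
    then show ?thesis by (simp add: norm_mult)
  qed
  then show "AE x in M. norm (f x * g x) \<le> norm ((cmod (f x))\<^sup>2 + (cmod (g x))\<^sup>2)" by simp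
qed

lemma L2_cnj: "f \<in> vecs (L2 M) \<Longrightarrow> (\<lambda>x. cnj (f x)) \<in> vecs (L2 M)"
  by (auto simp: L2_iff intro!: measurable_compose[OF _ borel_measurable_cnj])

lemma norm2_cnj: "norm2 M (\<lambda>x. cnj (f x)) = norm2 M f"
  by (simp add: norm2_eq)

lemma L2_cmult: "f \<in> vecs (L2 M) \<Longrightarrow> (\<lambda>x. a * f x) \<in> vecs (L2 M)"
  by (auto simp: L2_iff norm_mult power_mult_distrib)

lemma norm2_cmult: "norm2 M (\<lambda>x. a * f x) = cmod a * norm2 M f"
  by (simp add: norm2_eq norm_mult power_mult_distrib real_sqrt_mult)

lemma L2_add:
  assumes "f \<in> vecs (L2 M)" "g \<in> vecs (L2 M)"
  shows "(\<lambda>x. f x + g x) \<in> vecs (L2 M)"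
proof -
  have "integrable M (\<lambda>x. (cmod (f x + g x))\<^sup>2)"
  proof (rule Bochner_Integration.integrable_bound)
    show "integrable M (\<lambda>x. 2 * (cmod (f x))\<^sup>2 + 2 * (cmod (g x))\<^sup>2)"
      using assms by (simp add: L2_iff)
    show "(\<lambda>x. (cmod (f x + g x))\<^sup>2) \<in> borel_measurable M"
      using assms by (auto simp: L2_iff)
    have "norm ((cmod (f x + g x))\<^sup>2) \<le> norm (2 * (cmod (f x))\<^sup>2 + 2 * (cmod (g x))\<^sup>2)" for x
    proof -
      have "(cmod (f x + g x))\<^sup>2 \<le> (cmod (f x) + cmod (g x))\<^sup>2"
        by (intro power_mono norm_triangle_ineq) auto
      also have "\<dots> \<le> 2 * (cmod (f x))\<^sup>2 + 2 * (cmod (g x))\<^sup>2"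
        using zero_le_power2[of "cmod (f x) - cmod (g x)"]
        unfolding power2_diff power2_sum by linarith
      finally show ?thesis by simp
    qed
    then show "AE x in M. norm ((cmod (f x + g x))\<^sup>2) \<le> norm (2 * (cmod (f x))\<^sup>2 + 2 * (cmod (g x))\<^sup>2)"
      by simp
  qed
  then show ?thesis using assms by (auto simp: L2_iff)
qed

lemma L2_lincomb:
  "f \<in> vecs (L2 M) \<Longrightarrow> g \<in> vecs (L2 M) \<Longrightarrow> (\<lambda>x. a * f x + b * g x) \<in> vecs (L2 M)"
  by (intro L2_add L2_cmult)

lemma L2_diff:
  assumes "f \<in> vecs (L2 M)" "g \<in> vecs (L2 M)"
  shows "(\<lambda>x. f x - g x) \<in> vecs (L2 M)"
  using L2_lincomb[OF assms, of 1 "-1"] by simp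

lemma L2_zero [simp]: "(\<lambda>_. 0) \<in> vecs (L2 M)"
  by (simp add: L2_iff)

lemma norm2_zero [simp]: "norm2 M (\<lambda>_. 0) = 0"
  by (simp add: norm2_eq)

lemma L2_sum: "(\<And>i. i \<in> I \<Longrightarrow> F i \<in> vecs (L2 M)) \<Longrightarrow> (\<lambda>x. \<Sum>i\<in>I. F i x) \<in> vecs (L2 M)"
  by (induction I rule: infinite_finite_induct) (auto intro: L2_add)

lemma norm2_eq_0_iff:
  assumes "f \<in> vecs (L2 M)"
  shows "norm2 M f = 0 \<longleftrightarrow> (AE x in M. f x = 0)"
  using assms by (simp add: norm2_eq L2_iff integral_nonneg_eq_0_iff_AE)

lemma norm2_diff_eq_0_iff:
  assumes "f \<in> vecs (L2 M)" "g \<in> vecs (L2 M)"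
  shows "norm2 M (\<lambda>x. f x - g x) = 0 \<longleftrightarrow> (AE x in M. f x = g x)"
  using norm2_eq_0_iff[OF L2_diff[OF assms]] by simp

lemma norm2_minus_commute: "norm2 M (\<lambda>x. f x - g x) = norm2 M (\<lambda>x. g x - f x)"
  by (simp add: norm2_eq norm_minus_commute)

lemma ennreal_le_if_power2_le:
  fixes x :: ennreal
  assumes "x\<^sup>2 \<le> (ennreal c)\<^sup>2" "0 \<le> c"
  shows "x \<le> ennreal c"
proof (cases x)
  case (real a)
  with assms have "a\<^sup>2 \<le> c\<^sup>2" by (simp add: ennreal_power)
  then have "a \<le> c" using assms(2) by (rule power2_le_imp_le)
  with real show ?thesis by (simp add: ennreal_leI)
next
  case top
  then show ?thesis using assms by (simp add: ennreal_power top_power_ennreal top_unique)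
qed

lemma nn_integral_Cauchy_Schwarz:
  assumes f: "f \<in> vecs (L2 M)" and g: "g \<in> vecs (L2 M)"
  shows "(\<integral>\<^sup>+x. ennreal (cmod (f x) * cmod (g x)) \<partial>M) \<le> ennreal (norm2 M f * norm2 M g)"
proof -
  have m: "f \<in> borel_measurable M" "g \<in> borel_measurable M"
    using f g by (auto simp: L2_iff)
  have "(\<integral>\<^sup>+x. ennreal (cmod (f x) * cmod (g x)) \<partial>M)\<^sup>2
      \<le> ennreal ((norm2 M f)\<^sup>2) * ennreal ((norm2 M g)\<^sup>2)"
    using Cauchy_Schwarz_nn_integral[of "\<lambda>x. ennreal (cmod (f x))" M "\<lambda>x. ennreal (cmod (g x))"] m
    by (simp add: ennreal_mult ennreal_power nn_integral_norm2[OF f] nn_integral_norm2[OF g])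
  also have "\<dots> = (ennreal (norm2 M f * norm2 M g))\<^sup>2"
    by (simp add: ennreal_mult[symmetric] ennreal_power power_mult_distrib)
  finally show ?thesis
    by (rule ennreal_le_if_power2_le) simp
qed

lemma Cauchy_Schwarz_L2:
  assumes f: "f \<in> vecs (L2 M)" and g: "g \<in> vecs (L2 M)"
  shows "cmod (LINT x|M. f x * g x) \<le> norm2 M f * norm2 M g"
proof -
  have "ennreal (cmod (LINT x|M. f x * g x)) \<le> (\<integral>\<^sup>+x. ennreal (cmod (f x * g x)) \<partial>M)"
    by (rule integral_norm_bound_ennreal[OF L2_mult_integrable[OF f g]])
  also have "\<dots> \<le> ennreal (norm2 M f * norm2 M g)"
    using nn_integral_Cauchy_Schwarz[OF f g] by (simp add: norm_mult)
  finally show ?thesis by (simp add: ennreal_le_iff)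
qed

lemma norm2_add_power2:
  assumes f: "f \<in> vecs (L2 M)" and g: "g \<in> vecs (L2 M)"
  shows "(norm2 M (\<lambda>x. f x + g x))\<^sup>2
       = (norm2 M f)\<^sup>2 + (norm2 M g)\<^sup>2 + 2 * Re (LINT x|M. f x * cnj (g x))"
proof -
  have i: "integrable M (\<lambda>x. f x * cnj (g x))"
    by (rule L2_mult_integrable[OF f L2_cnj[OF g]])
  have "(LINT x|M. (cmod (f x + g x))\<^sup>2)
      = (LINT x|M. (cmod (f x))\<^sup>2 + (cmod (g x))\<^sup>2 + 2 * Re (f x * cnj (g x)))"
    by (intro Bochner_Integration.integral_cong refl) (simp only: cmod_power2, simp add: power2_eq_square algebra_simps)
  also have "\<dots> = (LINT x|M. (cmod (f x))\<^sup>2) + (LINT x|M. (cmod (g x))\<^sup>2)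
       + 2 * (LINT x|M. Re (f x * cnj (g x)))"
  proof -
    have "(LINT x|M. A x + B x + 2 * R x) = (LINT x|M. A x) + (LINT x|M. B x) + 2 * (LINT x|M. R x)"
      if "integrable M A" "integrable M B" "integrable M R" for A B R :: "'a \<Rightarrow> real"
      using that by simp
    then show ?thesis
      using f g integrable_Re[OF i] by (simp only: L2_iff)
  qed
  also have "(LINT x|M. Re (f x * cnj (g x))) = Re (LINT x|M. f x * cnj (g x))"
    by (rule integral_Re[OF i])
  finally show ?thesis
    by (simp only: norm2_power2)
qed

lemma norm2_triangle:
  assumes f: "f \<in> vecs (L2 M)" and g: "g \<in> vecs (L2 M)"
  shows "norm2 M (\<lambda>x. f x + g x) \<le> norm2 M f + norm2 M g"
proof (rule power2_le_imp_le)
  have "Re (LINT x|M. f x * cnj (g x)) \<le> norm2 M f * norm2 M g"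
    using complex_Re_le_cmod order_trans Cauchy_Schwarz_L2[OF f L2_cnj[OF g]]
    by (fastforce simp: norm2_cnj)
  then show "(norm2 M (\<lambda>x. f x + g x))\<^sup>2 \<le> (norm2 M f + norm2 M g)\<^sup>2"
    unfolding norm2_add_power2[OF f g] by (simp add: power2_sum)
qed simp

lemma norm2_triangle_diff:
  assumes "f \<in> vecs (L2 M)" "g \<in> vecs (L2 M)" "h \<in> vecs (L2 M)"
  shows "norm2 M (\<lambda>x. f x - h x) \<le> norm2 M (\<lambda>x. f x - g x) + norm2 M (\<lambda>x. g x - h x)"
  using norm2_triangle[OF L2_diff[OF assms(1,2)] L2_diff[OF assms(2,3)]] by simp

lemma norm2_le_diff:
  assumes "f \<in> vecs (L2 M)" "g \<in> vecs (L2 M)"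
  shows "norm2 M f \<le> norm2 M g + norm2 M (\<lambda>x. f x - g x)"
  using norm2_triangle[OF assms(2) L2_diff[OF assms]] by simp

lemma null_sequence_if_bounded:
  fixes X :: "nat \<Rightarrow> 'a::real_normed_vector"
  assumes "\<And>n. norm (X n) \<le> Y n" "Y \<longlonglongrightarrow> 0"
  shows "X \<longlonglongrightarrow> 0"
  by (rule Lim_null_comparison[OF always_eventually[OF allI] assms(2)]) (rule assms(1))

lemma tendsto_L2_unique:
  assumes "tendsto_L2 M F g" "tendsto_L2 M F h"
  shows "AE x in M. g x = h x"
proof -
  have g: "g \<in> vecs (L2 M)" and h: "h \<in> vecs (L2 M)" and F: "F n \<in> vecs (L2 M)" for n
    using assms by (auto simp: tendsto_L2_def)
  have "norm2 M (\<lambda>x. g x - h x) \<le> norm2 M (\<lambda>x. F n x - g x) + norm2 M (\<lambda>x. F n x - h x)" for n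
    using norm2_triangle_diff[OF g F h, of n] norm2_minus_commute[of M g "F n"] by simp
  moreover have "(\<lambda>n. norm2 M (\<lambda>x. F n x - g x) + norm2 M (\<lambda>x. F n x - h x)) \<longlonglongrightarrow> 0 + 0"
    using assms by (intro tendsto_add) (auto simp: tendsto_L2_def)
  ultimately have "norm2 M (\<lambda>x. g x - h x) \<le> 0"
    by (intro LIMSEQ_le_const[of "\<lambda>n. norm2 M (\<lambda>x. F n x - g x) + norm2 M (\<lambda>x. F n x - h x)" "0"]) auto
  then show ?thesis
    using norm2_diff_eq_0_iff[OF g h] by (simp add: order_antisym)
qed

lemma tendsto_L2_cong_AE:
  assumes "tendsto_L2 M F g" "\<And>n. G n \<in> borel_measurable M" "h \<in> borel_measurable M"
    and "\<And>n. AE x in M. F n x = G n x" "AE x in M. g x = h x"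
  shows "tendsto_L2 M G h"
proof -
  have 1: "G n \<in> vecs (L2 M)" for n
    using assms by (auto simp: tendsto_L2_def intro: L2_cong_AE)
  have 2: "h \<in> vecs (L2 M)"
    using assms by (auto simp: tendsto_L2_def intro: L2_cong_AE)
  have "norm2 M (\<lambda>x. G n x - h x) = norm2 M (\<lambda>x. F n x - g x)" for n
    using assms(4)[of n] assms(5) assms(1) assms(2)[of n] assms(3)
    by (intro norm2_cong_AE borel_measurable_diff) (auto simp: tendsto_L2_def L2_iff)
  with 1 2 assms(1) show ?thesis by (simp add: tendsto_L2_def)
qed

lemma tendsto_L2_lincomb:
  assumes F: "tendsto_L2 M F f" and G: "tendsto_L2 M G g"
  shows "tendsto_L2 M (\<lambda>n x. a * F n x + b * G n x) (\<lambda>x. a * f x + b * g x)"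
proof -
  have v: "F n \<in> vecs (L2 M)" "f \<in> vecs (L2 M)" "G n \<in> vecs (L2 M)" "g \<in> vecs (L2 M)" for n
    using F G by (auto simp: tendsto_L2_def)
  have "norm2 M (\<lambda>x. a * F n x + b * G n x - (a * f x + b * g x))
      \<le> cmod a * norm2 M (\<lambda>x. F n x - f x) + cmod b * norm2 M (\<lambda>x. G n x - g x)" for n
  proof -
    have "(\<lambda>x. a * F n x + b * G n x - (a * f x + b * g x))
        = (\<lambda>x. a * (F n x - f x) + b * (G n x - g x))"
      by (simp add: algebra_simps)
    then show ?thesis
      using norm2_triangle[OF L2_cmult[OF L2_diff[OF v(1,2)]] L2_cmult[OF L2_diff[OF v(3,4)]], of a n b n]
      by (simp add: norm2_cmult)
  qed
  moreover have "(\<lambda>n. cmod a * norm2 M (\<lambda>x. F n x - f x) + cmod b * norm2 M (\<lambda>x. G n x - g x))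
      \<longlonglongrightarrow> 0"
    using F G by (auto intro!: tendsto_eq_intros simp: tendsto_L2_def)
  ultimately have "(\<lambda>n. norm2 M (\<lambda>x. a * F n x + b * G n x - (a * f x + b * g x))) \<longlonglongrightarrow> 0"
    by - (rule null_sequence_if_bounded[rotated], assumption, simp)
  then show ?thesis
    using v by (auto simp: tendsto_L2_def intro: L2_lincomb)
qed

lemma tendsto_L2_integral:
  assumes F: "tendsto_L2 M F f" and g: "g \<in> vecs (L2 M)"
  shows "(\<lambda>n. LINT x|M. F n x * g x) \<longlonglongrightarrow> (LINT x|M. f x * g x)"
proof -
  have v: "F n \<in> vecs (L2 M)" "f \<in> vecs (L2 M)" for n
    using F by (auto simp: tendsto_L2_def)
  have "cmod ((LINT x|M. F n x * g x) - (LINT x|M. f x * g x))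
      \<le> norm2 M (\<lambda>x. F n x - f x) * norm2 M g" for n
  proof -
    have "(LINT x|M. F n x * g x) - (LINT x|M. f x * g x) = (LINT x|M. (F n x - f x) * g x)"
      using L2_mult_integrable[OF v(1) g] L2_mult_integrable[OF v(2) g]
      by (simp add: left_diff_distrib)
    then show ?thesis using Cauchy_Schwarz_L2[OF L2_diff[OF v] g] by simp
  qed
  moreover have "(\<lambda>n. norm2 M (\<lambda>x. F n x - f x) * norm2 M g) \<longlonglongrightarrow> 0"
    using F by (auto intro!: tendsto_eq_intros simp: tendsto_L2_def)
  ultimately have "(\<lambda>n. (LINT x|M. F n x * g x) - (LINT x|M. f x * g x)) \<longlonglongrightarrow> 0"
    by (rule null_sequence_if_bounded)
  then show ?thesis by (simp add: LIM_zero_iff)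
qed

lemma tendsto_L2_norm2:
  assumes F: "tendsto_L2 M F f"
  shows "(\<lambda>n. norm2 M (F n)) \<longlonglongrightarrow> norm2 M f"
proof -
  have v: "F n \<in> vecs (L2 M)" "f \<in> vecs (L2 M)" for n
    using F by (auto simp: tendsto_L2_def)
  have "\<bar>norm2 M (F n) - norm2 M f\<bar> \<le> norm2 M (\<lambda>x. F n x - f x)" for n
    using norm2_le_diff[OF v, of n] norm2_le_diff[OF v(2) v(1), of n]
      norm2_minus_commute[of M f "F n"] by linarith
  then have "(\<lambda>n. norm2 M (F n) - norm2 M f) \<longlonglongrightarrow> 0"
    using F by - (rule null_sequence_if_bounded[rotated], auto simp: tendsto_L2_def)
  then show ?thesis by (simp add: LIM_zero_iff)
qed

lemma AE_eq_if_integrals_eq: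
  assumes g: "g \<in> vecs (L2 M)" and h: "h \<in> vecs (L2 M)"
    and eq: "\<And>f. f \<in> vecs (L2 M) \<Longrightarrow> (LINT x|M. f x * g x) = (LINT x|M. f x * h x)"
  shows "AE x in M. g x = h x"
proof -
  let ?d = "\<lambda>x. g x - h x"
  let ?f = "\<lambda>x. cnj (?d x)"
  have d: "?d \<in> vecs (L2 M)" by (rule L2_diff[OF g h])
  have f: "?f \<in> vecs (L2 M)" by (rule L2_cnj[OF d])
  have "(LINT x|M. ?f x * ?d x) = (LINT x|M. ?f x * g x - ?f x * h x)"
    by (simp only: right_diff_distrib)
  also have "\<dots> = (LINT x|M. ?f x * g x) - (LINT x|M. ?f x * h x)"
    by (rule Bochner_Integration.integral_diff[OF L2_mult_integrable[OF f g] L2_mult_integrable[OF f h]])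
  also have "\<dots> = 0" using eq[OF f] by simp
  finally have "(LINT x|M. ?d x * cnj (?d x)) = 0" by (simp only: mult.commute)
  then have "(LINT x|M. (cmod (?d x))\<^sup>2) = 0"
    unfolding complex_norm_square[symmetric] by (simp only: integral_complex_of_real of_real_eq_0_iff)
  then show ?thesis
    using norm2_diff_eq_0_iff[OF g h] by (simp add: norm2_eq)
qed

text \<open>
  Completeness. Along a rapidly convergent subsequence with increments \<open>D\<^sub>n\<close>, the weighted sum
  \<open>\<Sum> 2\<^sup>n D\<^sub>n\<^sup>2\<close> has finite integral, hence is finite almost everywhere; there \<open>D\<^sub>n = O(2\<^sup>-\<^sup>n\<^sup>/\<^sup>2)\<close>, so that the
  subsequence converges pointwise, and Fatou's lemma identifies the pointwise limit as the \<open>L\<^sup>2\<close> limit.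
\<close>

theorem Riesz_Fischer:
  assumes F: "\<And>n. F n \<in> vecs (L2 M)"
    and Cauchy: "\<And>e. e > 0 \<Longrightarrow> \<exists>N. \<forall>m\<ge>N. \<forall>n\<ge>N. norm2 M (\<lambda>x. F m x - F n x) < e"
  shows "\<exists>g. tendsto_L2 M F g"
proof -
  have Fm [measurable]: "F n \<in> borel_measurable M" for n
    using F by (simp add: L2_iff)
  have "\<forall>k. \<exists>N. \<forall>m\<ge>N. \<forall>n\<ge>N. norm2 M (\<lambda>x. F m x - F n x) < (1/2)^k"
    using Cauchy by simp
  then obtain N where N: "\<And>k m n. N k \<le> m \<Longrightarrow> N k \<le> n \<Longrightarrow> norm2 M (\<lambda>x. F m x - F n x) < (1/2)^k"
    by metis
  define r where "r k = (\<Sum>j\<le>k. N j) + k" for k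
  have rN: "N k \<le> r k" for k
    using member_le_sum[of k "{..k}" N] by (simp add: r_def)
  have rS: "r k \<le> r (Suc k)" for k by (simp add: r_def)
  have r_ge: "k \<le> r k" for k by (simp add: r_def)
  have rr: "norm2 M (\<lambda>x. F (r (Suc k)) x - F (r k) x) < (1/2)^k" for k
    using N[of k] rN[of k] rS[of k] order_trans by blast
  define D where "D k x = F (r (Suc k)) x - F (r k) x" for k x
  have Dm [measurable]: "D k \<in> borel_measurable M" for k
    unfolding D_def by measurable
  have DL: "D k \<in> vecs (L2 M)" for k
    unfolding D_def by (intro L2_diff F)
  have "(\<integral>\<^sup>+x. (\<Sum>k. ennreal (2^k * (cmod (D k x))\<^sup>2)) \<partial>M)
      = (\<Sum>k. (\<integral>\<^sup>+x. ennreal (2^k * (cmod (D k x))\<^sup>2) \<partial>M))"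
    by (rule nn_integral_suminf) measurable
  also have "\<dots> \<le> (\<Sum>k. ennreal ((1/2)^k))"
  proof (intro suminf_le summableI allI)
    fix k
    have "(\<integral>\<^sup>+x. ennreal (2^k * (cmod (D k x))\<^sup>2) \<partial>M) = ennreal (2^k) * ennreal ((norm2 M (D k))\<^sup>2)"
      by (simp add: ennreal_mult nn_integral_cmult nn_integral_norm2[OF DL])
    also have "\<dots> \<le> ennreal (2^k) * ennreal (((1/2)^k)\<^sup>2)"
      using rr[of k] by (intro mult_left_mono ennreal_leI power_mono) (auto simp: D_def[abs_def])
    also have "\<dots> = ennreal ((1/2)^k)"
      by (simp add: ennreal_mult[symmetric] power2_eq_square power_mult_distrib[symmetric]
          flip: mult.assoc)
    finally show "(\<integral>\<^sup>+x. ennreal (2^k * (cmod (D k x))\<^sup>2) \<partial>M) \<le> ennreal ((1/2)^k)" .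
  qed
  also have "\<dots> = ennreal (\<Sum>k. (1/2)^k)"
    by (rule suminf_ennreal2) (auto intro: summable_geometric)
  finally have fin: "(\<integral>\<^sup>+x. (\<Sum>k. ennreal (2^k * (cmod (D k x))\<^sup>2)) \<partial>M) \<noteq> \<infinity>"
    by (auto simp: top_unique)
  have "AE x in M. (\<Sum>k. ennreal (2^k * (cmod (D k x))\<^sup>2)) \<noteq> \<infinity>"
    by (rule nn_integral_PInf_AE[OF _ fin]) measurable
  then have conv: "AE x in M. convergent (\<lambda>k. F (r k) x)"
  proof eventually_elim
    fix x assume "(\<Sum>k. ennreal (2^k * (cmod (D k x))\<^sup>2)) \<noteq> \<infinity>"
    then have "summable (\<lambda>k. 2^k * (cmod (D k x))\<^sup>2)"
      by (intro summable_suminf_not_top) auto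
    then have "Bseq (\<lambda>k. 2^k * (cmod (D k x))\<^sup>2)"
      by (intro convergent_imp_Bseq) (auto dest: summable_LIMSEQ_zero simp: convergent_def)
    then obtain B where B: "B > 0" "\<And>k. norm (2^k * (cmod (D k x))\<^sup>2) \<le> B"
      by (auto elim: BseqE)
    have bound: "norm (D k x) \<le> sqrt B * (1 / sqrt 2)^k" for k
    proof (rule power2_le_imp_le)
      have "(cmod (D k x))\<^sup>2 \<le> B / 2^k"
        using B(2)[of k] by (simp add: field_simps abs_mult)
      also have "\<dots> = (sqrt B * (1 / sqrt 2)^k)\<^sup>2"
      proof -
        have "((1 / sqrt 2)^k)\<^sup>2 = ((1 / sqrt 2)\<^sup>2)^k" by (simp only: power_mult[symmetric] mult.commute)
        also have "\<dots> = (1/2)^k" by (simp add: power_divide)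
        finally show ?thesis using B(1) by (simp add: power_mult_distrib power_divide)
      qed
      finally show "(norm (D k x))\<^sup>2 \<le> (sqrt B * (1 / sqrt 2)^k)\<^sup>2" .
      show "0 \<le> sqrt B * (1 / sqrt 2) ^ k" using B by simp
    qed
    have "summable (\<lambda>k. sqrt B * (1 / sqrt 2)^k)"
      by (intro summable_mult summable_geometric) (simp add: real_less_rsqrt)
    then have "summable (\<lambda>k. D k x)"
      by (rule summable_comparison_test') (use bound in auto)
    then have "convergent (\<lambda>n. \<Sum>k<n. D k x)"
      by (simp add: summable_iff_convergent)
    moreover have "(\<Sum>k<n. D k x) = F (r n) x - F (r 0) x" for n
      unfolding D_def by (rule sum_lessThan_telescope)
    ultimately have "convergent (\<lambda>n. F (r n) x - F (r 0) x)" by simp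
    then have "convergent (\<lambda>n. (F (r n) x - F (r 0) x) + F (r 0) x)"
      by (intro convergent_add convergent_const)
    then show "convergent (\<lambda>k. F (r k) x)" by simp
  qed
  define g where "g x = lim (\<lambda>k. F (r k) x)" for x
  have gm [measurable]: "g \<in> borel_measurable M"
    unfolding g_def by (rule borel_measurable_lim_metric) measurable
  have lim: "AE x in M. (\<lambda>k. F (r k) x) \<longlonglongrightarrow> g x"
    using conv by eventually_elim (simp add: g_def convergent_LIMSEQ_iff)
  have key: "\<exists>n0. \<forall>m\<ge>n0. (\<lambda>x. F m x - g x) \<in> vecs (L2 M) \<and> norm2 M (\<lambda>x. F m x - g x) \<le> e"
    if e: "e > 0" for e
  proof -
    obtain n0 where n0: "\<And>m n. n0 \<le> m \<Longrightarrow> n0 \<le> n \<Longrightarrow> norm2 M (\<lambda>x. F m x - F n x) < e"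
      using Cauchy[OF e] by blast
    have "(\<lambda>x. F m x - g x) \<in> vecs (L2 M) \<and> norm2 M (\<lambda>x. F m x - g x) \<le> e" if m: "m \<ge> n0" for m
    proof -
      have "(\<integral>\<^sup>+x. ennreal ((cmod (F m x - g x))\<^sup>2) \<partial>M)
          = (\<integral>\<^sup>+x. liminf (\<lambda>k. ennreal ((cmod (F m x - F (r k) x))\<^sup>2)) \<partial>M)"
      proof (intro nn_integral_cong_AE, use lim in eventually_elim)
        fix x assume "(\<lambda>k. F (r k) x) \<longlonglongrightarrow> g x"
        then have "(\<lambda>k. ennreal ((cmod (F m x - F (r k) x))\<^sup>2)) \<longlonglongrightarrow> ennreal ((cmod (F m x - g x))\<^sup>2)"
          by (intro tendsto_intros) auto
        then show "ennreal ((cmod (F m x - g x))\<^sup>2) = liminf (\<lambda>k. ennreal ((cmod (F m x - F (r k) x))\<^sup>2))"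
          by (intro lim_imp_Liminf[symmetric]) simp_all
      qed
      also have "\<dots> \<le> liminf (\<lambda>k. (\<integral>\<^sup>+x. ennreal ((cmod (F m x - F (r k) x))\<^sup>2) \<partial>M))"
        by (rule nn_integral_liminf) measurable
      also have "\<dots> \<le> ennreal (e\<^sup>2)"
      proof (rule Liminf_le)
        show "\<forall>\<^sub>F k in sequentially. (\<integral>\<^sup>+x. ennreal ((cmod (F m x - F (r k) x))\<^sup>2) \<partial>M) \<le> ennreal (e\<^sup>2)"
          using eventually_ge_at_top[of n0]
        proof eventually_elim
          case (elim k)
          have "norm2 M (\<lambda>x. F m x - F (r k) x) < e"
            using n0[OF m] r_ge[of k] elim by auto
          then show ?case
            using nn_integral_norm2[OF L2_diff[OF F F]] by (simp add: ennreal_leI power_mono)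
        qed
      qed simp
      finally show ?thesis
        using L2_I_nn_integral[of "\<lambda>x. F m x - g x" M e] e by auto
    qed
    then show ?thesis by blast
  qed
  obtain n1 where "(\<lambda>x. F n1 x - g x) \<in> vecs (L2 M)"
    using key[of 1] by auto
  from L2_diff[OF F this, of n1] have gL: "g \<in> vecs (L2 M)" by simp
  have "(\<lambda>n. norm2 M (\<lambda>x. F n x - g x)) \<longlonglongrightarrow> 0"
  proof (rule LIMSEQ_I)
    fix e :: real assume "e > 0"
    then obtain n0 where "\<forall>m\<ge>n0. norm2 M (\<lambda>x. F m x - g x) \<le> e/2"
      using key[of "e/2"] by auto
    then show "\<exists>n0. \<forall>n\<ge>n0. norm (norm2 M (\<lambda>x. F n x - g x) - 0) < e"
      using \<open>e > 0\<close> by (intro exI[of _ n0]) (fastforce)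
  qed
  then show ?thesis using F gL unfolding tendsto_L2_def by blast
qed

text \<open>
  The representing function is the conjugate of the minimiser of \<open>J f = \<parallel>f\<parallel>\<^sup>2 - 2 Re (\<phi> f)\<close>: minimising sequences are Cauchy by the
  parallelogram law, and the first variation of \<open>J\<close> at the minimiser is the representation.
\<close>

theorem Riesz_representation_L2:
  assumes lin: "\<And>f g a b. f \<in> vecs (L2 M) \<Longrightarrow> g \<in> vecs (L2 M) \<Longrightarrow>
      \<phi> (\<lambda>x. a * f x + b * g x) = a * \<phi> f + b * \<phi> g"
    and bnd: "\<And>f. f \<in> vecs (L2 M) \<Longrightarrow> cmod (\<phi> f) \<le> C * norm2 M f"
  shows "\<exists>g\<in>vecs (L2 M). \<forall>f\<in>vecs (L2 M). \<phi> f = (LINT x|M. f x * g x)"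
proof -
  define J where "J f = (norm2 M f)\<^sup>2 - 2 * Re (\<phi> f)" for f
  define I where "I = (INF f\<in>vecs (L2 M). J f)"
  have J_lb: "- C\<^sup>2 \<le> J f" if f: "f \<in> vecs (L2 M)" for f
  proof -
    have "Re (\<phi> f) \<le> C * norm2 M f"
      using bnd[OF f] complex_Re_le_cmod order_trans by blast
    moreover have "0 \<le> (norm2 M f - C)\<^sup>2" by simp
    ultimately show ?thesis by (simp add: J_def power2_diff algebra_simps)
  qed
  have bdd: "bdd_below (J ` vecs (L2 M))"
    using J_lb by (auto simp: bdd_below_def)
  have ne: "vecs (L2 M) \<noteq> {}"
    using L2_zero by blast
  have I_le: "I \<le> J f" if "f \<in> vecs (L2 M)" for f
    unfolding I_def by (rule cINF_lower[OF bdd that])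
  have "\<exists>f\<in>vecs (L2 M). J f < I + 1 / real (Suc n)" for n
    using cINF_less_iff[OF ne bdd, of "I + 1 / real (Suc n)"] by (simp add: I_def)
  then obtain F where F: "\<And>n. F n \<in> vecs (L2 M)" and FJ: "\<And>n. J (F n) < I + 1 / real (Suc n)"
    by metis
  have para: "(norm2 M (\<lambda>x. f x - h x))\<^sup>2 \<le> 2 * (J f - I) + 2 * (J h - I)"
    if f: "f \<in> vecs (L2 M)" and h: "h \<in> vecs (L2 M)" for f h
  proof -
    let ?m = "\<lambda>x. 1/2 * f x + 1/2 * h x"
    have m: "?m \<in> vecs (L2 M)" by (intro L2_lincomb f h)
    have "(norm2 M (\<lambda>x. f x - h x))\<^sup>2 + (norm2 M (\<lambda>x. f x + h x))\<^sup>2 = 2 * (norm2 M f)\<^sup>2 + 2 * (norm2 M h)\<^sup>2"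
      using norm2_add_power2[OF f h] norm2_add_power2[OF f L2_cmult[OF h, of "-1"]]
      by (simp add: norm2_cmult[of M "-1", simplified])
    moreover have "norm2 M (\<lambda>x. f x + h x) = 2 * norm2 M ?m"
    proof -
      have "(\<lambda>x. f x + h x) = (\<lambda>x. 2 * ?m x)" by (simp add: algebra_simps)
      then show ?thesis using norm2_cmult[of M 2 ?m] by simp
    qed
    moreover have "Re (\<phi> ?m) = (Re (\<phi> f) + Re (\<phi> h)) / 2"
      using lin[OF f h, of "1/2" "1/2"] by simp
    ultimately have "(norm2 M (\<lambda>x. f x - h x))\<^sup>2 = 2 * J f + 2 * J h - 4 * J ?m"
      by (simp add: J_def power_mult_distrib algebra_simps)
    with I_le[OF m] show ?thesis by simp
  qed
  have "\<exists>g. tendsto_L2 M F g"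
  proof (rule Riesz_Fischer[OF F])
    fix e :: real assume e: "e > 0"
    then have "4 / e\<^sup>2 > 0" by simp
    obtain N where N: "4 / e\<^sup>2 < real (Suc N)"
      using reals_Archimedean2[of "4 / e\<^sup>2"] by (metis less_Suc_eq less_trans of_nat_less_iff)
    have "norm2 M (\<lambda>x. F m x - F n x) < e" if "m \<ge> N" "n \<ge> N" for m n
    proof (rule power2_less_imp_less)
      have *: "1 / real (Suc k) \<le> 1 / real (Suc N)" if "k \<ge> N" for k
        using that by (simp add: frac_le)
      have "(norm2 M (\<lambda>x. F m x - F n x))\<^sup>2 < 4 * (1 / real (Suc N))"
        using para[OF F F, of m n] FJ[of m] FJ[of n] *[OF that(1)] *[OF that(2)] by simp
      also have "\<dots> < e\<^sup>2"
        using N e by (simp add: field_simps)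
      finally show "(norm2 M (\<lambda>x. F m x - F n x))\<^sup>2 < e\<^sup>2" .
    qed (use e in simp)
    then show "\<exists>N. \<forall>m\<ge>N. \<forall>n\<ge>N. norm2 M (\<lambda>x. F m x - F n x) < e" by blast
  qed
  then obtain g where g: "tendsto_L2 M F g" by blast
  have gL: "g \<in> vecs (L2 M)" using g by (simp add: tendsto_L2_def)
  have "(\<lambda>n. \<phi> (F n)) \<longlonglongrightarrow> \<phi> g"
  proof -
    have "norm (\<phi> (F n) - \<phi> g) \<le> C * norm2 M (\<lambda>x. F n x - g x)" for n
      using bnd[OF L2_diff[OF F gL], of n] lin[OF F gL, of 1 n "-1"] by simp
    moreover have "(\<lambda>n. C * norm2 M (\<lambda>x. F n x - g x)) \<longlonglongrightarrow> 0"
      using g by (auto intro!: tendsto_eq_intros simp: tendsto_L2_def)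
    ultimately have "(\<lambda>n. \<phi> (F n) - \<phi> g) \<longlonglongrightarrow> 0"
      by (rule null_sequence_if_bounded)
    then show ?thesis by (simp add: LIM_zero_iff)
  qed
  then have "(\<lambda>n. J (F n)) \<longlonglongrightarrow> J g"
    unfolding J_def using tendsto_L2_norm2[OF g] by (intro tendsto_intros)
  moreover have "(\<lambda>n. I + 1 / real (Suc n)) \<longlonglongrightarrow> I + 0"
    by (intro tendsto_intros LIMSEQ_Suc lim_1_over_n)
  ultimately have "J g \<le> I + 0"
    by (rule LIMSEQ_le) (use FJ in \<open>auto intro: less_imp_le\<close>)
  then have min: "J g \<le> J f" if "f \<in> vecs (L2 M)" for f
    using I_le[OF that] by simp
  have Re0: "Re (\<phi> f) = Re (LINT x|M. f x * cnj (g x))" if f: "f \<in> vecs (L2 M)" for f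
  proof -
    define d where "d = Re (LINT x|M. f x * cnj (g x)) - Re (\<phi> f)"
    have quad: "0 \<le> t\<^sup>2 * (norm2 M f)\<^sup>2 + 2 * t * d" for t
    proof -
      have tf: "(\<lambda>x. complex_of_real t * f x) \<in> vecs (L2 M)" by (rule L2_cmult[OF f])
      have "J (\<lambda>x. complex_of_real t * f x + g x) = J g + t\<^sup>2 * (norm2 M f)\<^sup>2 + 2 * t * d"
      proof -
        define c where "c = (LINT x|M. f x * cnj (g x))"
        have c: "(LINT x|M. complex_of_real t * f x * cnj (g x)) = complex_of_real t * c"
          by (simp add: mult.assoc c_def)
        have n: "(norm2 M (\<lambda>x. complex_of_real t * f x))\<^sup>2 = t\<^sup>2 * (norm2 M f)\<^sup>2"
          by (simp only: norm2_cmult power_mult_distrib) simp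
        have p: "Re (\<phi> (\<lambda>x. complex_of_real t * f x + g x)) = t * Re (\<phi> f) + Re (\<phi> g)"
          using lin[OF f gL, of "complex_of_real t" 1] by simp
        have "J (\<lambda>x. complex_of_real t * f x + g x)
            = t\<^sup>2 * (norm2 M f)\<^sup>2 + (norm2 M g)\<^sup>2 + 2 * Re (complex_of_real t * c)
              - 2 * (t * Re (\<phi> f) + Re (\<phi> g))"
          unfolding J_def norm2_add_power2[OF tf gL] c n p ..
        also have "Re (complex_of_real t * c) = t * Re c" by simp
        finally show ?thesis by (simp add: J_def d_def c_def[symmetric] algebra_simps)
      qed
      with min[OF L2_add[OF tf gL]] show ?thesis by simp
    qed
    have "d = 0"
    proof (rule ccontr)
      assume "d \<noteq> 0"
      define n where "n = (norm2 M f)\<^sup>2 + 1"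
      have n: "n > 0" by (simp add: n_def add_nonneg_pos)
      have "0 \<le> (- d / n)\<^sup>2 * (norm2 M f)\<^sup>2 + 2 * (- d / n) * d" by (rule quad)
      also have "\<dots> \<le> (- d / n)\<^sup>2 * n + 2 * (- d / n) * d"
        by (intro add_right_mono mult_left_mono) (auto simp: n_def)
      also have "\<dots> = - (d\<^sup>2 / n)"
        using n by (simp add: power2_eq_square field_simps)
      also have "\<dots> < 0" using n \<open>d \<noteq> 0\<close> by simp
      finally show False by simp
    qed
    then show ?thesis by (simp add: d_def)
  qed
  have "\<phi> f = (LINT x|M. f x * cnj (g x))" if f: "f \<in> vecs (L2 M)" for f
  proof (rule complex_eqI)
    show "Re (\<phi> f) = Re (LINT x|M. f x * cnj (g x))" by (rule Re0[OF f])
    have 1: "\<phi> (\<lambda>x. \<i> * f x) = \<i> * \<phi> f"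
      using lin[OF f f, of \<i> 0] by simp
    have 2: "(LINT x|M. \<i> * f x * cnj (g x)) = \<i> * (LINT x|M. f x * cnj (g x))"
      by (simp add: mult.assoc)
    have "- Im (\<phi> f) = - Im (LINT x|M. f x * cnj (g x))"
      using Re0[OF L2_cmult[OF f, of \<i>]] unfolding 1 2 Re_i_times .
    then show "Im (\<phi> f) = Im (LINT x|M. f x * cnj (g x))"
      by (rule neg_equal_iff_equal[THEN iffD1])
  qed
  then show ?thesis
    by (intro bexI[OF _ L2_cnj[OF gL]] ballI)
qed

section \<open>Pairing the range of a projection with the range of its transpose\<close>

lemma banach_dual_vecs:
  "\<phi> \<in> vecs (banach_dual X) \<longleftrightarrow>
    (\<forall>x\<in>vecs X. \<forall>y\<in>vecs X. \<forall>a b. \<phi> (\<lambda>u. a * x u + b * y u) = a * \<phi> x + b * \<phi> y) \<and>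
    (\<exists>C. \<forall>x\<in>vecs X. cmod (\<phi> x) \<le> C * snorm X x)"
  by (simp add: banach_dual_def)

lemma banach_dual_snorm:
  "snorm (banach_dual X) \<phi> = (SUP x\<in>{x \<in> vecs X. snorm X x \<le> 1}. cmod (\<phi> x))"
  by (simp add: banach_dual_def)

text \<open>
  Multiplication by \<open>\<rho>\<close> is an isometry of \<open>L\<^sup>2(\<rho>\<^sup>2 \<mu>)\<close> onto \<open>L\<^sup>2(\<mu>)\<close> that turns the pairing into
  \<open>\<integral> f g d\<mu>\<close>, and the hypothesis on \<open>H'\<close> says that \<open>H'\<close> is the fixed space of the transpose of \<open>P\<close>.
  Surjectivity is the Riesz representation of \<open>\<phi> \<circ> P\<close>. Injectivity holds because an element of \<open>H'\<close>
  that annihilates \<open>H\<close> annihilates every \<open>f\<close>, as \<open>\<langle>f, g\<rangle> = \<langle>P f, g\<rangle>\<close>.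
\<close>

lemma hilbert_pairing_duality:
  fixes M M' N :: "'a measure" and \<rho> :: "'a \<Rightarrow> real"
    and P :: "('a \<Rightarrow> complex) \<Rightarrow> 'a \<Rightarrow> complex" and H H' :: "'a fspace"
  assumes \<rho>m [measurable]: "\<rho> \<in> borel_measurable M"
    and \<rho>pos: "AE x in M. 0 < \<rho> x"
    and M': "M' = density M (\<lambda>x. ennreal ((\<rho> x)\<^sup>2))"
    and N: "N = density M (\<lambda>x. ennreal (\<rho> x))"
    and P_L2: "\<And>f. f \<in> vecs (L2 M) \<Longrightarrow> P f \<in> vecs (L2 M)"
    and P_lin: "\<And>f g a b. f \<in> vecs (L2 M) \<Longrightarrow> g \<in> vecs (L2 M) \<Longrightarrow>
        AE x in M. P (\<lambda>t. a * f t + b * g t) x = a * P f x + b * P g x"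
    and P_bnd: "\<And>f. f \<in> vecs (L2 M) \<Longrightarrow> norm2 M (P f) \<le> C * norm2 M f"
    and P_idem: "\<And>f. f \<in> vecs (L2 M) \<Longrightarrow> AE x in M. P (P f) x = P f x"
    and H_fix: "\<And>f. f \<in> vecs H \<longleftrightarrow> f \<in> vecs (L2 M) \<and> (AE x in M. P f x = f x)"
    and H_norm: "snorm H = norm2 M"
    and H'_vecs: "\<And>g. g \<in> vecs H' \<longleftrightarrow> g \<in> vecs (L2 M') \<and>
        (\<forall>f\<in>vecs (L2 M). (LINT x|N. P f x * g x) = (LINT x|N. f x * g x))"
    and H'_norm: "snorm H' = norm2 M'"
    and T: "T = (\<lambda>g f. LINT x|N. f x * g x)"
  shows "\<exists>S. inverse_operators H' (banach_dual H) T S \<and>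
             op_norm (banach_dual H) H' S = op_norm (L2 M) (L2 M) P"
proof -
  have [measurable_cong]: "sets M' = sets M" "sets N = sets M"
    by (simp_all add: M' N)
  define up where "up g x = g x * complex_of_real (\<rho> x)" for g :: "'a \<Rightarrow> complex" and x
  have up_norm_sq: "(LINT x|M'. (cmod (g x))\<^sup>2) = (LINT x|M. (cmod (up g x))\<^sup>2)"
    if [measurable]: "g \<in> borel_measurable M" for g
    unfolding M' up_def
    by (subst integral_density) (simp_all add: norm_mult power_mult_distrib mult.commute)
  have up_L2: "g \<in> vecs (L2 M') \<longleftrightarrow> g \<in> borel_measurable M \<and> up g \<in> vecs (L2 M)" for g
  proof (cases "g \<in> borel_measurable M")
    case True
    note [measurable] = True
    have "up g \<in> borel_measurable M" unfolding up_def by measurable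
    moreover have "integrable M' (\<lambda>x. (cmod (g x))\<^sup>2) \<longleftrightarrow> integrable M (\<lambda>x. (cmod (up g x))\<^sup>2)"
      unfolding M' up_def
      by (subst integrable_density) (simp_all add: norm_mult power_mult_distrib mult.commute)
    moreover have "g \<in> borel_measurable M'" by measurable
    ultimately show ?thesis using True by (simp add: L2_iff)
  next
    case False
    moreover have "borel_measurable M' = (borel_measurable M :: ('a \<Rightarrow> complex) set)"
      by (rule measurable_cong_sets) (simp_all add: M')
    ultimately show ?thesis by (simp add: L2_iff)
  qed
  have up_norm: "norm2 M' g = norm2 M (up g)" if "g \<in> vecs (L2 M')" for g
    using that up_L2 up_norm_sq by (simp add: norm2_eq)
  have pair: "(LINT x|N. f x * g x) = (LINT x|M. f x * up g x)"
    if f: "f \<in> vecs (L2 M)" and g: "g \<in> vecs (L2 M')" for f g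
  proof -
    have [measurable]: "f \<in> borel_measurable M" "g \<in> borel_measurable M"
      using f g up_L2 by (auto simp: L2_iff)
    have "(LINT x|N. f x * g x) = (LINT x|M. \<rho> x *\<^sub>R (f x * g x))"
      unfolding N using \<rho>pos by (subst integral_density) (auto elim: eventually_mono)
    then show ?thesis
      by (simp add: up_def scaleR_conv_of_real ac_simps)
  qed
  define dn where "dn g x = g x / complex_of_real (\<rho> x)" for g :: "'a \<Rightarrow> complex" and x
  have dn: "dn g \<in> vecs (L2 M')" "AE x in M. up (dn g) x = g x" if g: "g \<in> vecs (L2 M)" for g
  proof -
    have [measurable]: "g \<in> borel_measurable M" using g by (simp add: L2_iff)
    have [measurable]: "dn g \<in> borel_measurable M" unfolding dn_def by measurable
    show ae: "AE x in M. up (dn g) x = g x"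
      using \<rho>pos by eventually_elim (simp add: up_def dn_def)
    have "up (dn g) \<in> borel_measurable M" unfolding up_def by measurable
    then have "up (dn g) \<in> vecs (L2 M)"
      using ae g by (intro L2_cong_AE[OF g]) auto
    then show "dn g \<in> vecs (L2 M')" by (simp add: up_L2)
  qed
  have pair_dn: "(LINT x|N. f x * dn g x) = (LINT x|M. f x * g x)"
    if f: "f \<in> vecs (L2 M)" and g: "g \<in> vecs (L2 M)" for f g
  proof -
    have "up (dn g) \<in> borel_measurable M"
      using dn(1)[OF g] unfolding up_L2 by (simp add: L2_iff)
    then show ?thesis
      unfolding pair[OF f dn(1)[OF g]] using dn(2)[OF g] f g
      by (intro integral_cong_AE borel_measurable_times) (auto simp: L2_iff)
  qed
  have norm_dn: "norm2 M' (dn g) = norm2 M g" if g: "g \<in> vecs (L2 M)" for g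
    unfolding up_norm[OF dn(1)[OF g]] using dn[OF g] g
    unfolding up_L2 by (intro norm2_cong_AE) (auto simp: L2_iff)
  have CS: "cmod (LINT x|N. f x * g x) \<le> norm2 M f * norm2 M' g"
    if f: "f \<in> vecs (L2 M)" and g: "g \<in> vecs (L2 M')" for f g
    unfolding pair[OF f g] up_norm[OF g] using g
    by (intro Cauchy_Schwarz_L2[OF f]) (simp add: up_L2)
  have pair_integrable: "integrable N (\<lambda>x. f x * g x)"
    if f: "f \<in> vecs (L2 M)" and g: "g \<in> vecs (L2 M')" for f g
  proof -
    have [measurable]: "f \<in> borel_measurable M" "g \<in> borel_measurable M"
      using f g up_L2 by (auto simp: L2_iff)
    have "integrable M (\<lambda>x. f x * up g x)"
      using g by (intro L2_mult_integrable f) (simp add: up_L2)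
    then have "integrable M (\<lambda>x. \<rho> x *\<^sub>R (f x * g x))"
      by (simp add: up_def scaleR_conv_of_real ac_simps)
    then show ?thesis
      unfolding N using \<rho>pos by (subst integrable_density) (auto elim: eventually_mono)
  qed
  have pair_sep: "norm2 M' (\<lambda>x. g x - h x) = 0"
    if g: "g \<in> vecs (L2 M')" and h: "h \<in> vecs (L2 M')"
      and eq: "\<And>f. f \<in> vecs (L2 M) \<Longrightarrow> (LINT x|N. f x * g x) = (LINT x|N. f x * h x)" for g h
  proof -
    have up: "up g \<in> vecs (L2 M)" "up h \<in> vecs (L2 M)" using g h by (simp_all add: up_L2)
    have "AE x in M. up g x = up h x"
      using eq pair[OF _ g] pair[OF _ h] by (intro AE_eq_if_integrals_eq up) simp
    moreover have "up (\<lambda>x. g x - h x) = (\<lambda>x. up g x - up h x)"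
      by (simp add: up_def[abs_def] left_diff_distrib)
    ultimately show ?thesis
      unfolding up_norm[OF L2_diff[OF g h]] using norm2_diff_eq_0_iff[OF up] by simp
  qed
  have H_L2: "f \<in> vecs (L2 M)" if "f \<in> vecs H" for f using that by (simp add: H_fix)
  have H'_L2: "g \<in> vecs (L2 M')" if "g \<in> vecs H'" for g using that H'_vecs by blast
  have H'_fix: "(LINT x|N. P f x * g x) = (LINT x|N. f x * g x)"
    if "g \<in> vecs H'" "f \<in> vecs (L2 M)" for g f using that H'_vecs by blast
  have PH: "P f \<in> vecs H" if "f \<in> vecs (L2 M)" for f
    using P_L2[OF that] P_idem[OF that] by (simp add: H_fix)
  have H_lin: "(\<lambda>x. a * f x + b * g x) \<in> vecs H" if f: "f \<in> vecs H" and g: "g \<in> vecs H" for f g a b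
  proof -
    have "AE x in M. P f x = f x" "AE x in M. P g x = g x"
      using f g by (simp_all add: H_fix)
    with P_lin[OF H_L2[OF f] H_L2[OF g], of a b]
    have "AE x in M. P (\<lambda>x. a * f x + b * g x) x = a * f x + b * g x"
      by eventually_elim simp
    then show ?thesis using f g by (simp add: H_fix L2_lincomb)
  qed
  have H'_lin: "(\<lambda>x. a * f x + b * g x) \<in> vecs H'" if f: "f \<in> vecs H'" and g: "g \<in> vecs H'" for f g a b
  proof -
    have eq: "(LINT x|N. h x * (a * f x + b * g x)) = a * (LINT x|N. h x * f x) + b * (LINT x|N. h x * g x)"
      if h: "h \<in> vecs (L2 M)" for h
    proof -
      have "(LINT x|N. h x * (a * f x + b * g x)) = (LINT x|N. a * (h x * f x) + b * (h x * g x))"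
        by (simp add: algebra_simps)
      then show ?thesis
        using pair_integrable[OF h H'_L2[OF f]] pair_integrable[OF h H'_L2[OF g]] by simp
    qed
    show ?thesis
      using H'_fix[OF f] H'_fix[OF g] H'_L2[OF f] H'_L2[OF g]
      by (subst H'_vecs) (simp add: eq P_L2 L2_lincomb)
  qed
  have ball_ne: "{x \<in> vecs H. snorm H x \<le> 1} \<noteq> {}"
  proof -
    have "AE x in M. P (\<lambda>_. 0) x = 0"
      using P_lin[OF L2_zero L2_zero, of 0 0] by simp
    then have "(\<lambda>_. 0) \<in> vecs H" by (simp add: H_fix)
    then show ?thesis by (auto simp: H_norm intro!: exI[of _ "\<lambda>_. 0"])
  qed
  have dual_bdd: "bdd_above ((\<lambda>x. cmod (\<phi> x)) ` {x \<in> vecs H. snorm H x \<le> 1})"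
    if phi: "\<phi> \<in> vecs (banach_dual H)" for \<phi>
  proof -
    obtain D where D: "\<And>x. x \<in> vecs H \<Longrightarrow> cmod (\<phi> x) \<le> D * norm2 M x"
      using phi unfolding banach_dual_vecs H_norm by blast
    show ?thesis
    proof (rule bdd_aboveI2)
      fix x assume "x \<in> {x \<in> vecs H. snorm H x \<le> 1}"
      then show "cmod (\<phi> x) \<le> \<bar>D\<bar>"
        using D[of x] mult_mono[of D "\<bar>D\<bar>" "norm2 M x" 1] by (auto simp: H_norm abs_ge_self)
    qed
  qed
  have dual_nonneg: "0 \<le> snorm (banach_dual H) \<phi>" if phi: "\<phi> \<in> vecs (banach_dual H)" for \<phi>
  proof -
    obtain x where x: "x \<in> {x \<in> vecs H. snorm H x \<le> 1}" using ball_ne by blast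
    show ?thesis
      unfolding banach_dual_snorm by (rule cSUP_upper2[OF dual_bdd[OF phi] x]) simp
  qed
  have dual_le: "cmod (\<phi> f) \<le> snorm (banach_dual H) \<phi> * norm2 M f"
    if phi: "\<phi> \<in> vecs (banach_dual H)" and f: "f \<in> vecs H" for \<phi> f
  proof -
    obtain D where D: "\<And>x. x \<in> vecs H \<Longrightarrow> cmod (\<phi> x) \<le> D * norm2 M x"
      using phi unfolding banach_dual_vecs H_norm by blast
    show ?thesis
    proof (cases "norm2 M f = 0")
      case True
      then show ?thesis using D[OF f] by simp
    next
      case False
      then have pos: "norm2 M f > 0" using norm2_nonneg[of M f] by linarith
      let ?c = "complex_of_real (1 / norm2 M f)"
      have "(\<lambda>x. ?c * f x) \<in> {x \<in> vecs H. snorm H x \<le> 1}"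
        using H_lin[OF f f, of ?c 0] pos norm2_cmult[of M ?c f] by (simp add: H_norm norm_divide)
      then have "cmod (\<phi> (\<lambda>x. ?c * f x)) \<le> snorm (banach_dual H) \<phi>"
        unfolding banach_dual_snorm by (rule cSUP_upper[OF _ dual_bdd[OF phi]])
      moreover have "\<phi> (\<lambda>x. ?c * f x) = ?c * \<phi> f"
      proof -
        have "\<phi> (\<lambda>x. ?c * f x + 0 * f x) = ?c * \<phi> f + 0 * \<phi> f"
          using phi f unfolding banach_dual_vecs by blast
        then show ?thesis by simp
      qed
      ultimately have le: "cmod ?c * cmod (\<phi> f) \<le> snorm (banach_dual H) \<phi>"
        by (simp only: norm_mult)
      have "cmod ?c = 1 / norm2 M f" using pos by (simp add: norm_divide)
      from le[unfolded this] show ?thesis using pos by (simp add: field_simps)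
    qed
  qed
  have phi_cong: "\<phi> f = \<phi> g"
    if phi: "\<phi> \<in> vecs (banach_dual H)" and f: "f \<in> vecs H" and g: "g \<in> vecs H" and e: "AE x in M. f x = g x"
    for \<phi> f g
  proof -
    have "cmod (\<phi> (\<lambda>x. 1 * f x + (-1) * g x)) \<le> snorm (banach_dual H) \<phi> * norm2 M (\<lambda>x. 1 * f x + (-1) * g x)"
      by (rule dual_le[OF phi H_lin[OF f g]])
    also have "norm2 M (\<lambda>x. 1 * f x + (-1) * g x) = 0"
      using e norm2_diff_eq_0_iff[OF H_L2[OF f] H_L2[OF g]] by simp
    also have "\<phi> (\<lambda>x. 1 * f x + (-1) * g x) = 1 * \<phi> f + (-1) * \<phi> g"
      using phi f g unfolding banach_dual_vecs by blast
    finally show ?thesis by simp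
  qed
  have rep: "\<exists>g. g \<in> vecs H' \<and> (\<forall>f\<in>vecs H. T g f = \<phi> f)" if phi: "\<phi> \<in> vecs (banach_dual H)" for \<phi>
  proof -
    have "\<exists>g\<in>vecs (L2 M). \<forall>f\<in>vecs (L2 M). \<phi> (P f) = (LINT x|M. f x * g x)"
    proof (rule Riesz_representation_L2)
      fix f g a b assume f: "f \<in> vecs (L2 M)" and g: "g \<in> vecs (L2 M)"
      have "\<phi> (P (\<lambda>x. a * f x + b * g x)) = \<phi> (\<lambda>x. a * P f x + b * P g x)"
        by (rule phi_cong[OF phi PH[OF L2_lincomb[OF f g]] H_lin[OF PH[OF f] PH[OF g]] P_lin[OF f g]])
      then show "\<phi> (P (\<lambda>x. a * f x + b * g x)) = a * \<phi> (P f) + b * \<phi> (P g)"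
        using phi PH[OF f] PH[OF g] by (simp add: banach_dual_vecs)
    next
      fix f assume f: "f \<in> vecs (L2 M)"
      note s0 = dual_nonneg[OF phi]
      have "cmod (\<phi> (P f)) \<le> snorm (banach_dual H) \<phi> * norm2 M (P f)"
        by (rule dual_le[OF phi PH[OF f]])
      also have "\<dots> \<le> snorm (banach_dual H) \<phi> * (C * norm2 M f)"
        by (rule mult_left_mono[OF P_bnd[OF f] s0])
      finally show "cmod (\<phi> (P f)) \<le> (snorm (banach_dual H) \<phi> * C) * norm2 M f"
        by (simp add: mult.assoc)
    qed
    then obtain g where g: "g \<in> vecs (L2 M)"
      and gr: "\<And>f. f \<in> vecs (L2 M) \<Longrightarrow> \<phi> (P f) = (LINT x|M. f x * g x)" by blast
    have eq: "(LINT x|N. f x * dn g x) = \<phi> (P f)" if "f \<in> vecs (L2 M)" for f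
      using pair_dn[OF that g] gr[OF that] by simp
    have "dn g \<in> vecs H'"
      unfolding H'_vecs
    proof (intro conjI ballI dn(1)[OF g])
      fix f assume f: "f \<in> vecs (L2 M)"
      have "\<phi> (P (P f)) = \<phi> (P f)"
        by (rule phi_cong[OF phi PH[OF P_L2[OF f]] PH[OF f] P_idem[OF f]])
      then show "(LINT x|N. P f x * dn g x) = (LINT x|N. f x * dn g x)"
        using eq[OF f] eq[OF P_L2[OF f]] by simp
    qed
    moreover have "T (dn g) f = \<phi> f" if f: "f \<in> vecs H" for f
    proof -
      have "\<phi> (P f) = \<phi> f"
        using f PH[OF H_L2[OF f]] by (intro phi_cong[OF phi]) (auto simp: H_fix)
      then show ?thesis using eq[OF H_L2[OF f]] by (simp add: T)
    qed
    ultimately show ?thesis by blast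
  qed
  define S where "S \<phi> = (SOME g. g \<in> vecs H' \<and> (\<forall>f\<in>vecs H. T g f = \<phi> f))" for \<phi>
  have S: "S \<phi> \<in> vecs H'" "\<And>f. f \<in> vecs H \<Longrightarrow> T (S \<phi>) f = \<phi> f"
    if "\<phi> \<in> vecs (banach_dual H)" for \<phi>
    using someI_ex[OF rep[OF that]] unfolding S_def by blast+
  have T_uniq: "norm2 M' (\<lambda>x. g x - h x) = 0"
    if g: "g \<in> vecs H'" and h: "h \<in> vecs H'" and eq: "\<And>f. f \<in> vecs H \<Longrightarrow> T g f = T h f" for g h
  proof (rule pair_sep[OF H'_L2[OF g] H'_L2[OF h]])
    fix f assume f: "f \<in> vecs (L2 M)"
    show "(LINT x|N. f x * g x) = (LINT x|N. f x * h x)"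
      using eq[OF PH[OF f]] H'_fix[OF g f] H'_fix[OF h f] by (simp add: T)
  qed
  have T_lin: "T (\<lambda>x. a * g x + b * h x) f = a * T g f + b * T h f"
    if g: "g \<in> vecs H'" and h: "h \<in> vecs H'" and f: "f \<in> vecs H" for a b g h f
  proof -
    have "(LINT x|N. f x * (a * g x + b * h x)) = (LINT x|N. a * (f x * g x) + b * (f x * h x))"
      by (simp add: algebra_simps)
    then show ?thesis
      using pair_integrable[OF H_L2[OF f] H'_L2[OF g]] pair_integrable[OF H_L2[OF f] H'_L2[OF h]]
      by (simp add: T)
  qed
  have T_lin': "T g (\<lambda>x. a * f x + b * h x) = a * T g f + b * T g h"
    if g: "g \<in> vecs H'" and h: "h \<in> vecs H" and f: "f \<in> vecs H" for a b g h f
  proof -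
    have "(LINT x|N. (a * f x + b * h x) * g x) = (LINT x|N. a * (f x * g x) + b * (h x * g x))"
      by (simp add: algebra_simps)
    then show ?thesis
      using pair_integrable[OF H_L2[OF f] H'_L2[OF g]] pair_integrable[OF H_L2[OF h] H'_L2[OF g]]
      by (simp add: T)
  qed
  have T_CS: "cmod (T g f) \<le> norm2 M' g * norm2 M f" if "g \<in> vecs H'" "f \<in> vecs H" for g f
    using CS[OF H_L2[OF that(2)] H'_L2[OF that(1)]] by (simp add: T mult.commute)
  have T_dual: "T g \<in> vecs (banach_dual H)" if g: "g \<in> vecs H'" for g
    unfolding banach_dual_vecs H_norm using T_lin'[OF g] T_CS[OF g] by blast
  have dual_norm_le: "snorm (banach_dual H) \<phi> \<le> c"
    if "\<And>f. f \<in> vecs H \<Longrightarrow> cmod (\<phi> f) \<le> c * norm2 M f" "0 \<le> c" for \<phi> c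
    unfolding banach_dual_snorm
  proof (rule cSUP_least[OF ball_ne])
    fix f assume "f \<in> {x \<in> vecs H. snorm H x \<le> 1}"
    then show "cmod (\<phi> f) \<le> c"
      using that(1)[of f] mult_left_mono[of "norm2 M f" 1 c] that(2) by (auto simp: H_norm)
  qed
  have dual_norm_0: "snorm (banach_dual H) \<phi> = 0" if "\<And>f. f \<in> vecs H \<Longrightarrow> \<phi> f = 0" for \<phi>
  proof -
    have "snorm (banach_dual H) \<phi> = (SUP x\<in>{x \<in> vecs H. snorm H x \<le> 1}. 0)"
      unfolding banach_dual_snorm using that by (intro SUP_cong) auto
    with ball_ne show ?thesis by simp
  qed
  have S_bound: "norm2 M' (S \<phi>) \<le> c"
    if phi: "\<phi> \<in> vecs (banach_dual H)"
      and c: "\<And>f. f \<in> vecs (L2 M) \<Longrightarrow> norm2 M f \<le> 1 \<Longrightarrow> cmod (\<phi> (P f)) \<le> c" and c0: "0 \<le> c" for \<phi> c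
  proof (cases "norm2 M' (S \<phi>) = 0")
    case False
    let ?g = "S \<phi>"
    have g: "?g \<in> vecs H'" by (rule S(1)[OF phi])
    have ug: "up ?g \<in> vecs (L2 M)" using H'_L2[OF g] by (simp add: up_L2)
    define k where "k = norm2 M (up ?g)"
    have k: "k > 0" using False up_norm[OF H'_L2[OF g]] by (simp add: k_def order_less_le)
    \<comment> \<open>a unit vector at which the functional represented by \<open>?g\<close> attains its norm \<open>k\<close>\<close>
    let ?f = "\<lambda>x. complex_of_real (1 / k) * cnj (up ?g x)"
    have f: "?f \<in> vecs (L2 M)" by (rule L2_cmult[OF L2_cnj[OF ug]])
    have "norm2 M ?f = 1"
      using k by (subst norm2_cmult, subst norm2_cnj) (simp add: k_def[symmetric] norm_divide)
    moreover have "\<phi> (P ?f) = complex_of_real k"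
    proof -
      have "\<phi> (P ?f) = (LINT x|N. ?f x * ?g x)"
        using S(2)[OF phi PH[OF f]] H'_fix[OF g f] by (simp add: T)
      also have "\<dots> = (LINT x|M. ?f x * up ?g x)" by (rule pair[OF f H'_L2[OF g]])
      also have "\<dots> = (LINT x|M. complex_of_real (1 / k) * complex_of_real ((cmod (up ?g x))\<^sup>2))"
        by (intro Bochner_Integration.integral_cong refl)
           (simp add: complex_norm_square mult.commute del: of_real_power)
      also have "\<dots> = complex_of_real (1 / k) * complex_of_real (LINT x|M. (cmod (up ?g x))\<^sup>2)"
        by (simp only: integral_mult_right_zero integral_complex_of_real)
      also have "\<dots> = complex_of_real k"
        unfolding norm2_power2[symmetric] k_def[symmetric] using k by (simp add: power2_eq_square)
      finally show ?thesis .
    qed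
    ultimately have "k \<le> c" using c[OF f] k by simp
    then show ?thesis using up_norm[OF H'_L2[OF g]] by (simp add: k_def)
  qed (use c0 in simp)
  have C0: "cmod (\<phi> (P f)) \<le> snorm (banach_dual H) \<phi> * norm2 M (P f)"
    if "\<phi> \<in> vecs (banach_dual H)" "f \<in> vecs (L2 M)" for \<phi> f
    by (rule dual_le[OF that(1) PH[OF that(2)]])
  have inv: "inverse_operators H' (banach_dual H) T S"
    unfolding inverse_operators_def bounded_operator_def
  proof (intro conjI ballI allI)
    show "T g \<in> vecs (banach_dual H)" if "g \<in> vecs H'" for g by (rule T_dual[OF that])
    show "snorm (banach_dual H) (\<lambda>f. T (\<lambda>u. a * g u + b * h u) f - (a * T g f + b * T h f)) = 0"
      if "g \<in> vecs H'" "h \<in> vecs H'" for g h a b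
      by (rule dual_norm_0) (simp add: T_lin[OF that])
    show "\<exists>C. \<forall>g\<in>vecs H'. snorm (banach_dual H) (T g) \<le> C * snorm H' g"
      by (intro exI[of _ 1] ballI) (simp add: H'_norm dual_norm_le T_CS)
    show "S \<phi> \<in> vecs H'" if "\<phi> \<in> vecs (banach_dual H)" for \<phi> by (rule S(1)[OF that])
    show "snorm H' (\<lambda>t. S (\<lambda>u. a * \<phi> u + b * \<psi> u) t - (a * S \<phi> t + b * S \<psi> t)) = 0"
      if phi: "\<phi> \<in> vecs (banach_dual H)" and psi: "\<psi> \<in> vecs (banach_dual H)" for \<phi> \<psi> a b
    proof -
      have sum: "(\<lambda>u. a * \<phi> u + b * \<psi> u) \<in> vecs (banach_dual H)"
      proof -
        have "cmod (a * \<phi> f + b * \<psi> f)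
            \<le> (cmod a * snorm (banach_dual H) \<phi> + cmod b * snorm (banach_dual H) \<psi>) * norm2 M f"
          if f: "f \<in> vecs H" for f
        proof -
          have "cmod (a * \<phi> f + b * \<psi> f) \<le> cmod a * cmod (\<phi> f) + cmod b * cmod (\<psi> f)"
            by (metis norm_mult norm_triangle_ineq)
          also have "\<dots> \<le> cmod a * (snorm (banach_dual H) \<phi> * norm2 M f)
              + cmod b * (snorm (banach_dual H) \<psi> * norm2 M f)"
            by (intro add_mono mult_left_mono dual_le phi psi f) auto
          finally show ?thesis by (simp add: algebra_simps)
        qed
        moreover have "a * \<phi> (\<lambda>u. c * x u + d * y u) + b * \<psi> (\<lambda>u. c * x u + d * y u)
            = c * (a * \<phi> x + b * \<psi> x) + d * (a * \<phi> y + b * \<psi> y)"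
          if "x \<in> vecs H" "y \<in> vecs H" for x y c d
        proof -
          have "\<phi> (\<lambda>u. c * x u + d * y u) = c * \<phi> x + d * \<phi> y"
            "\<psi> (\<lambda>u. c * x u + d * y u) = c * \<psi> x + d * \<psi> y"
            using phi psi that unfolding banach_dual_vecs by blast+
          then show ?thesis by (simp add: algebra_simps)
        qed
        ultimately show ?thesis unfolding banach_dual_vecs H_norm by blast
      qed
      show ?thesis
        unfolding H'_norm
        by (rule T_uniq[OF S(1)[OF sum] H'_lin[OF S(1)[OF phi] S(1)[OF psi]]])
           (simp add: S(2)[OF sum] T_lin[OF S(1)[OF phi] S(1)[OF psi]] S(2)[OF phi] S(2)[OF psi])
    qed
    show "\<exists>D. \<forall>\<phi>\<in>vecs (banach_dual H). snorm H' (S \<phi>) \<le> D * snorm (banach_dual H) \<phi>"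
    proof (intro exI[of _ "\<bar>C\<bar>"] ballI)
      fix \<phi> assume phi: "\<phi> \<in> vecs (banach_dual H)"
      note s0 = dual_nonneg[OF phi]
      show "snorm H' (S \<phi>) \<le> \<bar>C\<bar> * snorm (banach_dual H) \<phi>"
        unfolding H'_norm
      proof (rule S_bound[OF phi])
        fix f assume f: "f \<in> vecs (L2 M)" and f1: "norm2 M f \<le> 1"
        have "norm2 M (P f) \<le> \<bar>C\<bar> * 1"
          using P_bnd[OF f] mult_mono[of C "\<bar>C\<bar>" "norm2 M f" 1] f1 by (simp add: abs_ge_self)
        then have "snorm (banach_dual H) \<phi> * norm2 M (P f) \<le> snorm (banach_dual H) \<phi> * \<bar>C\<bar>"
          using s0 by (intro mult_left_mono) auto
        with C0[OF phi f] show "cmod (\<phi> (P f)) \<le> \<bar>C\<bar> * snorm (banach_dual H) \<phi>"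
          by (simp add: mult.commute)
      qed (use s0 in simp)
    qed
    show "snorm H' (\<lambda>u. S (T g) u - g u) = 0" if g: "g \<in> vecs H'" for g
      unfolding H'_norm
      by (rule T_uniq[OF S(1)[OF T_dual[OF g]] g]) (rule S(2)[OF T_dual[OF g]])
    show "snorm (banach_dual H) (\<lambda>t. T (S \<phi>) t - \<phi> t) = 0" if phi: "\<phi> \<in> vecs (banach_dual H)" for \<phi>
      by (rule dual_norm_0) (simp add: S(2)[OF phi])
  qed
  have "op_norm (banach_dual H) H' S = op_norm (L2 M) (L2 M) P"
  proof (rule antisym)
    let ?n = "op_norm (L2 M) (L2 M) P"
    have up: "ereal (norm2 M (P f)) \<le> ?n" if "f \<in> vecs (L2 M)" "norm2 M f \<le> 1" for f
      unfolding op_norm_def using that by (intro SUP_upper) simp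
    show "op_norm (banach_dual H) H' S \<le> ?n"
      unfolding op_norm_def[of "banach_dual H"]
    proof (rule SUP_least)
      fix \<phi> assume "\<phi> \<in> {x \<in> vecs (banach_dual H). snorm (banach_dual H) x \<le> 1}"
      then have phi: "\<phi> \<in> vecs (banach_dual H)" and phi1: "snorm (banach_dual H) \<phi> \<le> 1" by auto
      have nn: "0 \<le> ?n"
        using up[OF L2_zero] by (simp add: order_trans[OF _ up[OF L2_zero]])
      have "norm2 M (P f) \<le> \<bar>C\<bar>" if "f \<in> vecs (L2 M)" "norm2 M f \<le> 1" for f
        using P_bnd[OF that(1)] mult_mono[of C "\<bar>C\<bar>" "norm2 M f" 1] that(2) by (simp add: abs_ge_self)
      then have "?n \<le> ereal \<bar>C\<bar>"
        unfolding op_norm_def by (intro SUP_least) simp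
      with nn obtain c where c: "?n = ereal c" "0 \<le> c"
        by (cases ?n) auto
      have "norm2 M' (S \<phi>) \<le> c"
      proof (rule S_bound[OF phi _ c(2)])
        fix f assume f: "f \<in> vecs (L2 M)" and f1: "norm2 M f \<le> 1"
        have "cmod (\<phi> (P f)) \<le> 1 * norm2 M (P f)"
          using C0[OF phi f] mult_right_mono[OF phi1 norm2_nonneg[of M "P f"]] by linarith
        also have "\<dots> \<le> c" using up[OF f f1] c by simp
        finally show "cmod (\<phi> (P f)) \<le> c" .
      qed
      then show "ereal (snorm H' (S \<phi>)) \<le> ?n" by (simp add: c H'_norm)
    qed
    show "?n \<le> op_norm (banach_dual H) H' S"
      unfolding op_norm_def[of "L2 M"]
    proof (rule SUP_least)
      fix f assume "f \<in> {x \<in> vecs (L2 M). norm2 M x \<le> 1}"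
      then have f: "f \<in> vecs (L2 M)" and f1: "norm2 M f \<le> 1" by auto
      define k where "k = norm2 M (P f)"
      \<comment> \<open>a functional of norm at most \<open>1\<close> that norms \<open>P f\<close>; if \<open>k = 0\<close> it is zero, because \<open>1 / 0 = 0\<close>\<close>
      define \<phi> where "\<phi> h = (LINT x|M. h x * (complex_of_real (1 / k) * cnj (P f x)))" for h
      let ?q = "\<lambda>x. complex_of_real (1 / k) * cnj (P f x)"
      have q: "?q \<in> vecs (L2 M)" by (intro L2_cmult L2_cnj P_L2 f)
      have qn: "norm2 M ?q \<le> 1"
      proof -
        have "0 \<le> k" by (simp add: k_def)
        then show ?thesis
          by (subst norm2_cmult, subst norm2_cnj) (simp add: k_def[symmetric] norm_divide)
      qed
      have phi_b: "cmod (\<phi> h) \<le> 1 * norm2 M h" if "h \<in> vecs H" for h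
        using Cauchy_Schwarz_L2[OF H_L2[OF that] q] mult_left_mono[OF qn norm2_nonneg[of M h]]
        unfolding \<phi>_def by linarith
      have "\<phi> (\<lambda>x. a * h x + b * g x) = a * \<phi> h + b * \<phi> g" if h: "h \<in> vecs H" and g: "g \<in> vecs H" for h g a b
      proof -
        have "(LINT x|M. (a * h x + b * g x) * ?q x) = (LINT x|M. a * (h x * ?q x) + b * (g x * ?q x))"
          by (intro Bochner_Integration.integral_cong refl) (simp add: algebra_simps)
        also have "\<dots> = a * (LINT x|M. h x * ?q x) + b * (LINT x|M. g x * ?q x)"
          using L2_mult_integrable[OF H_L2[OF h] q] L2_mult_integrable[OF H_L2[OF g] q]
          by (subst Bochner_Integration.integral_add) (simp_all only: integrable_mult_right integral_mult_right_zero)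
        finally show ?thesis by (simp only: \<phi>_def)
      qed
      then have phi: "\<phi> \<in> vecs (banach_dual H)"
        unfolding banach_dual_vecs H_norm using phi_b by blast
      have phi1: "snorm (banach_dual H) \<phi> \<le> 1" by (rule dual_norm_le[OF phi_b]) auto
      have "k = cmod (\<phi> (P f))"
      proof -
        have "\<phi> (P f) = (LINT x|M. complex_of_real (1 / k) * complex_of_real ((cmod (P f x))\<^sup>2))"
          unfolding \<phi>_def by (intro Bochner_Integration.integral_cong refl)
           (simp add: complex_norm_square mult.commute del: of_real_power)
        also have "\<dots> = complex_of_real (1 / k) * complex_of_real (LINT x|M. (cmod (P f x))\<^sup>2)"
          by (simp only: integral_mult_right_zero integral_complex_of_real)
        also have "\<dots> = complex_of_real k"
          unfolding norm2_power2[symmetric] k_def[symmetric] by (simp add: power2_eq_square)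
        finally show ?thesis by (simp add: k_def)
      qed
      also have "\<dots> = cmod (LINT x|N. f x * S \<phi> x)"
        using S(2)[OF phi PH[OF f]] H'_fix[OF S(1)[OF phi] f] by (simp add: T)
      also have "\<dots> \<le> norm2 M f * norm2 M' (S \<phi>)"
        by (rule CS[OF f H'_L2[OF S(1)[OF phi]]])
      also have "\<dots> \<le> 1 * norm2 M' (S \<phi>)"
        by (rule mult_right_mono[OF f1]) simp
      finally have "ereal (norm2 M (P f)) \<le> ereal (snorm H' (S \<phi>))"
        by (simp add: k_def H'_norm)
      also have "\<dots> \<le> op_norm (banach_dual H) H' S"
        unfolding op_norm_def using phi phi1 by (intro SUP_upper) simp
      finally show "ereal (norm2 M (P f)) \<le> op_norm (banach_dual H) H' S" .
    qed
  qed
  with inv show ?thesis by blast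
qed

section \<open>Schur kernels and orthogonal series of them\<close>

definition kernel_op :: "'a measure \<Rightarrow> ('a \<Rightarrow> 'a \<Rightarrow> complex) \<Rightarrow> ('a \<Rightarrow> complex) \<Rightarrow> 'a \<Rightarrow> complex" where
  "kernel_op M A f x = (LINT y|M. A x y * f y)"

text \<open>
  The hypotheses of Schur's test with one weight for both variables, which makes the notion
  invariant under transposition. They bound the operator with kernel \<open>\<bar>A\<bar>\<close>, so that every use of
  Fubini's theorem on \<open>L\<^sup>2\<close> functions is covered.
\<close>

definition schur :: "'a measure \<Rightarrow> ('a \<Rightarrow> real) \<Rightarrow> real \<Rightarrow> ('a \<Rightarrow> 'a \<Rightarrow> complex) \<Rightarrow> bool" where
  "schur M p C A \<longleftrightarrow>
     (\<lambda>(x, y). A x y) \<in> borel_measurable (M \<Otimes>\<^sub>M M) \<and>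
     p \<in> borel_measurable M \<and> (AE x in M. 0 < p x) \<and> 0 \<le> C \<and>
     (AE x in M. (\<integral>\<^sup>+y. ennreal (cmod (A x y) * p y) \<partial>M) \<le> ennreal (C * p x)) \<and>
     (AE y in M. (\<integral>\<^sup>+x. ennreal (cmod (A x y) * p x) \<partial>M) \<le> ennreal (C * p y))"

lemma schur_transpose:
  assumes "schur M p C A" shows "schur M p C (\<lambda>x y. A y x)"
  using assms measurable_pair_swap[of "\<lambda>(x, y). A x y" M M borel]
  by (auto simp: schur_def)

lemma schur_cnj:
  assumes "schur M p C A" shows "schur M p C (\<lambda>x y. cnj (A x y))"
proof -
  have "(\<lambda>z. cnj (case z of (x, y) \<Rightarrow> A x y)) \<in> borel_measurable (M \<Otimes>\<^sub>M M)"
    by (rule measurable_compose[OF _ borel_measurable_cnj]) (use assms in \<open>simp add: schur_def\<close>)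
  then show ?thesis using assms by (simp add: schur_def split_beta)
qed

context sigma_finite_measure
begin

text \<open>
  The Cauchy--Schwarz inequality for the splitting \<open>\<bar>A\<bar> = (\<bar>A\<bar> p)\<^sup>1\<^sup>/\<^sup>2 (\<bar>A\<bar> / p)\<^sup>1\<^sup>/\<^sup>2\<close>: the first factor is
  controlled by the row condition and, once the integrals are exchanged, the second by the column
  condition.
\<close>

lemma schur_test:
  assumes A: "schur M p C A" and u [measurable]: "u \<in> borel_measurable M"
  shows "(\<integral>\<^sup>+x. (\<integral>\<^sup>+y. ennreal (cmod (A x y)) * u y \<partial>M)\<^sup>2 \<partial>M) \<le> ennreal (C\<^sup>2) * (\<integral>\<^sup>+x. (u x)\<^sup>2 \<partial>M)"
proof -
  interpret P: pair_sigma_finite M M ..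
  have Am [measurable]: "(\<lambda>(x, y). A x y) \<in> borel_measurable (M \<Otimes>\<^sub>M M)"
    and pm [measurable]: "p \<in> borel_measurable M" and C: "0 \<le> C"
    and p: "AE x in M. 0 < p x"
    and A1: "AE x in M. (\<integral>\<^sup>+y. ennreal (cmod (A x y) * p y) \<partial>M) \<le> ennreal (C * p x)"
    and A2: "AE y in M. (\<integral>\<^sup>+x. ennreal (cmod (A x y) * p x) \<partial>M) \<le> ennreal (C * p y)"
    using A by (auto simp: schur_def)
  have Ax [measurable]: "A x \<in> borel_measurable M" if "x \<in> space M" for x
    using measurable_compose_Pair1[OF that Am] by simp
  let ?w = "\<lambda>x y. ennreal (cmod (A x y) / p y) * (u y)\<^sup>2"
  have wmu [measurable]: "(\<lambda>(x, y). ?w x y) \<in> borel_measurable (M \<Otimes>\<^sub>M M)" by measurable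
  have "(\<integral>\<^sup>+x. (\<integral>\<^sup>+y. ennreal (cmod (A x y)) * u y \<partial>M)\<^sup>2 \<partial>M)
      \<le> (\<integral>\<^sup>+x. ennreal (C * p x) * (\<integral>\<^sup>+y. ?w x y \<partial>M) \<partial>M)"
  proof (rule nn_integral_mono_AE, use A1 p AE_space in eventually_elim)
    fix x assume x1: "(\<integral>\<^sup>+y. ennreal (cmod (A x y) * p y) \<partial>M) \<le> ennreal (C * p x)"
      and x: "x \<in> space M"
    note [measurable] = Ax[OF x]
    have "(\<integral>\<^sup>+y. ennreal (cmod (A x y)) * u y \<partial>M)
        = (\<integral>\<^sup>+y. ennreal (sqrt (cmod (A x y) * p y)) * (ennreal (sqrt (cmod (A x y) / p y)) * u y) \<partial>M)"
    proof (rule nn_integral_cong_AE, use p in eventually_elim)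
      fix y assume "0 < p y"
      then have "sqrt (cmod (A x y) * p y) * sqrt (cmod (A x y) / p y) = cmod (A x y)"
        by (simp add: real_sqrt_mult[symmetric])
      then show "ennreal (cmod (A x y)) * u y
          = ennreal (sqrt (cmod (A x y) * p y)) * (ennreal (sqrt (cmod (A x y) / p y)) * u y)"
        using \<open>0 < p y\<close> by (simp add: mult.assoc[symmetric] ennreal_mult[symmetric])
    qed
    then have "(\<integral>\<^sup>+y. ennreal (cmod (A x y)) * u y \<partial>M)\<^sup>2
        \<le> (\<integral>\<^sup>+y. (ennreal (sqrt (cmod (A x y) * p y)))\<^sup>2 \<partial>M)
          * (\<integral>\<^sup>+y. (ennreal (sqrt (cmod (A x y) / p y)) * u y)\<^sup>2 \<partial>M)"
      using Cauchy_Schwarz_nn_integral[of "\<lambda>y. ennreal (sqrt (cmod (A x y) * p y))" M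
          "\<lambda>y. ennreal (sqrt (cmod (A x y) / p y)) * u y"] by simp
    also have "(\<integral>\<^sup>+y. (ennreal (sqrt (cmod (A x y) * p y)))\<^sup>2 \<partial>M) = (\<integral>\<^sup>+y. ennreal (cmod (A x y) * p y) \<partial>M)"
      by (rule nn_integral_cong_AE, use p in eventually_elim) (simp add: ennreal_power)
    also have "(\<integral>\<^sup>+y. (ennreal (sqrt (cmod (A x y) / p y)) * u y)\<^sup>2 \<partial>M) = (\<integral>\<^sup>+y. ?w x y \<partial>M)"
      by (rule nn_integral_cong_AE, use p in eventually_elim) (simp add: ennreal_power power_mult_distrib)
    finally show "(\<integral>\<^sup>+y. ennreal (cmod (A x y)) * u y \<partial>M)\<^sup>2 \<le> ennreal (C * p x) * (\<integral>\<^sup>+y. ?w x y \<partial>M)"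
      using mult_right_mono[OF x1] by (rule order_trans) simp
  qed
  also have "\<dots> = (\<integral>\<^sup>+x. (\<integral>\<^sup>+y. ennreal (C * p x) * ?w x y \<partial>M) \<partial>M)"
    by (intro nn_integral_cong nn_integral_cmult[symmetric]) measurable
  also have "\<dots> = (\<integral>\<^sup>+y. (\<integral>\<^sup>+x. ennreal (C * p x) * ?w x y \<partial>M) \<partial>M)"
    by (rule P.Fubini'[symmetric]) measurable
  also have "\<dots> \<le> (\<integral>\<^sup>+y. ennreal (C\<^sup>2) * (u y)\<^sup>2 \<partial>M)"
  proof (rule nn_integral_mono_AE, use A2 p AE_space in eventually_elim)
    fix y assume y2: "(\<integral>\<^sup>+x. ennreal (cmod (A x y) * p x) \<partial>M) \<le> ennreal (C * p y)"
      and y: "y \<in> space M" and py: "0 < p y"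
    have [measurable]: "(\<lambda>x. A x y) \<in> borel_measurable M"
      using measurable_Pair1[OF Am y] by simp
    have "(\<integral>\<^sup>+x. ennreal (C * p x) * ?w x y \<partial>M)
        = (\<integral>\<^sup>+x. (ennreal (C / p y) * (u y)\<^sup>2) * ennreal (cmod (A x y) * p x) \<partial>M)"
    proof (rule nn_integral_cong_AE, use p in eventually_elim)
      fix x assume "0 < p x"
      then have "ennreal (C * p x) * ennreal (cmod (A x y) / p y)
          = ennreal (C / p y) * ennreal (cmod (A x y) * p x)"
        using py C by (subst (1 2) ennreal_mult[symmetric]) (auto simp: field_simps)
      then show "ennreal (C * p x) * ?w x y
          = (ennreal (C / p y) * (u y)\<^sup>2) * ennreal (cmod (A x y) * p x)"
        by (metis mult.assoc mult.commute)
    qed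
    also have "\<dots> = (ennreal (C / p y) * (u y)\<^sup>2) * (\<integral>\<^sup>+x. ennreal (cmod (A x y) * p x) \<partial>M)"
      by (rule nn_integral_cmult) measurable
    also have "\<dots> \<le> (ennreal (C / p y) * (u y)\<^sup>2) * ennreal (C * p y)"
      by (rule mult_left_mono[OF y2]) simp
    also have "\<dots> = (ennreal (C / p y) * ennreal (C * p y)) * (u y)\<^sup>2"
      by (simp only: ac_simps)
    also have "ennreal (C / p y) * ennreal (C * p y) = ennreal (C\<^sup>2)"
      using py C by (subst ennreal_mult[symmetric]) (auto simp: power2_eq_square)
    finally show "(\<integral>\<^sup>+x. ennreal (C * p x) * ?w x y \<partial>M) \<le> ennreal (C\<^sup>2) * (u y)\<^sup>2" .
  qed
  also have "\<dots> = ennreal (C\<^sup>2) * (\<integral>\<^sup>+y. (u y)\<^sup>2 \<partial>M)"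
    by (rule nn_integral_cmult) measurable
  finally show ?thesis .
qed

lemma schur_kernel_op:
  assumes A: "schur M p C A" and f: "f \<in> vecs (L2 M)"
  shows schur_integrable: "AE x in M. integrable M (\<lambda>y. A x y * f y)"
    and schur_L2: "kernel_op M A f \<in> vecs (L2 M)"
    and schur_norm: "norm2 M (kernel_op M A f) \<le> C * norm2 M f"
proof -
  have Am [measurable]: "(\<lambda>(x, y). A x y) \<in> borel_measurable (M \<Otimes>\<^sub>M M)" and C: "0 \<le> C"
    using A by (auto simp: schur_def)
  have fm [measurable]: "f \<in> borel_measurable M" using f by (simp add: L2_iff)
  have Ax [measurable]: "A x \<in> borel_measurable M" if "x \<in> space M" for x
    using measurable_compose_Pair1[OF that Am] by simp
  let ?v = "\<lambda>x. \<integral>\<^sup>+y. ennreal (cmod (A x y)) * ennreal (cmod (f y)) \<partial>M"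
  have "(\<integral>\<^sup>+x. (?v x)\<^sup>2 \<partial>M) \<le> ennreal (C\<^sup>2) * (\<integral>\<^sup>+x. (ennreal (cmod (f x)))\<^sup>2 \<partial>M)"
    by (rule schur_test[OF A]) measurable
  also have "\<dots> = ennreal ((C * norm2 M f)\<^sup>2)"
    by (simp add: ennreal_power nn_integral_norm2[OF f] ennreal_mult[symmetric] power_mult_distrib)
  finally have v: "(\<integral>\<^sup>+x. (?v x)\<^sup>2 \<partial>M) \<le> ennreal ((C * norm2 M f)\<^sup>2)" .
  have "AE x in M. (?v x)\<^sup>2 \<noteq> \<infinity>"
    by (rule nn_integral_PInf_AE) (use v in \<open>auto simp: top_unique\<close>)
  then show "AE x in M. integrable M (\<lambda>y. A x y * f y)"
    using AE_space
  proof eventually_elim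
    fix x assume fin: "(?v x)\<^sup>2 \<noteq> \<infinity>" and x: "x \<in> space M"
    note [measurable] = Ax[OF x]
    have "?v x < \<infinity>" using fin by (auto simp: power_less_top_ennreal simp flip: less_top)
    then show "integrable M (\<lambda>y. A x y * f y)"
      by (intro integrableI_bounded) (auto simp: norm_mult ennreal_mult)
  qed
  have km: "kernel_op M A f \<in> borel_measurable M"
    unfolding kernel_op_def[abs_def] by measurable
  have "(\<integral>\<^sup>+x. ennreal ((cmod (kernel_op M A f x))\<^sup>2) \<partial>M) \<le> (\<integral>\<^sup>+x. (?v x)\<^sup>2 \<partial>M)"
  proof (rule nn_integral_mono)
    fix x assume x: "x \<in> space M"
    note [measurable] = Ax[OF x]
    have "ennreal (cmod (kernel_op M A f x)) \<le> ?v x"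
    proof (cases "integrable M (\<lambda>y. A x y * f y)")
      case True
      then show ?thesis
        using integral_norm_bound_ennreal[OF True] by (simp add: kernel_op_def norm_mult ennreal_mult)
    next
      case False
      then show ?thesis by (simp add: kernel_op_def not_integrable_integral_eq)
    qed
    then have "(ennreal (cmod (kernel_op M A f x)))\<^sup>2 \<le> (?v x)\<^sup>2" by (rule power_mono_ennreal)
    then show "ennreal ((cmod (kernel_op M A f x))\<^sup>2) \<le> (?v x)\<^sup>2" by (simp add: ennreal_power)
  qed
  also note v
  finally show "kernel_op M A f \<in> vecs (L2 M)" "norm2 M (kernel_op M A f) \<le> C * norm2 M f"
    using L2_I_nn_integral[OF km, of "C * norm2 M f"] C by auto
qed

lemma kernel_op_lincomb:
  assumes A: "schur M p C A" and f: "f \<in> vecs (L2 M)" and g: "g \<in> vecs (L2 M)"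
  shows "AE x in M. kernel_op M A (\<lambda>y. a * f y + b * g y) x = a * kernel_op M A f x + b * kernel_op M A g x"
  using schur_integrable[OF A f] schur_integrable[OF A g]
proof eventually_elim
  case (elim x)
  have "(LINT y|M. A x y * (a * f y + b * g y)) = (LINT y|M. a * (A x y * f y) + b * (A x y * g y))"
    by (simp add: algebra_simps)
  then show ?case using elim by (simp add: kernel_op_def)
qed

lemma kernel_op_transpose:
  assumes A: "schur M p C A" and f: "f \<in> vecs (L2 M)" and h: "h \<in> vecs (L2 M)"
  shows "(LINT x|M. kernel_op M A f x * h x) = (LINT y|M. f y * kernel_op M (\<lambda>x y. A y x) h y)"
proof -
  interpret P: pair_sigma_finite M M ..
  have Am [measurable]: "(\<lambda>(x, y). A x y) \<in> borel_measurable (M \<Otimes>\<^sub>M M)" and C: "0 \<le> C"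
    using A by (auto simp: schur_def)
  have [measurable]: "f \<in> borel_measurable M" "h \<in> borel_measurable M"
    using f h by (auto simp: L2_iff)
  let ?v = "\<lambda>x. \<integral>\<^sup>+y. ennreal (cmod (A x y)) * ennreal (cmod (f y)) \<partial>M"
  have Ax [measurable]: "A x \<in> borel_measurable M" if "x \<in> space M" for x
    using measurable_compose_Pair1[OF that Am] by simp
  have int: "integrable (M \<Otimes>\<^sub>M M) (\<lambda>(x, y). A x y * f y * h x)"
  proof (rule integrableI_bounded)
    have "(\<integral>\<^sup>+z. ennreal (norm (case z of (x, y) \<Rightarrow> A x y * f y * h x)) \<partial>(M \<Otimes>\<^sub>M M))
        = (\<integral>\<^sup>+x. (\<integral>\<^sup>+y. ennreal (norm (A x y * f y * h x)) \<partial>M) \<partial>M)"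
      by (subst nn_integral_fst[symmetric]) simp_all
    also have "\<dots> = (\<integral>\<^sup>+x. ?v x * ennreal (cmod (h x)) \<partial>M)"
    proof (rule nn_integral_cong)
      fix x assume x: "x \<in> space M"
      note [measurable] = Ax[OF x]
      show "(\<integral>\<^sup>+y. ennreal (norm (A x y * f y * h x)) \<partial>M) = ?v x * ennreal (cmod (h x))"
        by (subst nn_integral_multc[symmetric]) (auto simp: norm_mult ennreal_mult)
    qed
    also have "\<dots> < \<infinity>"
    proof -
      have "(\<integral>\<^sup>+x. ?v x * ennreal (cmod (h x)) \<partial>M)\<^sup>2
          \<le> (\<integral>\<^sup>+x. (?v x)\<^sup>2 \<partial>M) * (\<integral>\<^sup>+x. (ennreal (cmod (h x)))\<^sup>2 \<partial>M)"
        by (rule Cauchy_Schwarz_nn_integral) measurable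
      also have "\<dots> \<le> (ennreal (C\<^sup>2) * (\<integral>\<^sup>+x. (ennreal (cmod (f x)))\<^sup>2 \<partial>M)) * (\<integral>\<^sup>+x. (ennreal (cmod (h x)))\<^sup>2 \<partial>M)"
        by (intro mult_right_mono schur_test[OF A]) auto
      also have "\<dots> < \<infinity>"
        by (simp add: ennreal_power nn_integral_norm2[OF f] nn_integral_norm2[OF h] ennreal_mult_less_top)
      finally show ?thesis by (simp add: power_less_top_ennreal)
    qed
    finally show "(\<integral>\<^sup>+z. ennreal (norm (case z of (x, y) \<Rightarrow> A x y * f y * h x)) \<partial>(M \<Otimes>\<^sub>M M)) < \<infinity>" .
  qed measurable
  have "(LINT x|M. kernel_op M A f x * h x) = (LINT x|M. (LINT y|M. A x y * f y * h x))"
    by (simp add: kernel_op_def)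
  also have "\<dots> = (LINT y|M. (LINT x|M. A x y * f y * h x))"
    by (rule P.Fubini_integral[OF int, symmetric])
  also have "\<dots> = (LINT y|M. (LINT x|M. f y * (A x y * h x)))"
    by (intro Bochner_Integration.integral_cong refl) (simp add: ac_simps)
  finally show ?thesis by (simp add: kernel_op_def)
qed

text \<open>
  For almost every \<open>x\<close> the iterated integral of \<open>\<bar>A x y\<bar> \<bar>B y z\<bar> \<bar>f z\<bar>\<close> is finite, so the integral that
  defines the composed kernel converges for almost every \<open>z\<close> with \<open>f z \<noteq> 0\<close>. This is why the formula
  for the composed kernel is only asked for where that integral converges.
\<close>

lemma kernel_op_compose:
  assumes A: "schur M p C A" and B: "schur M p D B" and f: "f \<in> vecs (L2 M)"
    and Rm [measurable]: "(\<lambda>(x, y). R x y) \<in> borel_measurable (M \<Otimes>\<^sub>M M)"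
    and R: "AE x in M. AE z in M. integrable M (\<lambda>y. A x y * B y z) \<longrightarrow>
        (LINT y|M. A x y * B y z) = R x z"
  shows "AE x in M. kernel_op M A (kernel_op M B f) x = kernel_op M R f x"
proof -
  interpret P: pair_sigma_finite M M ..
  have Am [measurable]: "(\<lambda>(x, y). A x y) \<in> borel_measurable (M \<Otimes>\<^sub>M M)"
    and Bm [measurable]: "(\<lambda>(x, y). B x y) \<in> borel_measurable (M \<Otimes>\<^sub>M M)"
    using A B by (auto simp: schur_def)
  have fm [measurable]: "f \<in> borel_measurable M" using f by (simp add: L2_iff)
  have Ax [measurable]: "A x \<in> borel_measurable M" if "x \<in> space M" for x
    using measurable_compose_Pair1[OF that Am] by simp
  have Bx [measurable]: "B x \<in> borel_measurable M" if "x \<in> space M" for x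
    using measurable_compose_Pair1[OF that Bm] by simp
  have Rx [measurable]: "R x \<in> borel_measurable M" if "x \<in> space M" for x
    using measurable_compose_Pair1[OF that Rm] by simp
  let ?v = "\<lambda>y. \<integral>\<^sup>+z. ennreal (cmod (B y z)) * ennreal (cmod (f z)) \<partial>M"
  let ?w = "\<lambda>x. \<integral>\<^sup>+y. ennreal (cmod (A x y)) * ?v y \<partial>M"
  have "(\<integral>\<^sup>+x. (?w x)\<^sup>2 \<partial>M) \<le> ennreal (C\<^sup>2) * (\<integral>\<^sup>+y. (?v y)\<^sup>2 \<partial>M)"
    by (rule schur_test[OF A]) measurable
  also have "\<dots> \<le> ennreal (C\<^sup>2) * (ennreal (D\<^sup>2) * (\<integral>\<^sup>+y. (ennreal (cmod (f y)))\<^sup>2 \<partial>M))"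
    by (intro mult_left_mono schur_test[OF B]) auto
  also have "\<dots> < \<infinity>"
    by (simp add: ennreal_power nn_integral_norm2[OF f] ennreal_mult_less_top)
  finally have "AE x in M. (?w x)\<^sup>2 \<noteq> \<infinity>"
    by (intro nn_integral_PInf_AE) auto
  then show ?thesis
    using R AE_space
  proof eventually_elim
    fix x assume fin: "(?w x)\<^sup>2 \<noteq> \<infinity>" and x: "x \<in> space M"
      and R: "AE z in M. integrable M (\<lambda>y. A x y * B y z) \<longrightarrow> (LINT y|M. A x y * B y z) = R x z"
    note [measurable] = Ax[OF x] Rx[OF x]
    have wf: "?w x < \<infinity>" using fin by (auto simp: power_less_top_ennreal simp flip: less_top)
    have int: "integrable (M \<Otimes>\<^sub>M M) (\<lambda>(y, z). A x y * (B y z * f z))"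
    proof (rule integrableI_bounded)
      have "(\<integral>\<^sup>+q. ennreal (norm (case q of (y, z) \<Rightarrow> A x y * (B y z * f z))) \<partial>(M \<Otimes>\<^sub>M M))
          = (\<integral>\<^sup>+y. (\<integral>\<^sup>+z. ennreal (norm (A x y * (B y z * f z))) \<partial>M) \<partial>M)"
        by (subst nn_integral_fst[symmetric]) simp_all
      also have "\<dots> = ?w x"
      proof (rule nn_integral_cong)
        fix y assume y: "y \<in> space M"
        note [measurable] = Bx[OF y]
        show "(\<integral>\<^sup>+z. ennreal (norm (A x y * (B y z * f z))) \<partial>M) = ennreal (cmod (A x y)) * ?v y"
          by (subst nn_integral_cmult[symmetric]) (auto simp: norm_mult ennreal_mult)
      qed
      finally show "(\<integral>\<^sup>+q. ennreal (norm (case q of (y, z) \<Rightarrow> A x y * (B y z * f z))) \<partial>(M \<Otimes>\<^sub>M M)) < \<infinity>"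
        using wf by simp
    qed measurable
    have "kernel_op M A (kernel_op M B f) x = (LINT y|M. (LINT z|M. A x y * (B y z * f z)))"
      by (simp add: kernel_op_def)
    also have "\<dots> = (LINT z|M. (LINT y|M. A x y * (B y z * f z)))"
      by (rule P.Fubini_integral[OF int, symmetric])
    also have "\<dots> = (LINT z|M. R x z * f z)"
    proof (rule integral_cong_AE)
      show "(\<lambda>z. LINT y|M. A x y * (B y z * f z)) \<in> borel_measurable M"
        by measurable
      show "AE z in M. (LINT y|M. A x y * (B y z * f z)) = R x z * f z"
        using R P.AE_integrable_snd[OF int]
      proof eventually_elim
        case (elim z)
        have e: "(\<lambda>y. A x y * (B y z * f z)) = (\<lambda>y. (A x y * B y z) * f z)"
          by (simp add: mult.assoc)
        show ?case
        proof (cases "f z = 0")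
          case False
          have "integrable M (\<lambda>y. (A x y * B y z * f z) * inverse (f z))"
            using elim(2) by - (rule integrable_mult_left, simp add: mult.assoc)
          moreover have "(\<lambda>y. (A x y * B y z * f z) * inverse (f z)) = (\<lambda>y. A x y * B y z)"
            using False by (simp add: mult.assoc)
          ultimately have "integrable M (\<lambda>y. A x y * B y z)" by simp
          with elim(1) show ?thesis unfolding e by simp
        qed simp
      qed
    qed measurable
    finally show "kernel_op M A (kernel_op M B f) x = kernel_op M R f x"
      by (simp add: kernel_op_def)
  qed
qed

end

lemma norm2_sum_orthogonal:
  assumes "finite I" "\<And>i. i \<in> I \<Longrightarrow> F i \<in> vecs (L2 M)"
    and "\<And>i j. i \<in> I \<Longrightarrow> j \<in> I \<Longrightarrow> i \<noteq> j \<Longrightarrow> (LINT x|M. F i x * cnj (F j x)) = 0"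
  shows "(norm2 M (\<lambda>x. \<Sum>i\<in>I. F i x))\<^sup>2 = (\<Sum>i\<in>I. (norm2 M (F i))\<^sup>2)"
  using assms
proof (induction I rule: finite_induct)
  case (insert i I)
  have s: "(\<lambda>x. \<Sum>j\<in>I. F j x) \<in> vecs (L2 M)"
    using insert.prems by (intro L2_sum) auto
  have "(LINT x|M. F i x * cnj (\<Sum>j\<in>I. F j x)) = (LINT x|M. (\<Sum>j\<in>I. F i x * cnj (F j x)))"
    by (simp add: sum_distrib_left)
  also have "\<dots> = (\<Sum>j\<in>I. (LINT x|M. F i x * cnj (F j x)))"
    using insert.prems by (intro Bochner_Integration.integral_sum L2_mult_integrable L2_cnj) auto
  also have "\<dots> = 0"
    using insert by (intro sum.neutral ballI) auto
  finally show ?case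
    using insert norm2_add_power2[of "F i" M "\<lambda>x. \<Sum>j\<in>I. F j x"] s by simp
qed simp

text \<open>
  Orthogonal ranges and orthogonal coranges make the sum of a uniformly bounded sequence of
  operators \<open>A\<^sub>k\<close> bounded by the same constant: writing \<open>u\<^sub>k = A\<^sub>k f\<close>, one has
  \<open>\<Sum> \<parallel>u\<^sub>k\<parallel>\<^sup>2 = \<langle>f, \<Sum> A\<^sub>k\<^sup>* u\<^sub>k\<rangle> \<le> \<parallel>f\<parallel> C (\<Sum> \<parallel>u\<^sub>k\<parallel>\<^sup>2)\<^sup>1\<^sup>/\<^sup>2\<close>.
\<close>

locale schur_series = sigma_finite_measure M for M :: "'a measure" +
  fixes p :: "'a \<Rightarrow> real" and C :: real and A :: "nat \<Rightarrow> 'a \<Rightarrow> 'a \<Rightarrow> complex"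
  assumes schur: "\<And>k. schur M p C (A k)"
    and range_orth: "\<And>j k x z. j \<noteq> k \<Longrightarrow> (LINT y|M. A j y x * cnj (A k y z)) = 0"
    and corange_orth: "\<And>j k x z. j \<noteq> k \<Longrightarrow> (LINT y|M. A j x y * cnj (A k z y)) = 0"
    and mixed_orth: "\<And>j k x z. j \<noteq> k \<Longrightarrow> (LINT y|M. A j x y * A k y z) = 0"
    and reproducing: "\<And>k. AE x in M. AE z in M. integrable M (\<lambda>y. A k x y * A k y z) \<longrightarrow>
        (LINT y|M. A k x y * A k y z) = A k x z"
begin

lemma kernel_op_orthogonal:
  assumes B: "\<And>k. schur M p C (B k)"
    and orth: "\<And>j k x z. j \<noteq> k \<Longrightarrow> (LINT y|M. B j y x * cnj (B k y z)) = 0"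
    and f: "f \<in> vecs (L2 M)" and h: "h \<in> vecs (L2 M)" and "j \<noteq> k"
  shows "(LINT x|M. kernel_op M (B j) f x * cnj (kernel_op M (B k) h x)) = 0"
proof -
  have c: "(\<lambda>x. cnj (kernel_op M (B k) h x)) = kernel_op M (\<lambda>x y. cnj (B k x y)) (\<lambda>x. cnj (h x))"
    by (simp add: kernel_op_def fun_eq_iff flip: complex_cnj_mult)
  have "AE x in M. kernel_op M (\<lambda>x y. B j y x) (kernel_op M (\<lambda>x y. cnj (B k x y)) (\<lambda>x. cnj (h x))) x
      = kernel_op M (\<lambda>_ _. 0) (\<lambda>x. cnj (h x)) x"
    by (rule kernel_op_compose[OF schur_transpose[OF B] schur_cnj[OF B] L2_cnj[OF h]])
       (simp_all add: orth[OF \<open>j \<noteq> k\<close>])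
  then have z: "AE x in M. kernel_op M (\<lambda>x y. B j y x) (\<lambda>x. cnj (kernel_op M (B k) h x)) x = 0"
    unfolding c by (simp add: kernel_op_def)
  have hh: "(\<lambda>x. cnj (kernel_op M (B k) h x)) \<in> vecs (L2 M)"
    by (rule L2_cnj[OF schur_L2[OF B h]])
  have "(LINT x|M. kernel_op M (B j) f x * cnj (kernel_op M (B k) h x))
      = (LINT y|M. f y * kernel_op M (\<lambda>x y. B j y x) (\<lambda>x. cnj (kernel_op M (B k) h x)) y)"
    by (rule kernel_op_transpose[OF B f hh])
  also have "\<dots> = (LINT y|M. 0)"
    using z f schur_L2[OF schur_transpose[OF B] hh]
    by (intro integral_cong_AE borel_measurable_times) (auto simp: L2_iff elim: eventually_mono)
  finally show ?thesis by simp
qed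

definition partial_sum :: "('a \<Rightarrow> complex) \<Rightarrow> nat \<Rightarrow> 'a \<Rightarrow> complex" where
  "partial_sum f n x = (\<Sum>k<n. kernel_op M (A k) f x)"

lemma kernel_op_sum_norm:
  assumes f: "f \<in> vecs (L2 M)" and "finite I"
  shows "(norm2 M (\<lambda>x. \<Sum>k\<in>I. kernel_op M (A k) f x))\<^sup>2 = (\<Sum>k\<in>I. (norm2 M (kernel_op M (A k) f))\<^sup>2)"
  using kernel_op_orthogonal[OF schur range_orth f f] schur_L2[OF schur f] \<open>finite I\<close>
  by (intro norm2_sum_orthogonal) auto

lemma sum_norm_bound:
  assumes f: "f \<in> vecs (L2 M)"
  shows "(\<Sum>k<n. (norm2 M (kernel_op M (A k) f))\<^sup>2) \<le> (C * norm2 M f)\<^sup>2"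
proof -
  have C: "0 \<le> C" using schur[of 0] by (simp add: schur_def)
  define u where "u k = kernel_op M (A k) f" for k
  define w where "w k = kernel_op M (\<lambda>x y. A k y x) (\<lambda>x. cnj (u k x))" for k
  define s where "s = (\<Sum>k<n. (norm2 M (u k))\<^sup>2)"
  have s0: "0 \<le> s" unfolding s_def by (intro sum_nonneg) simp
  have u: "u k \<in> vecs (L2 M)" for k unfolding u_def by (rule schur_L2[OF schur f])
  have w: "w k \<in> vecs (L2 M)" for k
    unfolding w_def by (rule schur_L2[OF schur_transpose[OF schur] L2_cnj[OF u]])
  have w_le: "norm2 M (w k) \<le> C * norm2 M (u k)" for k
    unfolding w_def using schur_norm[OF schur_transpose[OF schur] L2_cnj[OF u], of k k]
    by (simp add: norm2_cnj)
  have w_orth: "(LINT x|M. w j x * cnj (w k x)) = 0" if "j \<noteq> k" for j k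
  proof -
    define B where "B k x y = A k y x" for k x y
    have B: "schur M p C (B k)" for k
      unfolding B_def by (rule schur_transpose[OF schur])
    have Bo: "(LINT y|M. B j y x * cnj (B k y z)) = 0" if "j \<noteq> k" for j k x z
      unfolding B_def using corange_orth[OF that] .
    show ?thesis
      using kernel_op_orthogonal[OF B Bo L2_cnj[OF u] L2_cnj[OF u] that]
      by (simp add: w_def B_def[abs_def])
  qed
  have wn: "(norm2 M (\<lambda>x. \<Sum>k<n. w k x))\<^sup>2 \<le> C\<^sup>2 * s"
  proof -
    have "(norm2 M (\<lambda>x. \<Sum>k<n. w k x))\<^sup>2 = (\<Sum>k<n. (norm2 M (w k))\<^sup>2)"
      using w w_orth by (intro norm2_sum_orthogonal) auto
    also have "\<dots> \<le> (\<Sum>k<n. (C * norm2 M (u k))\<^sup>2)"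
      by (intro sum_mono power_mono w_le) auto
    finally show ?thesis by (simp add: s_def sum_distrib_left power_mult_distrib)
  qed
  have "complex_of_real s = (\<Sum>k<n. (LINT x|M. u k x * cnj (u k x)))"
  proof -
    have "(LINT x|M. u k x * cnj (u k x)) = complex_of_real ((norm2 M (u k))\<^sup>2)" for k
      unfolding norm2_power2 integral_complex_of_real[symmetric] by (simp only: complex_norm_square)
    then show ?thesis by (simp add: s_def)
  qed
  also have "\<dots> = (\<Sum>k<n. (LINT y|M. f y * w k y))"
    unfolding w_def using kernel_op_transpose[OF schur f L2_cnj[OF u]] by (simp add: u_def)
  also have "\<dots> = (LINT y|M. f y * (\<Sum>k<n. w k y))"
    unfolding sum_distrib_left
    by (intro Bochner_Integration.integral_sum[symmetric] L2_mult_integrable f w)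
  finally have "s = cmod (LINT y|M. f y * (\<Sum>k<n. w k y))"
    using s0 by (metis abs_of_nonneg norm_of_real)
  also have "\<dots> \<le> norm2 M f * norm2 M (\<lambda>y. \<Sum>k<n. w k y)"
    by (intro Cauchy_Schwarz_L2 f L2_sum w)
  also have "\<dots> \<le> norm2 M f * (C * sqrt s)"
  proof (rule mult_left_mono, rule power2_le_imp_le)
    show "(norm2 M (\<lambda>x. \<Sum>k<n. w k x))\<^sup>2 \<le> (C * sqrt s)\<^sup>2"
      using wn s0 by (simp add: power_mult_distrib)
  qed (use C s0 in auto)
  finally have s_le: "s \<le> (C * norm2 M f) * sqrt s" by (simp add: ac_simps)
  have "sqrt s \<le> C * norm2 M f"
  proof (cases "s = 0")
    case False
    then have "sqrt s > 0" using s0 by simp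
    moreover have "sqrt s * sqrt s \<le> (C * norm2 M f) * sqrt s" using s_le s0 by simp
    ultimately show ?thesis by (rule_tac mult_right_le_imp_le)
  qed (use C in simp)
  then have "(sqrt s)\<^sup>2 \<le> (C * norm2 M f)\<^sup>2" using s0 by (intro power_mono) auto
  then show ?thesis using s0 by (simp add: s_def u_def)
qed

lemma partial_sum_L2: "f \<in> vecs (L2 M) \<Longrightarrow> partial_sum f n \<in> vecs (L2 M)"
  unfolding partial_sum_def[abs_def] by (intro L2_sum schur_L2[OF schur])

lemma series_converges:
  assumes f: "f \<in> vecs (L2 M)"
  shows "\<exists>g. tendsto_L2 M (partial_sum f) g"
proof (rule Riesz_Fischer[OF partial_sum_L2[OF f]])
  fix e :: real assume e: "e > 0"
  let ?a = "\<lambda>k. (norm2 M (kernel_op M (A k) f))\<^sup>2"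
  have "summable ?a"
    by (rule bounded_imp_summable[of _ "(C * norm2 M f)\<^sup>2"])
       (use sum_norm_bound[OF f, of "Suc n" for n] in \<open>auto simp: lessThan_Suc_atMost\<close>)
  moreover have "0 < e\<^sup>2" using e by simp
  ultimately obtain N where N: "\<And>m n. N \<le> m \<Longrightarrow> norm (sum ?a {m..<n}) < e\<^sup>2"
    unfolding summable_Cauchy by blast
  have lt: "norm2 M (\<lambda>x. partial_sum f n x - partial_sum f m x) < e" if "N \<le> m" "m \<le> n" for m n
  proof (rule power2_less_imp_less)
    have "(\<lambda>x. partial_sum f n x - partial_sum f m x) = (\<lambda>x. \<Sum>k\<in>{m..<n}. kernel_op M (A k) f x)"
      using sum_diff_nat_ivl[of 0 m n "\<lambda>k. kernel_op M (A k) f x" for x] that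
      by (simp add: partial_sum_def atLeast0LessThan)
    then have "(norm2 M (\<lambda>x. partial_sum f n x - partial_sum f m x))\<^sup>2 = sum ?a {m..<n}"
      using kernel_op_sum_norm[OF f, of "{m..<n}"] by simp
    also have "\<dots> < e\<^sup>2" using N[of m n] that by simp
    finally show "(norm2 M (\<lambda>x. partial_sum f n x - partial_sum f m x))\<^sup>2 < e\<^sup>2" .
  qed (use e in simp)
  have "norm2 M (\<lambda>x. partial_sum f m x - partial_sum f n x) < e" if "N \<le> m" "N \<le> n" for m n
    using lt[of m n] lt[of n m] that norm2_minus_commute[of M "partial_sum f m" "partial_sum f n"]
    by (cases "m \<le> n") auto
  then show "\<exists>N. \<forall>m\<ge>N. \<forall>n\<ge>N. norm2 M (\<lambda>x. partial_sum f m x - partial_sum f n x) < e" by blast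
qed

lemma series_norm:
  assumes f: "f \<in> vecs (L2 M)" and g: "tendsto_L2 M (partial_sum f) g"
  shows "norm2 M g \<le> C * norm2 M f"
proof -
  have C: "0 \<le> C" using schur[of 0] by (simp add: schur_def)
  have "norm2 M (partial_sum f n) \<le> C * norm2 M f" for n
  proof (rule power2_le_imp_le)
    show "(norm2 M (partial_sum f n))\<^sup>2 \<le> (C * norm2 M f)\<^sup>2"
      using sum_norm_bound[OF f, of n] kernel_op_sum_norm[OF f, of "{..<n}"] by (simp add: partial_sum_def[abs_def])
  qed (use C in simp)
  then show ?thesis
    by (intro LIMSEQ_le_const2[OF tendsto_L2_norm2[OF g]]) auto
qed

text \<open>
  Since \<open>A\<^sub>j A\<^sub>k f\<close> vanishes for \<open>j \<noteq> k\<close> and is \<open>A\<^sub>j f\<close> for \<open>j = k\<close>, continuity of \<open>A\<^sub>j\<close> gives \<open>A\<^sub>j g = A\<^sub>j f\<close>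
  for the sum \<open>g\<close>; hence \<open>g\<close> and \<open>f\<close> have the same series.
\<close>

lemma series_idempotent:
  assumes f: "f \<in> vecs (L2 M)" and g: "tendsto_L2 M (partial_sum f) g" and h: "tendsto_L2 M (partial_sum g) h"
  shows "AE x in M. h x = g x"
proof -
  have gL: "g \<in> vecs (L2 M)" using g by (simp add: tendsto_L2_def)
  have comp: "AE x in M. kernel_op M (A j) (kernel_op M (A k) f) x = (if j = k then kernel_op M (A j) f x else 0)" for j k
  proof (cases "j = k")
    case True
    have "AE x in M. kernel_op M (A k) (kernel_op M (A k) f) x = kernel_op M (A k) f x"
      using schur[of k] by (intro kernel_op_compose[OF schur schur f _ reproducing]) (simp add: schur_def)
    then show ?thesis using True by simp
  next
    case False
    have "AE x in M. kernel_op M (A j) (kernel_op M (A k) f) x = kernel_op M (\<lambda>_ _. 0) f x"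
      by (rule kernel_op_compose[OF schur schur f]) (simp_all add: mixed_orth[OF False])
    then show ?thesis using False by (simp add: kernel_op_def)
  qed
  have kpart: "AE x in M. kernel_op M (A j) (partial_sum f n) x = (\<Sum>k<n. kernel_op M (A j) (kernel_op M (A k) f) x)" for j n
  proof (induction n)
    case 0
    then show ?case by (simp add: partial_sum_def[abs_def] kernel_op_def)
  next
    case (Suc n)
    have "partial_sum f (Suc n) = (\<lambda>x. 1 * partial_sum f n x + 1 * kernel_op M (A n) f x)"
      by (simp add: partial_sum_def fun_eq_iff)
    with kernel_op_lincomb[OF schur partial_sum_L2[OF f] schur_L2[OF schur f], of j 1 n 1 n]
    have "AE x in M. kernel_op M (A j) (partial_sum f (Suc n)) x = kernel_op M (A j) (partial_sum f n) x + kernel_op M (A j) (kernel_op M (A n) f) x"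
      by simp
    with Suc show ?case by eventually_elim simp
  qed
  have kg: "AE x in M. kernel_op M (A j) g x = kernel_op M (A j) f x" for j
  proof -
    have "norm2 M (\<lambda>x. kernel_op M (A j) g x - kernel_op M (A j) f x) \<le> C * norm2 M (\<lambda>x. partial_sum f (Suc j + n) x - g x)" for n
    proof -
      let ?P = "partial_sum f (Suc j + n)"
      have P: "?P \<in> vecs (L2 M)" by (rule partial_sum_L2[OF f])
      have "AE x in M. \<forall>k\<in>{..<Suc j + n}. kernel_op M (A j) (kernel_op M (A k) f) x = (if j = k then kernel_op M (A j) f x else 0)"
        by (rule AE_finite_allI) (use comp in auto)
      then have Pj: "AE x in M. kernel_op M (A j) ?P x = kernel_op M (A j) f x"
        using kpart[of j "Suc j + n"] by eventually_elim (simp add: sum.delta')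
      have "AE x in M. kernel_op M (A j) (\<lambda>x. 1 * g x + (-1) * ?P x) x = 1 * kernel_op M (A j) g x + (-1) * kernel_op M (A j) ?P x"
        by (rule kernel_op_lincomb[OF schur gL P])
      with Pj have e: "AE x in M. kernel_op M (A j) g x - kernel_op M (A j) f x = kernel_op M (A j) (\<lambda>x. g x - ?P x) x"
        by eventually_elim simp
      have "norm2 M (\<lambda>x. kernel_op M (A j) g x - kernel_op M (A j) f x) = norm2 M (kernel_op M (A j) (\<lambda>x. g x - ?P x))"
        using e L2_diff[OF schur_L2[OF schur gL] schur_L2[OF schur f], of j j]
          schur_L2[OF schur L2_diff[OF gL P], of j]
        by (intro norm2_cong_AE) (auto simp: L2_iff)
      also have "\<dots> \<le> C * norm2 M (\<lambda>x. g x - ?P x)"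
        by (rule schur_norm[OF schur L2_diff[OF gL P]])
      finally show ?thesis by (simp add: norm2_minus_commute[of M g])
    qed
    moreover have "(\<lambda>n. C * norm2 M (\<lambda>x. partial_sum f (Suc j + n) x - g x)) \<longlonglongrightarrow> C * 0"
    proof (intro tendsto_intros)
      have "(\<lambda>n. norm2 M (\<lambda>x. partial_sum f n x - g x)) \<longlonglongrightarrow> 0" using g by (simp add: tendsto_L2_def)
      then show "(\<lambda>n. norm2 M (\<lambda>x. partial_sum f (Suc j + n) x - g x)) \<longlonglongrightarrow> 0"
        using LIMSEQ_ignore_initial_segment[of "\<lambda>n. norm2 M (\<lambda>x. partial_sum f n x - g x)" 0 "Suc j"]
        by (simp add: add.commute)
    qed
    ultimately have "norm2 M (\<lambda>x. kernel_op M (A j) g x - kernel_op M (A j) f x) \<le> C * 0"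
      by (intro LIMSEQ_le_const[of "\<lambda>n. C * norm2 M (\<lambda>x. partial_sum f (Suc j + n) x - g x)" "C * 0"]) auto
    then show ?thesis
      using norm2_diff_eq_0_iff[OF schur_L2[OF schur gL] schur_L2[OF schur f], of j j]
      by (simp add: order_antisym)
  qed
  have "AE x in M. partial_sum f n x = partial_sum g n x" for n
  proof -
    have "AE x in M. \<forall>k\<in>{..<n}. kernel_op M (A k) g x = kernel_op M (A k) f x"
      by (rule AE_finite_allI) (use kg in auto)
    then show ?thesis by eventually_elim (simp add: partial_sum_def)
  qed
  then have "tendsto_L2 M (partial_sum g) g"
    using partial_sum_L2[OF gL] gL by (intro tendsto_L2_cong_AE[OF g]) (auto simp: L2_iff)
  from tendsto_L2_unique[OF h this] show ?thesis .
qed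

end

section \<open>The measures in polar coordinates\<close>

definition radial :: "real \<Rightarrow> real measure" where
  "radial r = density lborel (\<lambda>\<alpha>. ennreal (indicator {0<..} \<alpha> * \<alpha> powr r))"

definition angular :: "real measure" where
  "angular = density lborel (\<lambda>\<theta>. ennreal (indicator {0..<2 * pi} \<theta>))"

text \<open>
  The absolute values make the parametrization land in the hypersurface for every real \<open>\<alpha>\<close>, so that
  it is a measurable map on a full product space.
\<close>

definition pt :: "real \<Rightarrow> real \<Rightarrow> real \<Rightarrow> real \<Rightarrow> complex \<times> complex" where
  "pt \<gamma> \<alpha> s \<theta> = (of_real \<bar>\<alpha>\<bar> * cis \<theta>, Complex s (\<bar>\<alpha>\<bar> powr \<gamma>))"

abbreviation hypM :: "real \<Rightarrow> (complex \<times> complex) measure" where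
  "hypM \<gamma> \<equiv> restrict_space borel (hyp \<gamma>)"

definition wmu :: "real \<Rightarrow> real \<Rightarrow> real \<Rightarrow> (complex \<times> complex) measure" where
  "wmu \<gamma> c r = scale_measure (ennreal c) (mu \<gamma> r)"

lemma sets_radial [measurable_cong, simp]: "sets (radial r) = sets borel"
  by (simp add: radial_def)

lemma sets_angular [measurable_cong, simp]: "sets angular = sets borel"
  by (simp add: angular_def)

lemma space_radial [simp]: "space (radial r) = UNIV"
  by (simp add: radial_def)

lemma space_angular [simp]: "space angular = UNIV"
  by (simp add: angular_def)

lemma sets_mu [simp, measurable_cong]: "sets (mu \<gamma> r) = sets (hypM \<gamma>)"
  by (simp add: mu_def)

lemma sets_wmu [simp, measurable_cong]: "sets (wmu \<gamma> c r) = sets (hypM \<gamma>)"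
  by (simp add: wmu_def)

lemma space_wmu [simp]: "space (wmu \<gamma> c r) = hyp \<gamma>"
  using sets_eq_imp_space_eq[OF sets_wmu[of \<gamma> c r]] by (simp add: space_restrict_space)

interpretation radial: sigma_finite_measure "radial r" for r
  unfolding radial_def
  by (subst sigma_finite_measure.sigma_finite_iff_density_finite[OF sigma_finite_lborel]) auto

lemma emeasure_angular: "emeasure angular UNIV = ennreal (2 * pi)"
proof -
  have "emeasure angular UNIV = (\<integral>\<^sup>+\<theta>. indicator {0..<2*pi} \<theta> \<partial>lborel)"
    unfolding angular_def by (simp add: emeasure_density ennreal_indicator)
  also have "\<dots> = ennreal (2 * pi)"
    by (subst nn_integral_indicator) auto
  finally show ?thesis .
qed

interpretation angular: finite_measure angular
  by standard (simp add: emeasure_angular)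

interpretation sa: pair_sigma_finite lborel angular ..

interpretation ra: pair_sigma_finite "radial r" "lborel \<Otimes>\<^sub>M angular" for r ..

lemma borel_measurable_cis [measurable]: "cis \<in> borel_measurable borel"
  by (intro borel_measurable_continuous_onI continuous_intros)

lemma pt_in_hyp: "pt \<gamma> \<alpha> s \<theta> \<in> hyp \<gamma>"
  by (simp add: pt_def hyp_def norm_mult)

lemma cmod_fst_pt [simp]: "cmod (fst (pt \<gamma> \<alpha> s \<theta>)) = \<bar>\<alpha>\<bar>"
  by (simp add: pt_def norm_mult)

lemma Re_snd_pt [simp]: "Re (snd (pt \<gamma> \<alpha> s \<theta>)) = s"
  by (simp add: pt_def)

lemma pt_measurable:
  assumes "f \<in> borel_measurable N" "g \<in> borel_measurable N" "h \<in> borel_measurable N"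
  shows "(\<lambda>x. pt \<gamma> (f x) (g x) (h x)) \<in> measurable N (hypM \<gamma>)"
proof (rule measurable_restrict_space2)
  note [measurable] = assms
  show "(\<lambda>x. pt \<gamma> (f x) (g x) (h x)) \<in> borel_measurable N"
    unfolding pt_def Complex_eq by (intro borel_measurable_Pair) measurable
qed (auto simp: pt_in_hyp)

lemma pt_periodic: "pt \<gamma> \<alpha> s (\<theta> + 2 * pi) = pt \<gamma> \<alpha> s \<theta>"
  by (simp add: pt_def flip: cis_mult)

lemma pt_measurable_comp [measurable (raw)]:
  assumes "F \<in> measurable (hypM \<gamma>) K"
    and "f \<in> borel_measurable N" "g \<in> borel_measurable N" "h \<in> borel_measurable N"
  shows "(\<lambda>x. F (pt \<gamma> (f x) (g x) (h x))) \<in> measurable N K"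
  using measurable_compose[OF pt_measurable[OF assms(2-4)] assms(1)] .

lemma nn_integral_radial:
  assumes [measurable]: "G \<in> borel_measurable borel"
  shows "(\<integral>\<^sup>+\<alpha>. G \<alpha> \<partial>radial r) = (\<integral>\<^sup>+\<alpha>. ennreal (indicator {0<..} \<alpha> * \<alpha> powr r) * G \<alpha> \<partial>lborel)"
  unfolding radial_def by (subst nn_integral_density) auto

lemma nn_integral_angular:
  assumes [measurable]: "G \<in> borel_measurable borel"
  shows "(\<integral>\<^sup>+\<theta>. G \<theta> \<partial>angular) = (\<integral>\<^sup>+\<theta>. indicator {0..<2 * pi} \<theta> * G \<theta> \<partial>lborel)"
  unfolding angular_def by (subst nn_integral_density) (auto simp: ennreal_indicator)

lemma AE_radial: "AE \<alpha> in radial r. 0 < \<alpha>"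
  unfolding radial_def by (subst AE_density) (auto simp: indicator_def)

lemma nn_integral_mu:
  assumes F [measurable]: "F \<in> borel_measurable (hypM \<gamma>)"
  shows "(\<integral>\<^sup>+z. F z \<partial>mu \<gamma> r) = (\<integral>\<^sup>+\<alpha>. (\<integral>\<^sup>+s. (\<integral>\<^sup>+\<theta>. F (pt \<gamma> \<alpha> s \<theta>) \<partial>angular) \<partial>lborel) \<partial>radial r)"
proof -
  let ?\<Omega> = "UNIV \<times> {0<..} \<times> {0..<2 * pi} :: (real \<times> real \<times> real) set"
  let ?w = "\<lambda>x :: real \<times> real \<times> real. ennreal (fst (snd x) powr r)"
  let ?q = "\<lambda>x :: real \<times> real \<times> real. pt \<gamma> (fst (snd x)) (fst x) (snd (snd x))"
  have b: "borel = (borel :: real measure) \<Otimes>\<^sub>M ((borel :: real measure) \<Otimes>\<^sub>M (borel :: real measure))"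
    by (simp add: borel_prod)
  have bl: "lborel = (lborel :: real measure) \<Otimes>\<^sub>M ((lborel :: real measure) \<Otimes>\<^sub>M (lborel :: real measure))"
    by (simp add: lborel_prod)
  have \<Omega> [measurable]: "?\<Omega> \<in> sets borel" unfolding b by measurable
  have m1 [measurable]: "fst \<in> borel_measurable (borel :: (real \<times> real \<times> real) measure)"
    "(\<lambda>x. fst (snd x)) \<in> borel_measurable (borel :: (real \<times> real \<times> real) measure)"
    "(\<lambda>x. snd (snd x)) \<in> borel_measurable (borel :: (real \<times> real \<times> real) measure)"
    unfolding b by measurable
  define H where "H x = ?w x * F (?q x) * indicator ?\<Omega> x" for x
  have Hm: "H \<in> borel_measurable borel"
    unfolding H_def[abs_def]
    by (intro borel_measurable_times_ennreal borel_measurable_indicator \<Omega>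
        pt_measurable_comp[OF F] m1 measurable_compose[OF _ measurable_ennreal] powr_real_measurable borel_measurable_const)
  have Hm2: "(\<lambda>y. H (s, y)) \<in> borel_measurable borel" for s
    by (rule measurable_compose[OF _ Hm]) (intro borel_measurable_Pair, simp_all)
  have pq: "param \<gamma> x = ?q x" if "x \<in> ?\<Omega>" for x
    using that by (auto simp: param_def pt_def split: prod.splits)
  have w: "(\<lambda>(s, \<alpha>, \<theta>). ennreal (\<alpha> powr r)) = ?w" by (auto simp: fun_eq_iff)
  have qm: "?q \<in> measurable (restrict_space lborel ?\<Omega>) (hypM \<gamma>)"
    by (intro measurable_restrict_space1 pt_measurable) simp_all
  have pm: "param \<gamma> \<in> measurable (density (restrict_space lborel ?\<Omega>) ?w) (hypM \<gamma>)"
    using qm by (subst measurable_cong[where g="?q"]) (auto simp: space_restrict_space pq)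
  have "(\<integral>\<^sup>+z. F z \<partial>mu \<gamma> r) = (\<integral>\<^sup>+x. F (param \<gamma> x) \<partial>density (restrict_space lborel ?\<Omega>) ?w)"
    unfolding mu_def w by (rule nn_integral_distr[OF pm]) simp
  also have "\<dots> = (\<integral>\<^sup>+x. F (?q x) \<partial>density (restrict_space lborel ?\<Omega>) ?w)"
    by (intro nn_integral_cong) (auto simp: space_restrict_space pq)
  also have "\<dots> = (\<integral>\<^sup>+x. ?w x * F (?q x) \<partial>restrict_space lborel ?\<Omega>)"
  proof (rule nn_integral_density)
    show "?w \<in> borel_measurable (restrict_space lborel ?\<Omega>)"
      by (rule measurable_restrict_space1) simp
    show "(\<lambda>x. F (?q x)) \<in> borel_measurable (restrict_space lborel ?\<Omega>)"
      by (rule measurable_compose[OF qm F])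
  qed
  also have "\<dots> = (\<integral>\<^sup>+x. H x \<partial>lborel)"
    unfolding H_def by (subst nn_integral_restrict_space) auto
  also have "\<dots> = (\<integral>\<^sup>+s. (\<integral>\<^sup>+y. H (s, y) \<partial>lborel) \<partial>lborel)"
    using lborel.nn_integral_fst[of H "lborel :: real measure"] Hm by (simp add: lborel_prod)
  also have "\<dots> = (\<integral>\<^sup>+s. (\<integral>\<^sup>+\<alpha>. (\<integral>\<^sup>+\<theta>. H (s, \<alpha>, \<theta>) \<partial>lborel) \<partial>lborel) \<partial>lborel)"
    using lborel.nn_integral_fst[of "\<lambda>y. H (s, y)" "lborel :: real measure" for s] Hm2
    by (intro nn_integral_cong) (simp add: lborel_prod)
  also have "\<dots> = (\<integral>\<^sup>+s. (\<integral>\<^sup>+\<alpha>. ennreal (indicator {0<..} \<alpha> * \<alpha> powr r) * (\<integral>\<^sup>+\<theta>. F (pt \<gamma> \<alpha> s \<theta>) \<partial>angular) \<partial>lborel) \<partial>lborel)"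
  proof (intro nn_integral_cong)
    fix s \<alpha> :: real
    have "(\<integral>\<^sup>+\<theta>. H (s, \<alpha>, \<theta>) \<partial>lborel)
        = (\<integral>\<^sup>+\<theta>. ennreal (indicator {0<..} \<alpha> * \<alpha> powr r) * (indicator {0..<2 * pi} \<theta> * F (pt \<gamma> \<alpha> s \<theta>)) \<partial>lborel)"
      by (intro nn_integral_cong) (auto simp: H_def indicator_def)
    also have "\<dots> = ennreal (indicator {0<..} \<alpha> * \<alpha> powr r) * (\<integral>\<^sup>+\<theta>. indicator {0..<2 * pi} \<theta> * F (pt \<gamma> \<alpha> s \<theta>) \<partial>lborel)"
      by (rule nn_integral_cmult) measurable
    finally show "(\<integral>\<^sup>+\<theta>. H (s, \<alpha>, \<theta>) \<partial>lborel)
        = ennreal (indicator {0<..} \<alpha> * \<alpha> powr r) * (\<integral>\<^sup>+\<theta>. F (pt \<gamma> \<alpha> s \<theta>) \<partial>angular)"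
      by (subst nn_integral_angular) measurable
  qed
  also have "\<dots> = (\<integral>\<^sup>+\<alpha>. (\<integral>\<^sup>+s. ennreal (indicator {0<..} \<alpha> * \<alpha> powr r) * (\<integral>\<^sup>+\<theta>. F (pt \<gamma> \<alpha> s \<theta>) \<partial>angular) \<partial>lborel) \<partial>lborel)"
    by (rule lborel_pair.Fubini') measurable
  also have "\<dots> = (\<integral>\<^sup>+\<alpha>. ennreal (indicator {0<..} \<alpha> * \<alpha> powr r) * (\<integral>\<^sup>+s. (\<integral>\<^sup>+\<theta>. F (pt \<gamma> \<alpha> s \<theta>) \<partial>angular) \<partial>lborel) \<partial>lborel)"
    by (intro nn_integral_cong nn_integral_cmult) measurable
  also have "\<dots> = (\<integral>\<^sup>+\<alpha>. (\<integral>\<^sup>+s. (\<integral>\<^sup>+\<theta>. F (pt \<gamma> \<alpha> s \<theta>) \<partial>angular) \<partial>lborel) \<partial>radial r)"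
    by (subst nn_integral_radial) measurable
  finally show ?thesis .
qed

lemma nn_integral_wmu:
  assumes F [measurable]: "F \<in> borel_measurable (hypM \<gamma>)"
  shows "(\<integral>\<^sup>+z. F z \<partial>wmu \<gamma> c r)
       = ennreal c * (\<integral>\<^sup>+\<alpha>. (\<integral>\<^sup>+s. (\<integral>\<^sup>+\<theta>. F (pt \<gamma> \<alpha> s \<theta>) \<partial>angular) \<partial>lborel) \<partial>radial r)"
  unfolding wmu_def using nn_integral_mu[OF F]
  by (subst nn_integral_scale_measure) (simp_all cong: measurable_cong_sets)

text \<open>
  The order of the factors, radius before height before angle, is that of the iterated integrals in
  the definition of the Leray transform.
\<close>

lemma mu_eq_distr:
  "mu \<gamma> r = distr (radial r \<Otimes>\<^sub>M (lborel \<Otimes>\<^sub>M angular)) (hypM \<gamma>) (\<lambda>x. pt \<gamma> (fst x) (fst (snd x)) (snd (snd x)))"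
  (is "_ = distr ?P _ ?q")
proof (rule measure_eqI)
  fix X assume "X \<in> sets (mu \<gamma> r)"
  then have X [measurable]: "X \<in> sets (hypM \<gamma>)" by simp
  have q [measurable]: "?q \<in> measurable ?P (hypM \<gamma>)"
    by (intro pt_measurable) measurable
  have "emeasure (mu \<gamma> r) X = (\<integral>\<^sup>+z. indicator X z \<partial>mu \<gamma> r)"
    by simp
  also have "\<dots> = (\<integral>\<^sup>+\<alpha>. (\<integral>\<^sup>+s. (\<integral>\<^sup>+\<theta>. indicator X (pt \<gamma> \<alpha> s \<theta>) \<partial>angular) \<partial>lborel) \<partial>radial r)"
    by (rule nn_integral_mu) simp
  also have "\<dots> = (\<integral>\<^sup>+\<alpha>. (\<integral>\<^sup>+y. indicator X (pt \<gamma> \<alpha> (fst y) (snd y)) \<partial>(lborel \<Otimes>\<^sub>M angular)) \<partial>radial r)"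
    by (intro nn_integral_cong, subst angular.nn_integral_fst[symmetric]) simp_all
  also have "\<dots> = (\<integral>\<^sup>+x. indicator X (?q x) \<partial>?P)"
    by (subst sa.P.nn_integral_fst[symmetric]) simp_all
  also have "\<dots> = (\<integral>\<^sup>+z. indicator X z \<partial>distr ?P (hypM \<gamma>) ?q)"
    by (rule nn_integral_distr[symmetric]) measurable
  also have "\<dots> = emeasure (distr ?P (hypM \<gamma>) ?q) X" by simp
  finally show "emeasure (mu \<gamma> r) X = emeasure (distr ?P (hypM \<gamma>) ?q) X" .
qed simp

lemma wmu_eq_density: "wmu \<gamma> c r = density (mu \<gamma> r) (\<lambda>_. ennreal c)"
  by (rule measure_eqI) (simp_all add: wmu_def emeasure_density nn_integral_cmult_indicator)

lemma integral_wmu: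
  fixes F :: "complex \<times> complex \<Rightarrow> complex"
  assumes F: "integrable (wmu \<gamma> c r) F" and c: "0 \<le> c"
  shows "(LINT z|wmu \<gamma> c r. F z)
       = of_real c * (LINT \<alpha>|radial r. (LINT s|lborel. (LINT \<theta>|angular. F (pt \<gamma> \<alpha> s \<theta>))))"
proof (cases "c = 0")
  case True
  have "AE z in wmu \<gamma> c r. F z = 0"
    unfolding wmu_eq_density using True by (subst AE_density) auto
  then have "(LINT z|wmu \<gamma> c r. F z) = 0"
    by (rule integral_eq_zero_AE)
  then show ?thesis using True by simp
next
  case False
  let ?P = "radial r \<Otimes>\<^sub>M (lborel \<Otimes>\<^sub>M angular)"
  let ?q = "\<lambda>x. pt \<gamma> (fst x) (fst (snd x)) (snd (snd x))"
  have q [measurable]: "?q \<in> measurable ?P (hypM \<gamma>)"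
    by (intro pt_measurable) measurable
  have Fm [measurable]: "F \<in> borel_measurable (hypM \<gamma>)"
    using F by (simp add: integrable_iff_bounded cong: measurable_cong_sets)
  have "integrable (mu \<gamma> r) (\<lambda>z. c *\<^sub>R F z)"
    using F c unfolding wmu_eq_density by (subst (asm) integrable_density) auto
  from integrable_scaleR_right[OF this, of "1 / c"] have "integrable (mu \<gamma> r) F"
    using False by simp
  then have i: "integrable ?P (\<lambda>x. F (?q x))"
    unfolding mu_eq_distr by (subst (asm) integrable_distr_eq) auto
  have "(LINT z|wmu \<gamma> c r. F z) = (LINT z|mu \<gamma> r. c *\<^sub>R F z)"
    unfolding wmu_eq_density using c by (subst integral_density) auto
  also have "\<dots> = of_real c * (LINT z|mu \<gamma> r. F z)"
    by (simp add: scaleR_conv_of_real)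
  also have "(LINT z|mu \<gamma> r. F z) = (LINT x|?P. F (?q x))"
    unfolding mu_eq_distr by (rule integral_distr) measurable
  also have "\<dots> = (LINT \<alpha>|radial r. (LINT y|(lborel \<Otimes>\<^sub>M angular). F (pt \<gamma> \<alpha> (fst y) (snd y))))"
    using ra.integral_fst'[OF i] by simp
  also have "\<dots> = (LINT \<alpha>|radial r. (LINT s|lborel. (LINT \<theta>|angular. F (pt \<gamma> \<alpha> s \<theta>))))"
  proof (rule integral_cong_AE)
    show "AE \<alpha> in radial r. (LINT y|(lborel \<Otimes>\<^sub>M angular). F (pt \<gamma> \<alpha> (fst y) (snd y)))
        = (LINT s|lborel. (LINT \<theta>|angular. F (pt \<gamma> \<alpha> s \<theta>)))"
      using ra.AE_integrable_fst'[OF i]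
    proof eventually_elim
      case (elim \<alpha>)
      then have "integrable (lborel \<Otimes>\<^sub>M angular) (\<lambda>y. F (pt \<gamma> \<alpha> (fst y) (snd y)))" by simp
      from sa.integral_fst'[OF this] show ?case by simp
    qed
  qed measurable
  finally show ?thesis .
qed

lemma AE_wmu_fst_nonzero: "AE z in wmu \<gamma> c r. fst z \<noteq> 0"
proof -
  have f [measurable]: "fst \<in> borel_measurable (hypM \<gamma>)"
    by (intro measurable_restrict_space1 borel_measurable_continuous_onI continuous_intros)
  have "(\<integral>\<^sup>+z. indicator {0} (fst z) \<partial>wmu \<gamma> c r)
      = ennreal c * (\<integral>\<^sup>+\<alpha>. (\<integral>\<^sup>+s. (\<integral>\<^sup>+\<theta>. indicator {0} (fst (pt \<gamma> \<alpha> s \<theta>)) \<partial>angular) \<partial>lborel) \<partial>radial r)"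
    by (rule nn_integral_wmu) measurable
  also have "(\<integral>\<^sup>+\<alpha>. (\<integral>\<^sup>+s. (\<integral>\<^sup>+\<theta>. indicator {0} (fst (pt \<gamma> \<alpha> s \<theta>)) \<partial>angular) \<partial>lborel) \<partial>radial r)
      = (\<integral>\<^sup>+\<alpha>. 0 \<partial>radial r)"
    by (rule nn_integral_cong_AE, use AE_radial in eventually_elim) (simp add: pt_def)
  finally have "(\<integral>\<^sup>+z. indicator {0} (fst z) \<partial>wmu \<gamma> c r) = 0" by simp
  then have "AE z in wmu \<gamma> c r. (indicator {0} (fst z) :: ennreal) = 0"
    by (subst (asm) nn_integral_0_iff_AE) (simp_all cong: measurable_cong_sets)
  then show ?thesis by (auto simp: indicator_def elim: eventually_mono split: if_splits)
qed

lemma sigma_finite_wmu: "sigma_finite_measure (wmu \<gamma> c r)"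
proof -
  obtain A :: "nat \<Rightarrow> real set" where A: "range A \<subseteq> sets (radial r)" "(\<Union>i. A i) = space (radial r)"
    "\<And>i. emeasure (radial r) (A i) \<noteq> \<infinity>"
    using radial.sigma_finite by blast
  have [measurable]: "A i \<in> sets borel" for i using A(1) by auto
  have f [measurable]: "fst \<in> borel_measurable (hypM \<gamma>)" "snd \<in> borel_measurable (hypM \<gamma>)"
    by (intro measurable_restrict_space1 borel_measurable_continuous_onI continuous_intros)+
  \<comment> \<open>the exhausting sets are preimages under \<open>z \<mapsto> (\<bar>z\<^sub>1\<bar>, Re z\<^sub>2)\<close>, which avoids inverting the parametrization\<close>
  define B where "B i n = {z \<in> space (hypM \<gamma>). cmod (fst z) \<in> A i \<and> \<bar>Re (snd z)\<bar> \<le> real n}" for i n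
  have B [measurable]: "B i n \<in> sets (hypM \<gamma>)" for i n
    unfolding B_def by measurable
  have fin: "emeasure (wmu \<gamma> c r) (B i n) < \<infinity>" for i n
  proof -
    have "emeasure (wmu \<gamma> c r) (B i n) = (\<integral>\<^sup>+z. indicator (B i n) z \<partial>wmu \<gamma> c r)" by simp
    also have "\<dots> = ennreal c * (\<integral>\<^sup>+\<alpha>. (\<integral>\<^sup>+s. (\<integral>\<^sup>+\<theta>. indicator (B i n) (pt \<gamma> \<alpha> s \<theta>) \<partial>angular) \<partial>lborel) \<partial>radial r)"
      by (rule nn_integral_wmu) measurable
    also have "(\<integral>\<^sup>+\<alpha>. (\<integral>\<^sup>+s. (\<integral>\<^sup>+\<theta>. indicator (B i n) (pt \<gamma> \<alpha> s \<theta>) \<partial>angular) \<partial>lborel) \<partial>radial r)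
        = (\<integral>\<^sup>+\<alpha>. (\<integral>\<^sup>+s. (\<integral>\<^sup>+\<theta>. indicator (A i) \<alpha> * indicator {- real n..real n} s \<partial>angular) \<partial>lborel) \<partial>radial r)"
    proof (rule nn_integral_cong_AE, use AE_radial in eventually_elim)
      fix \<alpha> :: real assume \<alpha>: "0 < \<alpha>"
      have "indicator (B i n) (pt \<gamma> \<alpha> s \<theta>) = (indicator (A i) \<alpha> * indicator {- real n..real n} s :: ennreal)" for s \<theta>
        using \<alpha> pt_in_hyp[of \<gamma> \<alpha> s \<theta>]
        by (auto simp: B_def indicator_def pt_def norm_mult space_restrict_space)
      then show "(\<integral>\<^sup>+s. (\<integral>\<^sup>+\<theta>. indicator (B i n) (pt \<gamma> \<alpha> s \<theta>) \<partial>angular) \<partial>lborel)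
          = (\<integral>\<^sup>+s. (\<integral>\<^sup>+\<theta>. indicator (A i) \<alpha> * indicator {- real n..real n} s \<partial>angular) \<partial>lborel)"
        by simp
    qed
    also have "\<dots> = (\<integral>\<^sup>+\<alpha>. indicator (A i) \<alpha> * (ennreal (2 * real n) * ennreal (2 * pi)) \<partial>radial r)"
    proof (intro nn_integral_cong)
      fix \<alpha> :: real
      have "(\<integral>\<^sup>+s. (\<integral>\<^sup>+\<theta>. indicator (A i) \<alpha> * indicator {- real n..real n} s \<partial>angular) \<partial>lborel)
          = (\<integral>\<^sup>+s. (indicator (A i) \<alpha> * ennreal (2 * pi)) * indicator {- real n..real n} s \<partial>lborel)"
        by (simp add: emeasure_angular ac_simps)
      also have "\<dots> = (indicator (A i) \<alpha> * ennreal (2 * pi)) * emeasure lborel {- real n..real n}"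
        by (rule nn_integral_cmult_indicator) simp
      finally show "(\<integral>\<^sup>+s. (\<integral>\<^sup>+\<theta>. indicator (A i) \<alpha> * indicator {- real n..real n} s \<partial>angular) \<partial>lborel)
          = indicator (A i) \<alpha> * (ennreal (2 * real n) * ennreal (2 * pi))"
        by (simp add: ac_simps)
    qed
    also have "\<dots> = emeasure (radial r) (A i) * (ennreal (2 * real n) * ennreal (2 * pi))"
      by (subst nn_integral_multc) auto
    also have "ennreal c * \<dots> < \<infinity>"
      using A(3)[of i] by (simp add: ennreal_mult_less_top less_top)
    finally show ?thesis .
  qed
  show ?thesis
  proof
    let ?X = "(\<lambda>(i, n). B i n) ` (UNIV \<times> UNIV)"
    show "\<exists>X. countable X \<and> X \<subseteq> sets (wmu \<gamma> c r) \<and> \<Union> X = space (wmu \<gamma> c r) \<and> (\<forall>a\<in>X. emeasure (wmu \<gamma> c r) a \<noteq> \<infinity>)"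
    proof (intro exI[of _ ?X] conjI ballI)
      show "\<Union> ?X = space (wmu \<gamma> c r)"
      proof safe
        fix z1 z2 :: complex assume z: "(z1, z2) \<in> space (wmu \<gamma> c r)"
        have "cmod z1 \<in> (\<Union>i. A i)" unfolding A(2) by simp
        then obtain i where "cmod z1 \<in> A i" by blast
        moreover obtain n where "\<bar>Re z2\<bar> \<le> real n" using real_arch_simple by blast
        ultimately have "(z1, z2) \<in> B i n" using z by (simp add: B_def space_restrict_space)
        then show "(z1, z2) \<in> \<Union> ?X" by blast
      qed (auto simp: B_def space_restrict_space)
    qed (use fin B in \<open>auto simp: less_top\<close>)
  qed
qed

lemma density_wmu:
  assumes "0 \<le> c" "0 \<le> d"
  shows "density (wmu \<gamma> c r) (\<lambda>z. ennreal (d * cmod (fst z) powr q)) = wmu \<gamma> (c * d) (r + q)"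
proof (rule measure_eqI)
  have f [measurable]: "fst \<in> borel_measurable (hypM \<gamma>)"
    by (intro measurable_restrict_space1 borel_measurable_continuous_onI continuous_intros)
  fix X assume "X \<in> sets (density (wmu \<gamma> c r) (\<lambda>z. ennreal (d * cmod (fst z) powr q)))"
  then have X [measurable]: "X \<in> sets (hypM \<gamma>)" by simp
  let ?J = "\<lambda>\<alpha>. (\<integral>\<^sup>+s. (\<integral>\<^sup>+\<theta>. indicator X (pt \<gamma> \<alpha> s \<theta>) \<partial>angular) \<partial>lborel)"
  have "emeasure (density (wmu \<gamma> c r) (\<lambda>z. ennreal (d * cmod (fst z) powr q))) X
      = (\<integral>\<^sup>+z. ennreal (d * cmod (fst z) powr q) * indicator X z \<partial>wmu \<gamma> c r)"
    by (rule emeasure_density) measurable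
  also have "\<dots> = ennreal c * (\<integral>\<^sup>+\<alpha>. (\<integral>\<^sup>+s. (\<integral>\<^sup>+\<theta>. ennreal (d * cmod (fst (pt \<gamma> \<alpha> s \<theta>)) powr q) * indicator X (pt \<gamma> \<alpha> s \<theta>) \<partial>angular) \<partial>lborel) \<partial>radial r)"
    by (rule nn_integral_wmu) measurable
  also have "(\<integral>\<^sup>+\<alpha>. (\<integral>\<^sup>+s. (\<integral>\<^sup>+\<theta>. ennreal (d * cmod (fst (pt \<gamma> \<alpha> s \<theta>)) powr q) * indicator X (pt \<gamma> \<alpha> s \<theta>) \<partial>angular) \<partial>lborel) \<partial>radial r)
      = (\<integral>\<^sup>+\<alpha>. ennreal (d * \<bar>\<alpha>\<bar> powr q) * ?J \<alpha> \<partial>radial r)"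
  proof (intro nn_integral_cong)
    fix \<alpha> :: real
    have "(\<integral>\<^sup>+\<theta>. ennreal (d * cmod (fst (pt \<gamma> \<alpha> s \<theta>)) powr q) * indicator X (pt \<gamma> \<alpha> s \<theta>) \<partial>angular)
        = ennreal (d * \<bar>\<alpha>\<bar> powr q) * (\<integral>\<^sup>+\<theta>. indicator X (pt \<gamma> \<alpha> s \<theta>) \<partial>angular)" for s
      by (subst nn_integral_cmult[symmetric]) simp_all
    then show "(\<integral>\<^sup>+s. (\<integral>\<^sup>+\<theta>. ennreal (d * cmod (fst (pt \<gamma> \<alpha> s \<theta>)) powr q) * indicator X (pt \<gamma> \<alpha> s \<theta>) \<partial>angular) \<partial>lborel)
        = ennreal (d * \<bar>\<alpha>\<bar> powr q) * ?J \<alpha>"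
      by (simp add: nn_integral_cmult)
  qed
  also have "\<dots> = (\<integral>\<^sup>+\<alpha>. ennreal (indicator {0<..} \<alpha> * \<alpha> powr r) * (ennreal (d * \<bar>\<alpha>\<bar> powr q) * ?J \<alpha>) \<partial>lborel)"
    by (rule nn_integral_radial) measurable
  also have "\<dots> = (\<integral>\<^sup>+\<alpha>. ennreal d * (ennreal (indicator {0<..} \<alpha> * \<alpha> powr (r + q)) * ?J \<alpha>) \<partial>lborel)"
  proof (intro nn_integral_cong)
    fix \<alpha> :: real
    have "ennreal (indicator {0<..} \<alpha> * \<alpha> powr r) * ennreal (d * \<bar>\<alpha>\<bar> powr q)
        = ennreal d * ennreal (indicator {0<..} \<alpha> * \<alpha> powr (r + q))"
      using assms by (subst (1 2) ennreal_mult[symmetric]) (auto simp: indicator_def powr_add)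
    then show "ennreal (indicator {0<..} \<alpha> * \<alpha> powr r) * (ennreal (d * \<bar>\<alpha>\<bar> powr q) * ?J \<alpha>)
        = ennreal d * (ennreal (indicator {0<..} \<alpha> * \<alpha> powr (r + q)) * ?J \<alpha>)"
      by (metis mult.assoc)
  qed
  also have "\<dots> = ennreal d * (\<integral>\<^sup>+\<alpha>. ennreal (indicator {0<..} \<alpha> * \<alpha> powr (r + q)) * ?J \<alpha> \<partial>lborel)"
    by (rule nn_integral_cmult) measurable
  also have "(\<integral>\<^sup>+\<alpha>. ennreal (indicator {0<..} \<alpha> * \<alpha> powr (r + q)) * ?J \<alpha> \<partial>lborel) = (\<integral>\<^sup>+\<alpha>. ?J \<alpha> \<partial>radial (r + q))"
    by (rule nn_integral_radial[symmetric]) measurable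
  also have "ennreal c * (ennreal d * (\<integral>\<^sup>+\<alpha>. ?J \<alpha> \<partial>radial (r + q))) = ennreal (c * d) * (\<integral>\<^sup>+\<alpha>. ?J \<alpha> \<partial>radial (r + q))"
    using assms by (simp add: ennreal_mult mult.assoc)
  also have "\<dots> = (\<integral>\<^sup>+z. indicator X z \<partial>wmu \<gamma> (c * d) (r + q))"
    by (rule nn_integral_wmu[symmetric]) measurable
  finally show "emeasure (density (wmu \<gamma> c r) (\<lambda>z. ennreal (d * cmod (fst z) powr q))) X
      = emeasure (wmu \<gamma> (c * d) (r + q)) X" by simp
qed simp

section \<open>The duality map\<close>

text \<open>
  Substitution on the compact intervals \<open>[1 / (n + 1), n + 2]\<close>, followed by exhaustion of the half-line.
\<close>

lemma nn_integral_power_substitution: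
  fixes \<Psi> :: "real \<Rightarrow> ennreal"
  assumes \<Psi> [measurable]: "\<Psi> \<in> borel_measurable borel" and q: "0 < q"
  shows "(\<integral>\<^sup>+x. \<Psi> x * indicator {0<..} x \<partial>lborel)
       = (\<integral>\<^sup>+a. \<Psi> (a powr q) * ennreal (q * a powr (q - 1)) * indicator {0<..} a \<partial>lborel)"
proof -
  let ?a = "\<lambda>n::nat. 1 / real (Suc n)" and ?b = "\<lambda>n::nat. real (Suc n) + 1"
  let ?N1 = "density lborel \<Psi>"
  let ?\<Phi> = "\<lambda>a. \<Psi> (a powr q) * ennreal (q * a powr (q - 1))"
  let ?N2 = "density lborel ?\<Phi>"
  let ?A = "\<lambda>n. {?a n..?b n}" and ?B = "\<lambda>n. {?a n powr q..?b n powr q}"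
  have a_dec: "?a n \<le> ?a m" if "m \<le> n" for m n
    using that by (simp add: frac_le)
  have step: "emeasure ?N1 (?B n) = emeasure ?N2 (?A n)" for n
  proof -
    have pos: "0 < x" if "x \<in> ?A n" for x
      using that by (auto intro: less_le_trans[of 0 "?a n"])
    have "(\<integral>\<^sup>+x. \<Psi> x * indicator {?a n powr q..?b n powr q} x \<partial>lborel)
        = (\<integral>\<^sup>+x. \<Psi> (x powr q) * (q * x powr (q - 1)) * indicator (?A n) x \<partial>lborel)"
    proof (rule nn_integral_substitution_aux)
      show "((\<lambda>x. x powr q) has_real_derivative q * x powr (q - 1)) (at x)" if "x \<in> ?A n" for x
        using has_real_derivative_powr[of x q] pos[OF that] by simp
      show "continuous_on (?A n) (\<lambda>x. q * x powr (q - 1))"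
        using pos by (intro continuous_intros) force
      show "?a n < ?b n"
        by (rule le_less_trans[of _ 1]) (auto simp: field_simps)
    qed (use q in auto)
    then show ?thesis by (simp add: emeasure_density)
  qed
  have UA: "(\<Union>n. ?A n) = {0<..}"
  proof (intro equalityI subsetI)
    fix x assume "x \<in> (\<Union>n. ?A n)"
    then obtain n where "x \<in> ?A n" by blast
    then show "x \<in> {0<..}" by (auto intro: less_le_trans[of 0 "?a n"])
  next
    fix x :: real assume "x \<in> {0<..}"
    then obtain n where n: "1 / real (Suc n) < x" using nat_approx_posE[of x] by auto
    obtain m where m: "x \<le> real m" using real_arch_simple by blast
    have "x \<in> ?A (max n m)"
      using a_dec[of n "max n m"] n m by (auto intro: less_imp_le order_trans)
    then show "x \<in> (\<Union>n. ?A n)" by blast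
  qed
  have UB: "(\<Union>n. ?B n) = {0<..}"
  proof (intro equalityI subsetI)
    fix x assume "x \<in> (\<Union>n. ?B n)"
    then obtain n where "x \<in> ?B n" by blast
    moreover have "0 < ?a n powr q" by simp
    ultimately show "x \<in> {0<..}" by (auto simp del: powr_gt_zero intro: less_le_trans)
  next
    fix x :: real assume x: "x \<in> {0<..}"
    then have "x powr (1 / q) \<in> (\<Union>n. ?A n)" unfolding UA by simp
    then obtain n where n: "?a n \<le> x powr (1 / q)" "x powr (1 / q) \<le> ?b n" by auto
    have "(x powr (1 / q)) powr q = x" using q x by (simp add: powr_powr)
    then have "x \<in> ?B n"
      using powr_mono2[OF less_imp_le[OF q] _ n(1)] powr_mono2[OF less_imp_le[OF q] _ n(2)] by auto
    then show "x \<in> (\<Union>n. ?B n)" by blast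
  qed
  have "incseq ?A"
  proof (rule incseq_SucI)
    show "?A n \<subseteq> ?A (Suc n)" for n
      using a_dec[of n "Suc n"] by auto
  qed
  moreover have "incseq ?B"
  proof (rule incseq_SucI)
    show "?B n \<subseteq> ?B (Suc n)" for n
      using powr_mono2[OF less_imp_le[OF q] _ a_dec[of n "Suc n"]]
        powr_mono2[OF less_imp_le[OF q], of "?b n" "?b (Suc n)"] by auto
  qed
  ultimately have "emeasure ?N1 (\<Union>n. ?B n) = emeasure ?N2 (\<Union>n. ?A n)"
    using SUP_emeasure_incseq[of ?B ?N1] SUP_emeasure_incseq[of ?A ?N2] step by force
  then show ?thesis
    unfolding UA UB by (simp add: emeasure_density)
qed

lemma nn_integral_radial_power:
  assumes \<Psi> [measurable]: "\<Psi> \<in> borel_measurable borel" and q: "0 < q"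
  shows "(\<integral>\<^sup>+a. \<Psi> (a powr q) \<partial>radial r) = ennreal (1 / q) * (\<integral>\<^sup>+a. \<Psi> a \<partial>radial ((r + 1) / q - 1))"
proof -
  let ?e = "(r + 1) / q - 1"
  have "(\<integral>\<^sup>+a. \<Psi> a \<partial>radial ?e) = (\<integral>\<^sup>+a. (ennreal (a powr ?e) * \<Psi> a) * indicator {0<..} a \<partial>lborel)"
    by (subst nn_integral_radial) (auto intro!: nn_integral_cong simp: indicator_def)
  also have "\<dots> = (\<integral>\<^sup>+a. (ennreal ((a powr q) powr ?e) * \<Psi> (a powr q)) * ennreal (q * a powr (q - 1)) * indicator {0<..} a \<partial>lborel)"
    by (rule nn_integral_power_substitution[OF _ q]) measurable
  also have "\<dots> = (\<integral>\<^sup>+a. ennreal q * (ennreal (indicator {0<..} a * a powr r) * \<Psi> (a powr q)) \<partial>lborel)"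
  proof (intro nn_integral_cong)
    fix a :: real
    show "(ennreal ((a powr q) powr ?e) * \<Psi> (a powr q)) * ennreal (q * a powr (q - 1)) * indicator {0<..} a
        = ennreal q * (ennreal (indicator {0<..} a * a powr r) * \<Psi> (a powr q))"
    proof (cases "0 < a")
      case True
      have "q * ?e + (q - 1) = r" using q by (simp add: field_simps)
      then have "(a powr q) powr ?e * a powr (q - 1) = a powr r"
        by (simp add: powr_powr powr_add[symmetric])
      then have "ennreal ((a powr q) powr ?e) * ennreal (q * a powr (q - 1)) = ennreal q * ennreal (a powr r)"
        using q by (simp add: ennreal_mult[symmetric] mult.left_commute)
      then show ?thesis using True
        by (simp add: mult.assoc mult.left_commute mult.commute)
    qed simp
  qed
  also have "\<dots> = ennreal q * (\<integral>\<^sup>+a. \<Psi> (a powr q) \<partial>radial r)"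
    by (subst nn_integral_cmult) (auto simp: nn_integral_radial)
  finally have "(\<integral>\<^sup>+a. \<Psi> a \<partial>radial ?e) = ennreal q * (\<integral>\<^sup>+a. \<Psi> (a powr q) \<partial>radial r)" .
  then show ?thesis
    using q by (simp add: mult.assoc[symmetric] ennreal_mult[symmetric])
qed

lemma nn_integral_angular_reflect:
  assumes H [measurable]: "H \<in> borel_measurable borel" and per: "\<And>\<theta>. H (\<theta> + 2 * pi) = H \<theta>"
  shows "(\<integral>\<^sup>+\<theta>. H (- \<theta>) \<partial>angular) = (\<integral>\<^sup>+\<theta>. H \<theta> \<partial>angular)"
proof -
  have "(\<integral>\<^sup>+\<theta>. H (- \<theta>) \<partial>angular) = (\<integral>\<^sup>+\<theta>. indicator {0..<2 * pi} \<theta> * H (- \<theta>) \<partial>lborel)"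
    by (rule nn_integral_angular) measurable
  also have "\<dots> = ennreal \<bar>-1\<bar> * (\<integral>\<^sup>+\<theta>. indicator {0..<2 * pi} (2 * pi + (-1) * \<theta>) * H (- (2 * pi + (-1) * \<theta>)) \<partial>lborel)"
    by (rule nn_integral_real_affine) auto
  also have "\<dots> = (\<integral>\<^sup>+\<theta>. indicator {0..<2 * pi} (2 * pi - \<theta>) * H \<theta> \<partial>lborel)"
    using per[of "\<theta> - 2 * pi" for \<theta>] by simp
  also have "\<dots> = (\<integral>\<^sup>+\<theta>. indicator {0..<2 * pi} \<theta> * H \<theta> \<partial>lborel)"
  proof (rule nn_integral_cong_AE)
    show "AE \<theta> in lborel. indicator {0..<2 * pi} (2 * pi - \<theta>) * H \<theta> = indicator {0..<2 * pi} \<theta> * H \<theta>"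
      using AE_lborel_singleton[of 0] AE_lborel_singleton[of "2 * pi"]
      by eventually_elim (auto simp: indicator_def)
  qed
  also have "\<dots> = (\<integral>\<^sup>+\<theta>. H \<theta> \<partial>angular)"
    by (rule nn_integral_angular[symmetric]) measurable
  finally show ?thesis .
qed

lemma dual_exponent_gt_1: "1 < \<gamma> \<Longrightarrow> 1 < dual_exponent \<gamma>"
  by (simp add: dual_exponent_def field_simps)

lemma dual_exponent_minus_1: "1 < \<gamma> \<Longrightarrow> dual_exponent \<gamma> - 1 = 1 / (\<gamma> - 1)"
  by (simp add: dual_exponent_def field_simps)

lemma dual_exponent_involution: "1 < \<gamma> \<Longrightarrow> dual_exponent (dual_exponent \<gamma>) = \<gamma>"
  by (simp add: dual_exponent_def field_simps)

lemma cmod_fst_dual_map: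
  assumes "1 < \<gamma>" shows "cmod (fst (dual_map \<gamma> z)) = cmod (fst z) powr (\<gamma> - 1)"
proof (cases "fst z = 0")
  case False
  then have "cmod (fst z) * cmod (fst z) powr (\<gamma> - 2) = cmod (fst z) powr (1 + (\<gamma> - 2))"
    by (subst powr_add) simp
  then show ?thesis by (simp add: dual_map_def norm_mult)
qed (simp add: dual_map_def)

lemma cmod_fst_dual_map_powr:
  assumes "1 < \<gamma>"
  shows "cmod (fst (dual_map \<gamma> z)) powr dual_exponent \<gamma> = cmod (fst z) powr \<gamma>"
  using assms by (simp add: cmod_fst_dual_map powr_powr dual_exponent_def)

lemma Im_snd_dual_map:
  assumes "1 < \<gamma>" "z \<in> hyp \<gamma>" shows "Im (snd (dual_map \<gamma> z)) = cmod (fst z) powr \<gamma>"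
proof -
  have "Im (snd (dual_map \<gamma> z)) = (Im (snd z) - \<gamma> * cmod (fst z) powr \<gamma>) / (1 - \<gamma>)"
    by (simp add: dual_map_def)
  also have "Im (snd z) - \<gamma> * cmod (fst z) powr \<gamma> = (1 - \<gamma>) * cmod (fst z) powr \<gamma>"
    using assms by (simp add: hyp_def left_diff_distrib)
  finally show ?thesis using assms by simp
qed

lemma Re_snd_dual_map: "Re (snd (dual_map \<gamma> z)) = Re (snd z) / (1 - \<gamma>)"
  by (simp add: dual_map_def)

lemma dual_map_hyp:
  assumes "1 < \<gamma>" "z \<in> hyp \<gamma>" shows "dual_map \<gamma> z \<in> hyp (dual_exponent \<gamma>)"
  using Im_snd_dual_map[OF assms] cmod_fst_dual_map_powr[OF assms(1)] by (simp add: hyp_def)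

lemma dual_map_dual_map:
  assumes \<gamma>: "1 < \<gamma>" and z: "z \<in> hyp \<gamma>"
  shows "dual_map (dual_exponent \<gamma>) (dual_map \<gamma> z) = z"
proof (rule prod_eqI)
  let ?g = "dual_exponent \<gamma>"
  let ?w = "dual_map \<gamma> z"
  show "fst (dual_map ?g ?w) = fst z"
  proof (cases "fst z = 0")
    case False
    have e: "(\<gamma> - 1) * (?g - 2) = 2 - \<gamma>"
      using \<gamma> by (simp add: dual_exponent_def field_simps)
    have "fst (dual_map ?g ?w) = cnj (fst ?w) * of_real (cmod (fst ?w) powr (?g - 2))"
      by (simp add: dual_map_def)
    also have "\<dots> = fst z * of_real (cmod (fst z) powr (\<gamma> - 2) * cmod (fst z) powr (2 - \<gamma>))"
      unfolding cmod_fst_dual_map[OF \<gamma>] powr_powr e by (simp add: dual_map_def)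
    also have "cmod (fst z) powr (\<gamma> - 2) * cmod (fst z) powr (2 - \<gamma>) = 1"
      using False by (subst powr_add[symmetric]) simp
    finally show ?thesis by simp
  qed (simp add: dual_map_def)
  show "snd (dual_map ?g ?w) = snd z"
  proof (rule complex_eqI)
    have "(1 - \<gamma>) * (1 - ?g) = 1"
      using \<gamma> by (simp add: dual_exponent_def field_simps)
    then show "Re (snd (dual_map ?g ?w)) = Re (snd z)"
      by (simp add: Re_snd_dual_map)
    have "Im (snd (dual_map ?g ?w)) = cmod (fst ?w) powr ?g"
      by (rule Im_snd_dual_map[OF dual_exponent_gt_1[OF \<gamma>] dual_map_hyp[OF \<gamma> z]])
    then show "Im (snd (dual_map ?g ?w)) = Im (snd z)"
      using z by (simp add: cmod_fst_dual_map_powr[OF \<gamma>] hyp_def)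
  qed
qed

lemma borel_measurable_fst_hypM [measurable]: "fst \<in> borel_measurable (hypM \<gamma>)"
  and borel_measurable_snd_hypM [measurable]: "snd \<in> borel_measurable (hypM \<gamma>)"
  by (intro measurable_restrict_space1 borel_measurable_continuous_onI continuous_intros)+

lemma dual_map_measurable:
  assumes "1 < \<gamma>" shows "dual_map \<gamma> \<in> measurable (hypM \<gamma>) (hypM (dual_exponent \<gamma>))"
proof (rule measurable_restrict_space2)
  show "dual_map \<gamma> \<in> space (hypM \<gamma>) \<rightarrow> hyp (dual_exponent \<gamma>)"
    using dual_map_hyp[OF assms] by (auto simp: space_restrict_space)
  show "dual_map \<gamma> \<in> borel_measurable (hypM \<gamma>)"
    unfolding dual_map_def[abs_def] by (intro borel_measurable_Pair) measurable
qed

lemma dual_map_pt: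
  assumes \<gamma>: "1 < \<gamma>" and \<alpha>: "0 < \<alpha>"
  shows "dual_map \<gamma> (pt \<gamma> \<alpha> s \<theta>) = pt (dual_exponent \<gamma>) (\<alpha> powr (\<gamma> - 1)) (s / (1 - \<gamma>)) (- \<theta>)"
proof (rule prod_eqI)
  let ?z = "pt \<gamma> \<alpha> s \<theta>"
  have "\<alpha> * \<alpha> powr (\<gamma> - 2) = \<alpha> powr (1 + (\<gamma> - 2))"
    using \<alpha> by (subst powr_add) simp
  then have "complex_of_real \<alpha> * complex_of_real (\<alpha> powr (\<gamma> - 2)) = complex_of_real (\<alpha> powr (\<gamma> - 1))"
    by (simp flip: of_real_mult)
  then show "fst (dual_map \<gamma> ?z) = fst (pt (dual_exponent \<gamma>) (\<alpha> powr (\<gamma> - 1)) (s / (1 - \<gamma>)) (- \<theta>))"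
    using \<alpha> by (simp add: dual_map_def pt_def norm_mult cis_cnj mult_ac)
  show "snd (dual_map \<gamma> ?z) = snd (pt (dual_exponent \<gamma>) (\<alpha> powr (\<gamma> - 1)) (s / (1 - \<gamma>)) (- \<theta>))"
  proof (rule complex_eqI)
    show "Re (snd (dual_map \<gamma> ?z)) = Re (snd (pt (dual_exponent \<gamma>) (\<alpha> powr (\<gamma> - 1)) (s / (1 - \<gamma>)) (- \<theta>)))"
      by (simp add: Re_snd_dual_map)
    have "Im (snd (dual_map \<gamma> ?z)) = \<alpha> powr \<gamma>"
      using \<alpha> by (simp add: Im_snd_dual_map[OF \<gamma> pt_in_hyp])
    then show "Im (snd (dual_map \<gamma> ?z)) = Im (snd (pt (dual_exponent \<gamma>) (\<alpha> powr (\<gamma> - 1)) (s / (1 - \<gamma>)) (- \<theta>)))"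
      using \<gamma> by (simp add: pt_def powr_powr dual_exponent_def)
  qed
qed

text \<open>
  In polar coordinates the duality map is \<open>\<alpha> \<mapsto> \<alpha>\<^sup>\<gamma>\<^sup>-\<^sup>1\<close>, \<open>s \<mapsto> s / (1 - \<gamma>)\<close>, \<open>\<theta> \<mapsto> - \<theta>\<close>. The Jacobians
  \<open>\<gamma> - 1\<close> of the height and \<open>1 / (\<gamma> - 1)\<close> of the radius cancel, so the constant \<open>c\<close> survives.
\<close>

lemma distr_dual_map:
  assumes \<gamma>: "1 < \<gamma>"
  shows "distr (wmu \<gamma> c r) (hypM (dual_exponent \<gamma>)) (dual_map \<gamma>)
       = wmu (dual_exponent \<gamma>) c ((r + 1) / (\<gamma> - 1) - 1)"
proof (rule measure_eqI)
  let ?g = "dual_exponent \<gamma>"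
  let ?e = "(r + 1) / (\<gamma> - 1) - 1"
  note [measurable] = dual_map_measurable[OF \<gamma>]
  fix X assume "X \<in> sets (distr (wmu \<gamma> c r) (hypM ?g) (dual_map \<gamma>))"
  then have X [measurable]: "X \<in> sets (hypM ?g)" by simp
  define F where "F \<alpha> s \<theta> = (indicator X (pt ?g \<alpha> s \<theta>) :: ennreal)" for \<alpha> s \<theta>
  have Fm [measurable]: "(\<lambda>x. F (f x) (g x) (h x)) \<in> borel_measurable N"
    if "f \<in> borel_measurable N" "g \<in> borel_measurable N" "h \<in> borel_measurable N" for f g h and N :: "'b measure"
    unfolding F_def using that by measurable
  define J where "J \<alpha> = (\<integral>\<^sup>+s. (\<integral>\<^sup>+\<theta>. F \<alpha> s \<theta> \<partial>angular) \<partial>lborel)" for \<alpha>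
  have Jm [measurable]: "J \<in> borel_measurable borel" unfolding J_def F_def by measurable
  have "emeasure (distr (wmu \<gamma> c r) (hypM ?g) (dual_map \<gamma>)) X
      = (\<integral>\<^sup>+z. indicator X z \<partial>distr (wmu \<gamma> c r) (hypM ?g) (dual_map \<gamma>))" by simp
  also have "\<dots> = (\<integral>\<^sup>+z. indicator X (dual_map \<gamma> z) \<partial>wmu \<gamma> c r)"
    by (rule nn_integral_distr) (simp_all add: dual_map_measurable[OF \<gamma>] cong: measurable_cong_sets)
  also have "\<dots> = ennreal c * (\<integral>\<^sup>+\<alpha>. (\<integral>\<^sup>+s. (\<integral>\<^sup>+\<theta>. indicator X (dual_map \<gamma> (pt \<gamma> \<alpha> s \<theta>)) \<partial>angular) \<partial>lborel) \<partial>radial r)"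
    by (rule nn_integral_wmu) measurable
  also have "(\<integral>\<^sup>+\<alpha>. (\<integral>\<^sup>+s. (\<integral>\<^sup>+\<theta>. indicator X (dual_map \<gamma> (pt \<gamma> \<alpha> s \<theta>)) \<partial>angular) \<partial>lborel) \<partial>radial r)
      = (\<integral>\<^sup>+\<alpha>. ennreal (\<gamma> - 1) * J (\<alpha> powr (\<gamma> - 1)) \<partial>radial r)"
  proof (rule nn_integral_cong_AE, use AE_radial in eventually_elim)
    fix \<alpha> :: real assume \<alpha>: "0 < \<alpha>"
    let ?b = "\<alpha> powr (\<gamma> - 1)"
    have "(\<integral>\<^sup>+s. (\<integral>\<^sup>+\<theta>. indicator X (dual_map \<gamma> (pt \<gamma> \<alpha> s \<theta>)) \<partial>angular) \<partial>lborel)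
        = (\<integral>\<^sup>+s. (\<integral>\<^sup>+\<theta>. F ?b (s / (1 - \<gamma>)) (- \<theta>) \<partial>angular) \<partial>lborel)"
      by (simp add: dual_map_pt[OF \<gamma> \<alpha>] F_def)
    also have "\<dots> = (\<integral>\<^sup>+s. (\<integral>\<^sup>+\<theta>. F ?b (s / (1 - \<gamma>)) \<theta> \<partial>angular) \<partial>lborel)"
      by (intro nn_integral_cong nn_integral_angular_reflect) (auto simp: F_def pt_periodic)
    also have "\<dots> = ennreal \<bar>1 - \<gamma>\<bar> * (\<integral>\<^sup>+s. (\<integral>\<^sup>+\<theta>. F ?b ((0 + (1 - \<gamma>) * s) / (1 - \<gamma>)) \<theta> \<partial>angular) \<partial>lborel)"
      using \<gamma> by (intro nn_integral_real_affine) (auto simp: F_def)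
    also have "\<dots> = ennreal (\<gamma> - 1) * J ?b"
      using \<gamma> by (simp add: J_def)
    finally show "(\<integral>\<^sup>+s. (\<integral>\<^sup>+\<theta>. indicator X (dual_map \<gamma> (pt \<gamma> \<alpha> s \<theta>)) \<partial>angular) \<partial>lborel)
        = ennreal (\<gamma> - 1) * J ?b" .
  qed
  also have "\<dots> = ennreal (\<gamma> - 1) * (\<integral>\<^sup>+\<alpha>. J (\<alpha> powr (\<gamma> - 1)) \<partial>radial r)"
    by (rule nn_integral_cmult) measurable
  also have "\<dots> = ennreal (\<gamma> - 1) * (ennreal (1 / (\<gamma> - 1)) * (\<integral>\<^sup>+\<alpha>. J \<alpha> \<partial>radial ?e))"
    using \<gamma> by (subst nn_integral_radial_power) auto
  also have "\<dots> = (\<integral>\<^sup>+\<alpha>. J \<alpha> \<partial>radial ?e)"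
    using \<gamma> by (simp add: mult.assoc[symmetric] ennreal_mult[symmetric])
  also have "ennreal c * \<dots> = (\<integral>\<^sup>+z. indicator X z \<partial>wmu ?g c ?e)"
    unfolding J_def F_def by (rule nn_integral_wmu[symmetric]) measurable
  also have "\<dots> = emeasure (wmu ?g c ?e) X" by simp
  finally show "emeasure (distr (wmu \<gamma> c r) (hypM ?g) (dual_map \<gamma>)) X = emeasure (wmu ?g c ?e) X" .
qed simp

section \<open>One-dimensional integrals\<close>

lemma inverse_one_plus_square_integral:
  fixes q :: real
  assumes q: "0 < q"
  shows integrable_inverse_one_plus_square: "integrable lborel (\<lambda>x. 1 / (1 + q * x\<^sup>2))"
    and nn_integral_inverse_one_plus_square:
      "(\<integral>\<^sup>+x. ennreal (1 / (1 + q * x\<^sup>2)) \<partial>lborel) = ennreal (pi / sqrt q)"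
proof -
  let ?F = "\<lambda>x. arctan (sqrt q * x) / sqrt q" and ?f = "\<lambda>x. 1 / (1 + q * x\<^sup>2)"
  have pos: "0 < 1 + q * x\<^sup>2" for x :: real using q by (simp add: add_pos_nonneg)
  have d: "DERIV ?F x :> ?f x" for x
  proof -
    have "DERIV (\<lambda>x. arctan (sqrt q * x)) x :> inverse (1 + (sqrt q * x)\<^sup>2) * sqrt q"
      by (rule DERIV_chain2[OF DERIV_arctan]) (auto intro!: derivative_eq_intros)
    from DERIV_cdivide[OF this, of "sqrt q"] show ?thesis
      using q by (simp add: power_mult_distrib inverse_eq_divide)
  qed
  have c: "isCont ?f x" for x using pos[of x] by (intro continuous_intros) simp
  have top: "(?F \<longlongrightarrow> (pi / 2) / sqrt q) at_top"
    using q by (intro tendsto_intros filterlim_compose[OF tendsto_arctan_at_top]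
       filterlim_tendsto_pos_mult_at_top[OF tendsto_const] filterlim_ident) auto
  have bot: "(?F \<longlongrightarrow> - (pi / 2) / sqrt q) at_bot"
    using q by (intro tendsto_intros filterlim_compose[OF tendsto_arctan_at_bot]
       filterlim_tendsto_pos_mult_at_bot[OF tendsto_const] filterlim_ident) auto
  have 1: "set_integrable lborel (einterval (-\<infinity>) \<infinity>) ?f"
    by (rule interval_integral_FTC_nonneg(1)[where F="?F"])
       (use d c top bot pos in \<open>auto simp: ereal_tendsto_simps less_imp_le\<close>)
  have 2: "(LBINT x=-\<infinity>..\<infinity>. ?f x) = (pi / 2) / sqrt q - (- (pi / 2) / sqrt q)"
    by (rule interval_integral_FTC_nonneg(2)[where F="?F"])
       (use d c top bot pos in \<open>auto simp: ereal_tendsto_simps less_imp_le\<close>)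
  show i: "integrable lborel ?f"
    using 1 by (simp add: set_integrable_def)
  have "(LINT x|lborel. ?f x) = pi / sqrt q"
    using 2 by (simp add: interval_lebesgue_integral_def set_lebesgue_integral_def field_simps)
  then show "(\<integral>\<^sup>+x. ennreal (?f x) \<partial>lborel) = ennreal (pi / sqrt q)"
    using nn_integral_eq_integral[OF i] pos by (simp add: less_imp_le)
qed

lemma nn_integral_inverse_one_plus_ln_square:
  fixes q :: real
  assumes q: "0 < q"
  shows "(\<integral>\<^sup>+u. ennreal (indicator {0<..} u * (1 / (u * (1 + q * (ln u)\<^sup>2)))) \<partial>lborel) = ennreal (pi / sqrt q)"
proof -
  let ?F = "\<lambda>x. arctan (sqrt q * ln x) / sqrt q" and ?f = "\<lambda>x. 1 / (x * (1 + q * (ln x)\<^sup>2))"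
  have pos: "0 < 1 + q * (ln x)\<^sup>2" for x :: real using q by (simp add: add_pos_nonneg)
  have d: "DERIV ?F x :> ?f x" if "0 < x" for x
  proof -
    have "DERIV (\<lambda>x. arctan (sqrt q * ln x)) x :> inverse (1 + (sqrt q * ln x)\<^sup>2) * (sqrt q * (1 / x))"
      using that by (intro DERIV_chain2[OF DERIV_arctan]) (auto intro!: derivative_eq_intros)
    from DERIV_cdivide[OF this, of "sqrt q"] show ?thesis
      using q by (simp add: power_mult_distrib inverse_eq_divide mult.commute)
  qed
  have c: "isCont ?f x" if "0 < x" for x using pos[of x] that by (intro continuous_intros) auto
  have top: "(?F \<longlongrightarrow> (pi / 2) / sqrt q) at_top"
    using q by (intro tendsto_intros filterlim_compose[OF tendsto_arctan_at_top]
       filterlim_tendsto_pos_mult_at_top[OF tendsto_const] ln_at_top) auto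
  have bot: "(?F \<longlongrightarrow> - (pi / 2) / sqrt q) (at_right 0)"
    using q by (intro tendsto_intros filterlim_compose[OF tendsto_arctan_at_bot]
       filterlim_tendsto_pos_mult_at_bot[OF tendsto_const] ln_at_0) auto
  have 1: "set_integrable lborel (einterval 0 \<infinity>) ?f"
    by (rule interval_integral_FTC_nonneg(1)[where F="?F"])
       (use d c top bot pos in \<open>auto simp: ereal_tendsto_simps zero_ereal_def less_imp_le\<close>)
  have 2: "(LBINT x=0..\<infinity>. ?f x) = (pi / 2) / sqrt q - (- (pi / 2) / sqrt q)"
    by (rule interval_integral_FTC_nonneg(2)[where F="?F"])
       (use d c top bot pos in \<open>auto simp: ereal_tendsto_simps zero_ereal_def less_imp_le\<close>)
  have e: "einterval 0 \<infinity> = {0<..}" by (auto simp: einterval_def)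
  have i: "integrable lborel (\<lambda>u. indicator {0<..} u * ?f u)"
    using 1 by (simp add: set_integrable_def e)
  have "(LINT u|lborel. indicator {0<..} u * ?f u) = pi / sqrt q"
    using 2 by (simp add: interval_lebesgue_integral_def set_lebesgue_integral_def e field_simps)
  then show ?thesis
    using nn_integral_eq_integral[OF i] pos
    by (auto simp: indicator_def less_imp_le)
qed

lemma nn_integral_inverse_norm_power:
  fixes L t :: real
  assumes L: "0 < L"
  shows "(\<integral>\<^sup>+s. ennreal (1 / cmod (Complex L (s - t)) ^ (k + 2)) \<partial>lborel)
      \<le> ennreal (pi * sqrt 2 / (sqrt (real k + 1) * L ^ (k + 1)))"
proof -
  let ?m = "(real k + 2) / 2"
  have "(\<integral>\<^sup>+s. ennreal (1 / cmod (Complex L (s - t)) ^ (k + 2)) \<partial>lborel)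
      = ennreal \<bar>L\<bar> * (\<integral>\<^sup>+s. ennreal (1 / cmod (Complex L (t + L * s - t)) ^ (k + 2)) \<partial>lborel)"
    using L unfolding cmod_def by (intro nn_integral_real_affine) auto
  also have "\<dots> \<le> ennreal \<bar>L\<bar> * (\<integral>\<^sup>+s. ennreal (1 / L ^ (k + 2)) * ennreal (1 / (1 + ?m * s\<^sup>2)) \<partial>lborel)"
  proof (intro mult_left_mono nn_integral_mono)
    fix s :: real
    have "Complex L (t + L * s - t) = of_real L * Complex 1 s"
      by (simp add: complex_eq_iff)
    then have n: "cmod (Complex L (t + L * s - t)) = L * sqrt (1 + s\<^sup>2)"
      using L by (simp only: norm_mult norm_of_real complex_norm) simp
    \<comment> \<open>Bernoulli's inequality, applied to the square\<close>
    have "(1 + ?m * s\<^sup>2)\<^sup>2 \<le> ((sqrt (1 + s\<^sup>2)) ^ (k + 2))\<^sup>2"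
    proof -
      have p: "(1 + x)^(k+2) \<ge> (1 + ?m * x)\<^sup>2" if "0 \<le> x" for x :: real
      proof (induction k)
        case 0 then show ?case by (simp add: power2_eq_square)
      next
        case (Suc k)
        have "(1 + (real (Suc k) + 2) / 2 * x)\<^sup>2 \<le> (1 + x) * (1 + (real k + 2) / 2 * x)\<^sup>2"
        proof -
          have "(1 + x) * (1 + (real k + 2) / 2 * x)\<^sup>2 - (1 + (real (Suc k) + 2) / 2 * x)\<^sup>2
              = x\<^sup>2 * ((real k + 2)\<^sup>2 / 4 * (1 + x) + real k + 2 - (real k + 3)\<^sup>2 / 4)"
            by (simp add: power2_eq_square field_simps)
          moreover have "(real k + 2)\<^sup>2 / 4 * (1 + x) + real k + 2 - (real k + 3)\<^sup>2 / 4 \<ge> 0"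
          proof -
            have "(real k + 2)\<^sup>2 / 4 + real k + 2 - (real k + 3)\<^sup>2 / 4 \<ge> 0"
              by (simp add: power2_eq_square field_simps)
            moreover have "(real k + 2)\<^sup>2 / 4 * x \<ge> 0" using that by simp
            moreover have "(real k + 2)\<^sup>2 / 4 * (1 + x) = (real k + 2)\<^sup>2 / 4 + (real k + 2)\<^sup>2 / 4 * x"
              by (simp only: distrib_left mult_1_right)
            ultimately show ?thesis by linarith
          qed
          ultimately show ?thesis
            by (metis diff_ge_0_iff_ge mult_nonneg_nonneg zero_le_power2)
        qed
        also have "\<dots> \<le> (1 + x) * (1 + x)^(k+2)"
          using Suc that by (intro mult_left_mono) auto
        finally show ?case by simp
      qed
      have "((sqrt (1 + s\<^sup>2)) ^ (k + 2))\<^sup>2 = ((sqrt (1 + s\<^sup>2))\<^sup>2) ^ (k + 2)"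
        by (simp only: power_mult[symmetric] mult.commute)
      also have "\<dots> = (1 + s\<^sup>2) ^ (k + 2)" by simp
      finally show ?thesis using p[of "s\<^sup>2"] by simp
    qed
    then have le: "1 + ?m * s\<^sup>2 \<le> (sqrt (1 + s\<^sup>2)) ^ (k + 2)"
      by (rule power2_le_imp_le) simp
    have "0 < 1 + ?m * s\<^sup>2" by (simp add: add_pos_nonneg)
    with le have "1 / (sqrt (1 + s\<^sup>2)) ^ (k + 2) \<le> 1 / (1 + ?m * s\<^sup>2)"
      by (rule frac_le[OF zero_le_one order_refl, rotated])
    then have "1 / L ^ (k + 2) * (1 / (sqrt (1 + s\<^sup>2)) ^ (k + 2)) \<le> 1 / L ^ (k + 2) * (1 / (1 + ?m * s\<^sup>2))"
      using L by (intro mult_left_mono) auto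
    then show "ennreal (1 / cmod (Complex L (t + L * s - t)) ^ (k + 2))
        \<le> ennreal (1 / L ^ (k + 2)) * ennreal (1 / (1 + ?m * s\<^sup>2))"
    proof -
      have e: "1 / (L * sqrt (1 + s\<^sup>2)) ^ (k + 2) = 1 / L ^ (k + 2) * (1 / (sqrt (1 + s\<^sup>2)) ^ (k + 2))"
        by (simp only: power_mult_distrib divide_divide_eq_left times_divide_times_eq mult_1)
      have "ennreal (1 / L ^ (k + 2)) * ennreal (1 / (1 + ?m * s\<^sup>2))
          = ennreal (1 / L ^ (k + 2) * (1 / (1 + ?m * s\<^sup>2)))"
        using L \<open>0 < 1 + ?m * s\<^sup>2\<close> by (intro ennreal_mult[symmetric] divide_nonneg_nonneg) auto
      then show ?thesis unfolding n e
        using \<open>1 / L ^ (k + 2) * (1 / (sqrt (1 + s\<^sup>2)) ^ (k + 2)) \<le> _\<close> by (simp only: ennreal_leI)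
    qed
  qed simp
  also have "\<dots> = ennreal \<bar>L\<bar> * (ennreal (1 / L ^ (k + 2)) * ennreal (pi / sqrt ?m))"
    by (subst nn_integral_cmult, simp) (subst nn_integral_inverse_one_plus_square, auto)
  also have "\<dots> = ennreal (pi / (sqrt ?m * L ^ (k + 1)))"
    using L by (simp add: ennreal_mult[symmetric] field_simps)
  also have "\<dots> \<le> ennreal (pi * sqrt 2 / (sqrt (real k + 1) * L ^ (k + 1)))"
  proof (rule ennreal_leI)
    have "sqrt (real k + 1) / sqrt 2 \<le> sqrt ?m"
      by (simp add: real_sqrt_divide[symmetric])
    then have "pi / (sqrt ?m * L ^ (k + 1)) \<le> pi / (sqrt (real k + 1) / sqrt 2 * L ^ (k + 1))"
      using L by (intro divide_left_mono mult_right_mono mult_pos_pos) auto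
    then show "pi / (sqrt ?m * L ^ (k + 1)) \<le> pi * sqrt 2 / (sqrt (real k + 1) * L ^ (k + 1))"
      by (simp add: field_simps)
  qed
  finally show ?thesis .
qed

text \<open>
  The radial profile of the kernel in the logarithmic variable. It has a nondegenerate maximum
  \<open>1\<close> at the origin and decays exponentially, so its \<open>n\<close>-th power has integral \<open>O(n\<^sup>-\<^sup>1\<^sup>/\<^sup>2)\<close>.
\<close>

definition profile :: "real \<Rightarrow> real \<Rightarrow> real" where
  "profile \<gamma> t = \<gamma> / ((\<gamma> - 1) * exp t + exp (- (\<gamma> - 1) * t))"

lemma exp_ge_quadratic: "0 \<le> t \<Longrightarrow> 1 + t + t\<^sup>2 / 2 \<le> exp (t :: real)"
  using exp_lower_Taylor_quadratic[of t] by simp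

lemma profile_le:
  assumes \<gamma>: "1 < \<gamma>"
  shows "\<exists>c>0. \<forall>t. profile \<gamma> t \<le> 1 / (1 + c * t\<^sup>2)"
proof (intro exI[of _ "min (\<gamma> - 1) ((\<gamma> - 1)\<^sup>2) / (2 * \<gamma>)"] conjI allI)
  let ?c = "min (\<gamma> - 1) ((\<gamma> - 1)\<^sup>2) / (2 * \<gamma>)"
  show c: "0 < ?c" using \<gamma> by simp
  fix t :: real
  have "\<gamma> * (1 + ?c * t\<^sup>2) \<le> (\<gamma> - 1) * exp t + exp (- (\<gamma> - 1) * t)"
  proof (cases "0 \<le> t")
    case True
    have "\<gamma> * (1 + ?c * t\<^sup>2) = \<gamma> + min (\<gamma> - 1) ((\<gamma> - 1)\<^sup>2) * t\<^sup>2 / 2"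
      using \<gamma> by (simp add: field_simps)
    also have "\<dots> \<le> \<gamma> + (\<gamma> - 1) * t\<^sup>2 / 2"
      by (intro add_left_mono divide_right_mono mult_right_mono) auto
    also have "\<dots> = (\<gamma> - 1) * (1 + t + t\<^sup>2 / 2) + (1 + - (\<gamma> - 1) * t)"
      by (simp add: field_simps)
    also have "\<dots> \<le> (\<gamma> - 1) * exp t + exp (- (\<gamma> - 1) * t)"
      using \<gamma> exp_ge_quadratic[OF True] by (intro add_mono mult_left_mono exp_ge_add_one_self) auto
    finally show ?thesis .
  next
    case False
    have q: "1 + (- (\<gamma> - 1) * t) + (- (\<gamma> - 1) * t)\<^sup>2 / 2 \<le> exp (- (\<gamma> - 1) * t)"
      using False \<gamma> by (intro exp_ge_quadratic) (simp add: mult_nonpos_nonpos)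
    have "\<gamma> * (1 + ?c * t\<^sup>2) = \<gamma> + min (\<gamma> - 1) ((\<gamma> - 1)\<^sup>2) * t\<^sup>2 / 2"
      using \<gamma> by (simp add: field_simps)
    also have "\<dots> \<le> \<gamma> + (\<gamma> - 1)\<^sup>2 * t\<^sup>2 / 2"
      by (intro add_left_mono divide_right_mono mult_right_mono) auto
    also have "\<dots> = (\<gamma> - 1) * (1 + t) + (1 + (- (\<gamma> - 1) * t) + (- (\<gamma> - 1) * t)\<^sup>2 / 2)"
      by (simp add: field_simps power2_eq_square)
    also have "\<dots> \<le> (\<gamma> - 1) * exp t + exp (- (\<gamma> - 1) * t)"
      using \<gamma> by (intro add_mono q mult_left_mono exp_ge_add_one_self) auto
    finally show ?thesis .
  qed
  moreover have "0 < 1 + ?c * t\<^sup>2"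
    by (intro add_pos_nonneg mult_nonneg_nonneg less_imp_le[OF c]) auto
  moreover have "0 < (\<gamma> - 1) * exp t + exp (- (\<gamma> - 1) * t)" using \<gamma> by (simp add: add_pos_pos)
  ultimately show "profile \<gamma> t \<le> 1 / (1 + ?c * t\<^sup>2)"
    unfolding profile_def by (simp only: pos_le_divide_eq pos_divide_le_eq times_divide_eq_left mult_1 mult.commute)
qed

lemma one_plus_square_le_exp:
  assumes "0 < d" "0 \<le> t" shows "1 + t\<^sup>2 \<le> (1 + 2 / d\<^sup>2) * exp (d * t :: real)"
proof -
  have "1 + d * t + (d * t)\<^sup>2 / 2 \<le> exp (d * t)" using assms by (intro exp_ge_quadratic) simp
  moreover have "0 \<le> d * t" "0 \<le> (d * t)\<^sup>2" using assms by simp_all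
  ultimately have "1 \<le> exp (d * t)" "(d * t)\<^sup>2 / 2 \<le> exp (d * t)"
    by linarith+
  then have "t\<^sup>2 \<le> 2 / d\<^sup>2 * exp (d * t)"
    using assms by (simp add: field_simps power_mult_distrib)
  from add_mono[OF \<open>1 \<le> exp (d * t)\<close> this] show ?thesis by (simp only: distrib_right mult_1)
qed

lemma profile_decay:
  assumes \<gamma>: "1 < \<gamma>" and \<beta>: "0 < \<beta>" "\<beta> < \<gamma>"
  shows "\<exists>D>0. \<forall>t. profile \<gamma> t * exp ((1 - \<beta>) * t) \<le> D / (1 + t\<^sup>2)"
proof -
  let ?D1 = "\<gamma> / (\<gamma> - 1) * (1 + 2 / \<beta>\<^sup>2)" and ?D2 = "\<gamma> * (1 + 2 / (\<gamma> - \<beta>)\<^sup>2)"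
  have D: "0 < ?D1" "0 < ?D2"
    using \<gamma> by (intro mult_pos_pos divide_pos_pos add_pos_nonneg; simp)+
  have "profile \<gamma> t * exp ((1 - \<beta>) * t) * (1 + t\<^sup>2) \<le> max ?D1 ?D2" for t
  proof (cases "0 \<le> t")
    case True
    have "profile \<gamma> t \<le> \<gamma> / ((\<gamma> - 1) * exp t)"
      unfolding profile_def using \<gamma> by (intro divide_left_mono mult_pos_pos add_pos_pos) auto
    then have "profile \<gamma> t * exp ((1 - \<beta>) * t) * (1 + t\<^sup>2)
        \<le> \<gamma> / ((\<gamma> - 1) * exp t) * exp ((1 - \<beta>) * t) * ((1 + 2 / \<beta>\<^sup>2) * exp (\<beta> * t))"
      using \<gamma> one_plus_square_le_exp[OF \<beta>(1) True]
      by (intro mult_mono mult_nonneg_nonneg) auto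
    also have "\<dots> = ?D1 * (exp ((1 - \<beta>) * t) * exp (\<beta> * t) / exp t)"
      by (simp add: field_simps)
    also have "exp ((1 - \<beta>) * t) * exp (\<beta> * t) / exp t = 1"
      by (simp add: exp_add[symmetric] algebra_simps)
    finally show ?thesis by simp
  next
    case False
    have "profile \<gamma> t \<le> \<gamma> / exp (- (\<gamma> - 1) * t)"
      unfolding profile_def using \<gamma> by (intro divide_left_mono mult_pos_pos add_pos_pos) auto
    then have "profile \<gamma> t * exp ((1 - \<beta>) * t) * (1 + (- t)\<^sup>2)
        \<le> \<gamma> / exp (- (\<gamma> - 1) * t) * exp ((1 - \<beta>) * t) * ((1 + 2 / (\<gamma> - \<beta>)\<^sup>2) * exp ((\<gamma> - \<beta>) * (- t)))"
      using \<gamma> \<beta> False one_plus_square_le_exp[of "\<gamma> - \<beta>" "- t"]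
      by (intro mult_mono mult_nonneg_nonneg) auto
    also have "\<dots> = ?D2 * (exp ((1 - \<beta>) * t) * exp ((\<gamma> - \<beta>) * (- t)) / exp (- (\<gamma> - 1) * t))"
      by (simp add: field_simps)
    also have "exp ((1 - \<beta>) * t) * exp ((\<gamma> - \<beta>) * (- t)) / exp (- (\<gamma> - 1) * t) = 1"
      by (simp add: exp_add[symmetric] exp_diff[symmetric] algebra_simps)
    finally show ?thesis by simp
  qed
  then have "profile \<gamma> t * exp ((1 - \<beta>) * t) \<le> max ?D1 ?D2 / (1 + t\<^sup>2)" for t
    by (subst pos_le_divide_eq) (auto simp: add_pos_nonneg)
  then show ?thesis using D by (intro exI[of _ "max ?D1 ?D2"]) auto
qed

text \<open>
  In the variable \<open>l = (ln u)\<^sup>2\<close>, \<open>k\<close> of the factors \<open>h\<close> provide the decay \<open>1 / (1 + k c l)\<close>, and the last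
  one absorbs the power of \<open>u\<close>. The product \<open>(1 + k c l) (1 + l)\<close> is at least \<open>1 + min c 1 (k + 1) l\<close>,
  which keeps the estimate uniform down to \<open>k = 0\<close>.
\<close>

lemma radial_integral_bound:
  fixes h :: "real \<Rightarrow> real"
  assumes c: "0 < c" and D: "0 < D"
    and h0: "\<And>u. 0 < u \<Longrightarrow> 0 \<le> h u"
    and h1: "\<And>u. 0 < u \<Longrightarrow> h u \<le> 1 / (1 + c * (ln u)\<^sup>2)"
    and h2: "\<And>u. 0 < u \<Longrightarrow> h u * u powr (\<sigma> + 1) \<le> D / (1 + (ln u)\<^sup>2)"
  shows "(\<integral>\<^sup>+u. ennreal (indicator {0<..} u * (h u ^ (k + 1) * u powr \<sigma>)) \<partial>lborel)
      \<le> ennreal (D * pi / (sqrt (min c 1) * sqrt (real k + 1)))"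
proof -
  let ?q = "min c 1 * (real k + 1)"
  have q: "0 < ?q" using c by simp
  have "(\<integral>\<^sup>+u. ennreal (indicator {0<..} u * (h u ^ (k + 1) * u powr \<sigma>)) \<partial>lborel)
      \<le> (\<integral>\<^sup>+u. ennreal D * ennreal (indicator {0<..} u * (1 / (u * (1 + ?q * (ln u)\<^sup>2)))) \<partial>lborel)"
  proof (rule nn_integral_mono)
    fix u :: real
    show "ennreal (indicator {0<..} u * (h u ^ (k + 1) * u powr \<sigma>))
        \<le> ennreal D * ennreal (indicator {0<..} u * (1 / (u * (1 + ?q * (ln u)\<^sup>2))))"
    proof (cases "0 < u")
      case True
      define l where "l = (ln u)\<^sup>2"
      have l: "0 \<le> l" by (simp add: l_def)
      have "h u ^ k \<le> (1 / (1 + c * l)) ^ k"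
        using h0[OF True] h1[OF True] by (intro power_mono) (auto simp: l_def)
      also have "\<dots> \<le> 1 / (1 + real k * (c * l))"
      proof -
        have "1 + real k * (c * l) \<le> (1 + c * l) ^ k"
          using c l by (intro Bernoulli_inequality) (simp add: order_trans[of "-1" 0])
        then show ?thesis
          using c l by (simp add: power_one_over frac_le add_pos_nonneg)
      qed
      finally have hk: "h u ^ k \<le> 1 / (1 + real k * (c * l))" .
      have "h u ^ (k + 1) * u powr (\<sigma> + 1) = h u ^ k * (h u * u powr (\<sigma> + 1))" by simp
      also have "\<dots> \<le> 1 / (1 + real k * (c * l)) * (D / (1 + l))"
        using hk h2[OF True] h0[OF True] c l by (intro mult_mono) (auto simp: l_def)
      also have "\<dots> = D * (1 / ((1 + real k * (c * l)) * (1 + l)))" by simp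
      also have "\<dots> \<le> D * (1 / (1 + ?q * l))"
      proof -
        have "1 + ?q * l \<le> 1 + (real k * c + 1) * l"
        proof -
          have "min c 1 * real k \<le> real k * c" using mult_right_mono[OF min.cobounded1[of c 1], of "real k"] by (simp add: mult.commute)
          then have "?q \<le> real k * c + 1" by (simp add: algebra_simps)
          then show ?thesis using l by (intro add_left_mono mult_right_mono)
        qed
        also have "\<dots> \<le> (1 + real k * (c * l)) * (1 + l)"
          using c l by (simp add: algebra_simps)
        finally show ?thesis using D q l
          by (intro mult_left_mono frac_le) (auto simp: add_pos_nonneg)
      qed
      finally have "h u ^ (k + 1) * u powr (\<sigma> + 1) \<le> D * (1 / (1 + ?q * l))" .
      then have "h u ^ (k + 1) * u powr \<sigma> * u \<le> D * (1 / (1 + ?q * l))"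
        using True by (simp add: powr_add mult.assoc)
      then have "h u ^ (k + 1) * u powr \<sigma> \<le> D * (1 / (1 + ?q * l)) / u"
        by (subst pos_le_divide_eq[OF True])
      also have "\<dots> = D * (1 / (u * (1 + ?q * l)))" by simp
      finally show ?thesis
        using True D q l by (simp add: ennreal_mult[symmetric] l_def add_nonneg_nonneg ennreal_leI)
    qed simp
  qed
  also have "\<dots> = ennreal D * ennreal (pi / sqrt ?q)"
    by (subst nn_integral_cmult, simp) (subst nn_integral_inverse_one_plus_ln_square[OF q], simp)
  also have "\<dots> = ennreal (D * pi / (sqrt (min c 1) * sqrt (real k + 1)))"
    using D c by (subst ennreal_mult[symmetric]) (auto simp: real_sqrt_mult)
  finally show ?thesis .
qed

lemma LINT_FTC_real_line:
  fixes f F :: "real \<Rightarrow> complex"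
  assumes "\<And>x. (F has_vector_derivative f x) (at x)" "\<And>x. isCont f x" "integrable lborel f"
    and "(F \<longlongrightarrow> A) at_bot" "(F \<longlongrightarrow> B) at_top"
  shows "(LINT x|lborel. f x) = B - A"
proof -
  have "(LBINT x=-\<infinity>..\<infinity>. f x) = B - A"
    by (rule interval_integral_FTC_integrable[where F=F])
       (use assms in \<open>auto simp: ereal_tendsto_simps set_integrable_def\<close>)
  then show ?thesis
    by (simp add: interval_lebesgue_integral_def set_lebesgue_integral_def)
qed

lemma LINT_FTC_half_line:
  fixes f F :: "real \<Rightarrow> complex"
  assumes "\<And>x. 0 < x \<Longrightarrow> (F has_vector_derivative f x) (at x)" "\<And>x. 0 < x \<Longrightarrow> isCont f x"
    and "integrable lborel (\<lambda>x. indicator {0<..} x *\<^sub>R f x)"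
    and "(F \<longlongrightarrow> A) (at_right 0)" "(F \<longlongrightarrow> B) at_top"
  shows "(LINT x|lborel. indicator {0<..} x *\<^sub>R f x) = B - A"
proof -
  have e: "einterval 0 \<infinity> = {0<..}" by (auto simp: einterval_def)
  have "(LBINT x=0..\<infinity>. f x) = B - A"
    by (rule interval_integral_FTC_integrable[where F=F])
       (use assms in \<open>auto simp: ereal_tendsto_simps zero_ereal_def set_integrable_def e[unfolded zero_ereal_def]\<close>)
  then show ?thesis
    by (simp add: interval_lebesgue_integral_def set_lebesgue_integral_def e)
qed

lemma powr_tendsto_0_at_right:
  assumes "0 < c" shows "((\<lambda>x::real. x powr c) \<longlongrightarrow> 0) (at_right 0)"
proof -
  have "((\<lambda>x::real. x powr c) \<longlongrightarrow> 0 powr c) (at_right 0)"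
    using assms by (intro tendsto_powr' tendsto_const tendsto_ident_at) (auto simp: eventually_at_filter)
  then show ?thesis by simp
qed

text \<open>
  The two factors of the integral over the height. Their denominators have the constant sum \<open>a + b\<close>,
  so a product of them splits by partial fractions.
\<close>

definition recip_plus :: "complex \<Rightarrow> real \<Rightarrow> complex" where "recip_plus a s = inverse (a + \<i> * of_real s)"
definition recip_minus :: "complex \<Rightarrow> real \<Rightarrow> complex" where "recip_minus b s = inverse (b - \<i> * of_real s)"

lemma recip_minus_eq: "recip_minus b s = recip_plus b (- s)"
  by (simp add: recip_plus_def recip_minus_def)

context
  fixes a b :: complex
  assumes a: "0 < Re a" and b: "0 < Re b"
begin

lemma recip_plus_nonzero: "a + \<i> * of_real s \<noteq> 0" "b - \<i> * of_real s \<noteq> 0"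
  using a b by (auto simp: complex_eq_iff)

lemma cmod_recip_plus_le: "cmod (recip_plus a s) \<le> 1 / Re a"
proof -
  have "Re a \<le> cmod (a + \<i> * of_real s)" using complex_Re_le_cmod[of "a + \<i> * of_real s"] by simp
  then show ?thesis
    using a le_imp_inverse_le[of "Re a" "cmod (a + \<i> * of_real s)"]
    by (simp add: recip_plus_def norm_inverse) (simp add: inverse_eq_divide)
qed

lemma recip_plus_tendsto_0: "(recip_plus a \<longlongrightarrow> 0) at_top" "(recip_plus a \<longlongrightarrow> 0) at_bot"
proof -
  have t: "filterlim (\<lambda>s. \<i> * complex_of_real s) at_infinity at_top"
    by (rule filterlim_norm_at_top_imp_at_infinity) (simp add: norm_mult filterlim_abs_real)
  have "filterlim (\<lambda>s::real. \<bar>s\<bar>) at_top at_bot"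
    using filterlim_uminus_at_top_at_bot
    by (rule filterlim_at_top_mono) (rule always_eventually, simp add: abs_ge_minus_self)
  then have b: "filterlim (\<lambda>s. \<i> * complex_of_real s) at_infinity at_bot"
    by (intro filterlim_norm_at_top_imp_at_infinity) (simp add: norm_mult)
  show "(recip_plus a \<longlongrightarrow> 0) at_top" unfolding recip_plus_def
    by (rule filterlim_compose[OF tendsto_inverse_0 tendsto_add_filterlim_at_infinity[OF tendsto_const t]])
  show "(recip_plus a \<longlongrightarrow> 0) at_bot" unfolding recip_plus_def
    by (rule filterlim_compose[OF tendsto_inverse_0 tendsto_add_filterlim_at_infinity[OF tendsto_const b]])
qed

lemma integrable_cmod_recip_plus_square: "integrable lborel (\<lambda>s. (cmod (recip_plus a s))\<^sup>2)"
proof -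
  have "integrable lborel (\<lambda>s. 1 / (1 + 1 * (Im a / Re a + (1 / Re a) * s)\<^sup>2))"
    using a by (intro lborel_integrable_real_affine integrable_inverse_one_plus_square) auto
  then have "integrable lborel (\<lambda>s. 1 / (Re a)\<^sup>2 * (1 / (1 + 1 * (Im a / Re a + (1 / Re a) * s)\<^sup>2)))"
    by (rule integrable_mult_right)
  moreover have "(cmod (recip_plus a s))\<^sup>2 = 1 / (Re a)\<^sup>2 * (1 / (1 + 1 * (Im a / Re a + (1 / Re a) * s)\<^sup>2))" for s
  proof -
    have "Im a / Re a + (1 / Re a) * s = (Im a + s) / Re a" by (simp add: add_divide_distrib)
    moreover have "(Re a)\<^sup>2 * (1 + ((Im a + s) / Re a)\<^sup>2) = (Re a)\<^sup>2 + (Im a + s)\<^sup>2"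
      using a by (simp add: power_divide distrib_left)
    moreover have "(cmod (recip_plus a s))\<^sup>2 = inverse ((cmod (a + \<i> * of_real s))\<^sup>2)"
      by (simp add: recip_plus_def norm_inverse power_inverse)
    moreover have "(cmod (a + \<i> * of_real s))\<^sup>2 = (Re a)\<^sup>2 + (Im a + s)\<^sup>2"
      by (simp add: cmod_power2)
    ultimately show ?thesis
      by (simp only: times_divide_times_eq mult_1 inverse_eq_divide)
  qed
  ultimately show ?thesis by simp
qed

lemma recip_plus_measurable [measurable]: "recip_plus c \<in> borel_measurable borel" "recip_minus c \<in> borel_measurable borel"
  unfolding recip_plus_def[abs_def] recip_minus_def[abs_def] by measurable

lemma integrable_recip_plus_power: "integrable lborel (\<lambda>s. recip_plus a s ^ (n + 2))"
proof (rule Bochner_Integration.integrable_bound)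
  show "integrable lborel (\<lambda>s. (1 / Re a) ^ n * (cmod (recip_plus a s))\<^sup>2)"
    using integrable_cmod_recip_plus_square by (rule integrable_mult_right)
  have "norm (recip_plus a s ^ (n + 2)) \<le> norm ((1 / Re a) ^ n * (cmod (recip_plus a s))\<^sup>2)" for s
  proof -
    have "cmod (recip_plus a s) ^ n * (cmod (recip_plus a s))\<^sup>2 \<le> (1 / Re a) ^ n * (cmod (recip_plus a s))\<^sup>2"
      by (intro mult_right_mono power_mono cmod_recip_plus_le) auto
    then show ?thesis using a by (simp add: norm_power norm_mult power_add power2_eq_square mult_ac)
  qed
  then show "AE s in lborel. norm (recip_plus a s ^ (n + 2)) \<le> norm ((1 / Re a) ^ n * (cmod (recip_plus a s))\<^sup>2)" by simp
qed simp

lemma recip_plus_derivative: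
  "((\<lambda>s. recip_plus a s) has_vector_derivative - \<i> * recip_plus a s ^ 2) (at s)"
  "((\<lambda>s. recip_minus b s) has_vector_derivative \<i> * recip_minus b s ^ 2) (at s)"
proof -
  have "((\<lambda>z. inverse (a + \<i> * z)) has_field_derivative - \<i> * recip_plus a s ^ 2) (at (of_real s))"
    unfolding recip_plus_def using recip_plus_nonzero
    by (auto intro!: derivative_eq_intros simp: power2_eq_square)
  from has_vector_derivative_real_field[OF this]
  show "((\<lambda>s. recip_plus a s) has_vector_derivative - \<i> * recip_plus a s ^ 2) (at s)" unfolding recip_plus_def .
  have "((\<lambda>z. inverse (b - \<i> * z)) has_field_derivative \<i> * recip_minus b s ^ 2) (at (of_real s))"
    unfolding recip_minus_def using recip_plus_nonzero
    by (auto intro!: derivative_eq_intros simp: power2_eq_square)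
  from has_vector_derivative_real_field[OF this]
  show "((\<lambda>s. recip_minus b s) has_vector_derivative \<i> * recip_minus b s ^ 2) (at s)" unfolding recip_minus_def .
qed

lemma has_vector_derivative_power':
  fixes f :: "real \<Rightarrow> complex"
  assumes "(f has_vector_derivative f') (at x)"
  shows "((\<lambda>x. f x ^ n) has_vector_derivative (of_nat n * f x ^ (n - 1) * f')) (at x)"
proof -
  have "((\<lambda>z. z ^ n) has_field_derivative of_nat n * f x ^ (n - 1)) (at (f x))"
    by (auto intro!: derivative_eq_intros)
  from field_vector_diff_chain_at[OF assms this] show ?thesis
    by (simp add: o_def mult.commute)
qed

lemma recip_plus_isCont: "isCont (recip_plus a) s" "isCont (recip_minus b) s"
  using recip_plus_derivative[THEN has_vector_derivative_continuous] by auto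

lemma integral_recip_plus_power: "(LINT s|lborel. recip_plus a s ^ (n + 2)) = 0"
proof -
  have "(LINT s|lborel. of_nat (n + 1) * (- \<i>) * recip_plus a s ^ (n + 2)) = 0 - 0"
  proof (rule LINT_FTC_real_line[where F="\<lambda>s. recip_plus a s ^ (n + 1)"])
    show "((\<lambda>s. recip_plus a s ^ (n + 1)) has_vector_derivative of_nat (n + 1) * (- \<i>) * recip_plus a s ^ (n + 2)) (at s)" for s
      using has_vector_derivative_power'[OF recip_plus_derivative(1), of "n + 1" s]
      by (simp add: power_add power2_eq_square mult_ac)
    show "isCont (\<lambda>s. of_nat (n + 1) * (- \<i>) * recip_plus a s ^ (n + 2)) s" for s
      by (intro continuous_intros recip_plus_isCont)
    show "integrable lborel (\<lambda>s. of_nat (n + 1) * (- \<i>) * recip_plus a s ^ (n + 2))"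
      by (intro integrable_mult_right integrable_recip_plus_power)
    show "((\<lambda>s. recip_plus a s ^ (n + 1)) \<longlongrightarrow> 0) at_bot" "((\<lambda>s. recip_plus a s ^ (n + 1)) \<longlongrightarrow> 0) at_top"
      using tendsto_power[OF recip_plus_tendsto_0(2), of "n + 1"] tendsto_power[OF recip_plus_tendsto_0(1), of "n + 1"] by auto
  qed
  moreover have "of_nat (n + 1) * (- \<i>) \<noteq> (0 :: complex)"
    using of_nat_neq_0[of n, where 'a=complex] by simp
  ultimately show ?thesis by (simp only: integral_mult_right_zero mult_eq_0_iff diff_self) simp
qed

end

context
  fixes a b :: complex
  assumes a: "0 < Re a" and b: "0 < Re b"
begin

lemma cmod_recip_minus_le: "cmod (recip_minus b s) \<le> 1 / Re b"
  unfolding recip_minus_eq using cmod_recip_plus_le[OF b b] .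

lemma integrable_recip_product: "integrable lborel (\<lambda>s. recip_plus a s ^ (n + 1) * recip_minus b s ^ (m + 1))"
proof (rule Bochner_Integration.integrable_bound)
  note [measurable] = recip_plus_measurable[OF a b]
  have "integrable lborel (\<lambda>s. (cmod (recip_minus b s))\<^sup>2)"
    using lborel_integrable_real_affine[OF integrable_cmod_recip_plus_square[OF b b], of "-1" 0]
    by (simp add: recip_minus_eq)
  then show "integrable lborel (\<lambda>s. (1 / Re a) ^ n * (1 / Re b) ^ m * ((cmod (recip_plus a s))\<^sup>2 + (cmod (recip_minus b s))\<^sup>2))"
    using integrable_cmod_recip_plus_square[OF a b] by (intro integrable_mult_right Bochner_Integration.integrable_add)
  show "(\<lambda>s. recip_plus a s ^ (n + 1) * recip_minus b s ^ (m + 1)) \<in> borel_measurable lborel" by measurable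
  have "norm (recip_plus a s ^ (n + 1) * recip_minus b s ^ (m + 1))
      \<le> norm ((1 / Re a) ^ n * (1 / Re b) ^ m * ((cmod (recip_plus a s))\<^sup>2 + (cmod (recip_minus b s))\<^sup>2))" for s
  proof -
    let ?u = "cmod (recip_plus a s)" and ?v = "cmod (recip_minus b s)"
    have "?u * ?v \<le> ?u\<^sup>2 + ?v\<^sup>2"
    proof -
      have "2 * (?u * ?v) \<le> ?u\<^sup>2 + ?v\<^sup>2"
        using zero_le_power2[of "?u - ?v"] unfolding power2_diff by (simp add: mult.assoc)
      moreover have "0 \<le> ?u * ?v" by simp
      ultimately show ?thesis by linarith
    qed
    then have "(?u ^ n * ?v ^ m) * (?u * ?v) \<le> ((1 / Re a) ^ n * (1 / Re b) ^ m) * (?u\<^sup>2 + ?v\<^sup>2)"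
      using a b by (intro mult_mono power_mono cmod_recip_plus_le[OF a b] cmod_recip_minus_le) auto
    then show ?thesis using a b by (simp add: norm_power norm_mult mult_ac)
  qed
  then show "AE s in lborel. norm (recip_plus a s ^ (n + 1) * recip_minus b s ^ (m + 1))
      \<le> norm ((1 / Re a) ^ n * (1 / Re b) ^ m * ((cmod (recip_plus a s))\<^sup>2 + (cmod (recip_minus b s))\<^sup>2))" by simp
qed

lemma recip_product_partial_fractions: "(a + b) * (recip_plus a s * recip_minus b s) = recip_plus a s + recip_minus b s"
proof -
  have "a + b = (a + \<i> * of_real s) + (b - \<i> * of_real s)" by simp
  then show ?thesis
    unfolding recip_plus_def recip_minus_def using recip_plus_nonzero[OF a b, of s] by (simp add: field_simps)
qed

lemma ab_nonzero: "a + b \<noteq> 0"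
  using a b by (auto simp: complex_eq_iff)

text \<open>
  The antiderivative is a difference of logarithms. The moduli of the two arguments have ratio tending
  to \<open>1\<close>, so in the limits only the arguments \<open>\<plusminus>\<pi>/2\<close> remain.
\<close>

lemma integral_recip_plus_recip_minus: "(LINT s|lborel. recip_plus a s * recip_minus b s) = 2 * pi / (a + b)"
proof -
  let ?F = "\<lambda>s. \<i> / (a + b) * (Ln (b - \<i> * of_real s) - Ln (a + \<i> * of_real s))"
  have lim: "((\<lambda>s. Ln (b - \<i> * of_real s) - Ln (a + \<i> * of_real s)) \<longlongrightarrow> - \<i> * pi) at_top"
    if a: "0 < Re a" and b: "0 < Re b" for a b
  proof -
    have inv: "((\<lambda>s::real. inverse s) \<longlongrightarrow> 0) at_top" by (rule tendsto_inverse_0_at_top) (rule filterlim_ident)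
    have 1: "((\<lambda>s. Ln (b * of_real (inverse s) - \<i>)) \<longlongrightarrow> Ln (b * of_real 0 - \<i>)) at_top"
      by (intro tendsto_intros inv) (auto simp: complex_nonpos_Reals_iff)
    have 2: "((\<lambda>s. Ln (a * of_real (inverse s) + \<i>)) \<longlongrightarrow> Ln (a * of_real 0 + \<i>)) at_top"
      by (intro tendsto_intros inv) (auto simp: complex_nonpos_Reals_iff)
    have "((\<lambda>s. Ln (b * of_real (inverse s) - \<i>) - Ln (a * of_real (inverse s) + \<i>)) \<longlongrightarrow> - \<i> * pi) at_top"
      using tendsto_diff[OF 1 2] by (simp add: field_simps)
    moreover have "eventually (\<lambda>s. Ln (b * of_real (inverse s) - \<i>) - Ln (a * of_real (inverse s) + \<i>)
        = Ln (b - \<i> * of_real s) - Ln (a + \<i> * of_real s)) at_top"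
      using eventually_gt_at_top[of 0]
    proof eventually_elim
      case (elim s)
      have eb: "b - \<i> * of_real s = of_real s * (b * of_real (inverse s) - \<i>)"
        and ea: "a + \<i> * of_real s = of_real s * (a * of_real (inverse s) + \<i>)"
        using elim by (simp_all add: field_simps)
      have nb: "b * of_real (inverse s) - \<i> \<noteq> 0" and na: "a * of_real (inverse s) + \<i> \<noteq> 0"
        using elim a b by (auto simp: complex_eq_iff)
      show ?case
        unfolding eb ea Ln_times_of_real[OF elim nb] Ln_times_of_real[OF elim na] by simp
    qed
    ultimately show ?thesis by (rule Lim_transform_eventually)
  qed
  have top: "(?F \<longlongrightarrow> \<i> / (a + b) * (- \<i> * pi)) at_top"
    by (intro tendsto_mult tendsto_const lim a b)
  have "((\<lambda>s. Ln (a + \<i> * of_real s) - Ln (b - \<i> * of_real s)) \<longlongrightarrow> - \<i> * pi) at_bot"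
    using lim[OF b a] unfolding filterlim_at_bot_mirror by simp
  from tendsto_minus[OF this]
  have bot: "(?F \<longlongrightarrow> \<i> / (a + b) * (\<i> * pi)) at_bot"
    by (intro tendsto_mult tendsto_const) simp
  have "(LINT s|lborel. recip_plus a s * recip_minus b s) = \<i> / (a + b) * (- \<i> * pi) - \<i> / (a + b) * (\<i> * pi)"
  proof (rule LINT_FTC_real_line[OF _ _ _ bot top])
    show "integrable lborel (\<lambda>s. recip_plus a s * recip_minus b s)" using integrable_recip_product[of 0 0] by simp
    show "isCont (\<lambda>s. recip_plus a s * recip_minus b s) s" for s by (intro continuous_intros recip_plus_isCont[OF a b])
    show "(?F has_vector_derivative recip_plus a s * recip_minus b s) (at s)" for s
    proof -
      have nb: "b - \<i> * of_real s \<notin> \<real>\<^sub>\<le>\<^sub>0" and na: "a + \<i> * of_real s \<notin> \<real>\<^sub>\<le>\<^sub>0"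
        using a b by (auto simp: complex_nonpos_Reals_iff)
      have "((\<lambda>z. \<i> / (a + b) * (Ln (b - \<i> * z) - Ln (a + \<i> * z))) has_field_derivative
          (\<i> / (a + b) * (- \<i> * recip_minus b s - \<i> * recip_plus a s))) (at (of_real s))"
        unfolding recip_plus_def recip_minus_def using na nb ab_nonzero
        by (auto intro!: derivative_eq_intros simp: inverse_eq_divide)
      moreover have "\<i> / (a + b) * (- \<i> * recip_minus b s - \<i> * recip_plus a s) = recip_plus a s * recip_minus b s"
      proof -
        have "\<i> / (a + b) * (- \<i> * recip_minus b s - \<i> * recip_plus a s) = (recip_plus a s + recip_minus b s) / (a + b)"
          by (simp add: algebra_simps add_divide_distrib)
        also have "\<dots> = recip_plus a s * recip_minus b s"
          unfolding recip_product_partial_fractions[of s, symmetric] using ab_nonzero by simp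
        finally show ?thesis .
      qed
      ultimately show ?thesis using has_vector_derivative_real_field by fastforce
    qed
  qed
  then show ?thesis by (simp add: field_simps flip: mult.assoc)
qed

lemma integral_recip_plus_power_recip_minus: "(LINT s|lborel. recip_plus a s ^ (n + 1) * recip_minus b s) = 2 * pi / (a + b) ^ (n + 1)"
proof (induction n)
  case 0 then show ?case using integral_recip_plus_recip_minus by simp
next
  case (Suc n)
  have "(a + b) * (LINT s|lborel. recip_plus a s ^ (Suc n + 1) * recip_minus b s)
      = (LINT s|lborel. recip_plus a s ^ (n + 1) * ((a + b) * (recip_plus a s * recip_minus b s)))"
    by (subst integral_mult_right_zero[symmetric]) (simp add: mult_ac)
  also have "\<dots> = (LINT s|lborel. recip_plus a s ^ (n + 2) + recip_plus a s ^ (n + 1) * recip_minus b s)"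
    unfolding recip_product_partial_fractions by (simp add: algebra_simps)
  also have "\<dots> = (LINT s|lborel. recip_plus a s ^ (n + 2)) + (LINT s|lborel. recip_plus a s ^ (n + 1) * recip_minus b s)"
    using integrable_recip_plus_power[OF a b, of n] integrable_recip_product[of n 0]
    by (intro Bochner_Integration.integral_add) simp_all
  also have "\<dots> = 2 * pi / (a + b) ^ (n + 1)"
    using Suc integral_recip_plus_power[OF a b, of n] by simp
  finally have "(LINT s|lborel. recip_plus a s ^ (Suc n + 1) * recip_minus b s) = 2 * pi / (a + b) ^ (n + 1) / (a + b)"
    by (simp only: nonzero_eq_divide_eq[OF ab_nonzero] mult.commute)
  then show ?case by (simp add: mult_ac)
qed

lemma integral_recip_product_by_parts:
  "of_nat (n + 1) * (LINT s|lborel. recip_plus a s ^ (n + 2) * recip_minus b s ^ (m + 1))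
   = of_nat (m + 1) * (LINT s|lborel. recip_plus a s ^ (n + 1) * recip_minus b s ^ (m + 2))"
proof -
  let ?f = "\<lambda>s. (- \<i> * of_nat (n + 1)) * (recip_plus a s ^ (n + 2) * recip_minus b s ^ (m + 1))
      + (\<i> * of_nat (m + 1)) * (recip_plus a s ^ (n + 1) * recip_minus b s ^ (m + 2))"
  have i1: "integrable lborel (\<lambda>s. recip_plus a s ^ (n + 2) * recip_minus b s ^ (m + 1))"
    and i2: "integrable lborel (\<lambda>s. recip_plus a s ^ (n + 1) * recip_minus b s ^ (m + 2))"
    using integrable_recip_product[of "n + 1" m] integrable_recip_product[of n "m + 1"] by simp_all
  have lim0: "((\<lambda>s. recip_plus a s ^ (n + 1) * recip_minus b s ^ (m + 1)) \<longlongrightarrow> 0) F"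
    if "(recip_plus a \<longlongrightarrow> 0) F" for F
  proof (rule Lim_null_comparison)
    show "((\<lambda>s. cmod (recip_plus a s) ^ (n + 1) * (1 / Re b) ^ (m + 1)) \<longlongrightarrow> 0) F"
      using that b by (auto intro!: tendsto_eq_intros simp: tendsto_norm_zero)
    show "\<forall>\<^sub>F s in F. norm (recip_plus a s ^ (n + 1) * recip_minus b s ^ (m + 1)) \<le> cmod (recip_plus a s) ^ (n + 1) * (1 / Re b) ^ (m + 1)"
      unfolding norm_mult norm_power
      by (intro always_eventually allI mult_left_mono power_mono cmod_recip_minus_le) auto
  qed
  have "(LINT s|lborel. ?f s) = 0 - 0"
  proof (rule LINT_FTC_real_line[where F="\<lambda>s. recip_plus a s ^ (n + 1) * recip_minus b s ^ (m + 1)"])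
    show "integrable lborel ?f"
      by (intro Bochner_Integration.integrable_add integrable_mult_right i1 i2)
    show "isCont ?f s" for s by (intro continuous_intros recip_plus_isCont[OF a b])
    show "((\<lambda>s. recip_plus a s ^ (n + 1) * recip_minus b s ^ (m + 1)) has_vector_derivative ?f s) (at s)" for s
      using has_vector_derivative_mult[OF has_vector_derivative_power'[OF a b recip_plus_derivative(1)[OF a b], of "n + 1" s]
         has_vector_derivative_power'[OF a b recip_plus_derivative(2)[OF a b], of "m + 1" s]]
      by (simp add: power2_eq_square algebra_simps)
  qed (use lim0 recip_plus_tendsto_0[OF a b] in auto)
  moreover have "(LINT s|lborel. ?f s) = (- \<i> * of_nat (n + 1)) * (LINT s|lborel. recip_plus a s ^ (n + 2) * recip_minus b s ^ (m + 1))
      + (\<i> * of_nat (m + 1)) * (LINT s|lborel. recip_plus a s ^ (n + 1) * recip_minus b s ^ (m + 2))"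
    by (subst Bochner_Integration.integral_add[OF integrable_mult_right[OF i1] integrable_mult_right[OF i2]])
       (simp only: integral_mult_right_zero)
  ultimately have "\<i> * (of_nat (m + 1) * (LINT s|lborel. recip_plus a s ^ (n + 1) * recip_minus b s ^ (m + 2)))
      = \<i> * (of_nat (n + 1) * (LINT s|lborel. recip_plus a s ^ (n + 2) * recip_minus b s ^ (m + 1)))"
    by (simp add: algebra_simps)
  then show ?thesis by simp
qed

text \<open>
  The convolution of two powers. Partial fractions lower the total degree by one, and integration by
  parts lets both resulting integrals be expressed by the same one.
\<close>

lemma integral_recip_product_power:
  "(LINT s|lborel. recip_plus a s ^ (n + 2) * recip_minus b s ^ (m + 1))
   = complex_of_real (2 * pi) * fact (n + m + 1) / (fact (n + 1) * fact m * (a + b) ^ (n + m + 2))"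
proof (induction m)
  case 0
  then show ?case
    using integral_recip_plus_power_recip_minus[of "n + 1"] fact_nonzero[of "Suc n", where 'a=complex] by (simp del: fact_Suc)
next
  case (Suc m)
  let ?I = "\<lambda>n m. (LINT s|lborel. recip_plus a s ^ n * recip_minus b s ^ m)"
  have "(a + b) * ?I (n + 2) (Suc m + 1)
      = (LINT s|lborel. recip_plus a s ^ (n + 1) * recip_minus b s ^ (m + 1) * ((a + b) * (recip_plus a s * recip_minus b s)))"
    by (subst integral_mult_right_zero[symmetric]) (simp add: mult_ac)
  also have "\<dots> = (LINT s|lborel. recip_plus a s ^ (n + 2) * recip_minus b s ^ (m + 1) + recip_plus a s ^ (n + 1) * recip_minus b s ^ (m + 2))"
    unfolding recip_product_partial_fractions by (simp add: algebra_simps)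
  also have "\<dots> = ?I (n + 2) (m + 1) + ?I (n + 1) (m + 2)"
    using integrable_recip_product[of "n + 1" m] integrable_recip_product[of n "m + 1"]
    by (intro Bochner_Integration.integral_add) simp_all
  finally have 1: "(a + b) * ?I (n + 2) (Suc m + 1) = ?I (n + 2) (m + 1) + ?I (n + 1) (m + 2)" .
  have 2: "?I (n + 1) (m + 2) = of_nat (n + 1) / of_nat (m + 1) * ?I (n + 2) (m + 1)"
    using integral_recip_product_by_parts[of n m] by (simp add: field_simps del: of_nat_Suc)
  have "(a + b) * ?I (n + 2) (Suc m + 1) = of_nat (n + m + 2) / of_nat (m + 1) * ?I (n + 2) (m + 1)"
    unfolding 1 2 by (simp add: field_simps del: of_nat_Suc) (simp add: algebra_simps)
  also have "\<dots> = of_nat (n + m + 2) / of_nat (m + 1)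
      * (complex_of_real (2 * pi) * fact (n + m + 1) / (fact (n + 1) * fact m * (a + b) ^ (n + m + 2)))"
    unfolding Suc ..
  also have "\<dots> = complex_of_real (2 * pi) * (of_nat (n + m + 2) * fact (n + m + 1))
      / (fact (n + 1) * (of_nat (m + 1) * fact m) * (a + b) ^ (n + m + 2))"
    by (simp add: field_simps)
  also have "of_nat (n + m + 2) * fact (n + m + 1) = (fact (n + Suc m + 1) :: complex)"
    by (simp add: fact_reduce)
  also have "of_nat (m + 1) * fact m = (fact (Suc m) :: complex)"
    by simp
  finally have "(a + b) * ?I (n + 2) (Suc m + 1)
      = complex_of_real (2 * pi) * fact (n + Suc m + 1) / (fact (n + 1) * fact (Suc m) * (a + b) ^ (n + m + 2))" .
  then have "?I (n + 2) (Suc m + 1)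
      = complex_of_real (2 * pi) * fact (n + Suc m + 1) / (fact (n + 1) * fact (Suc m) * (a + b) ^ (n + m + 2)) / (a + b)"
    using ab_nonzero by (simp only: nonzero_eq_divide_eq[OF ab_nonzero] mult.commute)
  then show ?case by (simp add: mult_ac)
qed

end

context
  fixes \<gamma> :: real and A :: complex
  assumes \<gamma>: "1 < \<gamma>" and A: "0 < Re A"
begin

text \<open>
  The factor of the integral over the radius that remains after the integration over the height;
  \<open>recip_power_re\<close> is the real function that dominates it.
\<close>

definition recip_power :: "real \<Rightarrow> complex" where "recip_power x = inverse (of_real (\<gamma> * x powr \<gamma>) + A)"
definition recip_power_re :: "real \<Rightarrow> real" where "recip_power_re x = inverse (\<gamma> * x powr \<gamma> + Re A)"

lemma recip_power_re_pos: "0 < \<gamma> * x powr \<gamma> + Re A" "0 < recip_power_re x"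
  using \<gamma> A by (auto simp: recip_power_re_def intro: add_nonneg_pos)

lemma recip_power_nonzero: "of_real (\<gamma> * x powr \<gamma>) + A \<noteq> 0"
  using recip_power_re_pos(1)[of x] by (auto simp: complex_eq_iff)

lemma cmod_recip_power: "cmod (recip_power x) \<le> recip_power_re x"
proof -
  have "\<gamma> * x powr \<gamma> + Re A \<le> cmod (of_real (\<gamma> * x powr \<gamma>) + A)"
    using complex_Re_le_cmod[of "of_real (\<gamma> * x powr \<gamma>) + A"] by simp
  then show ?thesis
    using recip_power_re_pos(1)[of x] by (simp add: recip_power_def recip_power_re_def norm_inverse le_imp_inverse_le)
qed

lemma power_recip_power_re_le: "x powr (\<gamma> * real j) * recip_power_re x ^ j \<le> (1 / \<gamma>) ^ j"
proof (cases "x = 0")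
  case False
  have "x powr \<gamma> * recip_power_re x \<le> 1 / \<gamma>"
    using recip_power_re_pos(1)[of x] \<gamma> A by (simp add: recip_power_re_def field_simps)
  then have "(x powr \<gamma> * recip_power_re x) ^ j \<le> (1 / \<gamma>) ^ j"
    using recip_power_re_pos(2)[of x] by (intro power_mono) (auto intro: less_imp_le)
  moreover have "x powr (\<gamma> * real j) = (x powr \<gamma>) ^ j"
    using False by (simp add: powr_powr[symmetric] powr_realpow)
  ultimately show ?thesis by (simp add: power_mult_distrib)
qed (use \<gamma> in simp)

lemma recip_power_re_tendsto_0: "(recip_power_re \<longlongrightarrow> 0) at_top"
proof -
  have "\<forall>\<^sub>F x in at_top. x \<le> x powr \<gamma>"
    using eventually_ge_at_top[of 1]
  proof eventually_elim
    case (elim x)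
    then show ?case using powr_mono[of 1 \<gamma> x] \<gamma> by simp
  qed
  then have "filterlim (\<lambda>x. x powr \<gamma>) at_top at_top"
    by (rule filterlim_at_top_mono[OF filterlim_ident])
  then have "filterlim (\<lambda>x. Re A + \<gamma> * x powr \<gamma>) at_top at_top"
    using \<gamma> by (intro filterlim_tendsto_add_at_top[OF tendsto_const]
       filterlim_tendsto_pos_mult_at_top[OF tendsto_const]) auto
  then have "filterlim (\<lambda>x. \<gamma> * x powr \<gamma> + Re A) at_top at_top"
    by (simp only: add.commute)
  then show ?thesis unfolding recip_power_re_def by (rule tendsto_inverse_0_at_top)
qed

lemma recip_power_re_derivative:
  assumes x: "0 < x"
  shows "((\<lambda>x. - (recip_power_re x ^ (p + 1) / (real (p + 1) * \<gamma>\<^sup>2))) has_real_derivative x powr (\<gamma> - 1) * recip_power_re x ^ (p + 2)) (at x)"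
proof -
  have "((\<lambda>x. \<gamma> * x powr \<gamma> + Re A) has_real_derivative \<gamma>\<^sup>2 * x powr (\<gamma> - 1)) (at x)"
    using x by (auto intro!: derivative_eq_intros simp: power2_eq_square)
  from DERIV_inverse_fun[OF this] have "(recip_power_re has_real_derivative - (recip_power_re x * (\<gamma>\<^sup>2 * x powr (\<gamma> - 1)) * recip_power_re x)) (at x)"
    using recip_power_re_pos(1)[of x] by (simp add: recip_power_re_def[abs_def] mult_ac)
  from DERIV_power[OF this, of "p + 1"]
  have "((\<lambda>x. recip_power_re x ^ (p + 1)) has_real_derivative - (real (p + 1) * \<gamma>\<^sup>2) * (x powr (\<gamma> - 1) * recip_power_re x ^ (p + 2))) (at x)"
    by (simp add: algebra_simps)
  from DERIV_minus[OF DERIV_cdivide[OF this, of "real (p + 1) * \<gamma>\<^sup>2"]] show ?thesis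
    using \<gamma> by simp
qed

lemma integrable_recip_power_re: "integrable lborel (\<lambda>x. indicator {0<..} x *\<^sub>R (x powr (\<gamma> - 1) * recip_power_re x ^ (p + 2)))"
proof -
  let ?F = "\<lambda>x. - (recip_power_re x ^ (p + 1) / (real (p + 1) * \<gamma>\<^sup>2))"
  have e: "einterval 0 \<infinity> = {0<..}" by (auto simp: einterval_def)
  have "set_integrable lborel (einterval 0 \<infinity>) (\<lambda>x. x powr (\<gamma> - 1) * recip_power_re x ^ (p + 2))"
  proof (rule interval_integral_FTC_nonneg(1)[where F="?F"])
    show "isCont (\<lambda>x. x powr (\<gamma> - 1) * recip_power_re x ^ (p + 2)) x" if "0 < ereal x" for x
      unfolding recip_power_re_def using that recip_power_re_pos(1)[of x] by (intro continuous_intros) auto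
    have p0: "((\<lambda>x::real. x powr \<gamma>) \<longlongrightarrow> 0) (at_right 0)"
      using \<gamma> by (intro powr_tendsto_0_at_right) simp
    have "(?F \<longlongrightarrow> - (inverse (\<gamma> * 0 + Re A) ^ (p + 1) / (real (p + 1) * \<gamma>\<^sup>2))) (at_right 0)"
      unfolding recip_power_re_def using A \<gamma> by (intro tendsto_intros p0) auto
    then show "((?F \<circ> real_of_ereal) \<longlongrightarrow> - (inverse (\<gamma> * 0 + Re A) ^ (p + 1) / (real (p + 1) * \<gamma>\<^sup>2))) (at_right 0)"
      by (simp add: ereal_tendsto_simps zero_ereal_def)
    have "(?F \<longlongrightarrow> - (0 ^ (p + 1) / (real (p + 1) * \<gamma>\<^sup>2))) at_top"
      using \<gamma> by (intro tendsto_intros recip_power_re_tendsto_0) auto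
    then show "((?F \<circ> real_of_ereal) \<longlongrightarrow> - (0 ^ (p + 1) / (real (p + 1) * \<gamma>\<^sup>2))) (at_left \<infinity>)"
      by (simp add: ereal_tendsto_simps)
  qed (use recip_power_re_derivative recip_power_re_pos in \<open>auto intro!: AE_I2 mult_nonneg_nonneg zero_le_power less_imp_le\<close>)
  then show ?thesis by (simp add: set_integrable_def e)
qed

lemma recip_power_isCont: "0 < x \<Longrightarrow> isCont recip_power x"
  unfolding recip_power_def using recip_power_nonzero[of x] by (intro continuous_intros) auto

lemma recip_power_measurable [measurable]: "recip_power \<in> borel_measurable borel"
  unfolding recip_power_def[abs_def] by measurable

lemma integrable_recip_power:
  "integrable lborel (\<lambda>x. indicator {0<..} x *\<^sub>R (of_real (x powr (\<gamma> * real j + \<gamma> - 1)) * recip_power x ^ (j + p + 2)))"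
proof (rule Bochner_Integration.integrable_bound)
  show "integrable lborel (\<lambda>x. (1 / \<gamma>) ^ j * (indicator {0<..} x *\<^sub>R (x powr (\<gamma> - 1) * recip_power_re x ^ (p + 2))))"
    by (intro integrable_mult_right integrable_recip_power_re)
  have "norm (indicator {0<..} x *\<^sub>R (of_real (x powr (\<gamma> * real j + \<gamma> - 1)) * recip_power x ^ (j + p + 2)))
      \<le> norm ((1 / \<gamma>) ^ j * (indicator {0<..} x *\<^sub>R (x powr (\<gamma> - 1) * recip_power_re x ^ (p + 2))))" for x
  proof (cases "0 < x")
    case True
    have "cmod (recip_power x) ^ (j + p + 2) \<le> recip_power_re x ^ (j + p + 2)"
      by (intro power_mono cmod_recip_power) simp
    then have "x powr (\<gamma> * real j + \<gamma> - 1) * cmod (recip_power x) ^ (j + p + 2)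
        \<le> x powr (\<gamma> * real j + (\<gamma> - 1)) * recip_power_re x ^ (j + p + 2)"
      by (simp add: mult_left_mono add_diff_eq)
    also have "\<dots> = (x powr (\<gamma> * real j) * recip_power_re x ^ j) * (x powr (\<gamma> - 1) * recip_power_re x ^ (p + 2))"
      by (simp add: powr_add power_add mult_ac)
    also have "\<dots> \<le> (1 / \<gamma>) ^ j * (x powr (\<gamma> - 1) * recip_power_re x ^ (p + 2))"
      using recip_power_re_pos(2)[of x] by (intro mult_right_mono power_recip_power_re_le) auto
    finally show ?thesis using True \<gamma> recip_power_re_pos(2)[of x] by (simp add: norm_mult norm_power)
  qed simp
  then show "AE x in lborel. norm (indicator {0<..} x *\<^sub>R (of_real (x powr (\<gamma> * real j + \<gamma> - 1)) * recip_power x ^ (j + p + 2)))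
      \<le> norm ((1 / \<gamma>) ^ j * (indicator {0<..} x *\<^sub>R (x powr (\<gamma> - 1) * recip_power_re x ^ (p + 2))))" by simp
qed measurable

lemma recip_power_power_derivative:
  assumes x: "0 < x"
  shows "((\<lambda>x. recip_power x ^ (p + 1)) has_vector_derivative
      - (of_nat (p + 1) * of_real (\<gamma>\<^sup>2) * (of_real (x powr (\<gamma> - 1)) * recip_power x ^ (p + 2)))) (at x)"
proof -
  have "((\<lambda>x. \<gamma> * x powr \<gamma>) has_real_derivative \<gamma>\<^sup>2 * x powr (\<gamma> - 1)) (at x)"
    using x by (auto intro!: derivative_eq_intros simp: power2_eq_square)
  then have "((\<lambda>x. of_real (\<gamma> * x powr \<gamma>) + A) has_vector_derivative of_real (\<gamma>\<^sup>2 * x powr (\<gamma> - 1)) + 0) (at x)"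
    by (intro has_vector_derivative_add has_vector_derivative_of_real has_vector_derivative_const)
       (simp add: has_real_derivative_iff_has_vector_derivative)
  moreover have "((\<lambda>z. inverse z ^ (p + 1)) has_field_derivative - (of_nat (p + 1) * recip_power x ^ (p + 2)))
      (at (of_real (\<gamma> * x powr \<gamma>) + A))"
    using DERIV_power[OF DERIV_inverse[OF recip_power_nonzero[of x]], of "p + 1"] by (simp add: recip_power_def mult_ac)
  ultimately have "((\<lambda>z. inverse z ^ (p + 1)) \<circ> (\<lambda>x. of_real (\<gamma> * x powr \<gamma>) + A) has_vector_derivative
      (of_real (\<gamma>\<^sup>2 * x powr (\<gamma> - 1)) + 0) * - (of_nat (p + 1) * recip_power x ^ (p + 2))) (at x)"
    by (rule field_vector_diff_chain_at)
  then show ?thesis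
    by (simp add: o_def recip_power_def mult_ac)
qed

text \<open>
  In the variable \<open>x\<^sup>\<gamma>\<close> this is a beta integral. Integration by parts lowers \<open>j\<close>.
\<close>

lemma integral_recip_power:
  "(LINT x|lborel. indicator {0<..} x *\<^sub>R (of_real (x powr (\<gamma> * real j + \<gamma> - 1)) * recip_power x ^ (j + p + 2)))
   = fact j * fact p / (fact (j + p + 1) * of_real \<gamma> ^ (j + 2) * A ^ (p + 1))"
proof (induction j)
  case 0
  let ?F = "\<lambda>x. - (recip_power x ^ (p + 1) / (of_nat (p + 1) * of_real (\<gamma>\<^sup>2)))"
  have "(LINT x|lborel. indicator {0<..} x *\<^sub>R (of_real (x powr (\<gamma> - 1)) * recip_power x ^ (p + 2)))
      = 0 - - (inverse (of_real (\<gamma> * 0) + A) ^ (p + 1) / (of_nat (p + 1) * of_real (\<gamma>\<^sup>2)))"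
  proof (rule LINT_FTC_half_line[where F="?F"])
    show "(?F has_vector_derivative of_real (x powr (\<gamma> - 1)) * recip_power x ^ (p + 2)) (at x)" if "0 < x" for x
    proof -
      have "((\<lambda>x. - (1 / (of_nat (p + 1) * of_real (\<gamma>\<^sup>2))) * recip_power x ^ (p + 1)) has_vector_derivative
         - (1 / (of_nat (p + 1) * of_real (\<gamma>\<^sup>2))) *
         - (of_nat (p + 1) * of_real (\<gamma>\<^sup>2) * (of_real (x powr (\<gamma> - 1)) * recip_power x ^ (p + 2)))) (at x)"
        by (rule has_vector_derivative_mult_right[OF recip_power_power_derivative[OF that]])
      moreover have "of_nat (p + 1) * complex_of_real (\<gamma>\<^sup>2) \<noteq> 0"
        using \<gamma> of_nat_neq_0[of p, where 'a=complex] by simp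
      ultimately show ?thesis by (simp del: of_nat_Suc of_nat_add)
    qed
    show "isCont (\<lambda>x. of_real (x powr (\<gamma> - 1)) * recip_power x ^ (p + 2)) x" if "0 < x" for x
      using that by (intro continuous_intros recip_power_isCont) auto
    show "integrable lborel (\<lambda>x. indicator {0<..} x *\<^sub>R (of_real (x powr (\<gamma> - 1)) * recip_power x ^ (p + 2)))"
      using integrable_recip_power[of 0 p] by simp
    have p0: "((\<lambda>x::real. x powr \<gamma>) \<longlongrightarrow> 0) (at_right 0)"
      using \<gamma> by (intro powr_tendsto_0_at_right) simp
    show "(?F \<longlongrightarrow> - (inverse (of_real (\<gamma> * 0) + A) ^ (p + 1) / (of_nat (p + 1) * of_real (\<gamma>\<^sup>2)))) (at_right 0)"
      unfolding recip_power_def using A \<gamma> by (intro tendsto_intros p0) (auto simp: complex_eq_iff)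
    have "(recip_power \<longlongrightarrow> 0) at_top"
      by (rule Lim_null_comparison[OF always_eventually recip_power_re_tendsto_0]) (simp add: cmod_recip_power)
    then have "(?F \<longlongrightarrow> - (0 ^ (p + 1) / (of_nat (p + 1) * of_real (\<gamma>\<^sup>2)))) at_top"
      using \<gamma> by (intro tendsto_intros) (auto simp del: of_nat_Suc)
    then show "(?F \<longlongrightarrow> 0) at_top" by simp
  qed
  moreover have "1 + complex_of_nat p \<noteq> 0" "A \<noteq> 0" "complex_of_real \<gamma> \<noteq> 0"
    using \<gamma> A of_nat_neq_0[of p, where 'a=complex] by auto
  moreover have "inverse A ^ (p + 1) / ((1 + complex_of_nat p) * of_real (\<gamma>\<^sup>2))
      = fact p / ((1 + complex_of_nat p) * fact p * (of_real \<gamma>)\<^sup>2 * A ^ (p + 1))"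
    by (simp add: power_one_over inverse_eq_divide mult_ac)
  ultimately show ?case by (simp add: mult_ac power2_eq_square)
next
  case (Suc j)
  let ?g = "\<lambda>j x. of_real (x powr (\<gamma> * real j + \<gamma> - 1)) * recip_power x ^ (j + p + 2)"
  let ?J = "\<lambda>j. (LINT x|lborel. indicator {0<..} x *\<^sub>R ?g j x)"
  let ?c = "of_real (\<gamma> * real (Suc j)) :: complex" and ?d = "of_nat (Suc j + p + 1) * of_real (\<gamma>\<^sup>2) :: complex"
  let ?F = "\<lambda>x. of_real (x powr (\<gamma> * real (Suc j))) * recip_power x ^ (Suc j + p + 1)"
  have "(LINT x|lborel. indicator {0<..} x *\<^sub>R (?c * ?g j x - ?d * ?g (Suc j) x)) = 0 - 0"
  proof (rule LINT_FTC_half_line[where F="?F"])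
    show "(?F has_vector_derivative ?c * ?g j x - ?d * ?g (Suc j) x) (at x)" if x: "0 < x" for x
    proof -
      have "((\<lambda>x. x powr (\<gamma> * real (Suc j))) has_real_derivative (\<gamma> * real (Suc j)) * x powr (\<gamma> * real (Suc j) - 1)) (at x)"
        using x by (intro has_real_derivative_powr)
      then have 1: "((\<lambda>x. complex_of_real (x powr (\<gamma> * real (Suc j)))) has_vector_derivative
          of_real ((\<gamma> * real (Suc j)) * x powr (\<gamma> * real (Suc j) - 1))) (at x)"
        by (rule has_vector_derivative_of_real)
      have e1: "\<gamma> * real (Suc j) - 1 = \<gamma> * real j + \<gamma> - 1" by (simp add: algebra_simps)
      have e2: "x powr (\<gamma> * real (Suc j)) * x powr (\<gamma> - 1) = x powr (\<gamma> * real (Suc j) + \<gamma> - 1)"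
        by (simp only: powr_add[symmetric] add_diff_eq)
      have "of_real (x powr (\<gamma> * real (Suc j))) * - (?d * (of_real (x powr (\<gamma> - 1)) * recip_power x ^ (Suc j + p + 2)))
          + of_real ((\<gamma> * real (Suc j)) * x powr (\<gamma> * real (Suc j) - 1)) * recip_power x ^ (Suc j + p + 1)
          = ?c * ?g j x - ?d * ?g (Suc j) x"
        unfolding e1 e2[symmetric] by (simp add: algebra_simps)
      with has_vector_derivative_mult[OF 1 recip_power_power_derivative[OF x, of "Suc j + p"]] show ?thesis
        by simp
    qed
    show "isCont (\<lambda>x. ?c * ?g j x - ?d * ?g (Suc j) x) x" if "0 < x" for x
      using that by (intro continuous_intros recip_power_isCont) auto
    have "integrable lborel (\<lambda>x. ?c * (indicator {0<..} x *\<^sub>R ?g j x) - ?d * (indicator {0<..} x *\<^sub>R ?g (Suc j) x))"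
      by (intro Bochner_Integration.integrable_diff integrable_mult_right integrable_recip_power)
    then show "integrable lborel (\<lambda>x. indicator {0<..} x *\<^sub>R (?c * ?g j x - ?d * ?g (Suc j) x))"
      by (simp only: scaleR_diff_right mult_scaleR_right)
    have Fb: "norm (?F x) \<le> x powr (\<gamma> * real (Suc j)) * recip_power_re x ^ (Suc j) * recip_power_re x ^ (p + 1)" for x
    proof -
      have "cmod (recip_power x) ^ (Suc j + p + 1) \<le> recip_power_re x ^ (Suc j + p + 1)" by (intro power_mono cmod_recip_power) simp
      then have "x powr (\<gamma> * real (Suc j)) * cmod (recip_power x) ^ (Suc j + p + 1) \<le> x powr (\<gamma> * real (Suc j)) * recip_power_re x ^ (Suc j + p + 1)"
        by (intro mult_left_mono) auto
      then show ?thesis by (simp add: norm_mult norm_power power_add mult_ac)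
    qed
    show "(?F \<longlongrightarrow> 0) at_top"
    proof (rule Lim_null_comparison[OF always_eventually[OF allI]])
      show "norm (?F x) \<le> (1 / \<gamma>) ^ Suc j * recip_power_re x ^ (p + 1)" for x
        using Fb[of x] mult_right_mono[OF power_recip_power_re_le[of x "Suc j"], of "recip_power_re x ^ (p + 1)"] recip_power_re_pos(2)[of x]
        by (meson less_imp_le order_trans zero_le_power)
      have "((\<lambda>x. (1 / \<gamma>) ^ Suc j * recip_power_re x ^ (p + 1)) \<longlongrightarrow> (1 / \<gamma>) ^ Suc j * 0 ^ (p + 1)) at_top"
        by (intro tendsto_intros recip_power_re_tendsto_0)
      then show "((\<lambda>x. (1 / \<gamma>) ^ Suc j * recip_power_re x ^ (p + 1)) \<longlongrightarrow> 0) at_top" by simp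
    qed
    show "(?F \<longlongrightarrow> 0) (at_right 0)"
    proof (rule Lim_null_comparison[OF always_eventually[OF allI]])
      show "norm (?F x) \<le> x powr (\<gamma> * real (Suc j)) * (1 / Re A) ^ (Suc j + p + 1)" for x
      proof -
        have "recip_power_re x \<le> 1 / Re A"
          using \<gamma> A by (simp add: recip_power_re_def inverse_eq_divide frac_le)
        then have "recip_power_re x ^ (Suc j + p + 1) \<le> (1 / Re A) ^ (Suc j + p + 1)"
          using recip_power_re_pos(2)[of x] by (intro power_mono) auto
        then have "x powr (\<gamma> * real (Suc j)) * recip_power_re x ^ (Suc j + p + 1)
            \<le> x powr (\<gamma> * real (Suc j)) * (1 / Re A) ^ (Suc j + p + 1)"
          by (intro mult_left_mono) auto
        then show ?thesis using Fb[of x] by (simp add: power_add mult_ac)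
      qed
      have "((\<lambda>x::real. x powr (\<gamma> * real (Suc j))) \<longlongrightarrow> 0) (at_right 0)"
        using \<gamma> by (intro powr_tendsto_0_at_right) simp
      from tendsto_mult[OF this tendsto_const[of "(1 / Re A) ^ (Suc j + p + 1)"]]
      show "((\<lambda>x. x powr (\<gamma> * real (Suc j)) * (1 / Re A) ^ (Suc j + p + 1)) \<longlongrightarrow> 0) (at_right 0)" by simp
    qed
  qed
  moreover have "(LINT x|lborel. indicator {0<..} x *\<^sub>R (?c * ?g j x - ?d * ?g (Suc j) x)) = ?c * ?J j - ?d * ?J (Suc j)"
  proof -
    have "(LINT x|lborel. indicator {0<..} x *\<^sub>R (?c * ?g j x - ?d * ?g (Suc j) x))
        = (LINT x|lborel. ?c * (indicator {0<..} x *\<^sub>R ?g j x) - ?d * (indicator {0<..} x *\<^sub>R ?g (Suc j) x))"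
      by (simp only: scaleR_diff_right mult_scaleR_right)
    also have "\<dots> = ?c * ?J j - ?d * ?J (Suc j)"
      by (subst Bochner_Integration.integral_diff[OF integrable_mult_right[OF integrable_recip_power] integrable_mult_right[OF integrable_recip_power]])
         (simp only: integral_mult_right_zero)
    finally show ?thesis .
  qed
  ultimately have e: "?d * ?J (Suc j) = ?c * ?J j" by simp
  have d: "?d \<noteq> 0" using \<gamma> of_nat_neq_0[of "Suc j + p", where 'a=complex] by simp
  have "?J (Suc j) = ?c * ?J j / ?d"
    unfolding e[symmetric] by (rule nonzero_mult_div_cancel_left[OF d, symmetric])
  also have "\<dots> = ?c * (fact j * fact p / (fact (j + p + 1) * of_real \<gamma> ^ (j + 2) * A ^ (p + 1))) / ?d"
    unfolding Suc ..
  also have "\<dots> = of_real \<gamma> * (of_nat (Suc j) * fact j) * fact p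
      / (of_real \<gamma> * of_real \<gamma> * (of_nat (Suc j + p + 1) * fact (j + p + 1)) * of_real \<gamma> ^ (j + 2) * A ^ (p + 1))"
    by (simp add: power2_eq_square mult_ac del: of_nat_Suc of_nat_add)
  also have "of_nat (Suc j) * fact j = (fact (Suc j) :: complex)" by simp
  also have "of_nat (Suc j + p + 1) * fact (j + p + 1) = (fact (Suc j + p + 1) :: complex)"
    by (simp add: fact_reduce)
  also have "of_real \<gamma> * fact (Suc j) * fact p
      / (of_real \<gamma> * of_real \<gamma> * fact (Suc j + p + 1) * of_real \<gamma> ^ (j + 2) * A ^ (p + 1))
      = fact (Suc j) * fact p / (fact (Suc j + p + 1) * of_real \<gamma> ^ (Suc j + 2) * A ^ (p + 1))"
    using \<gamma> by (simp add: mult_ac)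
  finally show ?case .
qed

end

section \<open>The kernels of the Leray transform\<close>

text \<open>
  The kernels of the pieces in intrinsic form. The product \<open>\<gamma> z\<^sub>1 w\<^sub>1(\<zeta>)\<close> has modulus \<open>B\<close> and
  the phase of \<open>z\<^sub>1 / \<zeta>\<^sub>1\<close>, so its \<open>k\<close>-th power contains the power of \<open>B\<close> as well as the characters that
  extract and restore the Fourier mode. The kernel \<open>leray_kernel\<close> is taken with respect to the pairing
  measure, \<open>pref_kernel\<close> with respect to the preferred measure, and \<open>rho\<close> is the density of the former
  measure with respect to the latter.
\<close>

definition denom :: "real \<Rightarrow> complex \<times> complex \<Rightarrow> complex \<times> complex \<Rightarrow> complex" where
  "denom \<gamma> z \<zeta> = Complex ((\<gamma> - 1) * cmod (fst \<zeta>) powr \<gamma> + cmod (fst z) powr \<gamma>) (Re (snd \<zeta>) - Re (snd z))"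

definition leray_kernel :: "real \<Rightarrow> nat \<Rightarrow> complex \<times> complex \<Rightarrow> complex \<times> complex \<Rightarrow> complex" where
  "leray_kernel \<gamma> k z \<zeta> = of_nat (k + 1) * (of_real \<gamma> * fst z * fst (dual_map \<gamma> \<zeta>)) ^ k / denom \<gamma> z \<zeta> ^ (k + 2)"

definition rho :: "real \<Rightarrow> complex \<times> complex \<Rightarrow> real" where
  "rho \<gamma> z = (\<gamma> - 1) powr (-1/3) * cmod (fst z) powr (\<gamma> - 1 - (\<gamma> + 1) / 3)"

definition pref_kernel :: "real \<Rightarrow> nat \<Rightarrow> complex \<times> complex \<Rightarrow> complex \<times> complex \<Rightarrow> complex" where
  "pref_kernel \<gamma> k z \<zeta> = leray_kernel \<gamma> k z \<zeta> * of_real (rho \<gamma> \<zeta>)"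

definition pref_const :: "real \<Rightarrow> real" where
  "pref_const \<gamma> = \<gamma>\<^sup>2 * (\<gamma> - 1) powr (1/3) / (4 * pi\<^sup>2)"

lemma pref_measure_wmu: "pref_measure \<gamma> = wmu \<gamma> (pref_const \<gamma>) ((\<gamma> + 1) / 3)"
  by (simp add: pref_measure_def wmu_def pref_const_def)

lemma sets_pref_measure [simp, measurable_cong]: "sets (pref_measure \<gamma>) = sets (hypM \<gamma>)"
  by (simp add: pref_measure_wmu)

lemma pref_const_nonneg [simp]: "0 \<le> pref_const \<gamma>"
  by (simp add: pref_const_def)

lemma rho_measurable [measurable]: "rho \<gamma> \<in> borel_measurable (hypM \<gamma>)"
  unfolding rho_def[abs_def] by measurable

lemma rho_nonneg [simp]: "0 \<le> rho \<gamma> z"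
  by (simp add: rho_def)

lemma rho_pos: "1 < \<gamma> \<Longrightarrow> fst z \<noteq> 0 \<Longrightarrow> 0 < rho \<gamma> z"
  by (simp add: rho_def)

lemma pref_const_mult:
  assumes "1 < \<gamma>" shows "pref_const \<gamma> * (\<gamma> - 1) powr (-1/3) = \<gamma>\<^sup>2 / (4 * pi\<^sup>2)"
proof -
  have "(\<gamma> - 1) powr (1/3) * (\<gamma> - 1) powr (-1/3) = 1"
    using assms by (subst powr_add[symmetric]) simp
  then show ?thesis by (simp add: pref_const_def mult.assoc)
qed

lemma pairing_measure_density:
  assumes \<gamma>: "1 < \<gamma>"
  shows "pairing_measure \<gamma> = density (pref_measure \<gamma>) (\<lambda>z. ennreal (rho \<gamma> z))"
  unfolding rho_def pref_measure_wmu using pref_const_mult[OF \<gamma>]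
  by (subst density_wmu) (simp_all add: pairing_measure_def wmu_def)

lemma pref_dual_measure_density:
  assumes \<gamma>: "1 < \<gamma>"
  shows "pref_dual_measure \<gamma> = density (pref_measure \<gamma>) (\<lambda>z. ennreal ((rho \<gamma> z)\<^sup>2))"
proof -
  have p: "(\<gamma> - 1) powr (1/3) * (\<gamma> - 1) powr (-2/3) = 1 / (\<gamma> - 1) powr (1/3)"
    using \<gamma> by (subst powr_add[symmetric]) (simp add: powr_minus_divide)
  have c: "pref_const \<gamma> * (\<gamma> - 1) powr (-2/3) = \<gamma>\<^sup>2 / (4 * pi\<^sup>2 * (\<gamma> - 1) powr (1/3))"
  proof -
    have "pref_const \<gamma> * x = \<gamma>\<^sup>2 / (4 * pi\<^sup>2) * ((\<gamma> - 1) powr (1/3) * x)" for x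
      by (simp add: pref_const_def)
    then show ?thesis by (simp only: p times_divide_times_eq mult_1_right)
  qed
  have e: "(rho \<gamma> z)\<^sup>2 = (\<gamma> - 1) powr (-2/3) * cmod (fst z) powr (2 * (\<gamma> - 1 - (\<gamma> + 1) / 3))" for z
  proof -
    have sq: "(x powr y)\<^sup>2 = x powr (2 * y)" for x y :: real
      by (simp only: power2_eq_square powr_add[symmetric] mult_2)
    show ?thesis
      unfolding rho_def power_mult_distrib sq by simp
  qed
  have r: "(\<gamma> + 1) / 3 + 2 * (\<gamma> - 1 - (\<gamma> + 1) / 3) = (5 * \<gamma> - 7) / 3"
    by (simp add: field_simps)
  show ?thesis
    unfolding e pref_measure_wmu density_wmu[OF pref_const_nonneg powr_ge_zero] c r
    by (simp only: pref_dual_measure_def wmu_def)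
qed

lemma pt_phase:
  "fst (pt \<gamma> \<alpha> s \<theta>) = cis \<theta> * fst (pt \<gamma> \<alpha> s 0)"
  "fst (dual_map \<gamma> (pt \<gamma> \<alpha> s \<theta>)) = cis (- \<theta>) * fst (dual_map \<gamma> (pt \<gamma> \<alpha> s 0))"
  by (simp_all add: pt_def dual_map_def norm_mult cis_cnj mult_ac)

lemma denom_pt [simp]:
  "denom \<gamma> (pt \<gamma> \<alpha> s \<theta>) \<zeta> = Complex ((\<gamma> - 1) * cmod (fst \<zeta>) powr \<gamma> + \<bar>\<alpha>\<bar> powr \<gamma>) (Re (snd \<zeta>) - s)"
  "denom \<gamma> z (pt \<gamma> \<alpha> s \<theta>) = Complex ((\<gamma> - 1) * \<bar>\<alpha>\<bar> powr \<gamma> + cmod (fst z) powr \<gamma>) (s - Re (snd z))"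
  by (simp_all add: denom_def)

lemma rho_pt [simp]: "rho \<gamma> (pt \<gamma> \<alpha> s \<theta>) = (\<gamma> - 1) powr (-1/3) * \<bar>\<alpha>\<bar> powr (\<gamma> - 1 - (\<gamma> + 1) / 3)"
  by (simp add: rho_def)

lemma leray_kernel_phase:
  "leray_kernel \<gamma> k (pt \<gamma> \<alpha> s \<theta>) \<zeta> = cis (real k * \<theta>) * leray_kernel \<gamma> k (pt \<gamma> \<alpha> s 0) \<zeta>"
  "leray_kernel \<gamma> k z (pt \<gamma> \<alpha> s \<theta>) = cis (- (real k * \<theta>)) * leray_kernel \<gamma> k z (pt \<gamma> \<alpha> s 0)"
proof -
  have "(of_real \<gamma> * fst (pt \<gamma> \<alpha> s \<theta>) * w) ^ k = cis (real k * \<theta>) * (of_real \<gamma> * fst (pt \<gamma> \<alpha> s 0) * w) ^ k" for w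
    using Complex.DeMoivre[of \<theta> k] unfolding pt_phase(1)[of \<gamma> \<alpha> s \<theta>] by (simp only: power_mult_distrib mult_ac)
  then show "leray_kernel \<gamma> k (pt \<gamma> \<alpha> s \<theta>) \<zeta> = cis (real k * \<theta>) * leray_kernel \<gamma> k (pt \<gamma> \<alpha> s 0) \<zeta>"
    by (simp only: leray_kernel_def denom_pt mult.left_commute times_divide_eq_right)
  have "cis (- \<theta>) ^ k = cis (- (real k * \<theta>))" by (simp add: Complex.DeMoivre)
  then have "(x * fst (dual_map \<gamma> (pt \<gamma> \<alpha> s \<theta>))) ^ k
      = cis (- (real k * \<theta>)) * (x * fst (dual_map \<gamma> (pt \<gamma> \<alpha> s 0))) ^ k" for x
    unfolding pt_phase(2)[of \<gamma> \<alpha> s \<theta>] by (simp only: power_mult_distrib mult_ac)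
  then show "leray_kernel \<gamma> k z (pt \<gamma> \<alpha> s \<theta>) = cis (- (real k * \<theta>)) * leray_kernel \<gamma> k z (pt \<gamma> \<alpha> s 0)"
    by (simp only: leray_kernel_def denom_pt mult.left_commute times_divide_eq_right)
qed

lemma pref_kernel_phase:
  "pref_kernel \<gamma> k (pt \<gamma> \<alpha> s \<theta>) \<zeta> = cis (real k * \<theta>) * pref_kernel \<gamma> k (pt \<gamma> \<alpha> s 0) \<zeta>"
  "pref_kernel \<gamma> k z (pt \<gamma> \<alpha> s \<theta>) = cis (- (real k * \<theta>)) * pref_kernel \<gamma> k z (pt \<gamma> \<alpha> s 0)"
  by (simp_all only: pref_kernel_def leray_kernel_phase(1)[of \<gamma> k \<alpha> s \<theta>] leray_kernel_phase(2)[of \<gamma> k z \<alpha> s \<theta>] rho_pt mult_ac)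

lemma cmod_leray_kernel:
  assumes "1 < \<gamma>"
  shows "cmod (leray_kernel \<gamma> k z \<zeta>)
    = real (k + 1) * (\<gamma> * cmod (fst z) * cmod (fst \<zeta>) powr (\<gamma> - 1)) ^ k / cmod (denom \<gamma> z \<zeta>) ^ (k + 2)"
  using assms cmod_fst_dual_map[OF assms, of \<zeta>]
  by (simp add: leray_kernel_def norm_mult norm_divide norm_power del: of_nat_Suc of_nat_add)

lemma leray_kernel_measurable:
  "(\<lambda>x. leray_kernel \<gamma> k (fst x) (snd x)) \<in> borel_measurable (hypM \<gamma> \<Otimes>\<^sub>M hypM \<gamma>)"
proof -
  note [measurable] =
    measurable_compose[OF measurable_fst borel_measurable_fst_hypM]
    measurable_compose[OF measurable_fst borel_measurable_snd_hypM]
    measurable_compose[OF measurable_snd borel_measurable_fst_hypM]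
    measurable_compose[OF measurable_snd borel_measurable_snd_hypM]
  show ?thesis
    unfolding leray_kernel_def denom_def dual_map_def Complex_eq fst_conv by measurable
qed

lemma pref_kernel_measurable:
  "(\<lambda>(x, y). pref_kernel \<gamma> k x y) \<in> borel_measurable (pref_measure \<gamma> \<Otimes>\<^sub>M pref_measure \<gamma>)"
proof -
  have r: "(\<lambda>x. rho \<gamma> (snd x)) \<in> borel_measurable (hypM \<gamma> \<Otimes>\<^sub>M hypM \<gamma>)"
    by (rule measurable_compose[OF measurable_snd rho_measurable])
  have borel_measurable_of_real': "complex_of_real \<in> borel_measurable borel" by measurable
  have "(\<lambda>x. pref_kernel \<gamma> k (fst x) (snd x)) \<in> borel_measurable (hypM \<gamma> \<Otimes>\<^sub>M hypM \<gamma>)"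
    unfolding pref_kernel_def
    by (intro borel_measurable_times leray_kernel_measurable measurable_compose[OF r borel_measurable_of_real'])
  then show ?thesis
    by (subst measurable_cong_sets[OF sets_pair_measure_cong[OF sets_pref_measure sets_pref_measure] refl])
       (simp add: split_beta)
qed

lemma pref_kernel_measurable2:
  assumes "z \<in> hyp \<gamma>"
  shows "(\<lambda>\<zeta>. pref_kernel \<gamma> k z \<zeta>) \<in> borel_measurable (hypM \<gamma>)" "(\<lambda>\<zeta>. pref_kernel \<gamma> k \<zeta> z) \<in> borel_measurable (hypM \<gamma>)"
proof -
  have s: "z \<in> space (pref_measure \<gamma>)" using assms by (simp add: pref_measure_wmu)
  show "(\<lambda>\<zeta>. pref_kernel \<gamma> k z \<zeta>) \<in> borel_measurable (hypM \<gamma>)"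
    using measurable_compose[OF measurable_Pair1'[OF s] pref_kernel_measurable]
    by (simp cong: measurable_cong_sets)
  show "(\<lambda>\<zeta>. pref_kernel \<gamma> k \<zeta> z) \<in> borel_measurable (hypM \<gamma>)"
    using measurable_compose[OF measurable_Pair2'[OF s] pref_kernel_measurable]
    by (simp cong: measurable_cong_sets)
qed

text \<open>
  The common form of the two estimates in Schur's test. The integral over \<open>s\<close> gains \<open>(k+1)\<^sup>-\<^sup>1\<^sup>/\<^sup>2\<close>, and
  so does the integral over \<open>\<alpha>\<close> of the \<open>(k+1)\<close>-st power of a profile \<open>h\<close> with a nondegenerate maximum;
  together they compensate the factor \<open>k+1\<close>.
\<close>

lemma polar_kernel_bound:
  fixes F :: "complex \<times> complex \<Rightarrow> ennreal" and h X L :: "real \<Rightarrow> real"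
  assumes F [measurable]: "F \<in> borel_measurable (hypM \<gamma>)"
    and h [measurable]: "h \<in> borel_measurable borel"
    and a: "0 < a" and c: "0 \<le> c" and K: "0 \<le> K" and c0: "0 < c0" and D: "0 < D"
    and h0: "\<And>u. 0 < u \<Longrightarrow> 0 \<le> h u"
    and h1: "\<And>u. 0 < u \<Longrightarrow> h u \<le> 1 / (1 + c0 * (ln u)\<^sup>2)"
    and h2: "\<And>u. 0 < u \<Longrightarrow> h u * u powr (\<sigma> + 1) \<le> D / (1 + (ln u)\<^sup>2)"
    and L: "\<And>\<alpha>. 0 < \<alpha> \<Longrightarrow> 0 < L \<alpha>" and X: "\<And>\<alpha>. 0 < \<alpha> \<Longrightarrow> 0 \<le> X \<alpha>"
    and FX: "\<And>\<alpha> s \<theta>. 0 < \<alpha> \<Longrightarrow> F (pt \<gamma> \<alpha> s \<theta>) = ennreal (X \<alpha> / cmod (Complex (L \<alpha>) (s - t)) ^ (k + 2))"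
    and XL: "\<And>\<alpha>. 0 < \<alpha> \<Longrightarrow> \<alpha> powr r * (X \<alpha> / L \<alpha> ^ (k + 1))
        = K * real (k + 1) * (h (\<alpha> / a) ^ (k + 1) * (\<alpha> / a) powr \<sigma>) * a powr (- \<beta> - 1)"
  shows "(\<integral>\<^sup>+z. F z \<partial>wmu \<gamma> c r)
      \<le> ennreal (c * (2 * pi) * (pi * sqrt 2) * K * (D * pi / sqrt (min c0 1)) * a powr (- \<beta>))"
proof -
  let ?k = "real k + 1"
  let ?H = "\<lambda>u. ennreal (indicator {0<..} u * (h u ^ (k + 1) * u powr \<sigma>))"
  let ?C = "2 * pi * (pi * sqrt 2 / sqrt ?k) * (K * ?k * a powr (- \<beta> - 1))"
  have inner: "(\<integral>\<^sup>+s. (\<integral>\<^sup>+\<theta>. F (pt \<gamma> \<alpha> s \<theta>) \<partial>angular) \<partial>lborel)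
      \<le> ennreal (2 * pi * (pi * sqrt 2 / sqrt ?k) * (X \<alpha> / L \<alpha> ^ (k + 1)))" if \<alpha>: "0 < \<alpha>" for \<alpha>
  proof -
    have "(\<integral>\<^sup>+s. (\<integral>\<^sup>+\<theta>. F (pt \<gamma> \<alpha> s \<theta>) \<partial>angular) \<partial>lborel)
        = (\<integral>\<^sup>+s. ennreal (2 * pi * X \<alpha>) * ennreal (1 / cmod (Complex (L \<alpha>) (s - t)) ^ (k + 2)) \<partial>lborel)"
    proof (intro nn_integral_cong)
      fix s :: real
      have "(\<integral>\<^sup>+\<theta>. F (pt \<gamma> \<alpha> s \<theta>) \<partial>angular) = ennreal (X \<alpha> / cmod (Complex (L \<alpha>) (s - t)) ^ (k + 2)) * ennreal (2 * pi)"
        unfolding FX[OF \<alpha>] by (simp add: emeasure_angular)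
      also have "\<dots> = ennreal (2 * pi * X \<alpha>) * ennreal (1 / cmod (Complex (L \<alpha>) (s - t)) ^ (k + 2))"
        using X[OF \<alpha>] by (subst (1 2) ennreal_mult[symmetric]) (auto simp: mult_ac)
      finally show "(\<integral>\<^sup>+\<theta>. F (pt \<gamma> \<alpha> s \<theta>) \<partial>angular)
          = ennreal (2 * pi * X \<alpha>) * ennreal (1 / cmod (Complex (L \<alpha>) (s - t)) ^ (k + 2))" .
    qed
    also have "\<dots> = ennreal (2 * pi * X \<alpha>) * (\<integral>\<^sup>+s. ennreal (1 / cmod (Complex (L \<alpha>) (s - t)) ^ (k + 2)) \<partial>lborel)"
      unfolding cmod_def by (rule nn_integral_cmult) simp
    also have "\<dots> \<le> ennreal (2 * pi * X \<alpha>) * ennreal (pi * sqrt 2 / (sqrt ?k * L \<alpha> ^ (k + 1)))"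
      by (intro mult_left_mono nn_integral_inverse_norm_power L \<alpha>) simp
    also have "\<dots> = ennreal (2 * pi * (pi * sqrt 2 / sqrt ?k) * (X \<alpha> / L \<alpha> ^ (k + 1)))"
      using X[OF \<alpha>] L[OF \<alpha>] by (subst ennreal_mult[symmetric]) (auto simp: field_simps)
    finally show ?thesis .
  qed
  have C0: "0 \<le> ?C" using K by (intro mult_nonneg_nonneg) auto
  have "(\<integral>\<^sup>+\<alpha>. (\<integral>\<^sup>+s. (\<integral>\<^sup>+\<theta>. F (pt \<gamma> \<alpha> s \<theta>) \<partial>angular) \<partial>lborel) \<partial>radial r)
      = (\<integral>\<^sup>+\<alpha>. ennreal (indicator {0<..} \<alpha> * \<alpha> powr r) * (\<integral>\<^sup>+s. (\<integral>\<^sup>+\<theta>. F (pt \<gamma> \<alpha> s \<theta>) \<partial>angular) \<partial>lborel) \<partial>lborel)"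
    by (rule nn_integral_radial) measurable
  also have "\<dots> \<le> (\<integral>\<^sup>+\<alpha>. ennreal ?C * ?H (\<alpha> / a) \<partial>lborel)"
  proof (rule nn_integral_mono)
    fix \<alpha> :: real
    show "ennreal (indicator {0<..} \<alpha> * \<alpha> powr r) * (\<integral>\<^sup>+s. (\<integral>\<^sup>+\<theta>. F (pt \<gamma> \<alpha> s \<theta>) \<partial>angular) \<partial>lborel)
        \<le> ennreal ?C * ?H (\<alpha> / a)"
    proof (cases "0 < \<alpha>")
      case True
      have "ennreal (indicator {0<..} \<alpha> * \<alpha> powr r) * (\<integral>\<^sup>+s. (\<integral>\<^sup>+\<theta>. F (pt \<gamma> \<alpha> s \<theta>) \<partial>angular) \<partial>lborel)
          \<le> ennreal (\<alpha> powr r) * ennreal (2 * pi * (pi * sqrt 2 / sqrt ?k) * (X \<alpha> / L \<alpha> ^ (k + 1)))"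
        using True by (intro mult_mono inner) auto
      also have "\<dots> = ennreal (2 * pi * (pi * sqrt 2 / sqrt ?k) * (\<alpha> powr r * (X \<alpha> / L \<alpha> ^ (k + 1))))"
        using X[OF True] L[OF True] by (subst ennreal_mult[symmetric]) (auto simp: mult_ac)
      also have "\<dots> = ennreal (?C * (h (\<alpha> / a) ^ (k + 1) * (\<alpha> / a) powr \<sigma>))"
        unfolding XL[OF True] by (simp add: mult_ac add.commute)
      also have "\<dots> = ennreal ?C * ?H (\<alpha> / a)"
        using True a C0 h0[of "\<alpha> / a"] by (subst ennreal_mult) auto
      finally show ?thesis .
    qed simp
  qed
  also have "\<dots> = ennreal ?C * (\<integral>\<^sup>+\<alpha>. ?H (\<alpha> / a) \<partial>lborel)"
    by (rule nn_integral_cmult) measurable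
  also have "(\<integral>\<^sup>+\<alpha>. ?H (\<alpha> / a) \<partial>lborel) = ennreal \<bar>a\<bar> * (\<integral>\<^sup>+u. ?H ((0 + a * u) / a) \<partial>lborel)"
    using a by (intro nn_integral_real_affine) auto
  also have "(\<integral>\<^sup>+u. ?H ((0 + a * u) / a) \<partial>lborel) = (\<integral>\<^sup>+u. ?H u \<partial>lborel)"
    using a by simp
  also have "ennreal ?C * (ennreal \<bar>a\<bar> * (\<integral>\<^sup>+u. ?H u \<partial>lborel))
      \<le> ennreal ?C * (ennreal \<bar>a\<bar> * ennreal (D * pi / (sqrt (min c0 1) * sqrt ?k)))"
    using h0 h1 h2 by (intro mult_left_mono radial_integral_bound[OF c0 D]) auto
  also have "\<dots> = ennreal (2 * pi * (pi * sqrt 2) * K * (D * pi / sqrt (min c0 1)) * a powr (- \<beta>))"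
  proof -
    have "sqrt ?k * sqrt ?k = ?k" by simp
    then have "?k / (sqrt ?k * sqrt ?k) = 1" by simp
    have ap: "a powr (- \<beta> - 1) * a = a powr (- \<beta>)"
      using a by (simp add: powr_diff)
    have "?C * (a * (D * pi / (sqrt (min c0 1) * sqrt ?k)))
        = 2 * pi * (pi * sqrt 2) * K * (D * pi / sqrt (min c0 1)) * (a powr (- \<beta> - 1) * a) * (?k / (sqrt ?k * sqrt ?k))"
      by (simp add: divide_simps)
    also have "\<dots> = 2 * pi * (pi * sqrt 2) * K * (D * pi / sqrt (min c0 1)) * a powr (- \<beta>)"
      unfolding \<open>?k / (sqrt ?k * sqrt ?k) = 1\<close> ap by simp
    finally have "?C * (a * (D * pi / (sqrt (min c0 1) * sqrt ?k)))
        = 2 * pi * (pi * sqrt 2) * K * (D * pi / sqrt (min c0 1)) * a powr (- \<beta>)" .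
    moreover have "0 \<le> D * pi / (sqrt (min c0 1) * sqrt ?k)" using D c0 by simp
    ultimately show ?thesis
      using C0 a by (simp only: ennreal_mult[symmetric] abs_of_pos mult_nonneg_nonneg less_imp_le)
  qed
  finally have "(\<integral>\<^sup>+\<alpha>. (\<integral>\<^sup>+s. (\<integral>\<^sup>+\<theta>. F (pt \<gamma> \<alpha> s \<theta>) \<partial>angular) \<partial>lborel) \<partial>radial r)
      \<le> ennreal (2 * pi * (pi * sqrt 2) * K * (D * pi / sqrt (min c0 1)) * a powr (- \<beta>))" .
  then have "ennreal c * (\<integral>\<^sup>+\<alpha>. (\<integral>\<^sup>+s. (\<integral>\<^sup>+\<theta>. F (pt \<gamma> \<alpha> s \<theta>) \<partial>angular) \<partial>lborel) \<partial>radial r)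
      \<le> ennreal c * ennreal (2 * pi * (pi * sqrt 2) * K * (D * pi / sqrt (min c0 1)) * a powr (- \<beta>))"
    by (rule mult_left_mono) simp
  also have "\<dots> = ennreal (c * (2 * pi) * (pi * sqrt 2) * K * (D * pi / sqrt (min c0 1)) * a powr (- \<beta>))"
    using c K D c0 by (subst ennreal_mult[symmetric]) (auto simp: mult_ac)
  finally show ?thesis
    by (subst nn_integral_wmu) auto
qed

lemma profile_ln:
  assumes \<gamma>: "1 < \<gamma>" and a: "0 < a" and b: "0 < b"
  shows "\<gamma> * a * b powr (\<gamma> - 1) / ((\<gamma> - 1) * b powr \<gamma> + a powr \<gamma>) = profile \<gamma> (ln (b / a))"
proof -
  have 1: "(b / a) * (a * b powr (\<gamma> - 1)) = b powr \<gamma>"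
    using a b by (simp add: powr_diff)
  have "exp (- (\<gamma> - 1) * ln (b / a)) = (b / a) powr (- (\<gamma> - 1))"
    using a b by (simp add: powr_def)
  also have "\<dots> = a powr (\<gamma> - 1) / b powr (\<gamma> - 1)"
    unfolding powr_minus using a b by (simp add: powr_divide)
  finally have "exp (- (\<gamma> - 1) * ln (b / a)) * (a * b powr (\<gamma> - 1)) = a * a powr (\<gamma> - 1)"
    using b by simp
  also have "\<dots> = a powr \<gamma>" using a by (simp add: powr_diff)
  finally have 2: "exp (- (\<gamma> - 1) * ln (b / a)) * (a * b powr (\<gamma> - 1)) = a powr \<gamma>" .
  have "(\<gamma> - 1) * b powr \<gamma> + a powr \<gamma>
      = ((\<gamma> - 1) * exp (ln (b / a)) + exp (- (\<gamma> - 1) * ln (b / a))) * (a * b powr (\<gamma> - 1))"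
    unfolding distrib_right 2 using a b by (simp only: exp_ln divide_pos_pos mult.assoc 1)
  moreover have "a * b powr (\<gamma> - 1) \<noteq> 0" using a b by simp
  ultimately show ?thesis unfolding profile_def by simp
qed

lemma profile_nonneg: "1 < \<gamma> \<Longrightarrow> 0 \<le> profile \<gamma> t"
  by (simp add: profile_def add_nonneg_nonneg)

lemma profile_measurable [measurable]: "profile \<gamma> \<in> borel_measurable borel"
  unfolding profile_def[abs_def] by measurable

text \<open>
  The exponent is \<open>(1 + r) / 2\<close>, where \<open>r = (\<gamma> + 1) / 3\<close> is the exponent of the preferred measure. For
  this choice the row and the column integrals reduce to the same radial integral, up to the
  inversion \<open>u \<mapsto> 1 / u\<close>.
\<close>

definition schur_weight :: "real \<Rightarrow> complex \<times> complex \<Rightarrow> real" where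
  "schur_weight \<gamma> z = cmod (fst z) powr (- ((\<gamma> + 4) / 6))"

lemma pref_kernel_schur:
  assumes \<gamma>: "1 < \<gamma>"
  shows "\<exists>C. \<forall>k. schur (pref_measure \<gamma>) (schur_weight \<gamma>) C (pref_kernel \<gamma> k)"
proof -
  let ?r = "(\<gamma> + 1) / 3"
  let ?\<beta> = "(\<gamma> + 4) / 6"
  let ?\<rho> = "(\<gamma> - 1) powr (-1/3)"
  have \<beta>: "0 < ?\<beta>" "?\<beta> < \<gamma>" using \<gamma> by auto
  obtain c where c: "0 < c" and pc: "\<And>t. profile \<gamma> t \<le> 1 / (1 + c * t\<^sup>2)"
    using profile_le[OF \<gamma>] by blast
  obtain D where D: "0 < D" and pD: "\<And>t. profile \<gamma> t * exp ((1 - ?\<beta>) * t) \<le> D / (1 + t\<^sup>2)"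
    using profile_decay[OF \<gamma> \<beta>] by blast
  let ?K = "?\<rho> / \<gamma>"
  have K: "0 \<le> ?K" using \<gamma> by simp
  let ?C = "pref_const \<gamma> * (2 * pi) * (pi * sqrt 2) * ?K * (D * pi / sqrt (min c 1))"
  have C: "0 \<le> ?C" using K D c \<gamma> by (intro mult_nonneg_nonneg divide_nonneg_nonneg) auto
  have sw [measurable]: "schur_weight \<gamma> \<in> borel_measurable (hypM \<gamma>)"
    unfolding schur_weight_def[abs_def] by measurable
  have row: "(\<integral>\<^sup>+\<zeta>. ennreal (cmod (pref_kernel \<gamma> k z \<zeta>) * schur_weight \<gamma> \<zeta>) \<partial>pref_measure \<gamma>) \<le> ennreal (?C * schur_weight \<gamma> z)"
    if z: "z \<in> hyp \<gamma>" "fst z \<noteq> 0" for z k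
  proof -
    note [measurable] = pref_kernel_measurable2[OF z(1)]
    define a where "a = cmod (fst z)"
    have a: "0 < a" using z(2) by (simp add: a_def)
    define L where "L \<alpha> = (\<gamma> - 1) * \<alpha> powr \<gamma> + a powr \<gamma>" for \<alpha>
    have L: "0 < L \<alpha>" for \<alpha> unfolding L_def using \<gamma> a by (intro add_nonneg_pos) auto
    define X where "X \<alpha> = real (k + 1) * (\<gamma> * a * \<alpha> powr (\<gamma> - 1)) ^ k
        * (?\<rho> * \<alpha> powr (\<gamma> - 1 - ?r)) * \<alpha> powr (- ?\<beta>)" for \<alpha>
    show ?thesis
      unfolding schur_weight_def[of \<gamma> z] a_def[symmetric] pref_measure_wmu
    proof (rule polar_kernel_bound[where h="\<lambda>u. profile \<gamma> (ln u)" and \<sigma>="- ?\<beta>" and X=X and L=L and t="Re (snd z)" and k=k])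
      show "profile \<gamma> (ln u) * u powr (- ?\<beta> + 1) \<le> D / (1 + (ln u)\<^sup>2)" if "0 < u" for u
        using pD[of "ln u"] that by (simp add: powr_def add.commute)
      show "ennreal (cmod (pref_kernel \<gamma> k z (pt \<gamma> \<alpha> s \<theta>)) * schur_weight \<gamma> (pt \<gamma> \<alpha> s \<theta>))
          = ennreal (X \<alpha> / cmod (Complex (L \<alpha>) (s - Re (snd z))) ^ (k + 2))" if "0 < \<alpha>" for \<alpha> s \<theta>
        using that \<gamma>
        by (simp add: pref_kernel_def norm_mult cmod_leray_kernel schur_weight_def X_def L_def a_def[symmetric] mult_ac
            del: power_Suc of_nat_Suc of_nat_add)
      show "\<alpha> powr ?r * (X \<alpha> / L \<alpha> ^ (k + 1))
          = ?K * real (k + 1) * (profile \<gamma> (ln (\<alpha> / a)) ^ (k + 1) * (\<alpha> / a) powr - ?\<beta>) * a powr (- ?\<beta> - 1)"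
        if \<alpha>: "0 < \<alpha>" for \<alpha>
      proof -
        have p: "profile \<gamma> (ln (\<alpha> / a)) = \<gamma> * a * \<alpha> powr (\<gamma> - 1) / L \<alpha>"
          unfolding L_def by (rule profile_ln[OF \<gamma> a \<alpha>, symmetric])
        have e1: "\<alpha> powr ?r * \<alpha> powr (\<gamma> - 1 - ?r) = \<alpha> powr (\<gamma> - 1)"
          by (simp add: powr_add[symmetric])
        have e2: "(\<alpha> / a) powr - ?\<beta> * a powr (- ?\<beta> - 1) = \<alpha> powr - ?\<beta> / a"
          using a \<alpha> by (simp add: powr_divide powr_diff)
        have "\<alpha> powr ?r * (X \<alpha> / L \<alpha> ^ (k + 1))
            = ?\<rho> * real (k + 1) * (\<gamma> * a * \<alpha> powr (\<gamma> - 1)) ^ k * (\<alpha> powr ?r * \<alpha> powr (\<gamma> - 1 - ?r)) * \<alpha> powr - ?\<beta> / L \<alpha> ^ (k + 1)"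
          unfolding X_def by (simp add: mult_ac)
        also have "\<dots> = ?K * real (k + 1) * ((\<gamma> * a * \<alpha> powr (\<gamma> - 1)) ^ (k + 1) / L \<alpha> ^ (k + 1)) * (\<alpha> powr - ?\<beta> / a)"
          unfolding e1 using \<gamma> a by (simp add: field_simps del: of_nat_Suc of_nat_add)
        also have "\<dots> = ?K * real (k + 1) * (profile \<gamma> (ln (\<alpha> / a)) ^ (k + 1) * (\<alpha> / a) powr - ?\<beta>) * a powr (- ?\<beta> - 1)"
          unfolding p power_divide e2[symmetric] by (simp only: mult.assoc)
        finally show ?thesis .
      qed
      show "0 \<le> X \<alpha>" if "0 < \<alpha>" for \<alpha> unfolding X_def using \<gamma> a by (intro mult_nonneg_nonneg zero_le_power) auto
      show "profile \<gamma> (ln u) \<le> 1 / (1 + c * (ln u)\<^sup>2)" for u by (rule pc)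
    qed (use a K c D L profile_nonneg[OF \<gamma>] in auto)
  qed
  have col: "(\<integral>\<^sup>+z. ennreal (cmod (pref_kernel \<gamma> k z \<zeta>) * schur_weight \<gamma> z) \<partial>pref_measure \<gamma>) \<le> ennreal (?C * schur_weight \<gamma> \<zeta>)"
    if z: "\<zeta> \<in> hyp \<gamma>" "fst \<zeta> \<noteq> 0" for \<zeta> k
  proof -
    note [measurable] = pref_kernel_measurable2[OF z(1)]
    define b where "b = cmod (fst \<zeta>)"
    have b: "0 < b" using z(2) by (simp add: b_def)
    define L where "L \<alpha> = (\<gamma> - 1) * b powr \<gamma> + \<alpha> powr \<gamma>" for \<alpha>
    have L: "0 < L \<alpha>" for \<alpha> unfolding L_def using \<gamma> b by (intro add_pos_nonneg) auto
    define X where "X \<alpha> = real (k + 1) * (\<gamma> * \<alpha> * b powr (\<gamma> - 1)) ^ k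
        * (?\<rho> * b powr (\<gamma> - 1 - ?r)) * \<alpha> powr (- ?\<beta>)" for \<alpha>
    have cswap: "cmod (Complex l (x - y)) = cmod (Complex l (y - x))" for l x y
      by (simp add: cmod_def power2_commute)
    show ?thesis
      unfolding schur_weight_def[of \<gamma> \<zeta>] b_def[symmetric] pref_measure_wmu
    proof (rule polar_kernel_bound[where h="\<lambda>u. profile \<gamma> (- ln u)" and \<sigma>="?\<beta> - 2" and X=X and L=L and t="Re (snd \<zeta>)" and k=k])
      show "profile \<gamma> (- ln u) * u powr (?\<beta> - 2 + 1) \<le> D / (1 + (ln u)\<^sup>2)" if "0 < u" for u
      proof -
        have e: "(x - 2 + 1) * l = (1 - x) * (- l)" for x l :: real by (simp add: algebra_simps)
        have "u powr (?\<beta> - 2 + 1) = exp ((?\<beta> - 2 + 1) * ln u)"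
          using that unfolding powr_def by simp
        then have "u powr (?\<beta> - 2 + 1) = exp ((1 - ?\<beta>) * (- ln u))"
          unfolding e .
        then show ?thesis using pD[of "- ln u"] by simp
      qed
      show "ennreal (cmod (pref_kernel \<gamma> k (pt \<gamma> \<alpha> s \<theta>) \<zeta>) * schur_weight \<gamma> (pt \<gamma> \<alpha> s \<theta>))
          = ennreal (X \<alpha> / cmod (Complex (L \<alpha>) (s - Re (snd \<zeta>))) ^ (k + 2))" if "0 < \<alpha>" for \<alpha> s \<theta>
        using that \<gamma> cswap[of "L \<alpha>" s "Re (snd \<zeta>)"]
        by (simp add: pref_kernel_def norm_mult cmod_leray_kernel schur_weight_def X_def L_def b_def[symmetric] rho_def mult_ac
            del: power_Suc of_nat_Suc of_nat_add)
      show "\<alpha> powr ?r * (X \<alpha> / L \<alpha> ^ (k + 1))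
          = ?K * real (k + 1) * (profile \<gamma> (- ln (\<alpha> / b)) ^ (k + 1) * (\<alpha> / b) powr (?\<beta> - 2)) * b powr (- ?\<beta> - 1)"
        if \<alpha>: "0 < \<alpha>" for \<alpha>
      proof -
        have "- ln (\<alpha> / b) = ln (b / \<alpha>)" using \<alpha> b by (simp add: ln_div)
        then have p: "profile \<gamma> (- ln (\<alpha> / b)) = \<gamma> * \<alpha> * b powr (\<gamma> - 1) / L \<alpha>"
          unfolding L_def using profile_ln[OF \<gamma> \<alpha> b] by simp
        have e1: "\<alpha> powr ?r * \<alpha> powr (- ?\<beta>) = \<alpha> powr (?\<beta> - 2) * \<alpha>"
        proof -
          have "?r + - ?\<beta> = (?\<beta> - 2) + 1" by (simp add: field_simps)
          then have "\<alpha> powr ?r * \<alpha> powr (- ?\<beta>) = \<alpha> powr ((?\<beta> - 2) + 1)"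
            by (simp only: powr_add[symmetric])
          then show ?thesis using \<alpha> by (simp only: powr_add powr_one)
        qed
        have e2: "(\<alpha> / b) powr (?\<beta> - 2) * b powr (- ?\<beta> - 1) = \<alpha> powr (?\<beta> - 2) * b powr (- ?r)"
        proof -
          have "- ?\<beta> - 1 = (?\<beta> - 2) + - ?r" by (simp add: field_simps)
          then have "b powr (- ?\<beta> - 1) = b powr (?\<beta> - 2) * b powr (- ?r)"
            by (simp only: powr_add)
          then show ?thesis using \<alpha> b by (simp add: powr_divide)
        qed
        have e3: "b powr (\<gamma> - 1 - ?r) = b powr (\<gamma> - 1) * b powr (- ?r)"
          by (simp only: powr_add[symmetric] diff_conv_add_uminus)
        have "\<alpha> powr ?r * (X \<alpha> / L \<alpha> ^ (k + 1))
            = ?\<rho> * real (k + 1) * (\<gamma> * \<alpha> * b powr (\<gamma> - 1)) ^ k * b powr (\<gamma> - 1 - ?r) * (\<alpha> powr ?r * \<alpha> powr - ?\<beta>) / L \<alpha> ^ (k + 1)"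
          unfolding X_def by (simp add: mult_ac)
        also have "\<dots> = ?K * real (k + 1) * ((\<gamma> * \<alpha> * b powr (\<gamma> - 1)) ^ (k + 1) / L \<alpha> ^ (k + 1)) * (\<alpha> powr (?\<beta> - 2) * b powr (- ?r))"
          unfolding e1 e3 using \<gamma> by (simp add: field_simps del: of_nat_Suc of_nat_add)
        also have "\<dots> = ?K * real (k + 1) * (profile \<gamma> (- ln (\<alpha> / b)) ^ (k + 1) * (\<alpha> / b) powr (?\<beta> - 2)) * b powr (- ?\<beta> - 1)"
          unfolding p power_divide e2[symmetric] by (simp only: mult.assoc)
        finally show ?thesis .
      qed
      show "0 \<le> X \<alpha>" if "0 < \<alpha>" for \<alpha> unfolding X_def using \<gamma> b that by (intro mult_nonneg_nonneg zero_le_power) auto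
      show "profile \<gamma> (- ln u) \<le> 1 / (1 + c * (ln u)\<^sup>2)" for u using pc[of "- ln u"] by simp
    qed (use b K c D L profile_nonneg[OF \<gamma>] in auto)
  qed
  have ae: "AE z in pref_measure \<gamma>. z \<in> hyp \<gamma> \<and> fst z \<noteq> 0"
    using AE_wmu_fst_nonzero[of \<gamma> "pref_const \<gamma>" ?r] AE_space[of "wmu \<gamma> (pref_const \<gamma>) ?r"]
    unfolding pref_measure_wmu by eventually_elim simp
  have "schur (pref_measure \<gamma>) (schur_weight \<gamma>) ?C (pref_kernel \<gamma> k)" for k
    unfolding schur_def
  proof (intro conjI)
    show "(\<lambda>(x, y). pref_kernel \<gamma> k x y) \<in> borel_measurable (pref_measure \<gamma> \<Otimes>\<^sub>M pref_measure \<gamma>)"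
      by (rule pref_kernel_measurable)
    show "schur_weight \<gamma> \<in> borel_measurable (pref_measure \<gamma>)" using sw by (simp cong: measurable_cong_sets)
    show "AE x in pref_measure \<gamma>. 0 < schur_weight \<gamma> x"
      using ae by eventually_elim (simp add: schur_weight_def)
    show "0 \<le> ?C" by (rule C)
    show "AE x in pref_measure \<gamma>. (\<integral>\<^sup>+y. ennreal (cmod (pref_kernel \<gamma> k x y) * schur_weight \<gamma> y) \<partial>pref_measure \<gamma>) \<le> ennreal (?C * schur_weight \<gamma> x)"
      using ae by eventually_elim (use row in blast)
    show "AE y in pref_measure \<gamma>. (\<integral>\<^sup>+x. ennreal (cmod (pref_kernel \<gamma> k x y) * schur_weight \<gamma> x) \<partial>pref_measure \<gamma>) \<le> ennreal (?C * schur_weight \<gamma> y)"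
      using ae by eventually_elim (use col in blast)
  qed
  then show ?thesis by blast
qed

lemma integral_radial:
  fixes G :: "real \<Rightarrow> complex"
  assumes [measurable]: "G \<in> borel_measurable borel"
  shows "(LINT \<alpha>|radial r. G \<alpha>) = (LINT \<alpha>|lborel. indicator {0<..} \<alpha> *\<^sub>R (of_real (\<alpha> powr r) * G \<alpha>))"
proof -
  have "(LINT \<alpha>|radial r. G \<alpha>) = (LINT \<alpha>|lborel. (indicator {0<..} \<alpha> * \<alpha> powr r) *\<^sub>R G \<alpha>)"
    unfolding radial_def by (subst integral_density) auto
  then show ?thesis by (simp add: scaleR_conv_of_real mult_ac)
qed

lemma integral_angular:
  fixes G :: "real \<Rightarrow> complex"
  assumes [measurable]: "G \<in> borel_measurable borel"
  shows "(LINT \<theta>|angular. G \<theta>) = (LINT \<theta>|lborel. indicator {0..<2 * pi} \<theta> *\<^sub>R G \<theta>)"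
  unfolding angular_def by (subst integral_density) auto

lemma integral_angular_const: "(LINT \<theta>|angular. (c :: complex)) = of_real (2 * pi) * c"
  by (simp add: measure_def emeasure_angular scaleR_conv_of_real)

lemma integral_angular_cis:
  fixes m :: int
  assumes "m \<noteq> 0"
  shows "(LINT \<theta>|angular. cis (of_int m * \<theta>)) = 0"
proof -
  let ?F = "\<lambda>\<theta>. cis (of_int m * \<theta>) / (\<i> * of_int m)"
  have d: "(?F has_vector_derivative cis (of_int m * \<theta>)) (at \<theta> within X)" for \<theta> X
  proof -
    have "((\<lambda>z. exp (\<i> * (of_int m * z)) / (\<i> * of_int m)) has_field_derivative exp (\<i> * (of_int m * of_real \<theta>))) (at (of_real \<theta>))"
      using assms by (auto intro!: derivative_eq_intros simp: mult_ac)
    from has_vector_derivative_real_field[OF this]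
    have "(?F has_vector_derivative cis (of_int m * \<theta>)) (at \<theta>)" by (simp add: cis_conv_exp)
    then show ?thesis by (rule has_vector_derivative_at_within)
  qed
  have "(LINT \<theta>|angular. cis (of_int m * \<theta>)) = (LINT \<theta>|lborel. indicator {0..<2 * pi} \<theta> *\<^sub>R cis (of_int m * \<theta>))"
    by (rule integral_angular) measurable
  also have "\<dots> = (LINT \<theta>|lborel. indicator {0..2 * pi} \<theta> *\<^sub>R cis (of_int m * \<theta>))"
  proof (rule integral_cong_AE)
    show "AE \<theta> in lborel. indicator {0..<2 * pi} \<theta> *\<^sub>R cis (of_int m * \<theta>) = indicator {0..2 * pi} \<theta> *\<^sub>R cis (of_int m * \<theta>)"
      using AE_lborel_singleton[of "2 * pi"] by eventually_elim (auto simp: indicator_def)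
  qed measurable
  also have "\<dots> = ?F (2 * pi) - ?F 0"
    by (rule integral_FTC_atLeastAtMost) (auto intro!: d continuous_intros)
  also have "cis (of_int m * (2 * pi)) = 1"
    by (simp add: cis.ctr complex_eq_iff) (metis cos_int_2pin sin_int_2pin mult.commute)
  finally show ?thesis by simp
qed

text \<open>
  The integral over the angle contains the factor \<open>\<integral> e\<^sup>i\<^sup>m\<^sup>\<theta> d\<theta> = 0\<close>. A function that is not integrable has
  integral zero by convention.
\<close>

lemma integral_wmu_rotation_weight:
  fixes m :: int
  assumes c: "0 \<le> c" and m: "m \<noteq> 0"
    and rot: "\<And>\<alpha> s \<theta>. \<Phi> (pt \<gamma> \<alpha> s \<theta>) = cis (of_int m * \<theta>) * \<Phi> (pt \<gamma> \<alpha> s 0)"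
  shows "(LINT z|wmu \<gamma> c r. (\<Phi> z :: complex)) = 0"
proof (cases "integrable (wmu \<gamma> c r) \<Phi>")
  case True
  have "(LINT \<theta>|angular. \<Phi> (pt \<gamma> \<alpha> s \<theta>)) = 0" for \<alpha> s
  proof -
    have "(LINT \<theta>|angular. \<Phi> (pt \<gamma> \<alpha> s \<theta>)) = (LINT \<theta>|angular. cis (of_int m * \<theta>) * \<Phi> (pt \<gamma> \<alpha> s 0))"
      by (subst rot) (rule refl)
    then show ?thesis by (simp add: integral_angular_cis[OF m])
  qed
  then show ?thesis by (subst integral_wmu[OF True c]) simp
qed (rule not_integrable_integral_eq)

lemma cis_mult_weight:
  "cis (real j * \<theta>) * cis (- (real k * \<theta>)) = cis (of_int (int j - int k) * \<theta>)"
  by (simp add: cis_mult algebra_simps)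

lemma pref_kernel_orthogonal:
  assumes "j \<noteq> k"
  shows "(LINT y|pref_measure \<gamma>. pref_kernel \<gamma> j y x * cnj (pref_kernel \<gamma> k y z)) = 0"
    and "(LINT y|pref_measure \<gamma>. pref_kernel \<gamma> j x y * cnj (pref_kernel \<gamma> k z y)) = 0"
    and "(LINT y|pref_measure \<gamma>. pref_kernel \<gamma> j x y * pref_kernel \<gamma> k y z) = 0"
proof -
  have m: "int j - int k \<noteq> 0" "int k - int j \<noteq> 0" using assms by auto
  show "(LINT y|pref_measure \<gamma>. pref_kernel \<gamma> j y x * cnj (pref_kernel \<gamma> k y z)) = 0"
    unfolding pref_measure_wmu
  proof (rule integral_wmu_rotation_weight[OF pref_const_nonneg m(1)])
    fix \<alpha> s \<theta>
    show "pref_kernel \<gamma> j (pt \<gamma> \<alpha> s \<theta>) x * cnj (pref_kernel \<gamma> k (pt \<gamma> \<alpha> s \<theta>) z)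
        = cis (of_int (int j - int k) * \<theta>) * (pref_kernel \<gamma> j (pt \<gamma> \<alpha> s 0) x * cnj (pref_kernel \<gamma> k (pt \<gamma> \<alpha> s 0) z))"
      unfolding pref_kernel_phase(1)[of \<gamma> _ \<alpha> s \<theta>] cis_mult_weight[symmetric] complex_cnj_mult cis_cnj
      by (simp only: mult_ac)
  qed
  show "(LINT y|pref_measure \<gamma>. pref_kernel \<gamma> j x y * cnj (pref_kernel \<gamma> k z y)) = 0"
    unfolding pref_measure_wmu
  proof (rule integral_wmu_rotation_weight[OF pref_const_nonneg m(2)])
    fix \<alpha> s \<theta>
    show "pref_kernel \<gamma> j x (pt \<gamma> \<alpha> s \<theta>) * cnj (pref_kernel \<gamma> k z (pt \<gamma> \<alpha> s \<theta>))
        = cis (of_int (int k - int j) * \<theta>) * (pref_kernel \<gamma> j x (pt \<gamma> \<alpha> s 0) * cnj (pref_kernel \<gamma> k z (pt \<gamma> \<alpha> s 0)))"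
      unfolding pref_kernel_phase(2)[of \<gamma> _ _ \<alpha> s \<theta>] cis_mult_weight[symmetric] complex_cnj_mult cis_cnj
      by (simp only: mult_ac minus_minus)
  qed
  show "(LINT y|pref_measure \<gamma>. pref_kernel \<gamma> j x y * pref_kernel \<gamma> k y z) = 0"
    unfolding pref_measure_wmu
  proof (rule integral_wmu_rotation_weight[OF pref_const_nonneg m(2)])
    fix \<alpha> s \<theta>
    show "pref_kernel \<gamma> j x (pt \<gamma> \<alpha> s \<theta>) * pref_kernel \<gamma> k (pt \<gamma> \<alpha> s \<theta>) z
        = cis (of_int (int k - int j) * \<theta>) * (pref_kernel \<gamma> j x (pt \<gamma> \<alpha> s 0) * pref_kernel \<gamma> k (pt \<gamma> \<alpha> s 0) z)"
      unfolding pref_kernel_phase(2)[of \<gamma> _ _ \<alpha> s \<theta>] pref_kernel_phase(1)[of \<gamma> _ \<alpha> s \<theta>] cis_mult_weight[symmetric]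
      by (simp only: mult_ac)
  qed
qed

text \<open>
  The integral over \<open>s\<close> is a convolution of powers, which leaves a
  power of \<open>\<gamma> \<alpha>\<^sup>\<gamma> + A\<close> where \<open>A\<close> is the denominator for the outer points; the integral over \<open>\<alpha>\<close> is
  then a beta integral.
\<close>

lemma pref_kernel_reproducing:
  assumes \<gamma>: "1 < \<gamma>" and x: "x \<in> hyp \<gamma>" "fst x \<noteq> 0" and z: "z \<in> hyp \<gamma>" "fst z \<noteq> 0"
    and int: "integrable (pref_measure \<gamma>) (\<lambda>y. pref_kernel \<gamma> k x y * pref_kernel \<gamma> k y z)"
  shows "(LINT y|pref_measure \<gamma>. pref_kernel \<gamma> k x y * pref_kernel \<gamma> k y z) = pref_kernel \<gamma> k x z"
proof -
  let ?r = "(\<gamma> + 1) / 3"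
  let ?\<rho> = "(\<gamma> - 1) powr (-1/3)"
  note [measurable] = pref_kernel_measurable2[OF x(1)] pref_kernel_measurable2[OF z(1)]
  define A where "A = denom \<gamma> x z"
  have ReA: "0 < Re A"
    using \<gamma> x(2) by (simp add: A_def denom_def add_nonneg_pos)
  define p where "p = of_real \<gamma> * fst x * fst (dual_map \<gamma> z)"
  define q where "q = (of_nat (k + 1))\<^sup>2 * (of_real \<gamma> * p) ^ k * of_real ?\<rho> * of_real (rho \<gamma> z)"
  define cs where "cs = complex_of_real (2 * pi) * fact (2 * k + 2) / (fact (k + 1) * fact (k + 1))"
  have inner: "(LINT s|lborel. (LINT \<theta>|angular. pref_kernel \<gamma> k x (pt \<gamma> \<alpha> s \<theta>) * pref_kernel \<gamma> k (pt \<gamma> \<alpha> s \<theta>) z))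
      = of_real (2 * pi) * q * cs * (of_real (\<alpha> powr (\<gamma> * real k) * \<alpha> powr (\<gamma> - 1 - ?r)) * recip_power \<gamma> A \<alpha> ^ (2 * k + 3))"
    if \<alpha>: "0 < \<alpha>" for \<alpha>
  proof -
    define a where "a = Complex ((\<gamma> - 1) * \<alpha> powr \<gamma> + cmod (fst x) powr \<gamma>) (- Re (snd x))"
    define b where "b = Complex ((\<gamma> - 1) * cmod (fst z) powr \<gamma> + \<alpha> powr \<gamma>) (Re (snd z))"
    have a: "0 < Re a" and b: "0 < Re b"
      using \<gamma> x(2) z(2) \<alpha> by (simp_all add: a_def b_def add_nonneg_pos)
    have ab: "a + b = of_real (\<gamma> * \<alpha> powr \<gamma>) + A"
      by (simp add: a_def b_def A_def denom_def complex_eq_iff algebra_simps)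
    have w: "fst (dual_map \<gamma> (pt \<gamma> \<alpha> s 0)) * fst (pt \<gamma> \<alpha> s 0) = of_real (\<alpha> powr \<gamma>)" for s
    proof -
      have "\<alpha> powr (\<gamma> - 1) * \<alpha> = \<alpha> powr \<gamma>" using \<alpha> by (simp add: powr_diff)
      then show ?thesis
        unfolding dual_map_pt[OF \<gamma> \<alpha>] using \<alpha> by (simp add: pt_def flip: of_real_mult)
    qed
    have val: "pref_kernel \<gamma> k x (pt \<gamma> \<alpha> s \<theta>) * pref_kernel \<gamma> k (pt \<gamma> \<alpha> s \<theta>) z
        = q * of_real (\<alpha> powr (\<gamma> * real k) * \<alpha> powr (\<gamma> - 1 - ?r)) * (recip_plus a s ^ (k + 2) * recip_minus b s ^ (k + 2))" for s \<theta>
    proof -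
      have phase: "pref_kernel \<gamma> k x (pt \<gamma> \<alpha> s \<theta>) * pref_kernel \<gamma> k (pt \<gamma> \<alpha> s \<theta>) z = pref_kernel \<gamma> k x (pt \<gamma> \<alpha> s 0) * pref_kernel \<gamma> k (pt \<gamma> \<alpha> s 0) z"
        unfolding pref_kernel_phase(2)[of \<gamma> _ _ \<alpha> s \<theta>] pref_kernel_phase(1)[of \<gamma> _ \<alpha> s \<theta>]
        using cis_mult_weight[of k \<theta> k] by (simp add: mult_ac)
      have KU: "denom \<gamma> x (pt \<gamma> \<alpha> s 0) = a + \<i> * of_real s" and KV: "denom \<gamma> (pt \<gamma> \<alpha> s 0) z = b - \<i> * of_real s"
        using \<alpha> by (simp_all add: a_def b_def complex_eq_iff)
      have pw: "of_real (\<alpha> powr (\<gamma> * real k)) = (of_real (\<alpha> powr \<gamma>)) ^ k"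
        using \<alpha> by (simp add: powr_powr[symmetric] powr_realpow)
      have f1: "(of_real \<gamma> * fst x * fst (dual_map \<gamma> (pt \<gamma> \<alpha> s 0))) ^ k * (of_real \<gamma> * fst (pt \<gamma> \<alpha> s 0) * fst (dual_map \<gamma> z)) ^ k
          = (of_real \<gamma> * p) ^ k * of_real (\<alpha> powr (\<gamma> * real k))"
        unfolding pw w[of s, symmetric] p_def power_mult_distrib by (simp only: mult_ac)
      have f2: "complex_of_real (rho \<gamma> (pt \<gamma> \<alpha> s 0)) = of_real ?\<rho> * of_real (\<alpha> powr (\<gamma> - 1 - ?r))"
        using \<alpha> by simp
      have f3: "x1 / denom \<gamma> x (pt \<gamma> \<alpha> s 0) ^ (k + 2) = x1 * recip_plus a s ^ (k + 2)"
          "x1 / denom \<gamma> (pt \<gamma> \<alpha> s 0) z ^ (k + 2) = x1 * recip_minus b s ^ (k + 2)" for x1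
        by (simp_all only: KU KV recip_plus_def recip_minus_def power_inverse divide_inverse)
      have "pref_kernel \<gamma> k x (pt \<gamma> \<alpha> s 0) * pref_kernel \<gamma> k (pt \<gamma> \<alpha> s 0) z
          = of_nat (k + 1) * of_nat (k + 1)
            * ((of_real \<gamma> * fst x * fst (dual_map \<gamma> (pt \<gamma> \<alpha> s 0))) ^ k * (of_real \<gamma> * fst (pt \<gamma> \<alpha> s 0) * fst (dual_map \<gamma> z)) ^ k)
            * of_real (rho \<gamma> (pt \<gamma> \<alpha> s 0)) * of_real (rho \<gamma> z) * (recip_plus a s ^ (k + 2) * recip_minus b s ^ (k + 2))"
        unfolding pref_kernel_def leray_kernel_def f3 by (simp only: mult_ac)
      then show ?thesis
        unfolding phase f1 f2 q_def power2_eq_square of_real_mult by (simp only: mult_ac)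
    qed
    have "(LINT s|lborel. (LINT \<theta>|angular. pref_kernel \<gamma> k x (pt \<gamma> \<alpha> s \<theta>) * pref_kernel \<gamma> k (pt \<gamma> \<alpha> s \<theta>) z))
        = (LINT s|lborel. (of_real (2 * pi) * q * of_real (\<alpha> powr (\<gamma> * real k) * \<alpha> powr (\<gamma> - 1 - ?r))) * (recip_plus a s ^ (k + 2) * recip_minus b s ^ (k + 2)))"
      unfolding val integral_angular_const by (simp only: mult.assoc)
    also have "\<dots> = (of_real (2 * pi) * q * of_real (\<alpha> powr (\<gamma> * real k) * \<alpha> powr (\<gamma> - 1 - ?r))) * (LINT s|lborel. recip_plus a s ^ (k + 2) * recip_minus b s ^ (k + 2))"
      by (rule integral_mult_right_zero)
    also have "(LINT s|lborel. recip_plus a s ^ (k + 2) * recip_minus b s ^ (k + 2)) = cs * recip_power \<gamma> A \<alpha> ^ (2 * k + 3)"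
    proof -
      have "k + 2 = (k + 1) + 1" "k + (k + 1) + 1 = 2 * k + 2" "k + (k + 1) + 2 = 2 * k + 3" by simp_all
      then show ?thesis
        using integral_recip_product_power[OF a b, of k "k + 1"]
        unfolding ab cs_def recip_power_def[OF \<gamma> ReA] by (simp only: power_inverse divide_inverse inverse_mult_distrib mult_ac)
    qed
    finally show ?thesis by (simp only: mult_ac)
  qed
  have "(LINT y|pref_measure \<gamma>. pref_kernel \<gamma> k x y * pref_kernel \<gamma> k y z)
      = of_real (pref_const \<gamma>) * (LINT \<alpha>|radial ?r. (LINT s|lborel. (LINT \<theta>|angular. pref_kernel \<gamma> k x (pt \<gamma> \<alpha> s \<theta>) * pref_kernel \<gamma> k (pt \<gamma> \<alpha> s \<theta>) z)))"
    using int unfolding pref_measure_wmu by (rule integral_wmu) simp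
  also have "(LINT \<alpha>|radial ?r. (LINT s|lborel. (LINT \<theta>|angular. pref_kernel \<gamma> k x (pt \<gamma> \<alpha> s \<theta>) * pref_kernel \<gamma> k (pt \<gamma> \<alpha> s \<theta>) z)))
      = (LINT \<alpha>|lborel. indicator {0<..} \<alpha> *\<^sub>R (of_real (\<alpha> powr ?r) * (LINT s|lborel. (LINT \<theta>|angular. pref_kernel \<gamma> k x (pt \<gamma> \<alpha> s \<theta>) * pref_kernel \<gamma> k (pt \<gamma> \<alpha> s \<theta>) z))))"
    by (rule integral_radial) measurable
  also have "\<dots> = (LINT \<alpha>|lborel. (of_real (2 * pi) * q * cs) *
      (indicator {0<..} \<alpha> *\<^sub>R (of_real (\<alpha> powr (\<gamma> * real k + \<gamma> - 1)) * recip_power \<gamma> A \<alpha> ^ (k + (k + 1) + 2))))"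
  proof (intro Bochner_Integration.integral_cong refl)
    fix \<alpha> :: real
    show "indicator {0<..} \<alpha> *\<^sub>R (of_real (\<alpha> powr ?r) * (LINT s|lborel. (LINT \<theta>|angular. pref_kernel \<gamma> k x (pt \<gamma> \<alpha> s \<theta>) * pref_kernel \<gamma> k (pt \<gamma> \<alpha> s \<theta>) z)))
        = (of_real (2 * pi) * q * cs) * (indicator {0<..} \<alpha> *\<^sub>R (of_real (\<alpha> powr (\<gamma> * real k + \<gamma> - 1)) * recip_power \<gamma> A \<alpha> ^ (k + (k + 1) + 2)))"
    proof (cases "0 < \<alpha>")
      case True
      have "\<alpha> powr ?r * (\<alpha> powr (\<gamma> * real k) * \<alpha> powr (\<gamma> - 1 - ?r)) = \<alpha> powr (?r + (\<gamma> * real k + (\<gamma> - 1 - ?r)))"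
        by (simp only: powr_add)
      also have "?r + (\<gamma> * real k + (\<gamma> - 1 - ?r)) = \<gamma> * real k + \<gamma> - 1" by simp
      finally have e: "complex_of_real (\<alpha> powr (\<gamma> * real k + \<gamma> - 1))
          = of_real (\<alpha> powr ?r) * of_real (\<alpha> powr (\<gamma> * real k) * \<alpha> powr (\<gamma> - 1 - ?r))"
        by (simp only: of_real_mult[symmetric])
      have n: "k + (k + 1) + 2 = 2 * k + 3" by simp
      show ?thesis unfolding inner[OF True] e n using True by (simp add: mult_ac)
    qed simp
  qed
  also have "\<dots> = (of_real (2 * pi) * q * cs) * (fact k * fact (k + 1) / (fact (k + (k + 1) + 1) * of_real \<gamma> ^ (k + 2) * A ^ (k + 1 + 1)))"
    unfolding integral_mult_right_zero integral_recip_power[OF \<gamma> ReA] ..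
  also have "of_real (pref_const \<gamma>) * \<dots> = pref_kernel \<gamma> k x z"
  proof -
    have c: "pref_const \<gamma> * ?\<rho> * (2 * pi) * (2 * pi) = \<gamma>\<^sup>2"
      unfolding pref_const_mult[OF \<gamma>] by (simp add: power2_eq_square)
    let ?g = "complex_of_real \<gamma>"
    have n: "k + (k + 1) + 1 = 2 * k + 2" "k + 1 + 1 = k + 2" by simp_all
    have g0: "?g \<noteq> 0" using \<gamma> by simp
    have f: "of_nat (k + 1) * fact k = (fact (k + 1) :: complex)" by simp
    have nz: "fact (2 * k + 2) \<noteq> (0 :: complex)" "fact (k + 1) \<noteq> (0 :: complex)" by (simp_all del: fact_Suc)
    have "of_real (pref_const \<gamma>) * ((of_real (2 * pi) * q * cs) * (fact k * fact (k + 1) / (fact (2 * k + 2) * ?g ^ (k + 2) * A ^ (k + 2))))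
        = of_real (pref_const \<gamma> * ?\<rho> * (2 * pi) * (2 * pi)) * of_nat (k + 1) * (?g * p) ^ k * of_real (rho \<gamma> z)
          * ((of_nat (k + 1) * fact k) / fact (k + 1)) * (fact (2 * k + 2) / fact (2 * k + 2)) * (fact (k + 1) / fact (k + 1)) / (?g ^ (k + 2) * A ^ (k + 2))"
      unfolding q_def cs_def of_real_mult power2_eq_square
      by (simp only: divide_inverse inverse_mult_distrib mult_ac)
    also have "\<dots> = ?g\<^sup>2 * of_nat (k + 1) * (?g * p) ^ k * of_real (rho \<gamma> z) / (?g ^ (k + 2) * A ^ (k + 2))"
      unfolding c f divide_self[OF nz(1)] divide_self[OF nz(2)] of_real_power mult_1_right ..
    also have "\<dots> = of_nat (k + 1) * p ^ k * of_real (rho \<gamma> z) / A ^ (k + 2)"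
    proof -
      have e: "?g\<^sup>2 * of_nat (k + 1) * (?g * p) ^ k * of_real (rho \<gamma> z) = ?g ^ (k + 2) * (of_nat (k + 1) * p ^ k * of_real (rho \<gamma> z))"
        by (simp only: power_mult_distrib power_add mult_ac)
      show ?thesis
        unfolding e using g0 by (intro nonzero_mult_divide_mult_cancel_left power_not_zero)
    qed
    also have "\<dots> = pref_kernel \<gamma> k x z"
      by (simp only: pref_kernel_def leray_kernel_def A_def p_def times_divide_eq_left)
    finally show ?thesis unfolding n .
  qed
  finally show ?thesis .
qed

lemma AE_pref_hyp: "AE z in pref_measure \<gamma>. z \<in> hyp \<gamma> \<and> fst z \<noteq> 0"
  using AE_wmu_fst_nonzero[of \<gamma> "pref_const \<gamma>" "(\<gamma> + 1) / 3"] AE_space[of "wmu \<gamma> (pref_const \<gamma>) ((\<gamma> + 1) / 3)"]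
  unfolding pref_measure_wmu by eventually_elim simp

lemma L2_pref_measurable: "f \<in> vecs (L2 (pref_measure \<gamma>)) \<Longrightarrow> f \<in> borel_measurable (hypM \<gamma>)"
  by (simp add: L2_iff cong: measurable_cong_sets)

lemma pref_kernel_series:
  assumes \<gamma>: "1 < \<gamma>"
  shows "\<exists>C. schur_series (pref_measure \<gamma>) (schur_weight \<gamma>) C (pref_kernel \<gamma>)"
proof -
  obtain C where C: "\<And>k. schur (pref_measure \<gamma>) (schur_weight \<gamma>) C (pref_kernel \<gamma> k)"
    using pref_kernel_schur[OF \<gamma>] by blast
  interpret sigma_finite_measure "pref_measure \<gamma>"
    unfolding pref_measure_wmu by (rule sigma_finite_wmu)
  have "schur_series (pref_measure \<gamma>) (schur_weight \<gamma>) C (pref_kernel \<gamma>)"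
  proof
    show "AE x in pref_measure \<gamma>. AE z in pref_measure \<gamma>.
        integrable (pref_measure \<gamma>) (\<lambda>y. pref_kernel \<gamma> k x y * pref_kernel \<gamma> k y z) \<longrightarrow>
        (LINT y|pref_measure \<gamma>. pref_kernel \<gamma> k x y * pref_kernel \<gamma> k y z) = pref_kernel \<gamma> k x z" for k
      using AE_pref_hyp[of \<gamma>]
    proof eventually_elim
      case (elim x)
      show ?case
        using AE_pref_hyp[of \<gamma>]
        by eventually_elim (use elim pref_kernel_reproducing[OF \<gamma>] in blast)
    qed
  qed (use C pref_kernel_orthogonal in auto)
  then show ?thesis by blast
qed

section \<open>The Leray transform on the space of square-integrable functions\<close>

lemma fourier_coeff_pt:
  assumes f: "f \<in> borel_measurable (hypM \<gamma>)" and \<alpha>: "0 < \<alpha>"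
  shows "fourier_coeff \<gamma> f (int k) s \<alpha> = (LINT \<theta>|angular. cis (- (real k * \<theta>)) * f (pt \<gamma> \<alpha> s \<theta>)) / (2 * pi)"
proof -
  note [measurable] = f
  have p: "param \<gamma> (s, \<alpha>, \<theta>) = pt \<gamma> \<alpha> s \<theta>" for \<theta>
    using \<alpha> by (simp add: param_def pt_def)
  have "(LINT \<theta>|angular. cis (- (real k * \<theta>)) * f (pt \<gamma> \<alpha> s \<theta>))
      = (LINT \<theta>|lborel. indicator {0..<2 * pi} \<theta> *\<^sub>R (cis (- (real k * \<theta>)) * f (pt \<gamma> \<alpha> s \<theta>)))"
    by (rule integral_angular) measurable
  then show ?thesis
    by (simp add: fourier_coeff_def set_lebesgue_integral_def p mult.commute)
qed

lemma leray_piece_polar: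
  assumes f: "f \<in> borel_measurable (hypM \<gamma>)"
  shows "leray_piece \<gamma> k f z = cis (real k * Arg (fst z)) * of_real (\<gamma>\<^sup>2 * (real k + 1) / (2 * pi)) *
     (LINT \<alpha>|lborel. indicator {0<..} \<alpha> *\<^sub>R (LINT s|lborel.
        of_real (\<gamma> * cmod (fst z) * \<alpha> powr (\<gamma> - 1)) ^ k
        / Complex ((\<gamma> - 1) * \<alpha> powr \<gamma> + cmod (fst z) powr \<gamma>) (s - Re (snd z)) ^ (k + 2)
        * ((LINT \<theta>|angular. cis (- (real k * \<theta>)) * f (pt \<gamma> \<alpha> s \<theta>)) / (2 * pi))
        * of_real (\<alpha> powr (\<gamma> - 1))))"
  unfolding leray_piece_def Let_def set_lebesgue_integral_def
proof (intro arg_cong2[where f="(*)"] refl Bochner_Integration.integral_cong)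
  fix \<alpha> :: real
  show "indicator {0<..} \<alpha> *\<^sub>R (LINT s|lborel. of_real (\<gamma> * cmod (fst z) * \<alpha> powr (\<gamma> - 1)) ^ k
        / Complex ((\<gamma> - 1) * \<alpha> powr \<gamma> + cmod (fst z) powr \<gamma>) (s - Re (snd z)) ^ (k + 2)
        * fourier_coeff \<gamma> f (int k) s \<alpha> * of_real (\<alpha> powr (\<gamma> - 1)))
      = indicator {0<..} \<alpha> *\<^sub>R (LINT s|lborel.
        of_real (\<gamma> * cmod (fst z) * \<alpha> powr (\<gamma> - 1)) ^ k
        / Complex ((\<gamma> - 1) * \<alpha> powr \<gamma> + cmod (fst z) powr \<gamma>) (s - Re (snd z)) ^ (k + 2)
        * ((LINT \<theta>|angular. cis (- (real k * \<theta>)) * f (pt \<gamma> \<alpha> s \<theta>)) / (2 * pi))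
        * of_real (\<alpha> powr (\<gamma> - 1)))"
    by (cases "0 < \<alpha>") (simp_all add: fourier_coeff_pt[OF f])
qed

lemma cis_Arg_power: "cis (real k * Arg z) = (if z = 0 then 1 else z / of_real (cmod z)) ^ k"
  by (cases "z = 0") (simp_all add: Complex.DeMoivre[symmetric] cis_Arg sgn_eq Arg_zero)

lemma leray_piece_measurable:
  assumes f: "f \<in> borel_measurable (hypM \<gamma>)"
  shows "leray_piece \<gamma> k f \<in> borel_measurable (hypM \<gamma>)"
proof -
  note [measurable] = f
  have 1: "(\<lambda>x. LINT \<alpha>|lborel. indicator {0<..} \<alpha> *\<^sub>R (LINT s|lborel.
        of_real (\<gamma> * a x * \<alpha> powr (\<gamma> - 1)) ^ k
        / Complex ((\<gamma> - 1) * \<alpha> powr \<gamma> + a x powr \<gamma>) (s - t x) ^ (k + 2)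
        * ((LINT \<theta>|angular. cis (- (real k * \<theta>)) * f (pt \<gamma> \<alpha> s \<theta>)) / (2 * pi))
        * of_real (\<alpha> powr (\<gamma> - 1)))) \<in> borel_measurable (hypM \<gamma>)"
    if [measurable]: "a \<in> borel_measurable (hypM \<gamma>)" "t \<in> borel_measurable (hypM \<gamma>)" for a t
    unfolding Complex_eq by measurable
  show ?thesis
    unfolding leray_piece_polar[OF f] cis_Arg_power
    by (intro borel_measurable_times 1) measurable
qed

text \<open>
  Fubini's theorem, in the order of integration of the definition. Its hypothesis holds for almost
  every \<open>z\<close> when \<open>f\<close> is square-integrable, by Schur's test.
\<close>

lemma leray_piece_eq_kernel_op:
  assumes \<gamma>: "1 < \<gamma>" and f: "f \<in> borel_measurable (hypM \<gamma>)" and z: "z \<in> hyp \<gamma>"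
    and int: "integrable (pref_measure \<gamma>) (\<lambda>\<zeta>. pref_kernel \<gamma> k z \<zeta> * f \<zeta>)"
  shows "leray_piece \<gamma> k f z = kernel_op (pref_measure \<gamma>) (pref_kernel \<gamma> k) f z"
proof -
  let ?r = "(\<gamma> + 1) / 3"
  let ?\<rho> = "(\<gamma> - 1) powr (-1/3)"
  note [measurable] = f pref_kernel_measurable2[OF z]
  let ?\<Theta> = "\<lambda>\<alpha> s. (LINT \<theta>|angular. cis (- (real k * \<theta>)) * f (pt \<gamma> \<alpha> s \<theta>))"
  let ?A = "\<lambda>\<alpha> s. Complex ((\<gamma> - 1) * \<alpha> powr \<gamma> + cmod (fst z) powr \<gamma>) (s - Re (snd z))"
  let ?Q = "\<lambda>\<alpha> s. of_real (\<gamma> * cmod (fst z) * \<alpha> powr (\<gamma> - 1)) ^ k / ?A \<alpha> s ^ (k + 2)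
        * (?\<Theta> \<alpha> s / (2 * pi)) * of_real (\<alpha> powr (\<gamma> - 1))"
  let ?c = "cis (real k * Arg (fst z)) * of_real (\<gamma>\<^sup>2 * (real k + 1) / (2 * pi))"
  have pc: "pref_const \<gamma> * ?\<rho> = \<gamma>\<^sup>2 / (2 * pi) * (1 / (2 * pi))"
    unfolding pref_const_mult[OF \<gamma>] by (simp add: power2_eq_square)
  have "kernel_op (pref_measure \<gamma>) (pref_kernel \<gamma> k) f z
      = of_real (pref_const \<gamma>) * (LINT \<alpha>|radial ?r. (LINT s|lborel. (LINT \<theta>|angular. pref_kernel \<gamma> k z (pt \<gamma> \<alpha> s \<theta>) * f (pt \<gamma> \<alpha> s \<theta>))))"
    using int unfolding pref_measure_wmu kernel_op_def by (rule integral_wmu) simp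
  also have "(LINT \<alpha>|radial ?r. (LINT s|lborel. (LINT \<theta>|angular. pref_kernel \<gamma> k z (pt \<gamma> \<alpha> s \<theta>) * f (pt \<gamma> \<alpha> s \<theta>))))
      = (LINT \<alpha>|lborel. indicator {0<..} \<alpha> *\<^sub>R (of_real (\<alpha> powr ?r) * (LINT s|lborel. (LINT \<theta>|angular. pref_kernel \<gamma> k z (pt \<gamma> \<alpha> s \<theta>) * f (pt \<gamma> \<alpha> s \<theta>)))))"
    by (rule integral_radial) measurable
  also have "of_real (pref_const \<gamma>) * \<dots>
      = (LINT \<alpha>|lborel. of_real (pref_const \<gamma>) * (indicator {0<..} \<alpha> *\<^sub>R (of_real (\<alpha> powr ?r) * (LINT s|lborel. (LINT \<theta>|angular. pref_kernel \<gamma> k z (pt \<gamma> \<alpha> s \<theta>) * f (pt \<gamma> \<alpha> s \<theta>))))))"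
    by (rule integral_mult_right_zero[symmetric])
  also have "\<dots> = (LINT \<alpha>|lborel. ?c * (indicator {0<..} \<alpha> *\<^sub>R (LINT s|lborel. ?Q \<alpha> s)))"
  proof (intro Bochner_Integration.integral_cong refl)
    fix \<alpha> :: real
    show "of_real (pref_const \<gamma>) * (indicator {0<..} \<alpha> *\<^sub>R (of_real (\<alpha> powr ?r) * (LINT s|lborel. (LINT \<theta>|angular. pref_kernel \<gamma> k z (pt \<gamma> \<alpha> s \<theta>) * f (pt \<gamma> \<alpha> s \<theta>)))))
        = ?c * (indicator {0<..} \<alpha> *\<^sub>R (LINT s|lborel. ?Q \<alpha> s))"
    proof (cases "0 < \<alpha>")
      case \<alpha>: True
      have e: "\<alpha> powr ?r * \<alpha> powr (\<gamma> - 1 - ?r) = \<alpha> powr (\<gamma> - 1)"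
        by (simp add: powr_add[symmetric])
      have w: "fst (dual_map \<gamma> (pt \<gamma> \<alpha> s 0)) = of_real (\<alpha> powr (\<gamma> - 1))" for s
        unfolding dual_map_pt[OF \<gamma> \<alpha>] by (simp add: pt_def)
      have zk: "fst z ^ k = cis (real k * Arg (fst z)) * of_real (cmod (fst z)) ^ k"
      proof (cases "fst z = 0")
        case True
        then show ?thesis by (cases k) (simp_all add: Arg_zero)
      next
        case False
        then have "fst z / of_real (cmod (fst z)) * of_real (cmod (fst z)) = fst z" by simp
        then show ?thesis
          unfolding cis_Arg_power power_mult_distrib[symmetric] using False by simp
      qed
      have s_eq: "of_real (pref_const \<gamma> * \<alpha> powr ?r) * (LINT \<theta>|angular. pref_kernel \<gamma> k z (pt \<gamma> \<alpha> s \<theta>) * f (pt \<gamma> \<alpha> s \<theta>)) = ?c * ?Q \<alpha> s" for s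
      proof -
        have "(LINT \<theta>|angular. pref_kernel \<gamma> k z (pt \<gamma> \<alpha> s \<theta>) * f (pt \<gamma> \<alpha> s \<theta>))
            = (LINT \<theta>|angular. pref_kernel \<gamma> k z (pt \<gamma> \<alpha> s 0) * (cis (- (real k * \<theta>)) * f (pt \<gamma> \<alpha> s \<theta>)))"
          by (subst pref_kernel_phase(2)) (simp only: mult_ac)
        also have "\<dots> = pref_kernel \<gamma> k z (pt \<gamma> \<alpha> s 0) * ?\<Theta> \<alpha> s"
          by (rule integral_mult_right_zero)
        finally have \<Theta>: "(LINT \<theta>|angular. pref_kernel \<gamma> k z (pt \<gamma> \<alpha> s \<theta>) * f (pt \<gamma> \<alpha> s \<theta>)) = pref_kernel \<gamma> k z (pt \<gamma> \<alpha> s 0) * ?\<Theta> \<alpha> s" .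
        have K: "denom \<gamma> z (pt \<gamma> \<alpha> s 0) = ?A \<alpha> s" using \<alpha> by simp
        have R: "rho \<gamma> (pt \<gamma> \<alpha> s 0) = ?\<rho> * \<alpha> powr (\<gamma> - 1 - ?r)" using \<alpha> by simp
        have "of_real (pref_const \<gamma> * \<alpha> powr ?r) * (pref_kernel \<gamma> k z (pt \<gamma> \<alpha> s 0) * ?\<Theta> \<alpha> s)
            = of_real ((pref_const \<gamma> * ?\<rho>) * (\<alpha> powr ?r * \<alpha> powr (\<gamma> - 1 - ?r))) * (of_nat (k + 1) * (of_real \<gamma> * fst z * of_real (\<alpha> powr (\<gamma> - 1))) ^ k / ?A \<alpha> s ^ (k + 2)) * ?\<Theta> \<alpha> s"
          unfolding pref_kernel_def leray_kernel_def w K R of_real_mult by (simp only: mult_ac)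
        also have "\<dots> = ?c * ?Q \<alpha> s"
        proof -
          have n: "complex_of_real (real k + 1) = of_nat (k + 1)" by simp
          show ?thesis
            unfolding e pc power_mult_distrib zk of_real_mult of_real_divide n
            by (simp only: divide_inverse of_real_mult of_real_inverse of_real_1 mult_1_left inverse_mult_distrib of_real_numeral mult_ac)
        qed
        finally show ?thesis unfolding \<Theta> .
      qed
      have "of_real (pref_const \<gamma>) * (of_real (\<alpha> powr ?r) * (LINT s|lborel. (LINT \<theta>|angular. pref_kernel \<gamma> k z (pt \<gamma> \<alpha> s \<theta>) * f (pt \<gamma> \<alpha> s \<theta>))))
          = (LINT s|lborel. of_real (pref_const \<gamma> * \<alpha> powr ?r) * (LINT \<theta>|angular. pref_kernel \<gamma> k z (pt \<gamma> \<alpha> s \<theta>) * f (pt \<gamma> \<alpha> s \<theta>)))"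
        by (simp only: integral_mult_right_zero of_real_mult mult.assoc)
      also have "\<dots> = ?c * (LINT s|lborel. ?Q \<alpha> s)"
        unfolding s_eq by (rule integral_mult_right_zero)
      finally show ?thesis using \<alpha> by simp
    qed simp
  qed
  also have "\<dots> = ?c * (LINT \<alpha>|lborel. indicator {0<..} \<alpha> *\<^sub>R (LINT s|lborel. ?Q \<alpha> s))"
    by (rule integral_mult_right_zero)
  finally show ?thesis
    unfolding leray_piece_polar[OF f] by simp
qed

context
  fixes \<gamma> C :: real
  assumes \<gamma>: "1 < \<gamma>" and ser: "schur_series (pref_measure \<gamma>) (schur_weight \<gamma>) C (pref_kernel \<gamma>)"
begin

interpretation schur_series "pref_measure \<gamma>" "schur_weight \<gamma>" C "pref_kernel \<gamma>" by (rule ser)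

lemma leray_partial_sum_AE:
  assumes f: "f \<in> vecs (L2 (pref_measure \<gamma>))"
  shows "AE z in pref_measure \<gamma>. partial_sum f n z = (\<Sum>k<n. leray_piece \<gamma> k f z)"
proof -
  note fm = L2_pref_measurable[OF f]
  have "AE z in pref_measure \<gamma>. kernel_op (pref_measure \<gamma>) (pref_kernel \<gamma> k) f z = leray_piece \<gamma> k f z" for k
    using schur_integrable[OF schur[of k] f] AE_pref_hyp[of \<gamma>]
    by eventually_elim (simp add: leray_piece_eq_kernel_op[OF \<gamma> fm])
  then have "AE z in pref_measure \<gamma>. \<forall>k\<in>{..<n}. kernel_op (pref_measure \<gamma>) (pref_kernel \<gamma> k) f z = leray_piece \<gamma> k f z"
    by (intro AE_finite_allI) auto
  then show ?thesis by eventually_elim (simp add: partial_sum_def)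
qed

lemma leray_partial_sum_measurable:
  assumes f: "f \<in> vecs (L2 (pref_measure \<gamma>))"
  shows "(\<lambda>z. \<Sum>k<n. leray_piece \<gamma> k f z) \<in> borel_measurable (pref_measure \<gamma>)"
proof -
  note fm = L2_pref_measurable[OF f]
  have "(\<lambda>z. \<Sum>k<n. leray_piece \<gamma> k f z) \<in> borel_measurable (hypM \<gamma>)"
    using leray_piece_measurable[OF fm] by (intro borel_measurable_sum) (simp add: eta_contract_eq)
  then show ?thesis by (simp cong: measurable_cong_sets)
qed

lemma partial_sum_tendsto_leray:
  assumes f: "f \<in> vecs (L2 (pref_measure \<gamma>))"
  shows "tendsto_L2 (pref_measure \<gamma>) (partial_sum f) (leray \<gamma> (pref_measure \<gamma>) f)"
proof -
  let ?S = "\<lambda>n z. \<Sum>k<n. leray_piece \<gamma> k f z"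
  obtain g where g: "tendsto_L2 (pref_measure \<gamma>) (partial_sum f) g"
    using series_converges[OF f] by blast
  have "tendsto_L2 (pref_measure \<gamma>) ?S g"
    using g by (intro tendsto_L2_cong_AE[OF g] leray_partial_sum_measurable[OF f] leray_partial_sum_AE[OF f])
      (auto simp: tendsto_L2_def L2_iff)
  then have S: "tendsto_L2 (pref_measure \<gamma>) ?S (leray \<gamma> (pref_measure \<gamma>) f)"
    unfolding leray_def by (rule someI[of "tendsto_L2 (pref_measure \<gamma>) ?S"])
  show ?thesis
  proof (rule tendsto_L2_cong_AE[OF S])
    show "partial_sum f n \<in> borel_measurable (pref_measure \<gamma>)" for n
      using partial_sum_L2[OF f] by (simp add: L2_iff)
    show "leray \<gamma> (pref_measure \<gamma>) f \<in> borel_measurable (pref_measure \<gamma>)"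
      using S by (simp add: tendsto_L2_def L2_iff)
    show "AE z in pref_measure \<gamma>. ?S n z = partial_sum f n z" for n
      using leray_partial_sum_AE[OF f, of n] by eventually_elim simp
  qed simp
qed

lemma leray_L2:
  assumes f: "f \<in> vecs (L2 (pref_measure \<gamma>))"
  shows "leray \<gamma> (pref_measure \<gamma>) f \<in> vecs (L2 (pref_measure \<gamma>))"
  using partial_sum_tendsto_leray[OF f] by (simp add: tendsto_L2_def)

lemma leray_bound:
  assumes f: "f \<in> vecs (L2 (pref_measure \<gamma>))"
  shows "norm2 (pref_measure \<gamma>) (leray \<gamma> (pref_measure \<gamma>) f) \<le> C * norm2 (pref_measure \<gamma>) f"
  by (rule series_norm[OF f partial_sum_tendsto_leray[OF f]])

lemma leray_idempotent:
  assumes f: "f \<in> vecs (L2 (pref_measure \<gamma>))"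
  shows "AE z in pref_measure \<gamma>. leray \<gamma> (pref_measure \<gamma>) (leray \<gamma> (pref_measure \<gamma>) f) z = leray \<gamma> (pref_measure \<gamma>) f z"
  by (rule series_idempotent[OF f partial_sum_tendsto_leray[OF f] partial_sum_tendsto_leray[OF leray_L2[OF f]]])

lemma leray_lincomb:
  assumes f: "f \<in> vecs (L2 (pref_measure \<gamma>))" and g: "g \<in> vecs (L2 (pref_measure \<gamma>))"
  shows "AE z in pref_measure \<gamma>. leray \<gamma> (pref_measure \<gamma>) (\<lambda>t. a * f t + b * g t) z
      = a * leray \<gamma> (pref_measure \<gamma>) f z + b * leray \<gamma> (pref_measure \<gamma>) g z"
proof -
  let ?h = "\<lambda>t. a * f t + b * g t"
  let ?M = "pref_measure \<gamma>"
  have h: "?h \<in> vecs (L2 ?M)" by (rule L2_lincomb[OF f g])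
  have lc: "tendsto_L2 ?M (\<lambda>n x. a * partial_sum f n x + b * partial_sum g n x) (\<lambda>x. a * leray \<gamma> ?M f x + b * leray \<gamma> ?M g x)"
    by (rule tendsto_L2_lincomb[OF partial_sum_tendsto_leray[OF f] partial_sum_tendsto_leray[OF g]])
  have "tendsto_L2 ?M (partial_sum ?h) (\<lambda>x. a * leray \<gamma> ?M f x + b * leray \<gamma> ?M g x)"
  proof (rule tendsto_L2_cong_AE[OF lc])
    show "partial_sum ?h n \<in> borel_measurable ?M" for n using partial_sum_L2[OF h] by (simp add: L2_iff)
    show "(\<lambda>x. a * leray \<gamma> ?M f x + b * leray \<gamma> ?M g x) \<in> borel_measurable ?M"
      by (rule L2_measurable[OF L2_lincomb[OF leray_L2[OF f] leray_L2[OF g]]])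
    show "AE x in ?M. a * partial_sum f n x + b * partial_sum g n x = partial_sum ?h n x" for n
    proof -
      have "AE x in ?M. \<forall>k\<in>{..<n}. kernel_op ?M (pref_kernel \<gamma> k) ?h x = a * kernel_op ?M (pref_kernel \<gamma> k) f x + b * kernel_op ?M (pref_kernel \<gamma> k) g x"
        by (intro AE_finite_allI kernel_op_lincomb[OF schur f g]) simp
      then show ?thesis
        by eventually_elim (simp add: partial_sum_def sum.distrib sum_distrib_left)
    qed
  qed simp
  then show ?thesis by (rule tendsto_L2_unique[OF partial_sum_tendsto_leray[OF h]])
qed

end

lemma hardy_iff_fixed:
  assumes \<gamma>: "1 < \<gamma>"
  shows "f \<in> vecs (hardy \<gamma>) \<longleftrightarrow> f \<in> vecs (L2 (pref_measure \<gamma>)) \<and>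
    (AE z in pref_measure \<gamma>. leray \<gamma> (pref_measure \<gamma>) f z = f z)"
proof -
  let ?M = "pref_measure \<gamma>"
  obtain C where ser: "schur_series ?M (schur_weight \<gamma>) C (pref_kernel \<gamma>)"
    using pref_kernel_series[OF \<gamma>] by blast
  note L2 = leray_L2[OF \<gamma> ser] and bnd = leray_bound[OF \<gamma> ser]
  show ?thesis
  proof
    assume "f \<in> vecs (hardy \<gamma>)"
    then obtain h where f: "f \<in> vecs (L2 ?M)" and h: "h \<in> vecs (L2 ?M)" and e: "AE z in ?M. f z = leray \<gamma> ?M h z"
      by (auto simp: hardy_def)
    have d: "(\<lambda>x. f x - leray \<gamma> ?M h x) \<in> vecs (L2 ?M)" by (rule L2_diff[OF f L2[OF h]])
    have "norm2 ?M (leray \<gamma> ?M (\<lambda>x. f x - leray \<gamma> ?M h x)) \<le> C * norm2 ?M (\<lambda>x. f x - leray \<gamma> ?M h x)"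
      by (rule bnd[OF d])
    also have "norm2 ?M (\<lambda>x. f x - leray \<gamma> ?M h x) = 0"
      using e norm2_diff_eq_0_iff[OF f L2[OF h]] by simp
    finally have "AE x in ?M. leray \<gamma> ?M (\<lambda>x. f x - leray \<gamma> ?M h x) x = 0"
      using norm2_eq_0_iff[OF L2[OF d]] by (simp add: order_antisym)
    moreover have "AE x in ?M. leray \<gamma> ?M (\<lambda>x. f x - leray \<gamma> ?M h x) x = leray \<gamma> ?M f x - leray \<gamma> ?M (leray \<gamma> ?M h) x"
      using leray_lincomb[OF \<gamma> ser f L2[OF h], of 1 "-1"] by simp
    ultimately have "AE x in ?M. leray \<gamma> ?M f x = f x"
      using leray_idempotent[OF \<gamma> ser h] e by eventually_elim simp
    with f show "f \<in> vecs (L2 ?M) \<and> (AE z in ?M. leray \<gamma> ?M f z = f z)" by blast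
  next
    assume "f \<in> vecs (L2 ?M) \<and> (AE z in ?M. leray \<gamma> ?M f z = f z)"
    then show "f \<in> vecs (hardy \<gamma>)"
      by (auto simp: hardy_def intro!: bexI[of _ f] elim: eventually_mono)
  qed
qed

section \<open>The transpose of the Leray transform and the dual Hardy space\<close>

lemma scale_measure_eq_density: "scale_measure c M = density M (\<lambda>_. c)"
  by (rule measure_eqI) (simp_all add: emeasure_density nn_integral_cmult_indicator)

lemma wmu_mult: "0 \<le> d \<Longrightarrow> 0 \<le> c \<Longrightarrow> wmu \<gamma> (d * c) r = density (wmu \<gamma> c r) (\<lambda>_. ennreal d)"
  unfolding scale_measure_eq_density[symmetric] by (simp add: wmu_def ennreal_mult)

lemma dual_pref_const:
  assumes \<gamma>: "1 < \<gamma>"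
  shows "\<gamma>\<^sup>2 / (4 * pi\<^sup>2 * (\<gamma> - 1) powr (1/3)) = (\<gamma> - 1)\<^sup>2 * pref_const (dual_exponent \<gamma>)"
proof -
  have "(1 / (\<gamma> - 1)) powr (1/3) = 1 / (\<gamma> - 1) powr (1/3)"
    using \<gamma> by (simp add: powr_divide)
  moreover have "(\<gamma> - 1)\<^sup>2 * (dual_exponent \<gamma>)\<^sup>2 = \<gamma>\<^sup>2"
    using \<gamma> by (simp add: dual_exponent_def power_divide)
  ultimately show ?thesis
    unfolding pref_const_def dual_exponent_minus_1[OF \<gamma>] by (simp add: mult.assoc[symmetric])
qed

lemma distr_pref_dual:
  assumes \<gamma>: "1 < \<gamma>"
  shows "distr (pref_dual_measure \<gamma>) (hypM (dual_exponent \<gamma>)) (dual_map \<gamma>)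
    = density (pref_measure (dual_exponent \<gamma>)) (\<lambda>_. ennreal ((\<gamma> - 1)\<^sup>2))"
proof -
  have e: "((5 * \<gamma> - 7) / 3 + 1) / (\<gamma> - 1) - 1 = (dual_exponent \<gamma> + 1) / 3"
    using \<gamma> by (simp add: dual_exponent_def field_simps)
  have "pref_dual_measure \<gamma> = wmu \<gamma> (\<gamma>\<^sup>2 / (4 * pi\<^sup>2 * (\<gamma> - 1) powr (1/3))) ((5 * \<gamma> - 7) / 3)"
    by (simp add: pref_dual_measure_def wmu_def)
  then have "distr (pref_dual_measure \<gamma>) (hypM (dual_exponent \<gamma>)) (dual_map \<gamma>)
      = wmu (dual_exponent \<gamma>) ((\<gamma> - 1)\<^sup>2 * pref_const (dual_exponent \<gamma>)) ((dual_exponent \<gamma> + 1) / 3)"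
    by (simp only: distr_dual_map[OF \<gamma>] e dual_pref_const[OF \<gamma>])
  then show ?thesis
    unfolding pref_measure_wmu wmu_mult[OF zero_le_power2 pref_const_nonneg] .
qed

lemma distr_pairing:
  assumes \<gamma>: "1 < \<gamma>"
  shows "distr (pairing_measure \<gamma>) (hypM (dual_exponent \<gamma>)) (dual_map \<gamma>)
    = density (pairing_measure (dual_exponent \<gamma>)) (\<lambda>_. ennreal ((\<gamma> - 1)\<^sup>2))"
proof -
  have e: "(\<gamma> - 1 + 1) / (\<gamma> - 1) - 1 = dual_exponent \<gamma> - 1"
    by (simp add: dual_exponent_def)
  have w: "pairing_measure g = wmu g (g\<^sup>2 / (4 * pi\<^sup>2)) (g - 1)" for g
    by (simp add: pairing_measure_def wmu_def)
  have c: "\<gamma>\<^sup>2 / (4 * pi\<^sup>2) = (\<gamma> - 1)\<^sup>2 * ((dual_exponent \<gamma>)\<^sup>2 / (4 * pi\<^sup>2))"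
    using \<gamma> by (simp add: dual_exponent_def power_divide)
  have n: "0 \<le> (dual_exponent \<gamma>)\<^sup>2 / (4 * pi\<^sup>2)" by simp
  have "distr (pairing_measure \<gamma>) (hypM (dual_exponent \<gamma>)) (dual_map \<gamma>)
      = wmu (dual_exponent \<gamma>) ((\<gamma> - 1)\<^sup>2 * ((dual_exponent \<gamma>)\<^sup>2 / (4 * pi\<^sup>2))) (dual_exponent \<gamma> - 1)"
    unfolding w distr_dual_map[OF \<gamma>] e c ..
  then show ?thesis
    unfolding wmu_mult[OF zero_le_power2 n] w .
qed

lemma AE_pref_dual_iff:
  assumes \<gamma>: "1 < \<gamma>"
  shows "(AE z in pref_dual_measure \<gamma>. P z) \<longleftrightarrow> (AE z in pref_measure \<gamma>. P z)"
proof -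
  have "(AE z in pref_dual_measure \<gamma>. P z) \<longleftrightarrow> (AE z in pref_measure \<gamma>. 0 < ennreal ((rho \<gamma> z)\<^sup>2) \<longrightarrow> P z)"
    unfolding pref_dual_measure_density[OF \<gamma>] by (subst AE_density) simp_all
  also have "\<dots> \<longleftrightarrow> (AE z in pref_measure \<gamma>. P z)"
  proof
    assume "AE z in pref_measure \<gamma>. 0 < ennreal ((rho \<gamma> z)\<^sup>2) \<longrightarrow> P z"
    then show "AE z in pref_measure \<gamma>. P z"
      using AE_pref_hyp[of \<gamma>] by eventually_elim (simp add: rho_pos[OF \<gamma>] less_imp_neq[symmetric] zero_less_power)
  qed (auto elim: eventually_mono)
  finally show ?thesis .
qed

lemma AE_dual_map:
  assumes \<gamma>: "1 < \<gamma>" and P: "AE y in pref_measure (dual_exponent \<gamma>). P y"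
  shows "AE z in pref_measure \<gamma>. P (dual_map \<gamma> z)"
proof -
  note [measurable] = dual_map_measurable[OF \<gamma>]
  have "AE y in distr (pref_dual_measure \<gamma>) (hypM (dual_exponent \<gamma>)) (dual_map \<gamma>). P y"
    unfolding distr_pref_dual[OF \<gamma>] using P by (subst AE_density) auto
  then have "AE z in pref_dual_measure \<gamma>. P (dual_map \<gamma> z)"
    by (rule AE_distrD[rotated]) (simp add: pref_dual_measure_density[OF \<gamma>] cong: measurable_cong_sets)
  then show ?thesis by (simp only: AE_pref_dual_iff[OF \<gamma>])
qed

text \<open>The factor \<open>rho\<close> makes this an isometry for the preferred measures, up to a constant.\<close>

definition pullback :: "real \<Rightarrow> (complex \<times> complex \<Rightarrow> complex) \<Rightarrow> complex \<times> complex \<Rightarrow> complex" where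
  "pullback \<gamma> G z = G (dual_map \<gamma> z) * of_real (rho \<gamma> z)"

lemma pullback_L2:
  assumes \<gamma>: "1 < \<gamma>" and G: "G \<in> borel_measurable (hypM (dual_exponent \<gamma>))"
  shows pullback_L2_iff: "pullback \<gamma> G \<in> vecs (L2 (pref_measure \<gamma>)) \<longleftrightarrow> G \<in> vecs (L2 (pref_measure (dual_exponent \<gamma>)))"
    and norm2_pullback: "norm2 (pref_measure \<gamma>) (pullback \<gamma> G) = (\<gamma> - 1) * norm2 (pref_measure (dual_exponent \<gamma>)) G"
proof -
  note [measurable] = dual_map_measurable[OF \<gamma>] G
  let ?D = "pref_dual_measure \<gamma>"
  have sD: "sets ?D = sets (hypM \<gamma>)" by (simp add: pref_dual_measure_density[OF \<gamma>])
  have wD: "dual_map \<gamma> \<in> measurable ?D (hypM (dual_exponent \<gamma>))"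
    using dual_map_measurable[OF \<gamma>] sD by (simp cong: measurable_cong_sets)
  have sq: "(cmod (pullback \<gamma> G z))\<^sup>2 = (rho \<gamma> z)\<^sup>2 *\<^sub>R (cmod (G (dual_map \<gamma> z)))\<^sup>2" for z
    by (simp add: pullback_def norm_mult power_mult_distrib)
  have pm: "pullback \<gamma> G \<in> borel_measurable (pref_measure \<gamma>)"
    unfolding pullback_def[abs_def] by measurable
  have "integrable (pref_measure \<gamma>) (\<lambda>z. (cmod (pullback \<gamma> G z))\<^sup>2) \<longleftrightarrow> integrable ?D (\<lambda>z. (cmod (G (dual_map \<gamma> z)))\<^sup>2)"
    unfolding sq pref_dual_measure_density[OF \<gamma>] by (subst integrable_density) auto
  also have "\<dots> \<longleftrightarrow> integrable (distr ?D (hypM (dual_exponent \<gamma>)) (dual_map \<gamma>)) (\<lambda>y. (cmod (G y))\<^sup>2)"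
    by (subst integrable_distr_eq[OF wD]) auto
  also have "\<dots> \<longleftrightarrow> integrable (pref_measure (dual_exponent \<gamma>)) (\<lambda>y. (cmod (G y))\<^sup>2)"
    unfolding distr_pref_dual[OF \<gamma>] using \<gamma> by (subst integrable_density) auto
  finally show "pullback \<gamma> G \<in> vecs (L2 (pref_measure \<gamma>)) \<longleftrightarrow> G \<in> vecs (L2 (pref_measure (dual_exponent \<gamma>)))"
    using pm G by (simp add: L2_iff cong: measurable_cong_sets)
  have "(LINT z|pref_measure \<gamma>. (cmod (pullback \<gamma> G z))\<^sup>2) = (LINT z|?D. (cmod (G (dual_map \<gamma> z)))\<^sup>2)"
    unfolding sq pref_dual_measure_density[OF \<gamma>] by (subst integral_density) auto
  also have "\<dots> = (LINT y|distr ?D (hypM (dual_exponent \<gamma>)) (dual_map \<gamma>). (cmod (G y))\<^sup>2)"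
    by (subst integral_distr[OF wD]) auto
  also have "\<dots> = (\<gamma> - 1)\<^sup>2 * (LINT y|pref_measure (dual_exponent \<gamma>). (cmod (G y))\<^sup>2)"
    unfolding distr_pref_dual[OF \<gamma>] by (subst integral_density) auto
  finally show "norm2 (pref_measure \<gamma>) (pullback \<gamma> G) = (\<gamma> - 1) * norm2 (pref_measure (dual_exponent \<gamma>)) G"
    using \<gamma> by (simp add: norm2_eq real_sqrt_mult)
qed

text \<open>
  At image points the numerator and the denominator of the dual kernel are those of the transposed
  kernel divided by \<open>\<gamma> - 1\<close>. The denominator has two more factors, which leaves \<open>(\<gamma> - 1)\<^sup>2\<close>.
\<close>

lemma leray_kernel_dual:
  assumes \<gamma>: "1 < \<gamma>" and z: "z \<in> hyp \<gamma>" and \<zeta>: "\<zeta> \<in> hyp \<gamma>"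
  shows "of_real ((\<gamma> - 1)\<^sup>2) * leray_kernel \<gamma> k z \<zeta> = leray_kernel (dual_exponent \<gamma>) k (dual_map \<gamma> \<zeta>) (dual_map \<gamma> z)"
proof -
  let ?g = "dual_exponent \<gamma>"
  let ?c = "complex_of_real (\<gamma> - 1)"
  have c0: "?c \<noteq> 0" using \<gamma> by simp
  have g: "complex_of_real ?g = of_real \<gamma> / ?c" by (simp add: dual_exponent_def)
  have d: "denom ?g (dual_map \<gamma> \<zeta>) (dual_map \<gamma> z) = denom \<gamma> z \<zeta> / ?c"
  proof -
    have "denom \<gamma> z \<zeta> = ?c * denom ?g (dual_map \<gamma> \<zeta>) (dual_map \<gamma> z)"
      unfolding denom_def cmod_fst_dual_map_powr[OF \<gamma>] Re_snd_dual_map dual_exponent_minus_1[OF \<gamma>]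
    proof -
      have "(\<gamma> - 1) * (1 / (\<gamma> - 1) * x + y) = (\<gamma> - 1) * y + x" for x y
        using \<gamma> by (simp add: distrib_left)
      moreover have "(\<gamma> - 1) * (x / (1 - \<gamma>) - y / (1 - \<gamma>)) = y - x" for x y
        using \<gamma> by (simp add: divide_simps) (simp add: algebra_simps)
      ultimately show "Complex ((\<gamma> - 1) * cmod (fst \<zeta>) powr \<gamma> + cmod (fst z) powr \<gamma>) (Re (snd \<zeta>) - Re (snd z))
          = ?c * Complex (1 / (\<gamma> - 1) * cmod (fst z) powr \<gamma> + cmod (fst \<zeta>) powr \<gamma>)
              (Re (snd z) / (1 - \<gamma>) - Re (snd \<zeta>) / (1 - \<gamma>))"
        by (simp only: complex_of_real_mult_Complex)
    qed
    then show ?thesis using c0 by simp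
  qed
  have n: "of_real ?g * fst (dual_map \<gamma> \<zeta>) * fst (dual_map ?g (dual_map \<gamma> z)) = (of_real \<gamma> * fst z * fst (dual_map \<gamma> \<zeta>)) / ?c"
    unfolding dual_map_dual_map[OF \<gamma> z] g by simp
  have "x ^ k / ?c ^ k / (y ^ (k + 2) / ?c ^ (k + 2)) = ?c\<^sup>2 * (x ^ k / y ^ (k + 2))" for x y
    using c0 by (simp add: power_add power2_eq_square)
  then show ?thesis
    unfolding leray_kernel_def n d power_divide
    by (simp only: of_real_power times_divide_eq_right[symmetric] mult.left_commute)
qed

text \<open>
  The factor \<open>(\<gamma> - 1)\<^sup>2\<close> in the identity for the kernels cancels the one in the push-forward of the
  pairing measure.
\<close>

lemma kernel_op_transpose_dual:
  assumes \<gamma>: "1 < \<gamma>" and G: "G \<in> borel_measurable (hypM (dual_exponent \<gamma>))" and \<zeta>: "\<zeta> \<in> hyp \<gamma>"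
  shows "kernel_op (pref_measure \<gamma>) (\<lambda>\<zeta> z. pref_kernel \<gamma> k z \<zeta>) (pullback \<gamma> G) \<zeta>
    = pullback \<gamma> (kernel_op (pref_measure (dual_exponent \<gamma>)) (pref_kernel (dual_exponent \<gamma>) k) G) \<zeta>"
proof -
  let ?g = "dual_exponent \<gamma>"
  let ?w = "dual_map \<gamma>"
  have g: "1 < ?g" by (rule dual_exponent_gt_1[OF \<gamma>])
  note [measurable] = dual_map_measurable[OF \<gamma>] G
  have w\<zeta>: "?w \<zeta> \<in> hyp ?g" by (rule dual_map_hyp[OF \<gamma> \<zeta>])
  have sP: "sets (pairing_measure \<gamma>) = sets (hypM \<gamma>)" for \<gamma>
    by (simp add: pairing_measure_def)
  have wP: "?w \<in> measurable (pairing_measure \<gamma>) (hypM ?g)"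
    using dual_map_measurable[OF \<gamma>] sP by (simp cong: measurable_cong_sets)
  have lk: "(\<lambda>y. leray_kernel ?g k (?w \<zeta>) y) \<in> borel_measurable (hypM ?g)"
    using measurable_compose[OF measurable_Pair1'[of "?w \<zeta>" "hypM ?g" "hypM ?g"] leray_kernel_measurable[of ?g k]] w\<zeta>
    by (simp add: space_restrict_space)
  have lk': "(\<lambda>z. leray_kernel \<gamma> k z \<zeta>) \<in> borel_measurable (hypM \<gamma>)"
    using measurable_compose[OF measurable_Pair2'[of \<zeta> "hypM \<gamma>" "hypM \<gamma>"] leray_kernel_measurable[of \<gamma> k]] \<zeta>
    by (simp add: space_restrict_space)
  note [measurable] = lk lk'
  have "kernel_op (pref_measure ?g) (pref_kernel ?g k) G (?w \<zeta>) = (LINT y|pref_measure ?g. rho ?g y *\<^sub>R (leray_kernel ?g k (?w \<zeta>) y * G y))"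
    unfolding kernel_op_def pref_kernel_def by (simp only: scaleR_conv_of_real mult_ac)
  also have "\<dots> = (LINT y|pairing_measure ?g. leray_kernel ?g k (?w \<zeta>) y * G y)"
    unfolding pairing_measure_density[OF g] by (subst integral_density) auto
  finally have 1: "of_real ((\<gamma> - 1)\<^sup>2) * kernel_op (pref_measure ?g) (pref_kernel ?g k) G (?w \<zeta>)
      = (LINT y|pairing_measure ?g. (\<gamma> - 1)\<^sup>2 *\<^sub>R (leray_kernel ?g k (?w \<zeta>) y * G y))"
    by (simp add: scaleR_conv_of_real)
  also have "\<dots> = (LINT y|distr (pairing_measure \<gamma>) (hypM ?g) ?w. leray_kernel ?g k (?w \<zeta>) y * G y)"
    unfolding distr_pairing[OF \<gamma>] by (subst integral_density) (auto simp: sP cong: measurable_cong_sets)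
  also have "\<dots> = (LINT z|pairing_measure \<gamma>. leray_kernel ?g k (?w \<zeta>) (?w z) * G (?w z))"
    by (rule integral_distr[OF wP]) measurable
  also have "\<dots> = (LINT z|pairing_measure \<gamma>. of_real ((\<gamma> - 1)\<^sup>2) * (leray_kernel \<gamma> k z \<zeta> * G (?w z)))"
  proof (intro Bochner_Integration.integral_cong refl)
    fix z assume "z \<in> space (pairing_measure \<gamma>)"
    then have "z \<in> hyp \<gamma>" using sets_eq_imp_space_eq[OF sP[of \<gamma>]] by (simp add: space_restrict_space)
    from leray_kernel_dual[OF \<gamma> this \<zeta>, of k, symmetric]
    show "leray_kernel ?g k (?w \<zeta>) (?w z) * G (?w z) = of_real ((\<gamma> - 1)\<^sup>2) * (leray_kernel \<gamma> k z \<zeta> * G (?w z))"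
      by (simp only: mult.assoc)
  qed
  also have "\<dots> = of_real ((\<gamma> - 1)\<^sup>2) * (LINT z|pairing_measure \<gamma>. leray_kernel \<gamma> k z \<zeta> * G (?w z))"
    by (rule integral_mult_right_zero)
  finally have "of_real ((\<gamma> - 1)\<^sup>2) * kernel_op (pref_measure ?g) (pref_kernel ?g k) G (?w \<zeta>)
      = of_real ((\<gamma> - 1)\<^sup>2) * (LINT z|pairing_measure \<gamma>. leray_kernel \<gamma> k z \<zeta> * G (?w z))" .
  then have 2: "kernel_op (pref_measure ?g) (pref_kernel ?g k) G (?w \<zeta>) = (LINT z|pairing_measure \<gamma>. leray_kernel \<gamma> k z \<zeta> * G (?w z))"
    using \<gamma> by simp
  have "kernel_op (pref_measure \<gamma>) (\<lambda>\<zeta> z. pref_kernel \<gamma> k z \<zeta>) (pullback \<gamma> G) \<zeta>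
      = (LINT z|pref_measure \<gamma>. (rho \<gamma> z *\<^sub>R (leray_kernel \<gamma> k z \<zeta> * G (?w z))) * of_real (rho \<gamma> \<zeta>))"
    unfolding kernel_op_def pref_kernel_def pullback_def by (simp only: scaleR_conv_of_real mult_ac)
  also have "\<dots> = (LINT z|pref_measure \<gamma>. rho \<gamma> z *\<^sub>R (leray_kernel \<gamma> k z \<zeta> * G (?w z))) * of_real (rho \<gamma> \<zeta>)"
    by (rule integral_mult_left_zero)
  also have "(LINT z|pref_measure \<gamma>. rho \<gamma> z *\<^sub>R (leray_kernel \<gamma> k z \<zeta> * G (?w z))) = (LINT z|pairing_measure \<gamma>. leray_kernel \<gamma> k z \<zeta> * G (?w z))"
    unfolding pairing_measure_density[OF \<gamma>] by (subst integral_density) auto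
  finally show ?thesis unfolding pullback_def 2 .
qed

text \<open>
  For each piece this is Fubini's theorem together with the previous lemma. The sums converge on both
  sides, since \<open>pullback\<close> is isometric up to a constant.
\<close>

lemma leray_transpose:
  assumes \<gamma>: "1 < \<gamma>" and f: "f \<in> vecs (L2 (pref_measure \<gamma>))"
    and G: "G \<in> vecs (L2 (pref_measure (dual_exponent \<gamma>)))"
  shows "(LINT z|pref_measure \<gamma>. leray \<gamma> (pref_measure \<gamma>) f z * pullback \<gamma> G z)
    = (LINT z|pref_measure \<gamma>. f z * pullback \<gamma> (leray (dual_exponent \<gamma>) (pref_measure (dual_exponent \<gamma>)) G) z)"
proof -
  let ?g = "dual_exponent \<gamma>"
  let ?M = "pref_measure \<gamma>" and ?M' = "pref_measure ?g"
  have g: "1 < ?g" by (rule dual_exponent_gt_1[OF \<gamma>])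
  obtain C where ser: "schur_series ?M (schur_weight \<gamma>) C (pref_kernel \<gamma>)"
    using pref_kernel_series[OF \<gamma>] by blast
  obtain C' where ser': "schur_series ?M' (schur_weight ?g) C' (pref_kernel ?g)"
    using pref_kernel_series[OF g] by blast
  interpret A: schur_series ?M "schur_weight \<gamma>" C "pref_kernel \<gamma>" by (rule ser)
  interpret B: schur_series ?M' "schur_weight ?g" C' "pref_kernel ?g" by (rule ser')
  note meas = L2_pref_measurable[where \<gamma>="?g"]
  have pullL: "pullback \<gamma> H \<in> vecs (L2 ?M)" if "H \<in> vecs (L2 ?M')" for H
    using that by (simp add: pullback_L2_iff[OF \<gamma> meas])
  have piece: "(LINT z|?M. kernel_op ?M (pref_kernel \<gamma> k) f z * pullback \<gamma> G z) = (LINT z|?M. f z * pullback \<gamma> (kernel_op ?M' (pref_kernel ?g k) G) z)" for k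
  proof -
    have "(LINT z|?M. kernel_op ?M (pref_kernel \<gamma> k) f z * pullback \<gamma> G z) = (LINT y|?M. f y * kernel_op ?M (\<lambda>x y. pref_kernel \<gamma> k y x) (pullback \<gamma> G) y)"
      by (rule A.kernel_op_transpose[OF A.schur f pullL[OF G]])
    also have "\<dots> = (LINT z|?M. f z * pullback \<gamma> (kernel_op ?M' (pref_kernel ?g k) G) z)"
      by (intro Bochner_Integration.integral_cong refl arg_cong2[where f="(*)"] kernel_op_transpose_dual[OF \<gamma> meas[OF G]])
         (simp add: pref_measure_wmu)
    finally show ?thesis .
  qed
  have parts: "(LINT z|?M. A.partial_sum f n z * pullback \<gamma> G z) = (LINT z|?M. pullback \<gamma> (B.partial_sum G n) z * f z)" for n
  proof -
    have "(LINT z|?M. A.partial_sum f n z * pullback \<gamma> G z) = (LINT z|?M. (\<Sum>k<n. kernel_op ?M (pref_kernel \<gamma> k) f z * pullback \<gamma> G z))"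
      by (simp add: A.partial_sum_def sum_distrib_right)
    also have "\<dots> = (\<Sum>k<n. (LINT z|?M. kernel_op ?M (pref_kernel \<gamma> k) f z * pullback \<gamma> G z))"
      by (intro Bochner_Integration.integral_sum L2_mult_integrable A.schur_L2[OF A.schur f] pullL G)
    also have "\<dots> = (\<Sum>k<n. (LINT z|?M. f z * pullback \<gamma> (kernel_op ?M' (pref_kernel ?g k) G) z))"
      unfolding piece ..
    also have "\<dots> = (LINT z|?M. (\<Sum>k<n. f z * pullback \<gamma> (kernel_op ?M' (pref_kernel ?g k) G) z))"
      by (intro Bochner_Integration.integral_sum[symmetric] L2_mult_integrable f pullL B.schur_L2[OF B.schur G])
    also have "\<dots> = (LINT z|?M. pullback \<gamma> (B.partial_sum G n) z * f z)"
      by (intro Bochner_Integration.integral_cong refl)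
         (simp add: pullback_def B.partial_sum_def sum_distrib_left sum_distrib_right mult_ac)
    finally show ?thesis .
  qed
  have L: "tendsto_L2 ?M' (B.partial_sum G) (leray ?g ?M' G)" by (rule partial_sum_tendsto_leray[OF g ser' G])
  have LG: "leray ?g ?M' G \<in> vecs (L2 ?M')" using L by (simp add: tendsto_L2_def)
  have "tendsto_L2 ?M (\<lambda>n. pullback \<gamma> (B.partial_sum G n)) (pullback \<gamma> (leray ?g ?M' G))"
    unfolding tendsto_L2_def
  proof (intro conjI allI pullL LG B.partial_sum_L2[OF G])
    have "norm2 ?M (\<lambda>x. pullback \<gamma> (B.partial_sum G n) x - pullback \<gamma> (leray ?g ?M' G) x)
        = (\<gamma> - 1) * norm2 ?M' (\<lambda>x. B.partial_sum G n x - leray ?g ?M' G x)" for n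
      using norm2_pullback[OF \<gamma> meas[OF L2_diff[OF B.partial_sum_L2[OF G] LG]], of n]
      by (simp add: pullback_def[abs_def] left_diff_distrib)
    moreover have "(\<lambda>n. (\<gamma> - 1) * norm2 ?M' (\<lambda>x. B.partial_sum G n x - leray ?g ?M' G x)) \<longlonglongrightarrow> (\<gamma> - 1) * 0"
      using L by (intro tendsto_intros) (simp add: tendsto_L2_def)
    ultimately show "(\<lambda>n. norm2 ?M (\<lambda>x. pullback \<gamma> (B.partial_sum G n) x - pullback \<gamma> (leray ?g ?M' G) x)) \<longlonglongrightarrow> 0"
      by simp
  qed
  from tendsto_L2_integral[OF this f]
  have "(\<lambda>n. LINT z|?M. A.partial_sum f n z * pullback \<gamma> G z) \<longlonglongrightarrow> (LINT z|?M. pullback \<gamma> (leray ?g ?M' G) z * f z)"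
    unfolding parts .
  moreover have "(\<lambda>n. LINT z|?M. A.partial_sum f n z * pullback \<gamma> G z) \<longlonglongrightarrow> (LINT z|?M. leray \<gamma> ?M f z * pullback \<gamma> G z)"
    by (rule tendsto_L2_integral[OF partial_sum_tendsto_leray[OF \<gamma> ser f] pullL[OF G]])
  ultimately show ?thesis
    using LIMSEQ_unique by (fastforce simp: mult.commute)
qed

text \<open>
  By the preceding lemma the transpose of the Leray transform acts on pullbacks as the Leray transform
  of the dual hypersurface, so it fixes the pullback of \<open>G\<close> exactly if \<open>G\<close> lies in the Hardy space of
  the dual hypersurface. Conversely every \<open>g\<close> is a pullback, because the duality map of the dual
  hypersurface is the inverse of the duality map.
\<close>

lemma hardy_dual_iff:
  assumes \<gamma>: "1 < \<gamma>"
  shows "g \<in> vecs (hardy_dual \<gamma>) \<longleftrightarrow> g \<in> vecs (L2 (pref_dual_measure \<gamma>)) \<and>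
    (\<forall>f\<in>vecs (L2 (pref_measure \<gamma>)).
      (LINT z|pairing_measure \<gamma>. leray \<gamma> (pref_measure \<gamma>) f z * g z) = (LINT z|pairing_measure \<gamma>. f z * g z))"
proof -
  let ?g = "dual_exponent \<gamma>"
  let ?M = "pref_measure \<gamma>" and ?M' = "pref_measure ?g" and ?D = "pref_dual_measure \<gamma>"
  have g1: "1 < ?g" by (rule dual_exponent_gt_1[OF \<gamma>])
  obtain C where ser: "schur_series ?M (schur_weight \<gamma>) C (pref_kernel \<gamma>)"
    using pref_kernel_series[OF \<gamma>] by blast
  obtain C' where ser': "schur_series ?M' (schur_weight ?g) C' (pref_kernel ?g)"
    using pref_kernel_series[OF g1] by blast
  note meas = L2_pref_measurable[where \<gamma>="?g"]
  have pullL: "pullback \<gamma> H \<in> vecs (L2 ?M)" if "H \<in> vecs (L2 ?M')" for H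
    using that by (simp add: pullback_L2_iff[OF \<gamma> meas])
  have Dm: "h \<in> borel_measurable (hypM \<gamma>)" if "h \<in> vecs (L2 ?D)" for h
    using that by (simp add: L2_iff pref_dual_measure_density[OF \<gamma>] cong: measurable_cong_sets)
  note AE_D = AE_pref_dual_iff[OF \<gamma>]
  have pair: "(LINT z|pairing_measure \<gamma>. f z * h z) = (LINT z|?M. f z * pullback \<gamma> G z)"
    if [measurable]: "f \<in> borel_measurable (hypM \<gamma>)" "h \<in> borel_measurable (hypM \<gamma>)" "G \<in> borel_measurable (hypM ?g)"
      and e: "AE z in ?M. h z = G (dual_map \<gamma> z)" for f h G
  proof -
    note [measurable] = dual_map_measurable[OF \<gamma>]
    have "(LINT z|pairing_measure \<gamma>. f z * h z) = (LINT z|?M. rho \<gamma> z *\<^sub>R (f z * h z))"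
      unfolding pairing_measure_density[OF \<gamma>] by (subst integral_density) auto
    also have "\<dots> = (LINT z|?M. f z * pullback \<gamma> G z)"
      unfolding pullback_def
      by (rule integral_cong_AE, measurable, use e in eventually_elim) (simp add: scaleR_conv_of_real mult_ac)
    finally show ?thesis .
  qed
  note Mm = L2_pref_measurable[where \<gamma>=\<gamma>]
  show ?thesis
  proof
    assume "g \<in> vecs (hardy_dual \<gamma>)"
    then obtain G where g: "g \<in> vecs (L2 ?D)" and GH: "G \<in> vecs (hardy ?g)"
      and e: "AE z in ?D. g z = G (dual_map \<gamma> z)"
      by (auto simp: hardy_dual_def)
    have G: "G \<in> vecs (L2 ?M')" and fixd: "AE y in ?M'. leray ?g ?M' G y = G y"
      using GH by (auto simp: hardy_iff_fixed[OF g1])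
    have e': "AE z in ?M. g z = G (dual_map \<gamma> z)" using e by (simp only: AE_D)
    have LG: "leray ?g ?M' G \<in> vecs (L2 ?M')" by (rule leray_L2[OF g1 ser' G])
    have "(LINT z|pairing_measure \<gamma>. leray \<gamma> ?M f z * g z) = (LINT z|pairing_measure \<gamma>. f z * g z)"
      if f: "f \<in> vecs (L2 ?M)" for f
    proof -
      have Lf: "leray \<gamma> ?M f \<in> vecs (L2 ?M)" by (rule leray_L2[OF \<gamma> ser f])
      have "(LINT z|pairing_measure \<gamma>. leray \<gamma> ?M f z * g z) = (LINT z|?M. leray \<gamma> ?M f z * pullback \<gamma> G z)"
        by (rule pair[OF Mm[OF Lf] Dm[OF g] meas[OF G] e'])
      also have "\<dots> = (LINT z|?M. f z * pullback \<gamma> (leray ?g ?M' G) z)"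
        by (rule leray_transpose[OF \<gamma> f G])
      also have "\<dots> = (LINT z|?M. f z * pullback \<gamma> G z)"
      proof (rule integral_cong_AE)
        show "AE z in ?M. f z * pullback \<gamma> (leray ?g ?M' G) z = f z * pullback \<gamma> G z"
          using AE_dual_map[OF \<gamma> fixd] by eventually_elim (simp add: pullback_def)
      qed (use f pullL[OF G] pullL[OF LG] in \<open>auto simp: L2_iff intro!: borel_measurable_times\<close>)
      also have "\<dots> = (LINT z|pairing_measure \<gamma>. f z * g z)"
        by (rule pair[OF Mm[OF f] Dm[OF g] meas[OF G] e', symmetric])
      finally show ?thesis .
    qed
    with g show "g \<in> vecs (L2 ?D) \<and> (\<forall>f\<in>vecs (L2 ?M).
      (LINT z|pairing_measure \<gamma>. leray \<gamma> ?M f z * g z) = (LINT z|pairing_measure \<gamma>. f z * g z))" by blast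
  next
    assume "g \<in> vecs (L2 ?D) \<and> (\<forall>f\<in>vecs (L2 ?M).
      (LINT z|pairing_measure \<gamma>. leray \<gamma> ?M f z * g z) = (LINT z|pairing_measure \<gamma>. f z * g z))"
    then have g: "g \<in> vecs (L2 ?D)"
      and inv: "\<And>f. f \<in> vecs (L2 ?M) \<Longrightarrow> (LINT z|pairing_measure \<gamma>. leray \<gamma> ?M f z * g z) = (LINT z|pairing_measure \<gamma>. f z * g z)"
      by auto
    define G where "G y = g (dual_map ?g y)" for y
    have Gw: "G (dual_map \<gamma> z) = g z" if "z \<in> hyp \<gamma>" for z
      by (simp add: G_def dual_map_dual_map[OF \<gamma> that])
    have Gm: "G \<in> borel_measurable (hypM ?g)"
      using measurable_compose[OF dual_map_measurable[OF g1], of g] Dm[OF g]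
      by (simp add: G_def[abs_def] dual_exponent_involution[OF \<gamma>])
    have e: "AE z in ?M. g z = G (dual_map \<gamma> z)"
      using AE_pref_hyp[of \<gamma>] by eventually_elim (simp add: Gw)
    have G: "G \<in> vecs (L2 ?M')"
    proof -
      note [measurable] = Dm[OF g] dual_map_measurable[OF \<gamma>] Gm
      have "integrable ?M (\<lambda>z. (rho \<gamma> z)\<^sup>2 *\<^sub>R (cmod (g z))\<^sup>2)"
        using g unfolding L2_iff pref_dual_measure_density[OF \<gamma>]
        by (auto simp: integrable_density)
      moreover have "integrable ?M (\<lambda>z. (rho \<gamma> z)\<^sup>2 *\<^sub>R (cmod (g z))\<^sup>2) \<longleftrightarrow> integrable ?M (\<lambda>z. (cmod (pullback \<gamma> G z))\<^sup>2)"
        unfolding pullback_def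
        by (rule integrable_cong_AE, measurable, use e in eventually_elim)
           (simp add: norm_mult power_mult_distrib)
      moreover have "pullback \<gamma> G \<in> borel_measurable ?M" unfolding pullback_def[abs_def] by measurable
      ultimately have "pullback \<gamma> G \<in> vecs (L2 ?M)" by (simp add: L2_iff)
      then show ?thesis by (simp add: pullback_L2_iff[OF \<gamma> Gm])
    qed
    have LG: "leray ?g ?M' G \<in> vecs (L2 ?M')" by (rule leray_L2[OF g1 ser' G])
    have "AE z in ?M. pullback \<gamma> (leray ?g ?M' G) z = pullback \<gamma> G z"
    proof (rule AE_eq_if_integrals_eq[OF pullL[OF LG] pullL[OF G]])
      fix f assume f: "f \<in> vecs (L2 ?M)"
      have Lf: "leray \<gamma> ?M f \<in> vecs (L2 ?M)" by (rule leray_L2[OF \<gamma> ser f])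
      show "(LINT x|?M. f x * pullback \<gamma> (leray ?g ?M' G) x) = (LINT x|?M. f x * pullback \<gamma> G x)"
        using leray_transpose[OF \<gamma> f G] inv[OF f] pair[OF Mm[OF f] Dm[OF g] Gm e] pair[OF Mm[OF Lf] Dm[OF g] Gm e]
        by simp
    qed
    then have "AE z in ?M. leray ?g ?M' G (dual_map \<gamma> z) = g z"
      using AE_pref_hyp[of \<gamma>]
    proof eventually_elim
      case (elim z)
      then show ?case using Gw[of z] rho_pos[OF \<gamma>, of z] by (simp add: pullback_def)
    qed
    then have "AE y in ?M'. leray ?g ?M' G (dual_map \<gamma> (dual_map ?g y)) = g (dual_map ?g y)"
      by (rule AE_dual_map[OF g1, of "\<lambda>z. leray ?g ?M' G (dual_map \<gamma> z) = g z",
            unfolded dual_exponent_involution[OF \<gamma>]])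
    then have "AE y in ?M'. leray ?g ?M' G y = G y"
      using AE_pref_hyp[of ?g]
    proof eventually_elim
      case (elim y)
      then show ?case
        using dual_map_dual_map[OF g1, of y] by (simp add: dual_exponent_involution[OF \<gamma>] G_def)
    qed
    then have "G \<in> vecs (hardy ?g)" using G by (simp add: hardy_iff_fixed[OF g1])
    moreover have "AE z in ?D. g z = G (dual_map \<gamma> z)" using e by (simp only: AE_D)
    ultimately show "g \<in> vecs (hardy_dual \<gamma>)" using g by (auto simp: hardy_dual_def)
  qed
qed

theorem theorem1p13:
  fixes \<gamma> :: real
  assumes "\<gamma> > 1"
  shows "\<exists>S. inverse_operators (hardy_dual \<gamma>) (banach_dual (hardy \<gamma>)) (chi \<gamma>) S \<and>
             op_norm (banach_dual (hardy \<gamma>)) (hardy_dual \<gamma>) S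
               = op_norm (L2 (pref_measure \<gamma>)) (L2 (pref_measure \<gamma>)) (leray \<gamma> (pref_measure \<gamma>))"
proof -
  obtain C where ser: "schur_series (pref_measure \<gamma>) (schur_weight \<gamma>) C (pref_kernel \<gamma>)"
    using pref_kernel_series[OF assms] by blast
  show ?thesis
  proof (rule hilbert_pairing_duality[where M="pref_measure \<gamma>" and M'="pref_dual_measure \<gamma>"
        and N="pairing_measure \<gamma>" and \<rho>="rho \<gamma>" and C=C])
    show "rho \<gamma> \<in> borel_measurable (pref_measure \<gamma>)"
      using rho_measurable by (simp cong: measurable_cong_sets)
    show "AE z in pref_measure \<gamma>. 0 < rho \<gamma> z"
      using AE_pref_hyp[of \<gamma>] by eventually_elim (simp add: rho_pos[OF assms])
    show "g \<in> vecs (hardy_dual \<gamma>) \<longleftrightarrow> g \<in> vecs (L2 (pref_dual_measure \<gamma>)) \<and>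
      (\<forall>f\<in>vecs (L2 (pref_measure \<gamma>)). (LINT z|pairing_measure \<gamma>. leray \<gamma> (pref_measure \<gamma>) f z * g z)
        = (LINT z|pairing_measure \<gamma>. f z * g z))" for g
      by (rule hardy_dual_iff[OF assms])
    show "f \<in> vecs (hardy \<gamma>) \<longleftrightarrow> f \<in> vecs (L2 (pref_measure \<gamma>)) \<and>
      (AE z in pref_measure \<gamma>. leray \<gamma> (pref_measure \<gamma>) f z = f z)" for f
      by (rule hardy_iff_fixed[OF assms])
    show "chi \<gamma> = (\<lambda>g f. LINT z|pairing_measure \<gamma>. f z * g z)"
      by (simp add: chi_def fun_eq_iff)
  qed (simp_all add: pref_dual_measure_density[OF assms] pairing_measure_density[OF assms]
      leray_L2[OF assms ser] leray_bound[OF assms ser] leray_lincomb[OF assms ser] leray_idempotent[OF assms ser]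
      hardy_def hardy_dual_def)
qed

end
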